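(* Consider the Gaussian Y-channel described in the context, with channel gains satisfying $h_1^2\ge h_2^2\ge h_3^2$ and power constraint $P$. Let $\vec R=(R_{12},R_{13},R_{21},R_{23},R_{31},R_{32})$ be a rate tuple. Suppose there exist nonnegative numbers (rate splits) $R_{ij}^b,R_{ij}^c,R_{ij}^u$ for all ordered pairs $(i,j)$ of distinct indices in $\{1,2,3\}$ with $R_{ij}=R_{ij}^b+R_{ij}^c+R_{ij}^u$, and $$R_{12}^b=R_{21}^b,\quad R_{13}^b=R_{31}^b,\quad R_{23}^b=R_{32}^b,\quad R_{12}^c=R_{23}^c=R_{31}^c=:R_{123}^c,\quad R_{13}^c=R_{32}^c=R_{21}^c=:R_{132}^c,$$ together with nonnegative user powers $P_{ij}^b,P_{ij}^c,P_{ij}^u$ (all ordered pairs $(i,j)$), $\tilde P_{23}^c,\tilde P_{13}^c$, and nonnegative relay powers $P_{r,ij}^u$ (all six ordered pairs), $P_{r,12}^c,P_{r,31}^c,P_{r,21}^c,P_{r,32}^c$, $P_{r,21}^b,P_{r,31}^b,P_{r,32}^b$, satisfying: (Alignment) $h_1^2P_{12}^b=h_2^2P_{21}^b$, $h_1^2P_{13}^b=h_3^2P_{31}^b$, $h_2^2P_{23}^b=h_3^2P_{32}^b$, $h_1^2P_{12}^c=h_2^2P_{23}^c$, $h_2^2\tilde P_{23}^c=h_3^2P_{31}^c$, $h_1^2P_{13}^c=h_3^2P_{32}^c$, $h_1^2\tilde P_{13}^c=h_2^2P_{21}^c$. (User power) $P_1:=P_{12}^b+P_{13}^b+P_{12}^c+P_{13}^c+\tilde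 P_{13}^c+P_{12}^u+P_{13}^u\le P$, $P_2:=P_{21}^b+P_{23}^b+P_{21}^c+P_{23}^c+\tilde P_{23}^c+P_{21}^u+P_{23}^u\le P$, $P_3:=P_{31}^b+P_{32}^b+P_{31}^c+P_{32}^c+P_{31}^u+P_{32}^u\le P$. (Relay power) the sum of all the relay powers listed above is at most $P$. (Uplink rate constraints) with $\sigma^2=1+h_3^2(2P_{31}^b+2P_{32}^b+2P_{31}^c+2P_{32}^c+P_{31}^u+P_{32}^u)$: $R_{12}^u\le C\!\left(\frac{h_1^2P_{12}^u}{1+h_3^2P_3+h_2^2P_2+h_1^2(P-P_{12}^u)}\right)$, $R_{13}^u\le C\!\left(\frac{h_1^2P_{13}^u}{1+h_3^2P_3+h_2^2P_2+h_1^2(P-P_{12}^u-P_{13}^u)}\right)$, $R_{21}^u\le C\!\left(\frac{h_2^2P_{21}^u}{1+h_3^2P_3+h_2^2(P_2-P_{21}^u)+h_1^2(P-P_{12}^u-P_{13}^u)}\right)$, $R_{23}^u\le C\!\left(\frac{h_2^2P_{23}^u}{1+h_3^2P_3+h_2^2(P_2-P_{21}^u-P_{23}^u)+h_1^2(P-P_{12}^u-P_{13}^u)}\right)$, $R_{132}^c\le C^+\!\left(\frac{h_2^2P_{21}^c}{\sigma^2+2h_2^2(P_{21}^b+P_{23}^c)}-\frac12\right)$, $R_{123}^c\le C^+\!\left(\frac{h_2^2P_{23}^c}{\sigma^2+2h_2^2P_{21}^b}-\frac12\right)$, $R_{21}^b\le C^+\!\left(\frac{h_2^2P_{21}^b}{\sigma^2}-\frac12\right)$,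 $R_{31}^u\le C\!\left(\frac{h_3^2P_{31}^u}{1+h_3^2(2P_{32}^b+2P_{31}^b+2P_{31}^c+2P_{32}^c+P_{32}^u)}\right)$, $R_{32}^u\le C\!\left(\frac{h_3^2P_{32}^u}{1+2h_3^2(P_{32}^b+P_{31}^b+P_{31}^c+P_{32}^c)}\right)$, $R_{132}^c\le C^+\!\left(\frac{h_3^2P_{32}^c}{1+2h_3^2(P_{32}^b+P_{31}^b+P_{31}^c)}-\frac12\right)$, $R_{123}^c\le C^+\!\left(\frac{h_3^2P_{31}^c}{1+2h_3^2(P_{32}^b+P_{31}^b)}-\frac12\right)$, $R_{31}^b\le C^+\!\left(\frac{h_3^2P_{31}^b}{1+2h_3^2P_{32}^b}-\frac12\right)$, $R_{32}^b\le C^+\!\left(h_3^2P_{32}^b-\frac12\right)$. (Downlink rate constraints) with $\sigma_{r1}^2=1+h_3^2(P_{r,12}^u+P_{r,32}^u+P_{r,12}^c+P_{r,21}^c+P_{r,21}^b+P_{r,21}^u+P_{r,31}^u)$ and $\sigma_{r2}^2=1+h_2^2(P_{r,21}^u+P_{r,31}^u)$: $R_{13}^u\le C\!\left(\frac{h_3^2P_{r,13}^u}{\sigma_{r1}^2+h_3^2(P_{r,23}^u+P_{r,32}^c+P_{r,31}^c+P_{r,31}^b+P_{r,32}^b)}\right)$, $R_{23}^u\le C\!\left(\frac{h_3^2P_{r,23}^u}{\sigma_{r1}^2+h_3^2(P_{r,32}^c+P_{r,31}^c+P_{r,31}^b+P_{r,32}^b)}\right)$, $R_{132}^c\le C\!\left(\frac{h_3^2P_{r,32}^c}{\sigma_{r1}^2+h_3^2(P_{r,31}^c+P_{r,31}^b+P_{r,32}^b)}\right)$,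 $R_{123}^c\le C\!\left(\frac{h_3^2P_{r,31}^c}{\sigma_{r1}^2+h_3^2(P_{r,31}^b+P_{r,32}^b)}\right)$, $R_{31}^b\le C\!\left(\frac{h_3^2P_{r,31}^b}{\sigma_{r1}^2+h_3^2P_{r,32}^b}\right)$, $R_{32}^b\le C\!\left(\frac{h_3^2P_{r,32}^b}{\sigma_{r1}^2}\right)$, $R_{12}^u\le C\!\left(\frac{h_2^2P_{r,12}^u}{\sigma_{r2}^2+h_2^2(P_{r,32}^u+P_{r,12}^c+P_{r,21}^c+P_{r,21}^b)}\right)$, $R_{32}^u\le C\!\left(\frac{h_2^2P_{r,32}^u}{\sigma_{r2}^2+h_2^2(P_{r,12}^c+P_{r,21}^c+P_{r,21}^b)}\right)$, $R_{123}^c\le C\!\left(\frac{h_2^2P_{r,12}^c}{\sigma_{r2}^2+h_2^2(P_{r,21}^c+P_{r,21}^b)}\right)$, $R_{132}^c\le C\!\left(\frac{h_2^2P_{r,21}^c}{\sigma_{r2}^2+h_2^2P_{r,21}^b}\right)$, $R_{21}^b\le C\!\left(\frac{h_2^2P_{r,21}^b}{\sigma_{r2}^2}\right)$, $R_{21}^u\le C\!\left(\frac{h_1^2P_{r,21}^u}{1+h_1^2P_{r,31}^u}\right)$, $R_{31}^u\le C(h_1^2P_{r,31}^u)$. Then $\vec R$ is achievable, i.e., it lies in the capacity region $\mathcal C_g$ of the Gaussian Y-channel. (Equivalently, the union over all such power allocations of the region of rate tuples satisfying these constraints is an inner bound on $\mathcal C_g$.)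
   Context: The Gaussian Y-channel consists of three users $U_1,U_2,U_3$ and a relay. Each user $U_i$ has an independent message $m_{ij}$ of rate $R_{ij}$ for each other user $U_j$ ($i\ne j$, $i,j\in\{1,2,3\}$), uniformly distributed. All communication goes via the relay (users do not hear each other directly). All signals are real-valued. At time $i$ the relay receives $y_{ri}=h_1x_{1i}+h_2x_{2i}+h_3x_{3i}+z_{ri}$, and user $j$ receives $y_{ji}=h_jx_{ri}+z_{ji}$, where $h_1,h_2,h_3\in\mathbb R$ are fixed constant channel gains (reciprocal for uplink and downlink), $x_{ri}$ is the relay's transmit symbol, and the noises $z_{ri},z_{ji}$ are i.i.d. $\mathcal N(0,1)$, independent of each other and of the messages. All nodes (users and relay) have average power constraint $P$ over a block of length $n$: $\frac1n\sum_{i=1}^n\mathbb E[X_{ki}^2]\le P$. The relay's transmit symbol at time $i$ may depend causally on its past received symbols; each user's transmit symbol at time $i$ may depend on its own messages and its past received symbols. Each user decodes its two intended messages from its received sequence and its own messages. A rate tuple is achievable if there exist codes of length $n$ with these rates whose probability of decoding error tends to $0$ as $n\to\infty$; the capacity region $\mathcal C_g$ is the closure of the set of achievable tuples. Notation: $C(x)=\frac12\log_2(1+x)$ and $C^+(x)=\max\{0,C(x)\}$. *)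

theory Defs
  imports "HOL-Probability.Probability"
begin

text \<open>Nodes: the relay is node 0, the users are nodes 1, 2, 3.
  A rate tuple / message tuple is indexed by ordered pairs (i,j), i \<noteq> j, of users;
  R (i,j) is the rate of the message m_ij from user i to user j.\<close>

definition yc_users :: "nat set" where
  "yc_users = {1, 2, 3}"

definition yc_pairs :: "(nat \<times> nat) set" where
  "yc_pairs = {(i, j). i \<in> yc_users \<and> j \<in> yc_users \<and> i \<noteq> j}"

definition yc_gain :: "real \<Rightarrow> real \<Rightarrow> real \<Rightarrow> nat \<Rightarrow> real" where
  "yc_gain h1 h2 h3 k = (if k = 1 then h1 else if k = 2 then h2 else h3)"

definition Cg :: "real \<Rightarrow> real" where
  "Cg x = log 2 (1 + x) / 2"

definition Cplus :: "real \<Rightarrow> real" where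
  "Cplus x = max 0 (Cg x)"

text \<open>Standard Gaussian N(0,1) distribution; noise samples are indexed by (node, time),
  node 0 = relay noise z_r, node k = noise z_k at user k. A block of length n uses the
  i.i.d. family indexed by {0..3} \<times> {..<n}.\<close>
definition std_gauss :: "real measure" where
  "std_gauss = density lborel std_normal_density"

definition yc_noise :: "nat \<Rightarrow> (nat \<times> nat \<Rightarrow> real) measure" where
  "yc_noise n = PiM ({0..3} \<times> {..<n}) (\<lambda>_. std_gauss)"

definition yc_msgs :: "(nat \<times> nat \<Rightarrow> nat) \<Rightarrow> (nat \<times> nat \<Rightarrow> nat) set" where
  "yc_msgs M = PiE yc_pairs (\<lambda>p. {..<M p})"

definition yc_own :: "nat \<Rightarrow> (nat \<times> nat \<Rightarrow> nat) \<Rightarrow> nat \<Rightarrow> nat" where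
  "yc_own k m = (\<lambda>j. m (k, j))"

type_synonym yc_enc = "nat \<Rightarrow> nat \<Rightarrow> (nat \<Rightarrow> nat) \<Rightarrow> (nat \<Rightarrow> real) \<Rightarrow> real"
  \<comment> \<open>user k, time t, own messages, past received sequence \<mapsto> transmit symbol\<close>
type_synonym yc_rel = "nat \<Rightarrow> (nat \<Rightarrow> real) \<Rightarrow> real"
  \<comment> \<open>time t, past received sequence of the relay \<mapsto> relay symbol\<close>
type_synonym yc_dec = "nat \<Rightarrow> (nat \<Rightarrow> nat) \<Rightarrow> (nat \<Rightarrow> real) \<Rightarrow> nat \<Rightarrow> nat"
  \<comment> \<open>user k, own messages, received block \<mapsto> (j \<mapsto> estimate of m_jk)\<close>

text \<open>yc_recv ... t k s: the symbol received by node k at time s, for s < t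
  (and 0 for s \<ge> t). Thus the functions passed to encoders/relay at time t only
  carry the received symbols at times < t (causality).\<close>
fun yc_recv :: "real \<Rightarrow> real \<Rightarrow> real \<Rightarrow> yc_enc \<Rightarrow> yc_rel \<Rightarrow> (nat \<times> nat \<Rightarrow> nat)
    \<Rightarrow> (nat \<times> nat \<Rightarrow> real) \<Rightarrow> nat \<Rightarrow> nat \<Rightarrow> nat \<Rightarrow> real" where
  "yc_recv h1 h2 h3 enc rel m z 0 = (\<lambda>k s. 0)"
| "yc_recv h1 h2 h3 enc rel m z (Suc t) =
    (let y = yc_recv h1 h2 h3 enc rel m z t;
         xr = rel t (y 0);
         x = (\<lambda>k. enc k t (yc_own k m) (y k))
     in (\<lambda>k s. if s = t then
                  (if k = 0 then (\<Sum>u\<in>yc_users. yc_gain h1 h2 h3 u * x u) + z (0, t)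
                   else yc_gain h1 h2 h3 k * xr + z (k, t))
                else y k s))"

definition yc_tx :: "real \<Rightarrow> real \<Rightarrow> real \<Rightarrow> yc_enc \<Rightarrow> yc_rel \<Rightarrow> (nat \<times> nat \<Rightarrow> nat)
    \<Rightarrow> (nat \<times> nat \<Rightarrow> real) \<Rightarrow> nat \<Rightarrow> nat \<Rightarrow> real" where
  "yc_tx h1 h2 h3 enc rel m z k t =
     (if k = 0 then rel t (yc_recv h1 h2 h3 enc rel m z t 0)
      else enc k t (yc_own k m) (yc_recv h1 h2 h3 enc rel m z t k))"

definition yc_error :: "real \<Rightarrow> real \<Rightarrow> real \<Rightarrow> nat \<Rightarrow> yc_enc \<Rightarrow> yc_rel \<Rightarrow> yc_dec
    \<Rightarrow> (nat \<times> nat \<Rightarrow> nat) \<Rightarrow> (nat \<times> nat \<Rightarrow> real) \<Rightarrow> bool" where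
  "yc_error h1 h2 h3 n enc rel dec m z \<longleftrightarrow>
     (\<exists>(j, k)\<in>yc_pairs. dec k (yc_own k m) (yc_recv h1 h2 h3 enc rel m z n k) j \<noteq> m (j, k))"

text \<open>A length-n code with message-set sizes M satisfying the power constraints
  (average over the block of E[X^2], expectation over uniform messages and noise;
  a nonnegative integral is used, so that non-integrable powers count as infinite).
  Encoders, relay functions and decoders are required to be (Borel) measurable.\<close>
definition yc_code :: "real \<Rightarrow> real \<Rightarrow> real \<Rightarrow> real \<Rightarrow> nat \<Rightarrow> (nat \<times> nat \<Rightarrow> nat)
    \<Rightarrow> yc_enc \<Rightarrow> yc_rel \<Rightarrow> yc_dec \<Rightarrow> bool" where
  "yc_code h1 h2 h3 P n M enc rel dec \<longleftrightarrow>
     (\<forall>k\<in>yc_users. \<forall>t<n. \<forall>a. enc k t a \<in> borel_measurable (PiM UNIV (\<lambda>_::nat. borel))) \<and>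
     (\<forall>t<n. rel t \<in> borel_measurable (PiM UNIV (\<lambda>_::nat. borel))) \<and>
     (\<forall>k\<in>yc_users. \<forall>a j. (\<lambda>y. dec k a y j) \<in> measurable (PiM UNIV (\<lambda>_::nat. borel)) (count_space UNIV)) \<and>
     (\<forall>k\<in>{0, 1, 2, 3}.
        ennreal (1 / (real n * real (card (yc_msgs M)))) *
          (\<Sum>t<n. \<Sum>m\<in>yc_msgs M.
             \<integral>\<^sup>+ z. ennreal ((yc_tx h1 h2 h3 enc rel m z k t)\<^sup>2) \<partial>yc_noise n)
        \<le> ennreal P)"

definition yc_perr :: "real \<Rightarrow> real \<Rightarrow> real \<Rightarrow> nat \<Rightarrow> (nat \<times> nat \<Rightarrow> nat)
    \<Rightarrow> yc_enc \<Rightarrow> yc_rel \<Rightarrow> yc_dec \<Rightarrow> real" where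
  "yc_perr h1 h2 h3 n M enc rel dec =
     (\<Sum>m\<in>yc_msgs M. measure (yc_noise n)
         {z \<in> space (yc_noise n). yc_error h1 h2 h3 n enc rel dec m z})
     / real (card (yc_msgs M))"

definition yc_achievable :: "real \<Rightarrow> real \<Rightarrow> real \<Rightarrow> real \<Rightarrow> (nat \<times> nat \<Rightarrow> real) \<Rightarrow> bool" where
  "yc_achievable h1 h2 h3 P R \<longleftrightarrow>
     (\<forall>\<epsilon>>0. \<exists>N. \<forall>n\<ge>N. \<exists>enc rel dec.
        yc_code h1 h2 h3 P n (\<lambda>p. nat \<lceil>2 powr (real n * R p)\<rceil>) enc rel dec \<and>
        yc_perr h1 h2 h3 n (\<lambda>p. nat \<lceil>2 powr (real n * R p)\<rceil>) enc rel dec \<le> \<epsilon>)"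

text \<open>Capacity region: closure (product topology) of the achievable rate tuples.
  Only the values at yc_pairs matter.\<close>
definition yc_capacity_region :: "real \<Rightarrow> real \<Rightarrow> real \<Rightarrow> real \<Rightarrow> (nat \<times> nat \<Rightarrow> real) set" where
  "yc_capacity_region h1 h2 h3 P = closure {R. yc_achievable h1 h2 h3 P R}"

end

theory Submission
  imports Defs "HOL-Number_Theory.Cong"
begin

text \<open>Each user splits its messages into streams. A stream is carried by a random affine code over the
  prime field with p elements, all streams using the same matrix, with the codeword shaped into a ball by a
  choice of additional coset symbols, as for nested lattice codes. Two users of an aligned stream are received
  with equal amplitude, so the relay can decode the modular sum of their messages; it does so successively,
  treating the undecoded streams as noise after MMSE scaling. This gives the rate 1/2 log(1/2 + SNR) for
  pairs and 1/2 log(1 + SNR) for single streams. The relay re-encodes the sums one block later, and every user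
  decodes successively until it can solve for its messages, using its own messages as side information.
  The error probability is averaged over matrix and dithers. Instead of tracking the exact law of the shaped
  codewords, it is dominated, at an arbitrarily small exponential cost, by a product of discrete Gaussian weights, under which the
  effective noise has an explicit Chernoff bound.\<close>

section \<open>Discrete Gaussian weights and ball shaping\<close>

text \<open>The rate formulas come from one volume ratio. Grid points within normalised squared
  distance \<tau> of an observation number about \<tau>^(N/2) times the shaping set, up to the
  discretisation term 2 \<gamma>, so a stream of rate \<rho> survives the union bound when 2^(2
  \<rho>) \<tau> < 1. The best scaling of m codewords received with amplitude x in interference n
  leaves the variance m n / (m x^2 + n), whose inverse is x^2 / n + 1 / m; this is the origin of 1 +
  SNR and 1/2 + SNR. A ball is used because cubic shaping loses rate. The obstacle is that the
  selected codeword depends on the matrix that also creates the wrong candidates. Dominating its law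
  costs a factor e^(3 \<delta> N) per codeword, and the number of codewords is fixed by the network;
  so thresholds and a common decay base are fixed before \<delta>, and \<delta> before the lattice.
  The channel forms an integer sum of codewords: 4 H < p makes its residues determine it, and the
  common matrix makes it a codeword of the same family.\<close>

lemma chernoff_factor:
  fixes \<nu> \<tau> :: real
  assumes "\<nu> > 0" "\<tau> > 0" "\<nu> \<noteq> \<tau>"
  defines "l \<equiv> (1/\<nu> - 1/\<tau>)/2"
  shows "2*l*\<nu> < 1" "exp (-l*\<tau>) / sqrt (1 - 2*l*\<nu>) < 1"
proof -
  \<comment> \<open>The tilt \<open>l\<close> is the stationary point of exp (-l \<tau>) / sqrt (1 -
    2 l \<nu>), and the value there is below 1 by the strict form of ln x \<le> x - 1 at x =
    \<tau>/\<nu>. For \<tau> < \<nu> the tilt is negative, so both tails are covered.\<close>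
  have eq: "1 - 2*l*\<nu> = \<nu>/\<tau>" using assms(1,2) by (simp add: l_def field_simps)
  have eq2: "-l*\<tau> = -(\<tau>/\<nu> - 1)/2" using assms(1,2) by (simp add: l_def field_simps)
  have pos: "\<nu>/\<tau> > 0" using assms by simp
  show "2*l*\<nu> < 1" using eq pos by linarith
  have "ln (\<tau>/\<nu>) < \<tau>/\<nu> - 1"
    using ln_le_minus_one[of "\<tau>/\<nu>"] ln_eq_minus_one[of "\<tau>/\<nu>"] assms by force
  hence "-(\<tau>/\<nu> - 1)/2 < ln (sqrt (\<nu>/\<tau>))"
    using pos assms by (simp add: ln_sqrt ln_div)
  hence "exp (-(\<tau>/\<nu> - 1)/2) < sqrt (\<nu>/\<tau>)"
    using pos by (metis exp_less_cancel_iff exp_ln real_sqrt_gt_zero)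
  thus "exp (-l*\<tau>) / sqrt (1 - 2*l*\<nu>) < 1"
    unfolding eq eq2 using pos by simp
qed

lemma half_gauss_bochner:
  assumes "c > 0"
  shows "has_bochner_integral lborel (\<lambda>x::real. indicator {0..} x * exp (- c * x\<^sup>2)) (sqrt (pi/c) / 2)"
proof -
  have "has_bochner_integral lborel
      (\<lambda>x. indicator {0..} (0 + sqrt c * x) *\<^sub>R exp (- (0 + sqrt c * x)\<^sup>2)) ((sqrt pi/2) /\<^sub>R \<bar>sqrt c\<bar>)"
    using gaussian_moment_0 assms by (subst (asm) lborel_has_bochner_integral_real_affine_iff[of "sqrt c" _ _ 0]) auto
  moreover have "indicator {0..} (0 + sqrt c * x) = (indicator {0..} x :: real)" for x
    using assms by (auto simp: indicator_def zero_le_mult_iff)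
  ultimately show ?thesis using assms
    by (simp add: power_mult_distrib real_sqrt_divide field_simps)
qed

lemma half_gauss_integral_le:
  assumes "c > 0" "r \<ge> 0"
  shows "integral {0..r} (\<lambda>x::real. exp (- c * x\<^sup>2)) \<le> sqrt (pi/c) / 2"
proof -
  let ?f = "\<lambda>x::real. indicator {0..} x * exp (- c * x\<^sup>2)"
  note b = half_gauss_bochner[OF assms(1)]
  have i: "(?f has_integral (sqrt (pi/c)/2)) UNIV"
    using has_integral_integral_lborel[OF has_bochner_integral_iff[THEN iffD1, OF b, THEN conjunct1]]
      has_bochner_integral_iff[THEN iffD1, OF b, THEN conjunct2] by (simp only:)
  have "integral {0..r} (\<lambda>x::real. exp (- c * x\<^sup>2)) = integral {0..r} ?f"
    by (intro integral_cong) auto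
  also have "\<dots> \<le> integral UNIV ?f"
  proof (intro integral_subset_le)
    have "(\<lambda>x. exp (- c * x\<^sup>2)) integrable_on {0..r}"
      by (intro integrable_continuous_real continuous_intros)
    thus "?f integrable_on {0..r}" by (rule integrable_eq) auto
  qed (use i in auto)
  also have "\<dots> = sqrt (pi/c)/2" using i by (rule integral_unique)
  finally show ?thesis .
qed

lemma half_gauss_integral_tendsto:
  assumes "c > 0"
  shows "(\<lambda>n. integral {0..real n} (\<lambda>x::real. exp (- c * x\<^sup>2))) \<longlonglongrightarrow> sqrt (pi/c) / 2"
proof -
  let ?f = "\<lambda>x::real. indicator {0..} x * exp (- c * x\<^sup>2)"
  note b = half_gauss_bochner[OF assms(1)]
  have i: "integrable lborel ?f" and v: "integral\<^sup>L lborel ?f = sqrt (pi/c)/2"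
    using b by (auto simp: has_bochner_integral_iff)
  have "((\<lambda>y. \<integral>x. indicator {..y} x *\<^sub>R ?f x \<partial>lborel) \<longlongrightarrow> sqrt (pi/c)/2) at_top"
    using tendsto_integral_at_top[OF _ i] unfolding v by simp
  hence "(\<lambda>n. \<integral>x. indicator {..real n} x *\<^sub>R ?f x \<partial>lborel) \<longlonglongrightarrow> sqrt (pi/c)/2"
    by (rule filterlim_compose[OF _ filterlim_real_sequentially])
  moreover have "(\<integral>x. indicator {..real n} x *\<^sub>R ?f x \<partial>lborel)
      = integral {0..real n} (\<lambda>x::real. exp (- c * x\<^sup>2))" for n
  proof -
    have "set_integrable lborel {0..real n} (\<lambda>x::real. exp (- c * x\<^sup>2))"
      by (intro borel_integrable_atLeastAtMost' continuous_intros)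
    from set_borel_integral_eq_integral(2)[OF this]
    have "(LINT x:{0..real n}|lborel. exp (- c * x\<^sup>2)) = integral {0..real n} (\<lambda>x::real. exp (- c * x\<^sup>2))" .
    moreover have "(\<lambda>x. indicator {..real n} x *\<^sub>R ?f x) = (\<lambda>x. indicator {0..real n} x *\<^sub>R exp (- c * x\<^sup>2))"
      by (auto simp: indicator_def fun_eq_iff)
    ultimately show ?thesis by (simp add: set_lebesgue_integral_def)
  qed
  ultimately show ?thesis by simp
qed

lemma gauss_sum_integral:
  assumes "c > 0"
  shows "integral {0..real n} (\<lambda>x::real. exp (- c * x\<^sup>2)) \<le> (\<Sum>k\<le>n. exp (- c * (real k)\<^sup>2))"
    and "(\<Sum>k\<le>n. exp (- c * (real k)\<^sup>2)) \<le> 1 + integral {0..real n} (\<lambda>x::real. exp (- c * x\<^sup>2))"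
proof -
  interpret antimono_fun_sum_integral_diff "\<lambda>x::real. exp (- c * x\<^sup>2)"
    using assms by unfold_locales (auto intro!: continuous_intros power_mono)
  show "integral {0..real n} (\<lambda>x::real. exp (- c * x\<^sup>2)) \<le> (\<Sum>k\<le>n. exp (- c * (real k)\<^sup>2))"
    using sum_integral_diff_series_nonneg[of n] unfolding sum_integral_diff_series_def by simp
  show "(\<Sum>k\<le>n. exp (- c * (real k)\<^sup>2)) \<le> 1 + integral {0..real n} (\<lambda>x::real. exp (- c * x\<^sup>2))"
    using sum_integral_diff_series_antimono[of 0 n] unfolding sum_integral_diff_series_def by simp
qed

text \<open>Splitting at the integer part of m / \<gamma>, each half is dominated term by term by
  the centred sum over the naturals, which exceeds its integral by at most 1. The two ones give the
  additive 2. Uniformity in the shift m is what allows completing the square later.\<close>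

lemma lattice_gauss_sum_le:
  fixes K :: "int set" and \<beta> \<gamma> m :: real
  assumes "\<beta> > 0" "\<gamma> > 0" "finite K"
  shows "(\<Sum>k\<in>K. exp (- \<beta> * (\<gamma> * of_int k - m)\<^sup>2)) \<le> 2 + sqrt (pi/\<beta>) / \<gamma>"
proof -
  define k0 where "k0 = \<lfloor>m/\<gamma>\<rfloor>"
  define r where "r = m - \<gamma> * of_int k0"
  have r: "0 \<le> r" "r \<le> \<gamma>"
  proof -
    have "of_int k0 \<le> m/\<gamma>" "m/\<gamma> \<le> of_int k0 + 1" unfolding k0_def by linarith+
    thus "0 \<le> r" "r \<le> \<gamma>" using assms unfolding r_def by (auto simp: field_simps)
  qed
  let ?f = "\<lambda>k::int. exp (- \<beta> * (\<gamma> * of_int k - m)\<^sup>2)"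
  let ?c = "\<beta> * \<gamma>\<^sup>2"
  have c: "?c > 0" using assms by simp
  obtain J :: nat where J: "\<And>k. k \<in> K \<Longrightarrow> \<bar>k - k0\<bar> \<le> int J"
  proof -
    have "finite ((\<lambda>k. nat \<bar>k - k0\<bar>) ` K)" using assms by simp
    then obtain J where "\<forall>x\<in>((\<lambda>k. nat \<bar>k - k0\<bar>) ` K). x \<le> J" using finite_nat_set_iff_bounded_le by blast
    hence "\<And>k. k \<in> K \<Longrightarrow> \<bar>k - k0\<bar> \<le> int J" by fastforce
    thus ?thesis using that by blast
  qed
  let ?A = "(\<lambda>j. k0 + 1 + int j) ` {..J}" and ?B = "(\<lambda>j. k0 - int j) ` {..J}"
  have sub: "K \<subseteq> ?A \<union> ?B"
  proof
    fix k assume k: "k \<in> K"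
    show "k \<in> ?A \<union> ?B"
    proof (cases "k > k0")
      case True
      hence "k = k0 + 1 + int (nat (k - k0 - 1))" "nat (k - k0 - 1) \<le> J" using J[OF k] by auto
      thus ?thesis by blast
    next
      case False
      hence "k = k0 - int (nat (k0 - k))" "nat (k0 - k) \<le> J" using J[OF k] by auto
      thus ?thesis by blast
    qed
  qed
  have one: "(\<Sum>j\<le>J. exp (- ?c * (real j)\<^sup>2)) \<le> 1 + sqrt (pi/\<beta>) / \<gamma> / 2"
    using gauss_sum_integral(2)[OF c, of J] half_gauss_integral_le[OF c, of "real J"] assms
    by (simp add: real_sqrt_divide real_sqrt_mult)
  have pt: "exp (- \<beta> * x\<^sup>2) \<le> exp (- ?c * (real j)\<^sup>2)" if "\<bar>x\<bar> \<ge> \<gamma> * real j" for x j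
  proof -
    have "(\<gamma> * real j)\<^sup>2 \<le> \<bar>x\<bar>\<^sup>2" using that assms by (intro power_mono) auto
    thus ?thesis using assms by (simp add: power_mult_distrib mult.assoc)
  qed
  have A: "sum ?f ?A \<le> 1 + sqrt (pi/\<beta>) / \<gamma> / 2"
  proof -
    have "sum ?f ?A = (\<Sum>j\<le>J. ?f (k0 + 1 + int j))" by (subst sum.reindex) (auto simp: inj_on_def)
    also have "\<dots> \<le> (\<Sum>j\<le>J. exp (- ?c * (real j)\<^sup>2))"
    proof (intro sum_mono pt)
      fix j
      have e: "\<gamma> * of_int (k0 + 1 + int j) - m = \<gamma> * real j + (\<gamma> - r)" by (simp add: r_def algebra_simps)
      show "\<gamma> * real j \<le> \<bar>\<gamma> * of_int (k0 + 1 + int j) - m\<bar>" unfolding e using r assms by auto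
    qed
    finally show ?thesis using one by linarith
  qed
  have B: "sum ?f ?B \<le> 1 + sqrt (pi/\<beta>) / \<gamma> / 2"
  proof -
    have "sum ?f ?B = (\<Sum>j\<le>J. ?f (k0 - int j))" by (subst sum.reindex) (auto simp: inj_on_def)
    also have "\<dots> \<le> (\<Sum>j\<le>J. exp (- ?c * (real j)\<^sup>2))"
    proof (intro sum_mono pt)
      fix j
      have e: "\<gamma> * of_int (k0 - int j) - m = - (\<gamma> * real j + r)" by (simp add: r_def algebra_simps)
      show "\<gamma> * real j \<le> \<bar>\<gamma> * of_int (k0 - int j) - m\<bar>" unfolding e using r assms by auto
    qed
    finally show ?thesis using one by linarith
  qed
  have "sum ?f K \<le> sum ?f (?A \<union> ?B)" using sub by (intro sum_mono2) auto
  also have "\<dots> \<le> sum ?f ?A + sum ?f ?B" by (subst sum.union_inter[symmetric]) (auto intro!: sum_nonneg)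
  finally show ?thesis using A B by linarith
qed

text \<open>The one-sided sum dominates the integral. Counting the term at 0 only once costs 1, and
  truncating the integral, allowed 1/2 on each side, costs another 1.\<close>

lemma lattice_gauss_sum_ge:
  fixes \<beta> \<gamma> :: real
  assumes "\<beta> > 0" "\<gamma> > 0"
  shows "\<forall>\<^sub>F H in sequentially. (\<Sum>k\<in>{-int H..int H}. exp (- \<beta> * (\<gamma> * of_int k)\<^sup>2)) \<ge> sqrt (pi/\<beta>) / \<gamma> - 2"
proof -
  let ?c = "\<beta> * \<gamma>\<^sup>2"
  have c: "?c > 0" using assms by simp
  have "\<forall>\<^sub>F H in sequentially. integral {0..real H} (\<lambda>x::real. exp (- ?c * x\<^sup>2)) > sqrt (pi/?c)/2 - 1/2"
    by (rule order_tendstoD(1)[OF half_gauss_integral_tendsto[OF c]]) simp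
  thus ?thesis
  proof eventually_elim
    case (elim H)
    let ?f = "\<lambda>k::int. exp (- \<beta> * (\<gamma> * of_int k)\<^sup>2)"
    have S: "(\<Sum>j\<le>H. exp (- ?c * (real j)\<^sup>2)) \<ge> sqrt (pi/?c)/2 - 1/2"
      using gauss_sum_integral(1)[OF c, of H] elim by linarith
    have e: "sqrt (pi/?c) = sqrt (pi/\<beta>)/\<gamma>" using assms by (simp add: real_sqrt_divide real_sqrt_mult)
    have un: "{-int H..int H} = {0..int H} \<union> {-int H..<0}" by auto
    have p: "sum ?f {0..int H} = (\<Sum>j\<le>H. exp (- ?c * (real j)\<^sup>2))"
      by (rule sum.reindex_bij_witness[of _ int nat])
         (auto simp: power_mult_distrib mult_ac)
    have "sum ?f {-int H..<0} = (\<Sum>j\<in>{1..H}. exp (- ?c * (real j)\<^sup>2))"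
      by (rule sum.reindex_bij_witness[of _ "\<lambda>j. - int j" "\<lambda>k. nat (-k)"])
         (auto simp: power_mult_distrib mult_ac)
    also have "\<dots> = (\<Sum>j\<le>H. exp (- ?c * (real j)\<^sup>2)) - 1"
      unfolding atMost_atLeast0 by (subst (2) sum.atLeast_Suc_atMost) auto
    finally have q: "sum ?f {-int H..<0} = (\<Sum>j\<le>H. exp (- ?c * (real j)\<^sup>2)) - 1" .
    have "sum ?f {-int H..int H} = sum ?f {0..int H} + sum ?f {-int H..<0}"
      unfolding un by (rule sum.union_disjoint) auto
    thus ?case using S e p q by linarith
  qed
qed

text \<open>Upper bound for the mass of exp (- x^2 / 2) on the grid \<gamma> Z, that is
  \<open>lattice_gauss_sum_le\<close> at variance 1; it normalises the Gaussian weights.\<close>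

definition gauss_norm :: "real \<Rightarrow> real" where "gauss_norm \<gamma> = 2 + sqrt (2*pi) / \<gamma>"

text \<open>Completing the square gives a Gaussian sum of variance 1/q with a shifted centre, so the
  Gaussian moment formula survives on the grid. The additive 2 of the grid bound is absorbed because
  1 \<le> 1 / sqrt q.\<close>

lemma gauss_weight_scalar:
  fixes K :: "int set" and \<gamma> l \<alpha> v :: real
  assumes "\<gamma> > 0" "finite K" "l \<ge> 0" "2*l*\<alpha>\<^sup>2 < 1"
  shows "(\<Sum>k\<in>K. exp (- (\<gamma> * of_int k)\<^sup>2/2) * exp (l * (\<alpha> * \<gamma> * of_int k + v)\<^sup>2))
      \<le> gauss_norm \<gamma> * (1 / sqrt (1 - 2*l*\<alpha>\<^sup>2)) * exp (l / (1 - 2*l*\<alpha>\<^sup>2) * v\<^sup>2)"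
proof -
  define q where "q = 1 - 2*l*\<alpha>\<^sup>2"
  have q: "q > 0" "q \<le> 1" using assms by (auto simp: q_def)
  define m where "m = 2*l*\<alpha>* v/q"
  have sq: "-(x\<^sup>2)/2 + l*(\<alpha>*x+v)\<^sup>2 = -(q/2) * (x - m)\<^sup>2 + l/q* v\<^sup>2" for x
  proof -
    have mq: "m * q = 2*l*\<alpha>* v" using q by (simp add: m_def)
    have "q * (-(x\<^sup>2)/2 + l*(\<alpha>*x+v)\<^sup>2) = q * (-(q/2) * x\<^sup>2 + (m*q)*x + l* v\<^sup>2)"
      unfolding mq by (simp add: q_def power2_eq_square field_simps)
    moreover have "q * (-(q/2) * (x - m)\<^sup>2 + l/q* v\<^sup>2) = q*(-(q/2)*x\<^sup>2 + (m*q)*x) - (m*q)\<^sup>2/2 + l* v\<^sup>2"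
      using q by (simp add: power2_eq_square algebra_simps)
    moreover have "q * l * v\<^sup>2 = - (m*q)\<^sup>2/2 + l* v\<^sup>2" unfolding mq
      by (simp add: q_def power2_eq_square algebra_simps)
    ultimately have "q * (-(x\<^sup>2)/2 + l*(\<alpha>*x+v)\<^sup>2) = q * (- (q/2) * (x - m)\<^sup>2 + l/q* v\<^sup>2)"
      by (simp add: algebra_simps)
    thus ?thesis using q by simp
  qed
  have "(\<Sum>k\<in>K. exp (- (\<gamma> * of_int k)\<^sup>2/2) * exp (l * (\<alpha> * \<gamma> * of_int k + v)\<^sup>2))
     = exp (l/q* v\<^sup>2) * (\<Sum>k\<in>K. exp (- (q/2) * (\<gamma> * of_int k - m)\<^sup>2))"
    unfolding sum_distrib_left
  proof (rule sum.cong, goal_cases)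
    case (2 k)
    show ?case unfolding mult_exp_exp using sq[of "\<gamma> * of_int k"] by (simp add: mult.assoc add.commute)
  qed simp
  also have "\<dots> \<le> exp (l/q* v\<^sup>2) * (2 + sqrt (pi/(q/2)) / \<gamma>)"
    using lattice_gauss_sum_le[of "q/2" \<gamma> K m] q assms by (intro mult_left_mono) auto
  also have "2 + sqrt (pi/(q/2)) / \<gamma> \<le> gauss_norm \<gamma> * (1 / sqrt q)"
  proof -
    have "1 \<le> 1 / sqrt q" using q by (simp add: field_simps)
    moreover have "sqrt (pi/(q/2)) / \<gamma> = sqrt (2*pi)/\<gamma> * (1/sqrt q)" 
      using q by (simp add: real_sqrt_divide mult.commute)
    ultimately show ?thesis by (simp add: gauss_norm_def algebra_simps)
  qed
  finally show ?thesis by (simp add: q_def mult_ac)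
qed

definition gauss_weight :: "nat \<Rightarrow> real \<Rightarrow> (nat \<Rightarrow> int) \<Rightarrow> real" where
  "gauss_weight N \<gamma> \<xi> = exp (- (\<Sum>i<N. (\<gamma> * of_int (\<xi> i))\<^sup>2)/2)"

lemma gauss_weight_nonneg: "gauss_weight N \<gamma> \<xi> \<ge> 0" by (simp add: gauss_weight_def)

lemma gauss_weight_vector:
  fixes K :: "int set" and \<gamma> l \<alpha> :: real and v :: "nat \<Rightarrow> real"
  assumes "\<gamma> > 0" "finite K" "l \<ge> 0" "2*l*\<alpha>\<^sup>2 < 1"
  shows "(\<Sum>\<xi>\<in>PiE {..<N} (\<lambda>_. K). gauss_weight N \<gamma> \<xi> * exp (l * (\<Sum>i<N. (\<alpha> * \<gamma> * of_int (\<xi> i) + v i)\<^sup>2)))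
      \<le> gauss_norm \<gamma> ^ N * (1 / sqrt (1 - 2*l*\<alpha>\<^sup>2)) ^ N * exp (l / (1 - 2*l*\<alpha>\<^sup>2) * (\<Sum>i<N. (v i)\<^sup>2))"
proof -
  let ?t = "\<lambda>i k. exp (- (\<gamma> * of_int k)\<^sup>2/2) * exp (l * (\<alpha> * \<gamma> * of_int k + v i)\<^sup>2)"
  have "(\<Sum>\<xi>\<in>PiE {..<N} (\<lambda>_. K). gauss_weight N \<gamma> \<xi> * exp (l * (\<Sum>i<N. (\<alpha> * \<gamma> * of_int (\<xi> i) + v i)\<^sup>2)))
     = (\<Sum>\<xi>\<in>PiE {..<N} (\<lambda>_. K). \<Prod>i<N. ?t i (\<xi> i))"
    by (rule sum.cong) (auto simp: gauss_weight_def prod.distrib exp_sum[symmetric] sum_distrib_left sum_negf sum_divide_distrib)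
  also have "\<dots> = (\<Prod>i<N. \<Sum>k\<in>K. ?t i k)" using assms by (subst prod_sum_PiE) auto
  also have "\<dots> \<le> (\<Prod>i<N. gauss_norm \<gamma> * (1 / sqrt (1 - 2*l*\<alpha>\<^sup>2)) * exp (l / (1 - 2*l*\<alpha>\<^sup>2) * (v i)\<^sup>2))"
    using assms gauss_weight_scalar[OF assms] by (intro prod_mono) (auto intro!: sum_nonneg)
  also have "\<dots> = gauss_norm \<gamma> ^ N * (1 / sqrt (1 - 2*l*\<alpha>\<^sup>2)) ^ N * exp (l / (1 - 2*l*\<alpha>\<^sup>2) * (\<Sum>i<N. (v i)\<^sup>2))"
    by (simp add: prod.distrib exp_sum[symmetric] sum_distrib_left prod_dividef power_divide)
  finally show ?thesis .
qed

text \<open>The codewords are summed out one at a time. Each turns the tilt l into l' = l / (1 - 2 l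
  \<alpha>^2), and the factors combine to the one for the total variance, since (1 - 2 l \<alpha>^2)
  (1 - 2 l' A) = 1 - 2 l (\<alpha>^2 + A).\<close>

lemma gauss_weight_components:
  fixes K :: "int set" and \<gamma> l :: real and \<alpha> :: "'c \<Rightarrow> real" and v :: "nat \<Rightarrow> real"
  assumes "finite C" "\<gamma> > 0" "finite K" "l \<ge> 0" "2*l*(\<Sum>c\<in>C. (\<alpha> c)\<^sup>2) < 1"
  shows "(\<Sum>\<xi>\<in>PiE C (\<lambda>_. PiE {..<N} (\<lambda>_. K)). (\<Prod>c\<in>C. gauss_weight N \<gamma> (\<xi> c)) *
             exp (l * (\<Sum>i<N. (\<gamma> * (\<Sum>c\<in>C. \<alpha> c * of_int (\<xi> c i)) + v i)\<^sup>2)))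
      \<le> (gauss_norm \<gamma> ^ N) ^ card C * (1 / sqrt (1 - 2*l*(\<Sum>c\<in>C. (\<alpha> c)\<^sup>2))) ^ N
          * exp (l / (1 - 2*l*(\<Sum>c\<in>C. (\<alpha> c)\<^sup>2)) * (\<Sum>i<N. (v i)\<^sup>2))"
  using assms
proof (induction C arbitrary: l v rule: finite_induct)
  case empty
  thus ?case by simp
next
  case (insert c C)
  define A where "A = (\<Sum>c\<in>C. (\<alpha> c)\<^sup>2)"
  have A: "(\<Sum>c\<in>insert c C. (\<alpha> c)\<^sup>2) = (\<alpha> c)\<^sup>2 + A" using insert by (simp add: A_def)
  have A0: "A \<ge> 0" by (auto simp: A_def intro: sum_nonneg)
  have h: "2*l*(\<alpha> c)\<^sup>2 + 2*l*A < 1" using insert.prems A by (simp add: algebra_simps)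
  have lA: "2*l*A \<ge> 0" "2*l*(\<alpha> c)\<^sup>2 \<ge> 0" using A0 insert.prems by auto
  define q where "q = 1 - 2*l*(\<alpha> c)\<^sup>2"
  have q: "q > 0" using h lA unfolding q_def by linarith
  define l' where "l' = l/q"
  have l': "l' \<ge> 0" "2*l'*A < 1" using q insert.prems h by (auto simp: l'_def q_def field_simps)
  have h1: "2*l*(\<alpha> c)\<^sup>2 < 1" using h lA by linarith
  have qq: "q * (1 - 2*l'*A) = 1 - 2*l*((\<alpha> c)\<^sup>2 + A)" using q by (simp add: l'_def field_simps q_def)
  let ?V = "PiE {..<N} (\<lambda>_. K)"
  let ?s = "\<lambda>\<xi> i. \<gamma> * (\<Sum>c\<in>C. \<alpha> c * of_int (\<xi> c i)) + v i"
  have inj: "inj_on (\<lambda>(y, g). g(c := y)) (?V \<times> PiE C (\<lambda>_. ?V))"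
    by (rule inj_combinator) (use insert in auto)
  have "(\<Sum>\<xi>\<in>PiE (insert c C) (\<lambda>_. ?V). (\<Prod>c\<in>insert c C. gauss_weight N \<gamma> (\<xi> c)) *
             exp (l * (\<Sum>i<N. (\<gamma> * (\<Sum>c\<in>insert c C. \<alpha> c * of_int (\<xi> c i)) + v i)\<^sup>2)))
     = (\<Sum>(y,\<xi>)\<in>?V \<times> PiE C (\<lambda>_. ?V). (\<Prod>c\<in>C. gauss_weight N \<gamma> (\<xi> c)) * (gauss_weight N \<gamma> y *
             exp (l * (\<Sum>i<N. (\<alpha> c * \<gamma> * of_int (y i) + ?s \<xi> i)\<^sup>2))))"
    unfolding PiE_insert_eq
  proof (subst sum.reindex[OF inj], rule sum.cong, goal_cases)
    case (2 x)
    obtain y g where x: "x = (y,g)" by force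
    have ne: "c' \<in> C \<Longrightarrow> (g(c := y)) c' = g c'" for c' using insert by auto
    have cC: "c \<notin> C" using insert by simp
    hence if1: "c' \<in> C \<Longrightarrow> (if c' = c then y else g c') = g c'" for c' by auto
    have 1: "(\<Prod>c'\<in>C. gauss_weight N \<gamma> ((g(c := y)) c')) = (\<Prod>c'\<in>C. gauss_weight N \<gamma> (g c'))" by (rule prod.cong, simp, simp only: ne)
    have 2: "(\<Sum>c'\<in>C. \<alpha> c' * of_int ((g(c := y)) c' i)) = (\<Sum>c'\<in>C. \<alpha> c' * of_int (g c' i))" for i
      by (rule sum.cong, simp, simp only: ne)
    show ?case unfolding x using insert.hyps 
      by (simp only: o_apply prod.case prod.insert[OF insert.hyps] sum.insert[OF insert.hyps] 1 2) (simp add: cC algebra_simps)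
  qed auto
  also have "\<dots> = (\<Sum>\<xi>\<in>PiE C (\<lambda>_. ?V). (\<Prod>c\<in>C. gauss_weight N \<gamma> (\<xi> c)) * (\<Sum>y\<in>?V. gauss_weight N \<gamma> y *
             exp (l * (\<Sum>i<N. (\<alpha> c * \<gamma> * of_int (y i) + ?s \<xi> i)\<^sup>2))))"
    by (subst sum.cartesian_product[symmetric], subst sum.swap) (simp add: sum_distrib_left)
  also have "\<dots> \<le> (\<Sum>\<xi>\<in>PiE C (\<lambda>_. ?V). (\<Prod>c\<in>C. gauss_weight N \<gamma> (\<xi> c)) *
      (gauss_norm \<gamma> ^ N * (1 / sqrt q) ^ N * exp (l' * (\<Sum>i<N. (?s \<xi> i)\<^sup>2))))"
    unfolding q_def l'_def using h1 insert.prems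
    by (intro sum_mono mult_left_mono gauss_weight_vector) (auto intro!: prod_nonneg gauss_weight_nonneg)
  also have "\<dots> = gauss_norm \<gamma> ^ N * (1 / sqrt q) ^ N * (\<Sum>\<xi>\<in>PiE C (\<lambda>_. ?V). (\<Prod>c\<in>C. gauss_weight N \<gamma> (\<xi> c)) *
       exp (l' * (\<Sum>i<N. (?s \<xi> i)\<^sup>2)))"
    by (simp add: sum_distrib_left mult_ac)
  also have "\<dots> \<le> gauss_norm \<gamma> ^ N * (1 / sqrt q) ^ N * ((gauss_norm \<gamma> ^ N) ^ card C * (1 / sqrt (1 - 2*l'*A)) ^ N
          * exp (l' / (1 - 2*l'*A) * (\<Sum>i<N. (v i)\<^sup>2)))"
    unfolding A_def using insert.prems l' q by (intro mult_left_mono insert.IH) (auto simp: A_def gauss_norm_def)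
  also have "\<dots> = (gauss_norm \<gamma> ^ N) ^ card (insert c C) * (1 / sqrt (q * (1 - 2*l'*A))) ^ N
       * exp (l / (q * (1 - 2*l'*A)) * (\<Sum>i<N. (v i)\<^sup>2))"
    using insert.hyps by (simp add: real_sqrt_mult power_mult_distrib l'_def power_divide)
  finally show ?case unfolding qq A .
qed

section \<open>Exponential quadratic moments of the channel noise\<close>

lemma prob_space_std_gauss: "prob_space std_gauss"
  unfolding std_gauss_def by (rule prob_space_normal_density) simp

lemma sets_std_gauss [simp, measurable_cong]: "sets std_gauss = sets borel"
  by (simp add: std_gauss_def)

text \<open>The tilted density is a normal density of variance 1 / (1 - 2 \<mu>) up to
  normalisation, and the normalisation is the value.\<close>

lemma std_gauss_square_mgf:
  fixes \<mu> :: real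
  assumes "\<mu> < 1/2"
  shows "(\<integral>\<^sup>+z. ennreal (exp (\<mu> * z\<^sup>2)) \<partial>std_gauss) = ennreal (1 / sqrt (1 - 2*\<mu>))"
proof -
  define s where "s = 1 / sqrt (1 - 2*\<mu>)"
  have s: "s > 0" using assms by (simp add: s_def)
  have s2: "s\<^sup>2 = 1/(1-2*\<mu>)" using assms by (simp add: s_def power_divide)
  have "(\<integral>\<^sup>+z. ennreal (exp (\<mu> * z\<^sup>2)) \<partial>std_gauss) = (\<integral>\<^sup>+z. ennreal (std_normal_density z) * ennreal (exp (\<mu> * z\<^sup>2)) \<partial>lborel)"
    unfolding std_gauss_def by (subst nn_integral_density) auto
  also have "\<dots> = (\<integral>\<^sup>+z. ennreal s * ennreal (normal_density 0 s z) \<partial>lborel)"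
  proof (rule nn_integral_cong)
    fix z :: real
    have "std_normal_density z * exp (\<mu> * z\<^sup>2) = s * normal_density 0 s z"
    proof -
      have "-(z\<^sup>2)/2 + \<mu>*z\<^sup>2 = -(z\<^sup>2) / (2* s\<^sup>2)" unfolding s2 using assms by (simp add: field_simps)
      thus ?thesis unfolding std_normal_density_def normal_density_def using s
        by (simp add: exp_add[symmetric] real_sqrt_mult)
    qed
    thus "ennreal (std_normal_density z) * ennreal (exp (\<mu> * z\<^sup>2)) = ennreal s * ennreal (normal_density 0 s z)"
      using s by (simp add: ennreal_mult'[symmetric])
  qed
  also have "\<dots> = ennreal s * (\<integral>\<^sup>+z. ennreal (normal_density 0 s z) \<partial>lborel)"
    by (rule nn_integral_cmult) auto
  also have "(\<integral>\<^sup>+z. ennreal (normal_density 0 s z) \<partial>lborel) = 1"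
    using prob_space.emeasure_space_1[OF prob_space_normal_density[OF s, of 0]]
    by (simp add: emeasure_density)
  finally show ?thesis by (simp add: s_def)
qed

text \<open>The injection \<iota> picks the samples of one node in one block out of the noise of the
  whole transmission; all other coordinates integrate to 1.\<close>

lemma noise_square_mgf:
  fixes \<mu> :: real and \<iota> :: "nat \<Rightarrow> 'j"
  assumes "finite J" "inj_on \<iota> {..<N}" "\<iota> ` {..<N} \<subseteq> J" "\<mu> < 1/2"
  shows "(\<integral>\<^sup>+z. ennreal (exp (\<mu> * (\<Sum>i<N. (z (\<iota> i))\<^sup>2))) \<partial>PiM J (\<lambda>_. std_gauss)) = ennreal ((1 / sqrt (1 - 2*\<mu>)) ^ N)"
proof -
  interpret product_sigma_finite "\<lambda>_. std_gauss"
    unfolding product_sigma_finite_def using prob_space_std_gauss prob_space_imp_sigma_finite by blast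
  let ?I = "\<iota> ` {..<N}"
  let ?f = "\<lambda>j x::real. if j \<in> ?I then ennreal (exp (\<mu> * x\<^sup>2)) else 1"
  have "(\<integral>\<^sup>+z. ennreal (exp (\<mu> * (\<Sum>i<N. (z (\<iota> i))\<^sup>2))) \<partial>PiM J (\<lambda>_. std_gauss))
     = (\<integral>\<^sup>+z. (\<Prod>j\<in>J. ?f j (z j)) \<partial>PiM J (\<lambda>_. std_gauss))"
  proof (rule nn_integral_cong)
    fix z :: "'j \<Rightarrow> real"
    have "(\<Prod>j\<in>J. ?f j (z j)) = (\<Prod>j\<in>?I. ?f j (z j))"
      using assms by (intro prod.mono_neutral_right) auto
    also have "\<dots> = (\<Prod>j\<in>?I. ennreal (exp (\<mu> * (z j)\<^sup>2)))" by (rule prod.cong) auto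
    also have "\<dots> = (\<Prod>i<N. ennreal (exp (\<mu> * (z (\<iota> i))\<^sup>2)))" using assms by (subst prod.reindex) auto
    also have "\<dots> = ennreal (exp (\<mu> * (\<Sum>i<N. (z (\<iota> i))\<^sup>2)))"
      by (simp add: prod_ennreal sum_distrib_left exp_sum)
    finally show "ennreal (exp (\<mu> * (\<Sum>i<N. (z (\<iota> i))\<^sup>2))) = (\<Prod>j\<in>J. ?f j (z j))" by simp
  qed
  also have "\<dots> = (\<Prod>j\<in>J. integral\<^sup>N std_gauss (?f j))"
    using assms by (intro product_nn_integral_prod) auto
  also have "\<dots> = (\<Prod>j\<in>?I. integral\<^sup>N std_gauss (?f j))"
    using assms prob_space.emeasure_space_1[OF prob_space_std_gauss] by (intro prod.mono_neutral_right) auto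
  also have "\<dots> = (\<Prod>j\<in>?I. ennreal (1 / sqrt (1 - 2*\<mu>)))"
    using assms std_gauss_square_mgf[of \<mu>] by (intro prod.cong) auto
  also have "\<dots> = ennreal ((1 / sqrt (1 - 2*\<mu>)) ^ N)"
    using assms by (simp add: card_image ennreal_power)
  finally show ?thesis .
qed

section \<open>Size of the shaping ball of unit power per symbol\<close>

definition shaping :: "nat \<Rightarrow> nat \<Rightarrow> real \<Rightarrow> (nat \<Rightarrow> int) set" where
  "shaping N H \<gamma> = {\<xi> \<in> PiE {..<N} (\<lambda>_. {- int H..int H}). (\<Sum>i<N. (\<gamma> * of_int (\<xi> i))\<^sup>2) \<le> real N}"

lemma gauss_box_sum:
  fixes \<gamma> b :: real
  assumes "finite (K :: int set)"
  shows "(\<Sum>\<xi>\<in>PiE {..<N} (\<lambda>_. K). exp (- b * (\<Sum>i<N. (\<gamma> * of_int (\<xi> i))\<^sup>2))) = (\<Sum>k\<in>K. exp (- b * (\<gamma> * of_int k)\<^sup>2)) ^ N"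
proof -
  have "(\<Sum>k\<in>K. exp (- b * (\<gamma> * of_int k)\<^sup>2)) ^ N = (\<Prod>i<N. \<Sum>k\<in>K. exp (- b * (\<gamma> * of_int k)\<^sup>2))" by simp
  also have "\<dots> = (\<Sum>\<xi>\<in>PiE {..<N} (\<lambda>_. K). \<Prod>i<N. exp (- b * (\<gamma> * of_int (\<xi> i))\<^sup>2))"
    using assms by (subst prod_sum_PiE) auto
  finally show ?thesis by (simp add: exp_sum[symmetric] sum_distrib_left)
qed

text \<open>A pointwise minorant of the indicator of the ball is summed: a Gaussian weight of
  variance S, scaled to be at most 1 beyond squared radius N S^2, times one minus two Chernoff
  corrections that make it nonpositive outside the shell from N S^2 to N. As S < 1, the typical
  squared radius N S lies strictly inside the shell.\<close>

lemma card_shaping_chernoff: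
  fixes \<gamma> S :: real and H N :: nat
  assumes S: "0 < S" "S < 1"
  defines "A \<equiv> (\<lambda>t::real. \<Sum>k\<in>{- int H..int H}. exp (- (1/(2*t)) * (\<gamma> * of_int k)\<^sup>2))"
  shows "real (card (shaping N H \<gamma>)) \<ge> exp (S/2) ^ N * A S ^ N *
     (1 - (exp (- ((1/S - 1)/2)) * A 1 / A S) ^ N - (exp ((1 - S)/2) * A (S\<^sup>2) / A S) ^ N)"
proof -
  let ?K = "{- int H..int H}" and ?X = "PiE {..<N} (\<lambda>_. {- int H..int H})"
  define n where "n = (\<lambda>\<xi>::nat \<Rightarrow> int. \<Sum>i<N. (\<gamma> * of_int (\<xi> i))\<^sup>2)"
  \<comment> \<open>These tilts change the variance S of the weight to 1 for the outer correction
    and to S^2 for the inner one; hence \<open>A 1\<close> and \<open>A (S\<^sup>2)\<close> in the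
    bound.\<close>
  define l1 where "l1 = (1/S - 1)/2"
  define l2 where "l2 = (1/S\<^sup>2 - 1/S)/2"
  have l: "l1 \<ge> 0" "l2 \<ge> 0" using S by (auto simp: l1_def l2_def power2_eq_square field_simps)
  let ?e = "\<lambda>\<xi>. exp ((1/(2*S)) * (N*S\<^sup>2 - n \<xi>))"
  have Apos: "A t > 0" for t unfolding A_def by (rule sum_pos) auto
  have bs: "(\<Sum>\<xi>\<in>?X. exp (- (1/(2*t)) * n \<xi>)) = A t ^ N" for t
    unfolding A_def n_def by (rule gauss_box_sum) simp
  have "(\<Sum>\<xi>\<in>?X. ?e \<xi> * (1 - exp (l1 * (n \<xi> - N)) - exp (l2 * (N*S\<^sup>2 - n \<xi>)))) \<le> (\<Sum>\<xi>\<in>?X. if n \<xi> \<le> N then 1 else 0)"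
  proof (rule sum_mono)
    fix \<xi> assume "\<xi> \<in> ?X"
    show "?e \<xi> * (1 - exp (l1 * (n \<xi> - N)) - exp (l2 * (N*S\<^sup>2 - n \<xi>))) \<le> (if n \<xi> \<le> N then 1 else 0)"
    proof (cases "n \<xi> \<le> N \<and> n \<xi> \<ge> N*S\<^sup>2")
      case True
      have "?e \<xi> \<le> 1" using True S by (simp add: mult_nonneg_nonpos divide_nonpos_pos)
      moreover have "1 - exp (l1 * (n \<xi> - N)) - exp (l2 * (N*S\<^sup>2 - n \<xi>)) \<le> 1"
        using exp_gt_zero[of "l1 * (n \<xi> - N)"] exp_gt_zero[of "l2 * (N*S\<^sup>2 - n \<xi>)"] by linarith
      ultimately have "?e \<xi> * (1 - exp (l1 * (n \<xi> - N)) - exp (l2 * (N*S\<^sup>2 - n \<xi>))) \<le> 1"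
        by (smt (verit) exp_gt_zero mult_le_cancel_left1 mult_left_le)
      thus ?thesis using True by simp
    next
      case False
      hence "exp (l1 * (n \<xi> - N)) \<ge> 1 \<or> exp (l2 * (N*S\<^sup>2 - n \<xi>)) \<ge> 1" using l by auto
      hence "1 - exp (l1 * (n \<xi> - N)) - exp (l2 * (N*S\<^sup>2 - n \<xi>)) \<le> 0"
        using exp_gt_zero[of "l1 * (n \<xi> - N)"] exp_gt_zero[of "l2 * (N*S\<^sup>2 - n \<xi>)"] by linarith
      hence "?e \<xi> * (1 - exp (l1 * (n \<xi> - N)) - exp (l2 * (N*S\<^sup>2 - n \<xi>))) \<le> 0"
        by (intro mult_nonneg_nonpos) auto
      thus ?thesis by auto
    qed
  qed
  also have "(\<Sum>\<xi>\<in>?X. if n \<xi> \<le> N then 1 else 0) = real (card (shaping N H \<gamma>))"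
  proof -
    have "finite ?X" by (intro finite_PiE) auto
    thus ?thesis by (simp add: sum.If_cases shaping_def n_def Int_def)
  qed
  also have "(\<Sum>\<xi>\<in>?X. ?e \<xi> * (1 - exp (l1 * (n \<xi> - N)) - exp (l2 * (N*S\<^sup>2 - n \<xi>))))
     = (\<Sum>\<xi>\<in>?X. exp (S/2) ^ N * exp (- (1/(2*S)) * n \<xi>)
           - exp (S/2) ^ N * exp (- l1) ^ N * exp (- (1/(2*1)) * n \<xi>)
           - exp (S/2) ^ N * exp ((1-S)/2) ^ N * exp (- (1/(2*S\<^sup>2)) * n \<xi>))"
  proof (rule sum.cong)
    fix \<xi>
    have e1: "?e \<xi> = exp (S/2) ^ N * exp (- (1/(2*S)) * n \<xi>)"
      unfolding exp_of_nat_mult[symmetric] mult_exp_exp using S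
      by (simp add: field_simps power2_eq_square)
    have e2: "?e \<xi> * exp (l1 * (n \<xi> - N)) = exp (S/2) ^ N * exp (- l1) ^ N * exp (- (1/(2*1)) * n \<xi>)"
      unfolding exp_of_nat_mult[symmetric] mult_exp_exp using S
      by (simp add: l1_def field_simps power2_eq_square)
    have e3: "?e \<xi> * exp (l2 * (N*S\<^sup>2 - n \<xi>)) = exp (S/2) ^ N * exp ((1-S)/2) ^ N * exp (- (1/(2*S\<^sup>2)) * n \<xi>)"
      unfolding exp_of_nat_mult[symmetric] mult_exp_exp using S
      by (simp add: l2_def field_simps power2_eq_square)
    show "?e \<xi> * (1 - exp (l1 * (n \<xi> - N)) - exp (l2 * (N*S\<^sup>2 - n \<xi>)))
      = exp (S/2) ^ N * exp (- (1/(2*S)) * n \<xi>)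
           - exp (S/2) ^ N * exp (- l1) ^ N * exp (- (1/(2*1)) * n \<xi>)
           - exp (S/2) ^ N * exp ((1-S)/2) ^ N * exp (- (1/(2*S\<^sup>2)) * n \<xi>)"
      unfolding e1[symmetric] e2[symmetric] e3[symmetric] by (simp add: algebra_simps)
  qed simp
  also have "\<dots> = exp (S/2) ^ N * A S ^ N - exp (S/2) ^ N * exp (- l1) ^ N * A 1 ^ N
      - exp (S/2) ^ N * exp ((1-S)/2) ^ N * A (S\<^sup>2) ^ N"
    by (simp only: sum_subtractf sum_distrib_left[symmetric] bs)
  also have "\<dots> = exp (S/2) ^ N * A S ^ N *
     (1 - (exp (- l1) * A 1 / A S) ^ N - (exp ((1 - S)/2) * A (S\<^sup>2) / A S) ^ N)"
    using Apos[of S] by (simp add: power_mult_distrib power_divide right_diff_distrib)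
  finally show ?thesis by (simp add: l1_def)
qed

lemma tendsto_exp_mult_imp_ge:
  fixes r1 r2 \<delta> :: real
  assumes "0 \<le> r1" "r1 < 1" "0 \<le> r2" "r2 < 1" "\<delta> > 0"
  shows "\<forall>\<^sub>F N in sequentially. 1 - r1 ^ N - r2 ^ N \<ge> exp (- \<delta>) ^ N"
proof -
  have "(\<lambda>N. 1 - r1 ^ N - r2 ^ N - exp (- \<delta>) ^ N) \<longlonglongrightarrow> 1 - 0 - 0 - 0"
    using assms by (intro tendsto_diff tendsto_const LIMSEQ_realpow_zero) auto
  hence "\<forall>\<^sub>F N in sequentially. 1 - r1 ^ N - r2 ^ N - exp (- \<delta>) ^ N > 0"
    by (rule order_tendstoD) simp
  thus ?thesis by eventually_elim simp
qed

text \<open>As \<gamma> decreases, ratios of grid sums tend to ratios of Gaussian integrals, for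
  which both Chernoff bases are below 1 by \<open>chernoff_factor\<close>. S is taken near 1 before
  \<gamma>, so that exp (S/2) \<open>A S\<close> loses at most half of \<delta> against exp (1/2)
  \<open>gauss_norm\<close>; the other half pays for the corrections.\<close>

lemma card_shaping_ge:
  fixes \<delta> :: real
  assumes "\<delta> > 0"
  shows "\<forall>\<^sub>F \<gamma> in at_right 0. \<exists>H. \<forall>\<^sub>F N in sequentially.
    real (card (shaping N H \<gamma>)) \<ge> (exp (1/2) * gauss_norm \<gamma>) ^ N * exp (- \<delta>) ^ N"
proof -
  have "((\<lambda>S::real. exp ((S - 1)/2) * sqrt S) \<longlongrightarrow> exp ((1 - 1)/2) * sqrt 1) (at_left 1)"
    by (intro tendsto_intros) auto
  hence "\<forall>\<^sub>F S in at_left (1::real). exp ((S - 1)/2) * sqrt S > exp (- \<delta>/2)"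
    using assms by (intro order_tendstoD) auto
  moreover have "\<forall>\<^sub>F S in at_left (1::real). S \<in> {0<..<1}" by (rule eventually_at_left_real) simp
  ultimately have ev: "\<forall>\<^sub>F S in at_left (1::real). S \<in> {0<..<1} \<and> exp ((S - 1)/2) * sqrt S > exp (- \<delta>/2)"
    by eventually_elim auto
  obtain S :: real where S: "0 < S" "S < 1" and S3: "exp ((S - 1)/2) * sqrt S > exp (- \<delta>/2)"
    using eventually_happens'[OF trivial_limit_at_left_real ev] by auto
  have c1: "exp (- ((1/S - 1)/2)) * sqrt (2*pi) / sqrt (2*pi*S) < 1"
    using chernoff_factor(2)[of S 1] S by (simp add: real_sqrt_mult real_sqrt_divide field_simps)
  have c2: "exp ((1 - S)/2) * sqrt (2*pi*S\<^sup>2) / sqrt (2*pi*S) < 1"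
  proof -
    have e: "- ((1/S - 1/S\<^sup>2)/2) * S\<^sup>2 = (1 - S)/2" using S by (simp add: field_simps power2_eq_square)
    have f: "1 - 2 * ((1/S - 1/S\<^sup>2)/2) * S = 1/S" using S by (simp add: field_simps power2_eq_square)
    have "S\<^sup>2 \<noteq> S" using S by (auto simp: power2_eq_square)
    with chernoff_factor(2)[of S "S\<^sup>2"] S have "exp ((1 - S)/2) / sqrt (1/S) < 1"
      unfolding e f by auto
    thus ?thesis using S
      by (simp add: real_sqrt_mult real_sqrt_divide power2_eq_square field_simps)
  qed
  have sp: "sqrt (2*pi*S) > 0" using S by simp
  let ?d = "\<lambda>\<gamma>::real. sqrt (2*pi*S) - 2*\<gamma>"
  have id: "((\<lambda>\<gamma>::real. \<gamma>) \<longlongrightarrow> 0) (at_right 0)" by (rule tendsto_ident_at)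
  have "((\<lambda>\<gamma>. exp (- ((1/S - 1)/2)) * (2*\<gamma> + sqrt (2*pi)) / ?d \<gamma>) \<longlongrightarrow>
      exp (- ((1/S - 1)/2)) * (2*0 + sqrt (2*pi)) / (sqrt (2*pi*S) - 2*0)) (at_right 0)"
    using sp by (intro tendsto_intros id) auto
  hence e1: "\<forall>\<^sub>F \<gamma> in at_right 0. exp (- ((1/S - 1)/2)) * (2*\<gamma> + sqrt (2*pi)) / ?d \<gamma> < 1"
    using c1 by (intro order_tendstoD) auto
  have "((\<lambda>\<gamma>. exp ((1-S)/2) * (2*\<gamma> + sqrt (2*pi*S\<^sup>2)) / ?d \<gamma>) \<longlongrightarrow>
      exp ((1-S)/2) * (2*0 + sqrt (2*pi*S\<^sup>2)) / (sqrt (2*pi*S) - 2*0)) (at_right 0)"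
    using sp by (intro tendsto_intros id) auto
  hence e2: "\<forall>\<^sub>F \<gamma> in at_right 0. exp ((1-S)/2) * (2*\<gamma> + sqrt (2*pi*S\<^sup>2)) / ?d \<gamma> < 1"
    using c2 by (intro order_tendstoD) auto
  have "((\<lambda>\<gamma>. exp ((S-1)/2) * (?d \<gamma> / (2*\<gamma> + sqrt (2*pi)))) \<longlongrightarrow>
      exp ((S-1)/2) * ((sqrt (2*pi*S) - 2*0) / (2*0 + sqrt (2*pi)))) (at_right 0)"
    by (intro tendsto_intros id) auto
  hence e3: "\<forall>\<^sub>F \<gamma> in at_right 0. exp ((S-1)/2) * (?d \<gamma> / (2*\<gamma> + sqrt (2*pi))) > exp (-\<delta>/2)"
    using S3 S by (intro order_tendstoD) (auto simp: real_sqrt_mult)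
  have t4: "((\<lambda>\<gamma>. ?d \<gamma>) \<longlongrightarrow> sqrt (2*pi*S) - 2*0) (at_right 0)" by (intro tendsto_intros id)
  have e4: "\<forall>\<^sub>F \<gamma> in at_right 0. ?d \<gamma> > 0" by (rule order_tendstoD(1)[OF t4]) (use sp in simp)
  have e5: "\<forall>\<^sub>F \<gamma>::real in at_right 0. \<gamma> > 0" by (simp add: eventually_at_right_less)
  show ?thesis
    using e1 e2 e3 e4 e5
  proof eventually_elim
    case (elim \<gamma>)
    obtain H where H: "(\<Sum>k\<in>{-int H..int H}. exp (- (1/(2*S)) * (\<gamma> * of_int k)\<^sup>2)) \<ge> sqrt (pi/(1/(2*S))) / \<gamma> - 2"
      using eventually_happens[OF lattice_gauss_sum_ge[of "1/(2*S)" \<gamma>]] elim S by auto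
    define A where "A = (\<lambda>t::real. \<Sum>k\<in>{- int H..int H}. exp (- (1/(2*t)) * (\<gamma> * of_int k)\<^sup>2))"
    have AS: "A S \<ge> ?d \<gamma> / \<gamma>" using H elim by (simp add: A_def mult_ac diff_divide_distrib)
    have Au: "A t \<le> (2*\<gamma> + sqrt (2*pi*t)) / \<gamma>" if "t > 0" for t
      using lattice_gauss_sum_le[of "1/(2*t)" \<gamma> "{- int H..int H}" 0] that elim
      by (simp add: A_def mult_ac add_divide_distrib)
    have dg: "?d \<gamma> / \<gamma> > 0" using elim by simp
    have A0: "A t \<ge> 0" for t unfolding A_def by (rule sum_nonneg) simp
    have rat: "A t / A S \<le> (2*\<gamma> + sqrt (2*pi*t)) / ?d \<gamma>" if "t > 0" for t
    proof -
      have "A t / A S \<le> ((2*\<gamma> + sqrt (2*pi*t)) / \<gamma>) / (?d \<gamma> / \<gamma>)"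
        using AS Au[OF that] dg A0[of t] elim that by (intro frac_le) auto
      thus ?thesis using elim by simp
    qed
    have r1: "exp (- ((1/S - 1)/2)) * A 1 / A S < 1"
    proof -
      have "exp (- ((1/S - 1)/2)) * (A 1 / A S) \<le> exp (- ((1/S - 1)/2)) * ((2*\<gamma> + sqrt (2*pi*1)) / ?d \<gamma>)"
        using rat[of 1] by (intro mult_left_mono) auto
      also have "\<dots> < 1" using elim by simp
      finally show ?thesis by simp
    qed
    have r2: "exp ((1 - S)/2) * A (S\<^sup>2) / A S < 1"
    proof -
      have "exp ((1-S)/2) * (A (S\<^sup>2) / A S) \<le> exp ((1-S)/2) * ((2*\<gamma> + sqrt (2*pi*S\<^sup>2)) / ?d \<gamma>)"
        using rat[of "S\<^sup>2"] S by (intro mult_left_mono) auto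
      also have "\<dots> < 1" using elim by simp
      finally show ?thesis by simp
    qed
    have ASp: "A S > 0" using AS dg by linarith
    have r0: "exp (S/2) * A S \<ge> exp (1/2) * gauss_norm \<gamma> * exp (- (\<delta>/2))"
    proof -
      have gz: "gauss_norm \<gamma> = (2*\<gamma> + sqrt (2*pi)) / \<gamma>" using elim by (simp add: gauss_norm_def add_divide_distrib)
      have pz: "2*\<gamma> + sqrt (2*pi) > 0" using elim by (simp add: add_pos_pos)
      have "exp (-\<delta>/2) * (2*\<gamma> + sqrt (2*pi)) \<le> exp ((S-1)/2) * ?d \<gamma>"
        using elim pz by (simp add: field_simps)
      hence "exp (1/2) * (exp (-\<delta>/2) * (2*\<gamma> + sqrt (2*pi))) \<le> exp (1/2) * (exp ((S-1)/2) * ?d \<gamma>)"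
        by (intro mult_left_mono) auto
      also have "exp (1/2) * (exp ((S-1)/2) * ?d \<gamma>) = exp (S/2) * ?d \<gamma>"
        unfolding mult.assoc[symmetric] mult_exp_exp by (simp add: diff_divide_distrib)
      finally have "exp (1/2) * (exp (-\<delta>/2) * (2*\<gamma> + sqrt (2*pi))) / \<gamma> \<le> exp (S/2) * ?d \<gamma> / \<gamma>"
        using elim by (intro divide_right_mono) auto
      also have "exp (S/2) * ?d \<gamma> / \<gamma> \<le> exp (S/2) * A S"
        using AS by (subst times_divide_eq_right[symmetric], intro mult_left_mono) auto
      finally show ?thesis unfolding gz by (simp add: mult_ac)
    qed
    have g0: "gauss_norm \<gamma> > 0" using elim by (auto simp: gauss_norm_def intro!: add_pos_nonneg)
    have "\<forall>\<^sub>F N in sequentially. 1 - (exp (- ((1/S - 1)/2)) * A 1 / A S) ^ N - (exp ((1 - S)/2) * A (S\<^sup>2) / A S) ^ N \<ge> exp (- (\<delta>/2)) ^ N"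
      using r1 r2 A0 assms by (intro tendsto_exp_mult_imp_ge) auto
    hence "\<forall>\<^sub>F N in sequentially. real (card (shaping N H \<gamma>)) \<ge> (exp (1/2) * gauss_norm \<gamma>) ^ N * exp (- \<delta>) ^ N"
    proof eventually_elim
      case (elim N)
      have "(exp (1/2) * gauss_norm \<gamma>) ^ N * exp (- \<delta>) ^ N = (exp (1/2) * gauss_norm \<gamma> * exp (- (\<delta>/2))) ^ N * exp (- (\<delta>/2)) ^ N"
        unfolding power_mult_distrib[symmetric] mult.assoc mult_exp_exp by simp
      also have "\<dots> \<le> (exp (S/2) * A S) ^ N * (1 - (exp (- ((1/S - 1)/2)) * A 1 / A S) ^ N - (exp ((1 - S)/2) * A (S\<^sup>2) / A S) ^ N)"
      proof (rule mult_mono)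
        show "(exp (1/2) * gauss_norm \<gamma> * exp (- (\<delta>/2))) ^ N \<le> (exp (S/2) * A S) ^ N"
          using r0 g0 by (intro power_mono) auto
      qed (use elim ASp in auto)
      also have "\<dots> \<le> real (card (shaping N H \<gamma>))"
        using card_shaping_chernoff[OF S, where H=H and \<gamma>=\<gamma> and N=N] by (simp add: A_def power_mult_distrib)
      finally show ?case .
    qed
    thus ?case by blast
  qed
qed

text \<open>\<open>kc\<close> is the least number of coset symbols for which the expected number of
  shaped candidates reaches exp (\<delta> N). Minimality bounds the cost of the change of measure:
  one \<delta> is this excess, one the deficit in the count of the ball, and one the rounding to a
  power of p, as p \<le> exp (\<delta> N) for large N.\<close>

lemma lattice_parameters:
  fixes \<delta> \<gamma>1 :: real
  assumes "\<delta> > 0" "\<gamma>1 > 0"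
  shows "\<exists>\<gamma> H p. 0 < \<gamma> \<and> \<gamma> < \<gamma>1 \<and> prime (p::nat) \<and> 4 * H < p \<and>
    (\<forall>\<^sub>F N in sequentially. \<exists>kc. real p ^ N * exp \<delta> ^ N \<le> real p ^ kc * real (card (shaping N H \<gamma>)) \<and>
        real p ^ kc * (exp (1/2) * gauss_norm \<gamma>) ^ N \<le> real p ^ N * exp (3*\<delta>) ^ N)"
proof -
  have "\<forall>\<^sub>F \<gamma> in at_right (0::real). \<gamma> \<in> {0<..<\<gamma>1}" using assms by (intro eventually_at_right_real)
  with card_shaping_ge[OF assms(1)]
  have ev0: "\<forall>\<^sub>F \<gamma> in at_right (0::real). \<gamma> \<in> {0<..<\<gamma>1} \<and> (\<exists>H. \<forall>\<^sub>F N in sequentially.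
    real (card (shaping N H \<gamma>)) \<ge> (exp (1/2) * gauss_norm \<gamma>) ^ N * exp (- \<delta>) ^ N)" by eventually_elim auto
  obtain \<gamma> H where \<gamma>: "0 < \<gamma>" "\<gamma> < \<gamma>1" and
    H: "\<forall>\<^sub>F N in sequentially. real (card (shaping N H \<gamma>)) \<ge> (exp (1/2) * gauss_norm \<gamma>) ^ N * exp (- \<delta>) ^ N"
    using eventually_happens'[OF trivial_limit_at_right_real ev0] by auto
  obtain p :: nat where p: "prime p" "p > 4*H" using bigger_prime by blast
  have p1: "p > 1" using p prime_gt_1_nat by blast
  have ev: "\<forall>\<^sub>F N in sequentially. real p \<le> exp \<delta> ^ N"
  proof -
    obtain n where "real p < exp \<delta> ^ n" using real_arch_pow[of "exp \<delta>"] assms by auto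
    moreover have "exp \<delta> ^ n \<le> exp \<delta> ^ N" if "N \<ge> n" for N using assms that by (intro power_increasing) auto
    ultimately show ?thesis unfolding eventually_sequentially by (meson less_le_trans less_imp_le)
  qed
  have gz: "gauss_norm \<gamma> > 0" using \<gamma> by (auto simp: gauss_norm_def intro!: add_pos_nonneg)
  have main: "\<forall>\<^sub>F N in sequentially. \<exists>kc. real p ^ N * exp \<delta> ^ N \<le> real p ^ kc * real (card (shaping N H \<gamma>)) \<and>
        real p ^ kc * (exp (1/2) * gauss_norm \<gamma>) ^ N \<le> real p ^ N * exp (3*\<delta>) ^ N"
    using H ev
  proof eventually_elim
    case (elim N)
    let ?T = "real (card (shaping N H \<gamma>))"
    have Tpos: "?T > 0" using elim(1) gz by (smt (verit) exp_gt_zero mult_pos_pos zero_less_power)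
    have TN: "?T \<le> real p ^ N"
    proof -
      have "card (shaping N H \<gamma>) \<le> card (PiE {..<N} (\<lambda>_. {- int H..int H}))"
        unfolding shaping_def by (intro card_mono finite_PiE) auto
      also have "\<dots> = (2*H+1) ^ N" by (simp add: card_PiE nat_add_distrib nat_mult_distrib)
      also have "\<dots> \<le> p ^ N" using p by (intro power_mono) auto
      finally show ?thesis by (metis of_nat_le_iff of_nat_power)
    qed
    let ?P = "\<lambda>kc. real p ^ N * exp \<delta> ^ N \<le> real p ^ kc * ?T"
    have "\<exists>kc. ?P kc"
    proof -
      obtain kc where "real p ^ kc > real p ^ N * exp \<delta> ^ N / ?T" using real_arch_pow[of "real p"] p1 by auto
      thus ?thesis using Tpos by (auto simp: field_simps intro!: exI[of _ kc])
    qed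
    define kc where "kc = (LEAST kc. ?P kc)"
    have k1: "?P kc" unfolding kc_def using \<open>\<exists>kc. ?P kc\<close> by (rule LeastI_ex)
    have TG: "(exp (1/2) * gauss_norm \<gamma>) ^ N \<le> ?T * exp \<delta> ^ N"
    proof -
      have "(exp (1/2) * gauss_norm \<gamma>) ^ N * exp (- \<delta>) ^ N * exp \<delta> ^ N \<le> ?T * exp \<delta> ^ N"
        using elim by (intro mult_right_mono) auto
      moreover have "exp (- \<delta>) ^ N * exp \<delta> ^ N = 1"
        unfolding power_mult_distrib[symmetric] mult_exp_exp by simp
      ultimately show ?thesis by (simp add: mult.assoc)
    qed
    have e1: "exp \<delta> ^ N \<ge> 1" using assms by (intro one_le_power) simp
    have e3: "exp (3*\<delta>) ^ N = exp \<delta> ^ N * exp \<delta> ^ N * exp \<delta> ^ N"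
      unfolding power_mult_distrib[symmetric] mult_exp_exp by simp
    have "real p ^ kc * (exp (1/2) * gauss_norm \<gamma>) ^ N \<le> real p ^ N * exp (3*\<delta>) ^ N"
    proof (cases "kc = 0")
      \<comment> \<open>Without coset symbols minimality gives no information; instead the shaping
        set has at most p^N points because 2 H + 1 \<le> p.\<close>
      case True
      have "(exp (1/2) * gauss_norm \<gamma>) ^ N \<le> real p ^ N * exp \<delta> ^ N"
        using TG TN by (meson exp_ge_zero mult_right_mono order_trans zero_le_power)
      also have "\<dots> \<le> real p ^ N * exp (3*\<delta>) ^ N" using assms by (intro mult_left_mono power_mono) auto
      finally show ?thesis using True by simp
    next
      case False
      have "\<not> ?P (kc - 1)" unfolding kc_def by (rule not_less_Least) (use False in \<open>simp add: kc_def\<close>)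
      hence a: "real p ^ (kc - 1) * ?T \<le> real p ^ N * exp \<delta> ^ N" by simp
      have "real p ^ kc * (exp (1/2) * gauss_norm \<gamma>) ^ N \<le> real p ^ kc * (?T * exp \<delta> ^ N)"
        using TG by (intro mult_left_mono) auto
      also have "\<dots> = real p * (real p ^ (kc - 1) * ?T) * exp \<delta> ^ N"
        using False by (cases kc) auto
      also have "\<dots> \<le> real p * (real p ^ N * exp \<delta> ^ N) * exp \<delta> ^ N"
        using a by (intro mult_right_mono mult_left_mono) auto
      also have "\<dots> \<le> exp \<delta> ^ N * (real p ^ N * exp \<delta> ^ N) * exp \<delta> ^ N"
        using elim by (intro mult_right_mono) auto
      also have "\<dots> = real p ^ N * exp (3*\<delta>) ^ N" unfolding e3 by simp
      finally show ?thesis .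
    qed
    thus ?case using k1 by blast
  qed
  show ?thesis using \<gamma> p main by blast
qed

section \<open>Random linear codes with shaping\<close>

definition matvec :: "nat \<Rightarrow> (nat \<Rightarrow> nat \<Rightarrow> int) \<Rightarrow> (nat \<Rightarrow> int) \<Rightarrow> nat \<Rightarrow> int" where
  "matvec k G w i = (\<Sum>j<k. G i j * w j)"

lemma matvec_add: "matvec k G (\<lambda>j. v j + w j) i = matvec k G v i + matvec k G w i"
  by (simp add: matvec_def sum.distrib algebra_simps)

lemma matvec_diff: "matvec k G (\<lambda>j. v j - w j) i = matvec k G v i - matvec k G w i"
  by (simp add: matvec_def sum_subtractf algebra_simps)

text \<open>Changing coordinate j by (r' - r) w' mod p, where w' inverts \<open>w j\<close>, embeds
  the solutions for r into those for r'. So all p residues have equally many solutions.\<close>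

lemma card_linear_form_solutions:
  fixes p k :: nat and w :: "nat \<Rightarrow> int" and r :: int
  assumes p: "prime p" and j: "j < k" "\<not> int p dvd w j"
  shows "card {g \<in> PiE {..<k} (\<lambda>_. {0..<int p}). [(\<Sum>j<k. g j * w j) = r] (mod int p)} * p = p ^ k"
proof -
  let ?R = "PiE {..<k} (\<lambda>_. {0..<int p})"
  define sol where "sol = (\<lambda>r. {g \<in> ?R. [(\<Sum>j<k. g j * w j) = r] (mod int p)})"
  have p0: "int p > 0" using p prime_gt_0_nat by simp
  have fin: "finite (sol r)" for r unfolding sol_def
    by (rule finite_subset[OF _ finite_PiE[of "{..<k}" "\<lambda>_. {0..<int p}"]]) auto
  have le: "card (sol r) \<le> card (sol r')" for r r'
  proof -
    have "coprime (w j) (int p)" using p j by (simp add: coprime_commute prime_imp_coprime)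
    then obtain w' where w': "[w j * w' = 1] (mod int p)" using cong_solve_coprime_int by blast
    define s where "s = (r' - r) * w'"
    define f where "f = (\<lambda>g::nat\<Rightarrow>int. g(j := (g j + s) mod int p))"
    have "inj_on f (sol r)"
    proof (rule inj_onI)
      fix g h assume g: "g \<in> sol r" and h: "h \<in> sol r" and eq: "f g = f h"
      have "(g j + s) mod int p = (h j + s) mod int p" using fun_cong[OF eq, of j] by (simp add: f_def)
      hence "[g j + s = h j + s] (mod int p)" by (simp add: cong_def)
      hence "[g j = h j] (mod int p)" by (simp add: cong_add_rcancel)
      moreover have "g \<in> ?R" "h \<in> ?R" using g h unfolding sol_def by blast+
      hence "g j \<in> {0..<int p}" "h j \<in> {0..<int p}" using j PiE_mem by blast+
      ultimately have "g j = h j" unfolding cong_def by simp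
      moreover have "g i = h i" if "i \<noteq> j" for i using fun_cong[OF eq, of i] that by (simp add: f_def)
      ultimately show "g = h" by (intro ext) (metis)
    qed
    moreover have "f ` sol r \<subseteq> sol r'"
    proof
      fix x assume "x \<in> f ` sol r"
      then obtain g where g: "g \<in> ?R" "[(\<Sum>j<k. g j * w j) = r] (mod int p)" "x = f g" by (auto simp: sol_def)
      have "x \<in> ?R" unfolding g(3) f_def using g(1) j p0 unfolding PiE_iff extensional_def by simp
      moreover have "[(\<Sum>i<k. x i * w i) = r'] (mod int p)"
      proof -
        have "(\<Sum>i<k. x i * w i) = x j * w j + (\<Sum>i\<in>{..<k}-{j}. x i * w i)" using j by (subst sum.remove[of _ j]) auto
        also have "(\<Sum>i\<in>{..<k}-{j}. x i * w i) = (\<Sum>i\<in>{..<k}-{j}. g i * w i)" by (rule sum.cong) (auto simp: g(3) f_def)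
        also have "\<dots> = (\<Sum>i<k. g i * w i) - g j * w j" using j by (subst (2) sum.remove[of _ j]) auto
        finally have eq: "(\<Sum>i<k. x i * w i) = x j * w j + ((\<Sum>i<k. g i * w i) - g j * w j)" .
        have "[x j * w j = (g j + s) * w j] (mod int p)"
          unfolding g(3) f_def by (intro cong_mult) (auto simp: cong_def)
        hence "[x j * w j + ((\<Sum>i<k. g i * w i) - g j * w j) = (g j + s) * w j + (r - g j * w j)] (mod int p)"
          by (intro cong_add cong_diff g(2)) auto
        also have "(g j + s) * w j + (r - g j * w j) = r + (r' - r) * (w j * w')" by (simp add: s_def algebra_simps)
        also have "[r + (r' - r) * (w j * w') = r + (r' - r) * 1] (mod int p)" by (intro cong_add cong_mult w') auto
        finally show ?thesis unfolding eq by simp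
      qed
      ultimately show "x \<in> sol r'" by (simp add: sol_def)
    qed
    ultimately show ?thesis by (rule card_inj_on_le[OF _ _ fin])
  qed
  have eq: "card (sol r') = card (sol r)" for r' using le[of r r'] le[of r' r] by simp
  have "p ^ k = card ?R" by (simp add: card_PiE)
  also have "\<dots> = (\<Sum>g\<in>?R. 1)" by simp
  also have "\<dots> = (\<Sum>r'\<in>{0..<int p}. \<Sum>g\<in>{g\<in>?R. (\<Sum>j<k. g j * w j) mod int p = r'}. 1)"
    by (rule sum.group[symmetric]) (use p0 in \<open>simp_all add: finite_PiE image_subset_iff\<close>)
  also have "\<dots> = (\<Sum>r'\<in>{0..<int p}. card (sol r'))"
  proof (rule sum.cong)
    fix r' assume "r' \<in> {0..<int p}"
    hence "r' mod int p = r'" by simp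
    hence "{g\<in>?R. (\<Sum>j<k. g j * w j) mod int p = r'} = sol r'" unfolding sol_def cong_def by (simp only:)
    thus "(\<Sum>g\<in>{g\<in>?R. (\<Sum>j<k. g j * w j) mod int p = r'}. 1) = card (sol r')" by simp
  qed simp
  also have "\<dots> = (\<Sum>r'\<in>{0..<int p}. card (sol r))" by (rule sum.cong[OF refl]) (rule eq)
  also have "\<dots> = card (sol r) * p" by simp
  finally show ?thesis by (simp add: sol_def)
qed

text \<open>Codes of length N have k input symbols mod p, the first \<open>kc\<close> of them free
  for shaping. C indexes codewords that share the matrix but have separate dithers. The factor 4 in
  \<open>H_p\<close> is what differences of two sums of two codewords require.\<close>

locale linear_ensemble =
  fixes N k kc H p :: nat and \<gamma> :: real and C :: "'c set"
  assumes prime_p: "prime p" and H_p: "4 * H < p" and kc_k: "kc \<le> k"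
    and finite_C: "finite C" and gamma_pos: "\<gamma> > 0"
begin

text \<open>Messages, shifts and their sums are told apart by the set of positions on which they may
  be nonzero.\<close>

definition vecs :: "nat set \<Rightarrow> (nat \<Rightarrow> int) set" where
  "vecs I = PiE {..<k} (\<lambda>j. if j \<in> I then {0..<int p} else {0})"

definition Mat :: "(nat \<Rightarrow> nat \<Rightarrow> int) set" where
  "Mat = PiE {..<N} (\<lambda>_. PiE {..<k} (\<lambda>_. {0..<int p}))"

definition Dith :: "(nat \<Rightarrow> int) set" where
  "Dith = PiE {..<N} (\<lambda>_. {0..<int p})"

definition Shp :: "(nat \<Rightarrow> int) set" where "Shp = shaping N H \<gamma>"

text \<open>Symbols below kc choose the coset shift; the message occupies positions from kc on.\<close>
definition cand :: "(nat \<Rightarrow> nat \<Rightarrow> int) \<Rightarrow> (nat \<Rightarrow> int) \<Rightarrow> (nat \<Rightarrow> int) \<Rightarrow> ((nat \<Rightarrow> int) \<times> (nat \<Rightarrow> int)) set" where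
  "cand G d a = {(b, \<xi>). b \<in> vecs {..<kc} \<and> \<xi> \<in> Shp \<and>
     (\<forall>i<N. [\<xi> i = matvec k G a i + matvec k G b i + d i] (mod int p))}"

definition enc_ok where "enc_ok G d a \<longleftrightarrow> cand G d a \<noteq> {}"
definition sel where "sel G d a = (SOME x. x \<in> cand G d a)"
definition cw :: "(nat \<Rightarrow> nat \<Rightarrow> int) \<Rightarrow> (nat \<Rightarrow> int) \<Rightarrow> (nat \<Rightarrow> int) \<Rightarrow> nat \<Rightarrow> int" where
  "cw G d a = snd (sel G d a)"
definition shf :: "(nat \<Rightarrow> nat \<Rightarrow> int) \<Rightarrow> (nat \<Rightarrow> int) \<Rightarrow> (nat \<Rightarrow> int) \<Rightarrow> nat \<Rightarrow> int" where
  "shf G d a = fst (sel G d a)"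

lemma p_pos: "p > 0" using prime_p prime_gt_0_nat by simp

lemma finite_vecs [simp]: "finite (vecs I)" unfolding vecs_def by (intro finite_PiE) auto
lemma finite_Mat [simp]: "finite Mat" unfolding Mat_def by (intro finite_PiE) auto
lemma finite_Dith [simp]: "finite Dith" unfolding Dith_def by (intro finite_PiE) auto
lemma finite_Shp [simp]: "finite Shp" unfolding Shp_def shaping_def
  by (rule finite_subset[of _ "PiE {..<N} (\<lambda>_. {- int H..int H})"]) (auto intro: finite_PiE)
lemma card_Mat_pos: "card Mat > 0" unfolding Mat_def using p_pos by (simp add: card_PiE)
lemma card_Dith: "card Dith = p ^ N" unfolding Dith_def by (simp add: card_PiE)
lemma finite_cand [simp]: "finite (cand G d a)"
  by (rule finite_subset[of _ "vecs {..<kc} \<times> Shp"]) (auto simp: cand_def)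

lemma card_vecs: "I \<subseteq> {..<k} \<Longrightarrow> card (vecs I) = p ^ card I"
proof -
  assume I: "I \<subseteq> {..<k}"
  have "card (vecs I) = (\<Prod>j<k. if j \<in> I then p else 1)" unfolding vecs_def
    by (subst card_PiE) (auto intro!: prod.cong)
  also have "\<dots> = p ^ card I" using I by (subst prod.If_cases) (auto simp: Int_absorb1)
  finally show ?thesis .
qed

lemma sel_in: "enc_ok G d a \<Longrightarrow> sel G d a \<in> cand G d a"
  unfolding enc_ok_def sel_def by (metis ex_in_conv someI_ex)

lemma cw_in_Shp: "enc_ok G d a \<Longrightarrow> cw G d a \<in> Shp"
  using sel_in[of G d a] by (auto simp: cw_def cand_def split: prod.splits)

lemma shf_in_vecs: "enc_ok G d a \<Longrightarrow> shf G d a \<in> vecs {..<kc}"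
  using sel_in[of G d a] by (auto simp: shf_def cand_def split: prod.splits)

lemma cw_cong: "enc_ok G d a \<Longrightarrow> i < N \<Longrightarrow>
   [cw G d a i = matvec k G a i + matvec k G (shf G d a) i + d i] (mod int p)"
  using sel_in[of G d a] by (auto simp: cw_def shf_def cand_def split: prod.splits)

text \<open>The rows of the matrix are chosen independently, and for each row the image of a vector
  that is nonzero mod p is uniform.\<close>

lemma card_Mat_cong:
  assumes "j < k" "\<not> int p dvd w j"
  shows "real (card {G \<in> Mat. \<forall>i<N. [matvec k G w i = r i] (mod int p)}) = real (card Mat) / real p ^ N"
proof -
  let ?R = "PiE {..<k} (\<lambda>_. {0..<int p})"
  let ?sol = "\<lambda>r. {g \<in> ?R. [(\<Sum>j<k. g j * w j) = r] (mod int p)}"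
  have "{G \<in> Mat. \<forall>i<N. [matvec k G w i = r i] (mod int p)} = PiE {..<N} (\<lambda>i. ?sol (r i))"
    unfolding Mat_def matvec_def set_eq_iff mem_Collect_eq PiE_iff by blast
  hence "card {G \<in> Mat. \<forall>i<N. [matvec k G w i = r i] (mod int p)} * p ^ N = (\<Prod>i<N. card (?sol (r i)) * p)"
    by (simp add: card_PiE prod.distrib)
  also have "\<dots> = card Mat"
    unfolding card_linear_form_solutions[where w = w and j = j, OF prime_p assms] by (simp add: Mat_def card_PiE)
  finally have "real (card {G \<in> Mat. \<forall>i<N. [matvec k G w i = r i] (mod int p)} * p ^ N) = real (card Mat)"
    by (rule arg_cong)
  thus ?thesis using p_pos by (simp add: eq_divide_eq)
qed

lemma Dith_unique: "{d \<in> Dith. \<forall>i<N. [d i = f i] (mod int p)} = {\<lambda>i\<in>{..<N}. f i mod int p}"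
proof (intro equalityI subsetI; clarify)
  fix d assume d: "d \<in> Dith" "\<forall>i<N. [d i = f i] (mod int p)"
  show "d = (\<lambda>i\<in>{..<N}. f i mod int p)"
  proof
    fix i
    show "d i = (\<lambda>i\<in>{..<N}. f i mod int p) i"
    proof (cases "i < N")
      case True
      hence "d i \<in> {0..<int p}" "[d i = f i] (mod int p)" using d by (auto simp: Dith_def)
      thus ?thesis using True by (simp add: cong_def)
    next
      case False
      thus ?thesis using d by (auto simp: Dith_def PiE_iff extensional_def)
    qed
  qed
next
  show "(\<lambda>i\<in>{..<N}. f i mod int p) \<in> Dith \<and> (\<forall>i<N. [(\<lambda>i\<in>{..<N}. f i mod int p) i = f i] (mod int p))"
    using p_pos by (auto simp: Dith_def cong_def)
qed

lemma vecs_cong_eq: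
  assumes "v \<in> vecs I" "w \<in> vecs I'" "v \<noteq> w"
  shows "\<exists>j<k. \<not> int p dvd (v j - w j)"
proof (rule ccontr)
  assume c: "\<not> ?thesis"
  have "v j = w j" for j
  proof (cases "j < k")
    case True
    have "v j \<in> {0..<int p}" "w j \<in> {0..<int p}" using assms True p_pos by (auto simp: vecs_def PiE_iff split: if_splits)
    moreover have "[v j = w j] (mod int p)" using c True by (simp add: cong_iff_dvd_diff)
    ultimately show ?thesis by (simp add: cong_def)
  next
    case False
    thus ?thesis using assms by (auto simp: vecs_def PiE_iff extensional_def)
  qed
  thus False using assms by auto
qed

lemma Shp_cong_eq:
  assumes "\<xi> \<in> Shp" "\<xi>' \<in> Shp" "\<forall>i<N. [\<xi> i = \<xi>' i] (mod int p)"
  shows "\<xi> = \<xi>'"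
proof
  fix i
  show "\<xi> i = \<xi>' i"
  proof (cases "i < N")
    case True
    have "\<xi> i \<in> {- int H..int H}" "\<xi>' i \<in> {- int H..int H}"
      using assms True by (auto simp: Shp_def shaping_def dest!: PiE_mem)
    hence "\<bar>\<xi> i\<bar> \<le> int H" "\<bar>\<xi>' i\<bar> \<le> int H" by auto
    moreover have "int p dvd \<xi> i - \<xi>' i" using assms True by (simp add: cong_iff_dvd_diff)
    ultimately have "\<xi> i - \<xi>' i = 0" using H_p zdvd_imp_le[of "int p" "\<bar>\<xi> i - \<xi>' i\<bar>"] by force
    thus ?thesis by simp
  next
    case False
    thus ?thesis using assms by (auto simp: Shp_def shaping_def PiE_iff extensional_def)
  qed
qed

text \<open>Chebyshev for the number \<open>X\<close> of candidates under a random matrix and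
  dither. With q = p^N its mean is A / q, and pairwise independence makes the variance at most the
  mean, so \<open>X\<close> vanishes with probability at most q / A.\<close>

lemma encoding_failure_count:
  assumes T: "card Shp > 0"
  shows "real (card {(G, d) \<in> Mat \<times> Dith. \<not> enc_ok G d a})
     \<le> real (card Mat) * real p ^ N * (real p ^ N / (real p ^ kc * real (card Shp)))"
proof -
  let ?BT = "vecs {..<kc} \<times> Shp"
  let ?MD = "Mat \<times> Dith"
  define I where "I = (\<lambda>(G,d) (b,\<xi>). if \<forall>i<N. [\<xi> i = matvec k G a i + matvec k G b i + d i] (mod int p) then 1 else (0::real))"
  define X where "X = (\<lambda>\<omega>. \<Sum>x\<in>?BT. I \<omega> x)"
  define A where "A = real (card ?BT)"
  define m where "m = real (card Mat)"
  define q where "q = real p ^ N"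
  have q: "q > 0" using p_pos by (simp add: q_def)
  have m: "m > 0" using card_Mat_pos by (simp add: m_def)
  have cB: "card (vecs {..<kc}) = p ^ kc" using kc_k by (subst card_vecs) auto
  have A: "A = real p ^ kc * real (card Shp)" by (simp add: A_def cB card_cartesian_product)
  have A0: "A > 0" using T p_pos by (simp add: A)
  \<comment> \<open>The dither alone makes each pair uniform; this gives the mean and the first
    factor 1/q in the pair probabilities.\<close>
  have one: "(\<Sum>d\<in>Dith. I (G,d) x) = 1" for G x
  proof -
    obtain b \<xi> where x: "x = (b,\<xi>)" by force
    have "(\<Sum>d\<in>Dith. I (G,d) x) = real (card {d\<in>Dith. \<forall>i<N. [\<xi> i = matvec k G a i + matvec k G b i + d i] (mod int p)})"
      by (simp add: x I_def sum.If_cases Int_def)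
    also have "{d\<in>Dith. \<forall>i<N. [\<xi> i = matvec k G a i + matvec k G b i + d i] (mod int p)}
       = {d\<in>Dith. \<forall>i<N. [d i = \<xi> i - (matvec k G a i + matvec k G b i)] (mod int p)}"
      by (auto simp: cong_iff_dvd_diff dvd_diff_commute algebra_simps)
    finally show ?thesis by (simp add: Dith_unique)
  qed
  have S1: "(\<Sum>\<omega>\<in>?MD. X \<omega>) = A * m"
  proof -
    have "(\<Sum>\<omega>\<in>?MD. X \<omega>) = (\<Sum>x\<in>?BT. \<Sum>G\<in>Mat. \<Sum>d\<in>Dith. I (G,d) x)"
      unfolding X_def by (subst sum.swap) (simp add: sum.cartesian_product)
    thus ?thesis by (simp add: one A_def m_def)
  qed
  \<comment> \<open>Distinct pairs with the same shift exclude each other, because points of the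
    shaping set are distinct mod p. For different shifts, subtracting the two congruences removes
    the dither and leaves a condition on the matrix alone, of probability 1/q.\<close>
  have two: "(\<Sum>\<omega>\<in>?MD. I \<omega> x * I \<omega> x') \<le> (if x = x' then m else 0) + m/q" if x: "x \<in> ?BT" "x' \<in> ?BT" for x x'
  proof -
    obtain b \<xi> b' \<xi>' where xx: "x = (b,\<xi>)" "x' = (b',\<xi>')" by (metis surj_pair)
    have I01: "I \<omega> y \<le> 1" "I \<omega> y \<ge> 0" for \<omega> y by (auto simp: I_def split: prod.splits)
    show ?thesis
    proof (cases "x = x'")
      case True
      have "(\<Sum>\<omega>\<in>?MD. I \<omega> x * I \<omega> x') \<le> (\<Sum>\<omega>\<in>?MD. I \<omega> x)"
        using I01 by (intro sum_mono) (simp add: mult_left_le)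
      also have "\<dots> = (\<Sum>G\<in>Mat. \<Sum>d\<in>Dith. I (G,d) x)" by (simp add: sum.cartesian_product)
      also have "\<dots> = m" by (simp add: one m_def)
      finally have "(\<Sum>\<omega>\<in>?MD. I \<omega> x * I \<omega> x') \<le> m" .
      moreover have "m / q \<ge> 0" using m q by simp
      ultimately show ?thesis using True by simp
    next
      case False
      show ?thesis
      proof (cases "b = b'")
        case True
        hence ne: "\<xi> \<noteq> \<xi>'" using False xx by simp
        have z: "I \<omega> x * I \<omega> x' = 0" for \<omega>
        proof (rule ccontr)
          assume n: "I \<omega> x * I \<omega> x' \<noteq> 0"
          obtain G d where \<omega>: "\<omega> = (G,d)" by force
          have "\<forall>i<N. [\<xi> i = matvec k G a i + matvec k G b i + d i] (mod int p)"
            "\<forall>i<N. [\<xi>' i = matvec k G a i + matvec k G b i + d i] (mod int p)"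
            using n unfolding I_def \<omega> xx by (auto simp: True split: if_splits)
          hence "\<forall>i<N. [\<xi> i = \<xi>' i] (mod int p)" by (meson cong_sym cong_trans)
          thus False using Shp_cong_eq ne x xx by auto
        qed
        have "(\<Sum>\<omega>\<in>?MD. I \<omega> x * I \<omega> x') = 0" by (rule sum.neutral) (use z in blast)
        thus ?thesis using m q by simp
      next
        case bb: False
        then obtain j where j: "j < k" "\<not> int p dvd (b j - b' j)" using vecs_cong_eq x xx by (metis SigmaD1)
        let ?w = "\<lambda>j. b j - b' j"
        have "(\<Sum>\<omega>\<in>?MD. I \<omega> x * I \<omega> x') \<le> (\<Sum>\<omega>\<in>?MD. (if \<forall>i<N. [matvec k (fst \<omega>) ?w i = \<xi> i - \<xi>' i] (mod int p) then 1 else 0) * I \<omega> x)"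
        proof (rule sum_mono)
          fix \<omega> assume "\<omega> \<in> ?MD"
          obtain G d where \<omega>: "\<omega> = (G,d)" by force
          have *: "\<forall>i<N. [matvec k G ?w i = \<xi> i - \<xi>' i] (mod int p)"
            if 1: "\<forall>i<N. [\<xi> i = matvec k G a i + matvec k G b i + d i] (mod int p)"
            and 2: "\<forall>i<N. [\<xi>' i = matvec k G a i + matvec k G b' i + d i] (mod int p)"
          proof (intro allI impI)
            fix i assume i: "i < N"
            have "[\<xi> i - \<xi>' i = (matvec k G a i + matvec k G b i + d i) - (matvec k G a i + matvec k G b' i + d i)] (mod int p)"
              using 1 2 i by (intro cong_diff) auto
            thus "[matvec k G ?w i = \<xi> i - \<xi>' i] (mod int p)" by (simp add: matvec_diff cong_sym_eq)
          qed
          show "I \<omega> x * I \<omega> x' \<le> (if \<forall>i<N. [matvec k (fst \<omega>) ?w i = \<xi> i - \<xi>' i] (mod int p) then 1 else 0) * I \<omega> x"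
            using * unfolding I_def \<omega> xx by auto
        qed
        also have "\<dots> = (\<Sum>G\<in>Mat. (if \<forall>i<N. [matvec k G ?w i = \<xi> i - \<xi>' i] (mod int p) then 1 else 0) * (\<Sum>d\<in>Dith. I (G,d) x))"
          unfolding sum_distrib_left sum.cartesian_product by (rule sum.cong) auto
        also have "\<dots> = real (card {G\<in>Mat. \<forall>i<N. [matvec k G ?w i = \<xi> i - \<xi>' i] (mod int p)})"
          by (simp add: one sum.If_cases Int_def)
        also have "\<dots> = m / q" unfolding card_Mat_cong[where w = ?w and j = j, OF j] by (simp add: m_def q_def)
        finally show ?thesis using False by simp
      qed
    qed
  qed
  have S2: "(\<Sum>\<omega>\<in>?MD. (X \<omega>)\<^sup>2) \<le> A * m + A\<^sup>2 * m / q"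
  proof -
    have "(\<Sum>\<omega>\<in>?MD. (X \<omega>)\<^sup>2) = (\<Sum>x\<in>?BT. \<Sum>x'\<in>?BT. \<Sum>\<omega>\<in>?MD. I \<omega> x * I \<omega> x')"
      unfolding X_def power2_eq_square sum_product
      by (subst sum.swap, rule sum.cong[OF refl], subst sum.swap, rule refl)
    also have "\<dots> \<le> (\<Sum>x\<in>?BT. \<Sum>x'\<in>?BT. (if x = x' then m else 0) + m/q)"
      by (intro sum_mono two)
    also have "\<dots> = (\<Sum>x\<in>?BT. m + A * (m / q))"
      by (rule sum.cong) (auto simp: sum.distrib A_def)
    also have "\<dots> = A * m + A\<^sup>2 * m / q" by (simp add: A_def power2_eq_square algebra_simps)
    finally show ?thesis .
  qed
  let ?F = "{(G, d) \<in> ?MD. \<not> enc_ok G d a}"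
  have tot: "real (card ?MD) = m * q" by (simp add: card_cartesian_product card_Dith m_def q_def)
  have "real (card ?F) * (A/q)\<^sup>2 = (\<Sum>\<omega>\<in>?F. (X \<omega> - A/q)\<^sup>2)"
  proof -
    have "X \<omega> = 0" if "\<omega> \<in> ?F" for \<omega>
    proof -
      obtain G d where \<omega>: "\<omega> = (G,d)" by force
      hence "cand G d a = {}" using that by (simp add: enc_ok_def)
      hence "I \<omega> x = 0" if "x \<in> ?BT" for x using that unfolding I_def \<omega> cand_def by (auto split: prod.splits)
      thus ?thesis unfolding X_def by (simp add: sum.neutral)
    qed
    thus ?thesis by simp
  qed
  also have "\<dots> \<le> (\<Sum>\<omega>\<in>?MD. (X \<omega> - A/q)\<^sup>2)"
    by (intro sum_mono2) auto
  also have "\<dots> = (\<Sum>\<omega>\<in>?MD. (X \<omega>)\<^sup>2) - 2 * (A/q) * (\<Sum>\<omega>\<in>?MD. X \<omega>) + real (card ?MD) * (A/q)\<^sup>2"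
  proof -
    have "(\<Sum>\<omega>\<in>?MD. (X \<omega> - A/q)\<^sup>2) = (\<Sum>\<omega>\<in>?MD. (X \<omega>)\<^sup>2 - 2 * (A/q) * X \<omega> + (A/q)\<^sup>2)"
      by (rule sum.cong) (auto simp: power2_diff)
    thus ?thesis by (simp only: sum.distrib sum_subtractf sum_distrib_left[symmetric] sum_constant)
  qed
  also have "\<dots> \<le> A * m + A\<^sup>2 * m / q - 2 * (A/q) * (A * m) + m * q * (A/q)\<^sup>2"
    unfolding S1 tot using S2 by linarith
  also have "\<dots> = A * m" using q by (simp add: power2_eq_square field_simps)
  finally have "real (card ?F) * (A/q)\<^sup>2 \<le> A * m" .
  hence "real (card ?F) \<le> m * q * (q / A)" using q A0 by (simp add: power2_eq_square field_simps)
  thus ?thesis by (simp add: m_def q_def A)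
qed

text \<open>For a fixed matrix and message, the shift and the codeword determine the dither, and
  there are only p^kc shifts.\<close>

lemma card_cw_eq_le:
  assumes "\<xi> \<in> Shp"
  shows "card {d \<in> Dith. enc_ok G d a \<and> cw G d a = \<xi>} \<le> p ^ kc"
proof -
  have "inj_on (\<lambda>d. shf G d a) {d \<in> Dith. enc_ok G d a \<and> cw G d a = \<xi>}"
  proof (rule inj_onI; clarify)
    fix d d' assume d: "d \<in> Dith" "enc_ok G d a" and d': "d' \<in> Dith" "enc_ok G d' a" 
      and eq: "\<xi> = cw G d a" "cw G d' a = cw G d a" "shf G d a = shf G d' a"
    have "[d i = d' i] (mod int p)" if "i < N" for i
    proof -
      have "[matvec k G a i + matvec k G (shf G d' a) i + d i = matvec k G a i + matvec k G (shf G d' a) i + d' i] (mod int p)"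
        using cw_cong[OF d(2) that] cw_cong[OF d'(2) that] eq by (metis cong_sym cong_trans)
      thus ?thesis by (simp add: cong_add_lcancel)
    qed
    hence "d \<in> {d \<in> Dith. \<forall>i<N. [d i = d' i] (mod int p)}" "d' \<in> {d \<in> Dith. \<forall>i<N. [d i = d' i] (mod int p)}"
      using d d' by auto
    thus "d = d'" unfolding Dith_unique by auto
  qed
  hence "card {d \<in> Dith. enc_ok G d a \<and> cw G d a = \<xi>} \<le> card (vecs {..<kc})"
    by (rule card_inj_on_le) (auto simp: shf_in_vecs)
  also have "\<dots> = p ^ kc" using kc_k by (subst card_vecs) auto
  finally show ?thesis .
qed

text \<open>One draw serves all blocks and all messages. Reuse does no harm, since only averages for
  a single message tuple and a single block are ever taken.\<close>

definition Ens where "Ens = Mat \<times> PiE C (\<lambda>_. Dith)"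

definition all_ok where "all_ok \<omega> a \<longleftrightarrow> (\<forall>c\<in>C. enc_ok (fst \<omega>) (snd \<omega> c) (a c))"
definition cws where "cws \<omega> a = (\<lambda>c\<in>C. cw (fst \<omega>) (snd \<omega> c) (a c))"

definition avg :: "(((nat \<Rightarrow> nat \<Rightarrow> int) \<times> ('c \<Rightarrow> nat \<Rightarrow> int)) \<Rightarrow> real) \<Rightarrow> real" where
  "avg f = (\<Sum>\<omega>\<in>Ens. f \<omega>) / real (card Ens)"

lemma finite_Ens [simp]: "finite Ens" unfolding Ens_def using finite_C by (intro finite_cartesian_product finite_PiE) auto

lemma card_Ens: "real (card Ens) = real (card Mat) * (real p ^ N) ^ card C"
  unfolding Ens_def using finite_C by (simp add: card_cartesian_product card_PiE card_Dith)

lemma card_Ens_pos: "real (card Ens) > 0" unfolding card_Ens using card_Mat_pos p_pos by simp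

lemma avg_mono: "(\<And>\<omega>. \<omega> \<in> Ens \<Longrightarrow> f \<omega> \<le> g \<omega>) \<Longrightarrow> avg f \<le> avg g"
  unfolding avg_def by (intro divide_right_mono sum_mono) auto

lemma avg_sum: "avg (\<lambda>\<omega>. \<Sum>x\<in>X. f x \<omega>) = (\<Sum>x\<in>X. avg (f x))"
  unfolding avg_def by (subst sum.swap) (simp add: sum_divide_distrib)

lemma avg_add: "avg (\<lambda>\<omega>. f \<omega> + g \<omega>) = avg f + avg g"
  unfolding avg_def by (simp add: sum.distrib add_divide_distrib)

lemma avg_cmult: "avg (\<lambda>\<omega>. x * f \<omega>) = x * avg f"
  unfolding avg_def by (simp add: sum_distrib_left)

lemma avg_le_imp_ex: "avg f \<le> x \<Longrightarrow> \<exists>\<omega>\<in>Ens. f \<omega> \<le> x"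
proof (rule ccontr)
  assume a: "avg f \<le> x" and n: "\<not> (\<exists>\<omega>\<in>Ens. f \<omega> \<le> x)"
  have "Ens \<noteq> {}" using card_Ens_pos by auto
  hence "(\<Sum>\<omega>\<in>Ens. f \<omega>) > (\<Sum>\<omega>\<in>Ens. x)" using n by (intro sum_strict_mono) auto
  thus False using a card_Ens_pos by (simp add: avg_def field_simps)
qed

lemma avg_encoding_failure:
  assumes T: "card Shp > 0" and c: "c \<in> C"
  shows "avg (\<lambda>\<omega>. if enc_ok (fst \<omega>) (snd \<omega> c) a then 0 else 1) \<le> real p ^ N / (real p ^ kc * real (card Shp))"
proof -
  have fD: "finite Dith" "finite (C - {c})" using finite_C by auto
  let ?f = "\<lambda>G d. if enc_ok G d a then 0 else (1::real)"
  have marg: "(\<Sum>d\<in>PiE C (\<lambda>_. Dith). ?f G (d c)) = (\<Sum>x\<in>Dith. ?f G x) * (real p ^ N) ^ (card C - 1)" for G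
  proof -
    let ?F = "\<lambda>c' x. if c' = c then ?f G x else 1"
    have "(\<Sum>d\<in>PiE C (\<lambda>_. Dith). ?f G (d c)) = (\<Sum>d\<in>PiE C (\<lambda>_. Dith). \<Prod>c'\<in>C. ?F c' (d c'))"
      using finite_C c by (intro sum.cong refl) (simp add: prod.remove)
    also have "\<dots> = (\<Prod>c'\<in>C. \<Sum>x\<in>Dith. ?F c' x)" using finite_C by (subst prod_sum_PiE) auto
    also have "\<dots> = (\<Sum>x\<in>Dith. ?F c x) * (\<Prod>c'\<in>C-{c}. \<Sum>x\<in>Dith. ?F c' x)" using finite_C c by (subst prod.remove) auto
    also have "(\<Prod>c'\<in>C-{c}. \<Sum>x\<in>Dith. ?F c' x) = (\<Prod>c'\<in>C-{c}. real p ^ N)"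
      by (rule prod.cong) (auto simp: card_Dith)
    finally show ?thesis using finite_C c by simp
  qed
  have "(\<Sum>\<omega>\<in>Ens. ?f (fst \<omega>) (snd \<omega> c)) = (\<Sum>G\<in>Mat. \<Sum>d\<in>PiE C (\<lambda>_. Dith). ?f G (d c))"
    unfolding Ens_def sum.cartesian_product by (rule sum.cong) auto
  also have "\<dots> = (\<Sum>G\<in>Mat. \<Sum>x\<in>Dith. ?f G x) * (real p ^ N) ^ (card C - 1)"
    unfolding marg sum_distrib_right ..
  also have "(\<Sum>G\<in>Mat. \<Sum>x\<in>Dith. ?f G x) = real (card {(G, d) \<in> Mat \<times> Dith. \<not> enc_ok G d a})"
    unfolding sum.cartesian_product by (simp add: case_prod_unfold sum.If_cases Int_def) (auto intro!: arg_cong[of _ _ card])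
  also have "\<dots> * (real p ^ N) ^ (card C - 1) \<le> (real (card Mat) * real p ^ N * (real p ^ N / (real p ^ kc * real (card Shp)))) * (real p ^ N) ^ (card C - 1)"
    using encoding_failure_count[OF T] by (intro mult_right_mono) auto
  also have "\<dots> = real (card Ens) * (real p ^ N / (real p ^ kc * real (card Shp)))"
  proof -
    have "card C > 0" using c finite_C by (auto simp: card_gt_0_iff)
    then obtain r where r: "card C = Suc r" by (cases "card C") auto
    show ?thesis unfolding card_Ens r by (simp add: mult_ac)
  qed
  finally show ?thesis unfolding avg_def using card_Ens_pos by (simp add: field_simps)
qed

text \<open>Change of measure: given the matrix, a successfully shaped codeword takes each value of the shaping set
  with probability at most p^(kc - N), so the dependence of codewords on the matrix can be ignored at this price.\<close>
lemma avg_change_of_measure: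
  assumes "\<And>G \<xi>. \<Phi> G \<xi> \<ge> 0"
  shows "avg (\<lambda>\<omega>. if all_ok \<omega> a then \<Phi> (fst \<omega>) (cws \<omega> a) else 0)
      \<le> (real p ^ kc / real p ^ N) ^ card C * ((\<Sum>\<xi>\<in>PiE C (\<lambda>_. Shp). \<Sum>G\<in>Mat. \<Phi> G \<xi>) / real (card Mat))"
proof -
  let ?D = "PiE C (\<lambda>_. Dith)" and ?T = "PiE C (\<lambda>_. Shp)"
  have fin: "finite ?D" "finite ?T" using finite_C by (auto intro: finite_PiE)
  let ?S = "\<lambda>G \<xi>. {d \<in> ?D. all_ok (G,d) a \<and> cws (G,d) a = \<xi>}"
  have S: "real (card (?S G \<xi>)) \<le> (real p ^ kc) ^ card C" if "\<xi> \<in> ?T" for G \<xi>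
  proof -
    have "?S G \<xi> \<subseteq> PiE C (\<lambda>c. {d \<in> Dith. enc_ok G d (a c) \<and> cw G d (a c) = \<xi> c})"
      using that by (auto simp: all_ok_def cws_def PiE_iff extensional_def)
    hence "card (?S G \<xi>) \<le> card (PiE C (\<lambda>c. {d \<in> Dith. enc_ok G d (a c) \<and> cw G d (a c) = \<xi> c}))"
      using finite_C by (intro card_mono finite_PiE) auto
    also have "\<dots> = (\<Prod>c\<in>C. card {d \<in> Dith. enc_ok G d (a c) \<and> cw G d (a c) = \<xi> c})"
      using finite_C by (simp add: card_PiE)
    also have "\<dots> \<le> (\<Prod>c\<in>C. p ^ kc)" by (rule prod_mono) (simp add: card_cw_eq_le PiE_mem[OF that])
    finally have "card (?S G \<xi>) \<le> (p ^ kc) ^ card C" by simp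
    hence "real (card (?S G \<xi>)) \<le> real ((p ^ kc) ^ card C)" by (rule of_nat_mono)
    thus ?thesis by simp
  qed
  have "(\<Sum>\<omega>\<in>Ens. if all_ok \<omega> a then \<Phi> (fst \<omega>) (cws \<omega> a) else 0)
     = (\<Sum>G\<in>Mat. \<Sum>d\<in>?D. if all_ok (G,d) a then \<Phi> G (cws (G,d) a) else 0)"
    unfolding Ens_def sum.cartesian_product by (rule sum.cong) auto
  also have "\<dots> = (\<Sum>G\<in>Mat. \<Sum>d\<in>?D. \<Sum>\<xi>\<in>?T. if all_ok (G,d) a \<and> cws (G,d) a = \<xi> then \<Phi> G \<xi> else 0)"
  proof (intro sum.cong refl)
    fix G d assume "d \<in> ?D"
    show "(if all_ok (G,d) a then \<Phi> G (cws (G,d) a) else 0) = (\<Sum>\<xi>\<in>?T. if all_ok (G,d) a \<and> cws (G,d) a = \<xi> then \<Phi> G \<xi> else 0)"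
    proof (cases "all_ok (G,d) a")
      case True
      hence "cws (G,d) a \<in> ?T" by (auto simp: all_ok_def cws_def cw_in_Shp)
      thus ?thesis using True fin by (simp add: sum.delta)
    qed simp
  qed
  also have "\<dots> = (\<Sum>G\<in>Mat. \<Sum>\<xi>\<in>?T. real (card (?S G \<xi>)) * \<Phi> G \<xi>)"
    by (rule sum.cong[OF refl], subst sum.swap) (simp add: sum.If_cases fin Int_def)
  also have "\<dots> \<le> (\<Sum>G\<in>Mat. \<Sum>\<xi>\<in>?T. (real p ^ kc) ^ card C * \<Phi> G \<xi>)"
    using S assms by (intro sum_mono mult_right_mono) auto
  also have "\<dots> = (real p ^ kc) ^ card C * (\<Sum>\<xi>\<in>?T. \<Sum>G\<in>Mat. \<Phi> G \<xi>)"
    by (subst sum.swap) (simp add: sum_distrib_left)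
  finally have "(\<Sum>\<omega>\<in>Ens. if all_ok \<omega> a then \<Phi> (fst \<omega>) (cws \<omega> a) else 0)
     \<le> (real p ^ kc) ^ card C * (\<Sum>\<xi>\<in>?T. \<Sum>G\<in>Mat. \<Phi> G \<xi>)" .
  hence "avg (\<lambda>\<omega>. if all_ok \<omega> a then \<Phi> (fst \<omega>) (cws \<omega> a) else 0)
     \<le> (real p ^ kc) ^ card C * (\<Sum>\<xi>\<in>?T. \<Sum>G\<in>Mat. \<Phi> G \<xi>) / (real (card Mat) * (real p ^ N) ^ card C)"
    unfolding avg_def card_Ens by (rule divide_right_mono) simp
  thus ?thesis by (simp only: power_divide times_divide_times_eq mult.commute[of "real (card Mat)"])
qed

end

section \<open>Averaged probabilities of large noise and of confusion\<close>

context linear_ensemble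
begin

text \<open>The price per codeword of replacing the uniform average over dithers by normalised Gaussian weights.\<close>
definition loss :: real where
  "loss = (real p ^ kc / real p ^ N) * (exp (1/2) * gauss_norm \<gamma>) ^ N"

lemma gauss_norm_pos: "gauss_norm \<gamma> > 0" using gamma_pos by (auto simp: gauss_norm_def intro!: add_pos_nonneg)

lemma loss_nonneg: "loss \<ge> 0" using gauss_norm_pos by (simp add: loss_def)

lemma Shp_subset: "Shp \<subseteq> PiE {..<N} (\<lambda>_. {- int H..int H})" by (auto simp: Shp_def shaping_def)

text \<open>Points of the ball have squared norm at most N, so their Gaussian weight is at least exp
  (- N/2). This is the pointwise domination on which the analysis rests.\<close>

lemma gauss_weight_Shp_ge: "\<xi> \<in> Shp \<Longrightarrow> 1 \<le> exp (1/2) ^ N * gauss_weight N \<gamma> \<xi>"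
  unfolding gauss_weight_def exp_of_nat_mult[symmetric] mult_exp_exp by (simp add: Shp_def shaping_def)

lemma card_Shp_le: "real (card Shp) \<le> (exp (1/2) * gauss_norm \<gamma>) ^ N"
proof -
  let ?B = "PiE {..<N} (\<lambda>_. {- int H..int H})"
  have "real (card Shp) = (\<Sum>\<xi>\<in>Shp. 1)" by simp
  also have "\<dots> \<le> (\<Sum>\<xi>\<in>Shp. exp (1/2) ^ N * gauss_weight N \<gamma> \<xi>)" by (intro sum_mono gauss_weight_Shp_ge)
  also have "\<dots> \<le> (\<Sum>\<xi>\<in>?B. exp (1/2) ^ N * gauss_weight N \<gamma> \<xi>)"
    by (intro sum_mono2 Shp_subset finite_PiE) (auto simp: gauss_weight_nonneg)
  also have "\<dots> = exp (1/2) ^ N * (\<Sum>\<xi>\<in>?B. gauss_weight N \<gamma> \<xi>)" by (simp add: sum_distrib_left)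
  also have "(\<Sum>\<xi>\<in>?B. gauss_weight N \<gamma> \<xi>) \<le> gauss_norm \<gamma> ^ N"
    using gauss_weight_vector[OF gamma_pos, of "{- int H..int H}" 0 0 N "\<lambda>_. 0"] by simp
  finally show ?thesis by (simp add: power_mult_distrib)
qed

lemma noise_quadratic_measurable:
  assumes "\<iota> ` {..<N} \<subseteq> J"
  shows "(\<lambda>z. \<Sum>i<N. (v i + b * z (\<iota> i))\<^sup>2) \<in> borel_measurable (PiM J (\<lambda>_. std_gauss))"
proof (intro borel_measurable_sum borel_measurable_power borel_measurable_add borel_measurable_times borel_measurable_const)
  fix i assume "i \<in> {..<N}"
  hence "\<iota> i \<in> J" using assms by auto
  thus "(\<lambda>z. z (\<iota> i)) \<in> borel_measurable (PiM J (\<lambda>_. std_gauss))"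
    using measurable_component_singleton[of "\<iota> i" J "\<lambda>_. std_gauss"] by simp
qed

lemma prob_space_noise: "prob_space (PiM J (\<lambda>_. std_gauss))"
  by (intro prob_space_PiM prob_space_std_gauss)

text \<open>Once the Gaussian weights are inserted, the sum may be extended from the ball to the
  box, where it factorises. The codewords then act like independent Gaussians, and the exponential
  moment is that of a Gaussian whose variance is the sum of the \<alpha>^2 plus b^2.\<close>

lemma sum_measure_large_deviation:
  fixes \<alpha> :: "'c \<Rightarrow> real" and b l \<tau> :: real and \<iota> :: "nat \<Rightarrow> 'j"
  assumes J: "finite J" "inj_on \<iota> {..<N}" "\<iota> ` {..<N} \<subseteq> J"
    and l: "l \<ge> 0" "2*l*((\<Sum>c\<in>C. (\<alpha> c)\<^sup>2) + b\<^sup>2) < 1"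
  shows "(\<Sum>\<xi>\<in>PiE C (\<lambda>_. Shp). measure (PiM J (\<lambda>_. std_gauss))
      {z \<in> space (PiM J (\<lambda>_. std_gauss)). real N * \<tau> < (\<Sum>i<N. (\<gamma> * (\<Sum>c\<in>C. \<alpha> c * of_int (\<xi> c i)) + b * z (\<iota> i))\<^sup>2)})
    \<le> ((exp (1/2) * gauss_norm \<gamma>) ^ N) ^ card C * (exp (- l*\<tau>) / sqrt (1 - 2*l*((\<Sum>c\<in>C. (\<alpha> c)\<^sup>2) + b\<^sup>2))) ^ N"
proof -
  let ?M = "PiM J (\<lambda>_. std_gauss)" and ?T = "PiE C (\<lambda>_. Shp)"
  let ?B = "PiE {..<N} (\<lambda>_. {- int H..int H})"
  interpret prob_space ?M by (rule prob_space_noise)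
  define A where "A = (\<Sum>c\<in>C. (\<alpha> c)\<^sup>2)"
  have A0: "A \<ge> 0" unfolding A_def by (intro sum_nonneg) auto
  have lb: "2*l*A + 2*l*b\<^sup>2 < 1" using l by (simp add: A_def algebra_simps)
  have nn: "2*l*A \<ge> 0" "2*l*b\<^sup>2 \<ge> 0" using A0 l by auto
  have lA: "2*l*A < 1" using lb nn by linarith
  define Q where "Q = (\<lambda>\<xi> z. \<Sum>i<N. (\<gamma> * (\<Sum>c\<in>C. \<alpha> c * of_int (\<xi> c i)) + b * z (\<iota> i))\<^sup>2)"
  have Qm [measurable]: "Q \<xi> \<in> borel_measurable ?M" for \<xi>
    unfolding Q_def by (rule noise_quadratic_measurable[OF J(3)])
  have fT: "finite ?T" using finite_C by (intro finite_PiE) auto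
  \<comment> \<open>The tilt left for the noise after the codewords are summed out; the factors
    recombine at the end through (1 - 2 l A) (1 - 2 \<mu>) = 1 - 2 l (A + b^2).\<close>
  define \<mu> where "\<mu> = l / (1 - 2*l*A) * b\<^sup>2"
  have \<mu>: "\<mu> < 1/2" using lA lb by (simp add: \<mu>_def field_simps)
  define K where "K = (exp (1/2) ^ N) ^ card C * exp (- l * \<tau>) ^ N * ((gauss_norm \<gamma> ^ N) ^ card C * (1 / sqrt (1 - 2*l*A)) ^ N)"
  have K0: "K \<ge> 0" unfolding K_def using gauss_norm_pos lA by (auto intro!: mult_nonneg_nonneg)
  have key: "(\<Sum>\<xi>\<in>?T. exp (l * (Q \<xi> z - N*\<tau>))) \<le> K * exp (\<mu> * (\<Sum>i<N. (z (\<iota> i))\<^sup>2))" for z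
  proof -
    have "(\<Sum>\<xi>\<in>?T. exp (l * (Q \<xi> z - N*\<tau>))) \<le> (\<Sum>\<xi>\<in>?T. (exp (1/2) ^ N) ^ card C * (\<Prod>c\<in>C. gauss_weight N \<gamma> (\<xi> c)) * exp (l * (Q \<xi> z - N*\<tau>)))"
    proof (rule sum_mono)
      fix \<xi> assume \<xi>: "\<xi> \<in> ?T"
      have "(\<Prod>c\<in>C. 1) \<le> (\<Prod>c\<in>C. exp (1/2) ^ N * gauss_weight N \<gamma> (\<xi> c))"
        using gauss_weight_Shp_ge PiE_mem[OF \<xi>] by (intro prod_mono) auto
      hence "1 \<le> (exp (1/2) ^ N) ^ card C * (\<Prod>c\<in>C. gauss_weight N \<gamma> (\<xi> c))" by (simp add: prod.distrib)
      from mult_right_mono[OF this, of "exp (l * (Q \<xi> z - N*\<tau>))"]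
      show "exp (l * (Q \<xi> z - N*\<tau>)) \<le> (exp (1/2) ^ N) ^ card C * (\<Prod>c\<in>C. gauss_weight N \<gamma> (\<xi> c)) * exp (l * (Q \<xi> z - N*\<tau>))" by simp
    qed
    also have "\<dots> \<le> (\<Sum>\<xi>\<in>PiE C (\<lambda>_. ?B). (exp (1/2) ^ N) ^ card C * (\<Prod>c\<in>C. gauss_weight N \<gamma> (\<xi> c)) * exp (l * (Q \<xi> z - N*\<tau>)))"
      using Shp_subset finite_C
      by (intro sum_mono2 PiE_mono finite_PiE) (auto intro!: mult_nonneg_nonneg prod_nonneg simp: gauss_weight_nonneg finite_PiE)
    also have "\<dots> = (exp (1/2) ^ N) ^ card C * exp (- l * \<tau>) ^ N * (\<Sum>\<xi>\<in>PiE C (\<lambda>_. ?B). (\<Prod>c\<in>C. gauss_weight N \<gamma> (\<xi> c)) * exp (l * Q \<xi> z))"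
    proof -
      have "exp (l * (Q \<xi> z - N*\<tau>)) = exp (- l * \<tau>) ^ N * exp (l * Q \<xi> z)" for \<xi>
        unfolding exp_of_nat_mult[symmetric] mult_exp_exp by (simp add: algebra_simps)
      thus ?thesis by (simp only: sum_distrib_left) (simp add: mult_ac)
    qed
    also have "\<dots> \<le> (exp (1/2) ^ N) ^ card C * exp (- l * \<tau>) ^ N * ((gauss_norm \<gamma> ^ N) ^ card C * (1 / sqrt (1 - 2*l*A)) ^ N * exp (l / (1 - 2*l*A) * (\<Sum>i<N. (b * z (\<iota> i))\<^sup>2)))"
      unfolding Q_def A_def using lA l
      by (intro mult_left_mono gauss_weight_components finite_C gamma_pos) (auto simp: A_def)
    also have "\<dots> = K * exp (\<mu> * (\<Sum>i<N. (z (\<iota> i))\<^sup>2))"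
      by (simp add: K_def \<mu>_def power_mult_distrib sum_distrib_left[symmetric] mult.assoc)
    finally show ?thesis .
  qed
  have "ennreal (\<Sum>\<xi>\<in>?T. measure ?M {z \<in> space ?M. real N * \<tau> < Q \<xi> z})
      = (\<Sum>\<xi>\<in>?T. emeasure ?M {z \<in> space ?M. real N * \<tau> < Q \<xi> z})"
    by (simp add: emeasure_eq_measure)
  also have "\<dots> \<le> (\<Sum>\<xi>\<in>?T. \<integral>\<^sup>+z. ennreal (exp (l * (Q \<xi> z - N*\<tau>))) \<partial>?M)"
  proof (rule sum_mono)
    fix \<xi>
    have "emeasure ?M {z \<in> space ?M. real N * \<tau> < Q \<xi> z} = (\<integral>\<^sup>+z. indicator {z \<in> space ?M. real N * \<tau> < Q \<xi> z} z \<partial>?M)"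
      by simp
    also have "\<dots> \<le> (\<integral>\<^sup>+z. ennreal (exp (l * (Q \<xi> z - N*\<tau>))) \<partial>?M)"
      using l by (intro nn_integral_mono) (auto simp: indicator_def)
    finally show "emeasure ?M {z \<in> space ?M. real N * \<tau> < Q \<xi> z} \<le> (\<integral>\<^sup>+z. ennreal (exp (l * (Q \<xi> z - N*\<tau>))) \<partial>?M)" .
  qed
  also have "\<dots> = (\<integral>\<^sup>+z. (\<Sum>\<xi>\<in>?T. ennreal (exp (l * (Q \<xi> z - N*\<tau>)))) \<partial>?M)"
    by (rule nn_integral_sum[symmetric]) measurable
  also have "\<dots> \<le> (\<integral>\<^sup>+z. ennreal K * ennreal (exp (\<mu> * (\<Sum>i<N. (z (\<iota> i))\<^sup>2))) \<partial>?M)"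
    using key K0 by (intro nn_integral_mono) (simp add: sum_ennreal ennreal_mult'[symmetric])
  also have "\<dots> = ennreal K * (\<integral>\<^sup>+z. ennreal (exp (\<mu> * (\<Sum>i<N. (z (\<iota> i))\<^sup>2))) \<partial>?M)"
    using noise_quadratic_measurable[OF J(3), of "\<lambda>_. 0" 1] by (intro nn_integral_cmult) simp
  also have "\<dots> = ennreal (K * (1 / sqrt (1 - 2*\<mu>)) ^ N)"
    unfolding noise_square_mgf[OF J \<mu>] using K0 \<mu> by (simp add: ennreal_mult'[symmetric])
  finally have "(\<Sum>\<xi>\<in>?T. measure ?M {z \<in> space ?M. real N * \<tau> < Q \<xi> z}) \<le> K * (1 / sqrt (1 - 2*\<mu>)) ^ N"
    using K0 \<mu> by (simp add: ennreal_le_iff)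
  also have "\<dots> = ((exp (1/2) * gauss_norm \<gamma>) ^ N) ^ card C * (exp (- l*\<tau>) / sqrt ((1 - 2*l*A) * (1 - 2*\<mu>))) ^ N"
    by (simp add: K_def power_mult_distrib power_divide real_sqrt_mult)
  also have "(1 - 2*l*A) * (1 - 2*\<mu>) = 1 - 2*l*(A + b\<^sup>2)"
    using lA by (simp add: \<mu>_def field_simps)
  finally show ?thesis by (simp add: Q_def A_def)
qed

lemma avg_large_deviation:
  fixes \<alpha> :: "'c \<Rightarrow> real" and b l \<tau> :: real and \<iota> :: "nat \<Rightarrow> 'j"
  assumes J: "finite J" "inj_on \<iota> {..<N}" "\<iota> ` {..<N} \<subseteq> J"
    and l: "l \<ge> 0" "2*l*((\<Sum>c\<in>C. (\<alpha> c)\<^sup>2) + b\<^sup>2) < 1"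
  shows "avg (\<lambda>\<omega>. if all_ok \<omega> a then measure (PiM J (\<lambda>_. std_gauss))
      {z \<in> space (PiM J (\<lambda>_. std_gauss)). real N * \<tau> < (\<Sum>i<N. (\<gamma> * (\<Sum>c\<in>C. \<alpha> c * of_int (cws \<omega> a c i)) + b * z (\<iota> i))\<^sup>2)} else 0)
    \<le> loss ^ card C * (exp (- l*\<tau>) / sqrt (1 - 2*l*((\<Sum>c\<in>C. (\<alpha> c)\<^sup>2) + b\<^sup>2))) ^ N"
proof -
  let ?\<Phi> = "\<lambda>(G::nat \<Rightarrow> nat \<Rightarrow> int) \<xi>. measure (PiM J (\<lambda>_. std_gauss))
      {z \<in> space (PiM J (\<lambda>_. std_gauss)). real N * \<tau> < (\<Sum>i<N. (\<gamma> * (\<Sum>c\<in>C. \<alpha> c * of_int (\<xi> c i)) + b * z (\<iota> i))\<^sup>2)}"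
  let ?R = "(exp (- l*\<tau>) / sqrt (1 - 2*l*((\<Sum>c\<in>C. (\<alpha> c)\<^sup>2) + b\<^sup>2))) ^ N"
  have "avg (\<lambda>\<omega>. if all_ok \<omega> a then ?\<Phi> (fst \<omega>) (cws \<omega> a) else 0)
      \<le> (real p ^ kc / real p ^ N) ^ card C * ((\<Sum>\<xi>\<in>PiE C (\<lambda>_. Shp). \<Sum>G\<in>Mat. ?\<Phi> G \<xi>) / real (card Mat))"
    by (rule avg_change_of_measure) simp
  also have "(\<Sum>\<xi>\<in>PiE C (\<lambda>_. Shp). \<Sum>G\<in>Mat. ?\<Phi> G \<xi>) / real (card Mat) = (\<Sum>\<xi>\<in>PiE C (\<lambda>_. Shp). ?\<Phi> undefined \<xi>)"
    using card_Mat_pos by (simp add: sum_distrib_left[symmetric] card_gt_0_iff)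
  also have "(real p ^ kc / real p ^ N) ^ card C * \<dots> \<le> (real p ^ kc / real p ^ N) ^ card C * (((exp (1/2) * gauss_norm \<gamma>) ^ N) ^ card C * ?R)"
    by (intro mult_left_mono sum_measure_large_deviation J l) auto
  also have "\<dots> = loss ^ card C * ?R" by (simp only: loss_def power_mult_distrib mult.assoc)
  finally show ?thesis .
qed

text \<open>The range of a sum of at most two codewords.\<close>

definition Box :: "(nat \<Rightarrow> int) set" where "Box = PiE {..<N} (\<lambda>_. {- 2 * int H..2 * int H})"

lemma finite_Box [simp]: "finite Box" unfolding Box_def by (intro finite_PiE) auto

text \<open>Each point of the ball around y has weight exp (- |y - t|^2 / (2 \<tau>)) at least exp
  (- N/2), and per coordinate the weights of variance \<tau> sum to about sqrt \<tau> times
  \<open>gauss_norm\<close>. The 2 \<gamma> covers the additive term of the grid bound.\<close>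

lemma card_near_le:
  fixes y :: "nat \<Rightarrow> real"
  assumes "\<tau> > 0"
  shows "real (card {t \<in> Box. (\<Sum>i<N. (y i - \<gamma> * of_int (t i))\<^sup>2) \<le> real N * \<tau>}) \<le> (exp (1/2) * gauss_norm \<gamma>) ^ N * (sqrt \<tau> + 2 * \<gamma>) ^ N"
proof -
  let ?q = "\<lambda>t. \<Sum>i<N. (y i - \<gamma> * of_int (t i))\<^sup>2"
  have "real (card {t \<in> Box. ?q t \<le> real N * \<tau>}) = (\<Sum>t\<in>Box. if ?q t \<le> real N * \<tau> then 1 else 0)"
    by (simp add: sum.If_cases Int_def)
  also have "\<dots> \<le> (\<Sum>t\<in>Box. exp (1/2) ^ N * (\<Prod>i<N. exp (- (1/(2*\<tau>)) * (\<gamma> * of_int (t i) - y i)\<^sup>2)))"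
  proof (rule sum_mono)
    fix t
    have "exp (1/2) ^ N * (\<Prod>i<N. exp (- (1/(2*\<tau>)) * (\<gamma> * of_int (t i) - y i)\<^sup>2)) = exp ((real N * \<tau> - ?q t) / (2*\<tau>))"
    proof -
      have "(\<Prod>i<N. exp (- (1/(2*\<tau>)) * (\<gamma> * of_int (t i) - y i)\<^sup>2)) = exp (- (1/(2*\<tau>)) * ?q t)"
        by (simp add: exp_sum[symmetric] sum_distrib_left power2_commute sum_negf)
      thus ?thesis unfolding exp_of_nat_mult[symmetric] using assms
        by (simp add: mult_exp_exp field_simps)
    qed
    moreover have "?q t \<le> real N * \<tau> \<Longrightarrow> 1 \<le> exp ((real N * \<tau> - ?q t) / (2*\<tau>))" using assms by simp
    ultimately show "(if ?q t \<le> real N * \<tau> then 1 else 0) \<le> exp (1/2) ^ N * (\<Prod>i<N. exp (- (1/(2*\<tau>)) * (\<gamma> * of_int (t i) - y i)\<^sup>2))"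
      by auto
  qed
  also have "\<dots> = exp (1/2) ^ N * (\<Prod>i<N. \<Sum>k\<in>{- 2 * int H..2 * int H}. exp (- (1/(2*\<tau>)) * (\<gamma> * of_int k - y i)\<^sup>2))"
    unfolding Box_def by (subst prod_sum_PiE) (auto simp: sum_distrib_left)
  also have "\<dots> \<le> exp (1/2) ^ N * (\<Prod>i<N. 2 + sqrt (pi/(1/(2*\<tau>))) / \<gamma>)"
    using assms gamma_pos by (intro mult_left_mono prod_mono conjI lattice_gauss_sum_le sum_nonneg) auto
  also have "\<dots> \<le> exp (1/2) ^ N * (gauss_norm \<gamma> * (sqrt \<tau> + 2 * \<gamma>)) ^ N"
  proof -
    have "1 \<le> sqrt (2*pi)" using pi_ge_two by simp
    moreover have "sqrt \<tau> \<ge> 0" using assms by simp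
    moreover have "gauss_norm \<gamma> * (sqrt \<tau> + 2 * \<gamma>) = 2 * sqrt \<tau> + 4 * \<gamma> + sqrt (2*pi) * sqrt \<tau> / \<gamma> + 2 * sqrt (2*pi)"
      using gamma_pos by (simp add: gauss_norm_def field_simps)
    moreover have "sqrt (pi/(1/(2*\<tau>))) = sqrt (2*pi) * sqrt \<tau>" by (simp add: real_sqrt_mult mult_ac)
    ultimately have "2 + sqrt (pi/(1/(2*\<tau>))) / \<gamma> \<le> gauss_norm \<gamma> * (sqrt \<tau> + 2 * \<gamma>)"
      using gamma_pos by (simp only: times_divide_eq_left)
    thus ?thesis using assms gamma_pos by (simp add: power_mono add_nonneg_nonneg)
  qed
  finally show ?thesis by (simp add: power_mult_distrib mult.assoc)
qed

text \<open>A nonzero codeword difference w explains a lattice point t close to the observation y, where s is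
  the true point.\<close>
definition confusion where
  "confusion G I y s \<tau> \<longleftrightarrow> (\<exists>w\<in>vecs I. (\<exists>j<k. w j \<noteq> 0) \<and>
     (\<exists>t\<in>Box. (\<Sum>i<N. (y i - \<gamma> * of_int (t i))\<^sup>2) \<le> real N * \<tau> \<and>
       (\<forall>i<N. [matvec k G w i = t i - s i] (mod int p))))"

lemma confusion_measurable:
  fixes y :: "'z \<Rightarrow> nat \<Rightarrow> real"
  assumes y: "\<And>i. i < N \<Longrightarrow> (\<lambda>z. y z i) \<in> borel_measurable M"
  shows "{z \<in> space M. confusion G I (y z) s \<tau>} \<in> sets M"
proof -
  have "(\<lambda>z. \<Sum>i<N. (y z i - \<gamma> * of_int (t i))\<^sup>2) \<in> borel_measurable M" for t :: "nat \<Rightarrow> int"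
    using y by (intro borel_measurable_sum borel_measurable_power borel_measurable_diff borel_measurable_const) auto
  hence "{z \<in> space M. (\<Sum>i<N. (y z i - \<gamma> * of_int (t i))\<^sup>2) \<le> real N * \<tau>} \<in> sets M" for t :: "nat \<Rightarrow> int"
    by measurable
  thus ?thesis unfolding confusion_def
    by (intro sets.sets_Collect_finite_Ex sets.sets_Collect_conj sets.sets_Collect_const) auto
qed

text \<open>Here y and s do not depend on the matrix, so a fixed nonzero w is mapped to a given t -
  s by a fraction p^(-N) of the matrices. The union runs over at most p^|I| vectors w and the points
  t near y. The count holds for every noise value, so integrating over the noise is free.\<close>

lemma sum_measure_confusion:
  fixes y :: "'z \<Rightarrow> nat \<Rightarrow> real"
  assumes M: "prob_space M" and y: "\<And>i. i < N \<Longrightarrow> (\<lambda>z. y z i) \<in> borel_measurable M"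
    and \<tau>: "\<tau> > 0" and I: "I \<subseteq> {..<k}"
  shows "(\<Sum>G\<in>Mat. measure M {z \<in> space M. confusion G I (y z) s \<tau>})
    \<le> real (card Mat) * (real p ^ card I / real p ^ N * ((exp (1/2) * gauss_norm \<gamma>) ^ N * (sqrt \<tau> + 2 * \<gamma>) ^ N))"
proof -
  interpret prob_space M by (rule M)
  let ?W = "{w \<in> vecs I. \<exists>j<k. w j \<noteq> 0}"
  let ?near = "\<lambda>y. {t \<in> Box. (\<Sum>i<N. (y i - \<gamma> * of_int (t i))\<^sup>2) \<le> real N * \<tau>}"
  let ?E = "\<lambda>G. {z \<in> space M. confusion G I (y z) s \<tau>}"
  let ?K = "real (card Mat) * (real p ^ card I / real p ^ N * ((exp (1/2) * gauss_norm \<gamma>) ^ N * (sqrt \<tau> + 2 * \<gamma>) ^ N))"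
  have K0: "?K \<ge> 0" using gauss_norm_pos gamma_pos \<tau> by (intro mult_nonneg_nonneg) (auto intro!: divide_nonneg_nonneg mult_nonneg_nonneg)
  have meas: "?E G \<in> sets M" for G using y by (rule confusion_measurable)
  have cnt: "(\<Sum>G\<in>Mat. indicator (?E G) z) \<le> ?K" for z
  proof -
    have "(\<Sum>G\<in>Mat. indicator (?E G) z) \<le> (\<Sum>G\<in>Mat. \<Sum>w\<in>?W. \<Sum>t\<in>?near (y z). if \<forall>i<N. [matvec k G w i = t i - s i] (mod int p) then 1 else (0::real))"
    proof (rule sum_mono)
      fix G
      let ?g = "\<lambda>w t. if \<forall>i<N. [matvec k G w i = t i - s i] (mod int p) then 1 else (0::real)"
      show "indicator (?E G) z \<le> (\<Sum>w\<in>?W. \<Sum>t\<in>?near (y z). ?g w t)"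
      proof (cases "z \<in> ?E G")
        case True
        then obtain w t where "w \<in> vecs I" "\<exists>j<k. w j \<noteq> 0" "t \<in> Box"
          "(\<Sum>i<N. (y z i - \<gamma> * of_int (t i))\<^sup>2) \<le> real N * \<tau>"
          "\<forall>i<N. [matvec k G w i = t i - s i] (mod int p)"
          unfolding confusion_def by blast
        hence w: "w \<in> ?W" and t: "t \<in> ?near (y z)" and g: "?g w t = 1" by auto
        have "1 \<le> (\<Sum>t\<in>?near (y z). ?g w t)"
          using member_le_sum[of t "?near (y z)" "?g w"] t g by auto
        also have "\<dots> \<le> (\<Sum>w\<in>?W. \<Sum>t\<in>?near (y z). ?g w t)"
          using w by (intro member_le_sum[of w ?W "\<lambda>w. \<Sum>t\<in>?near (y z). ?g w t"]) (auto intro!: sum_nonneg)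
        finally show ?thesis using True by simp
      next
        case False
        thus ?thesis by (auto intro!: sum_nonneg)
      qed
    qed
    also have "\<dots> = (\<Sum>w\<in>?W. \<Sum>t\<in>?near (y z). \<Sum>G\<in>Mat. if \<forall>i<N. [matvec k G w i = t i - s i] (mod int p) then 1 else (0::real))"
      by (subst sum.swap, rule sum.cong[OF refl], subst sum.swap, rule refl)
    also have "\<dots> = (\<Sum>w\<in>?W. \<Sum>t\<in>?near (y z). real (card Mat) / real p ^ N)"
    proof (intro sum.cong refl)
      fix w t assume "w \<in> ?W"
      then obtain j where w: "w \<in> vecs I" and j: "j < k" "w j \<noteq> 0" by blast
      have "w j \<in> (if j \<in> I then {0..<int p} else {0})"
        using w j(1) unfolding vecs_def by (intro PiE_mem[of w "{..<k}"]) auto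
      hence "w j \<in> {0..<int p}" using j(2) by (simp split: if_splits)
      hence "\<not> int p dvd w j" using j(2) zdvd_not_zless[of "w j" "int p"] by auto
      from card_Mat_cong[where w = w and r = "\<lambda>i. t i - s i", OF j(1) this]
      show "(\<Sum>G\<in>Mat. if \<forall>i<N. [matvec k G w i = t i - s i] (mod int p) then 1 else 0) = real (card Mat) / real p ^ N"
        by (simp add: sum.If_cases Int_def)
    qed
    also have "\<dots> = real (card ?W) * (real (card (?near (y z))) * (real (card Mat) / real p ^ N))" by simp
    also have "\<dots> \<le> real p ^ card I * (((exp (1/2) * gauss_norm \<gamma>) ^ N * (sqrt \<tau> + 2 * \<gamma>) ^ N) * (real (card Mat) / real p ^ N))"
    proof (intro mult_mono mult_right_mono card_near_le \<tau>)
      have "card ?W \<le> card (vecs I)" by (intro card_mono) auto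
      thus "real (card ?W) \<le> real p ^ card I" unfolding card_vecs[OF I] by (simp flip: of_nat_power)
    qed (use gauss_norm_pos gamma_pos \<tau> in \<open>auto intro!: mult_nonneg_nonneg\<close>)
    also have "\<dots> = ?K" by (simp add: mult_ac)
    finally show ?thesis .
  qed
  have "ennreal (\<Sum>G\<in>Mat. measure M (?E G)) = (\<Sum>G\<in>Mat. emeasure M (?E G))"
    by (simp add: emeasure_eq_measure)
  also have "\<dots> = (\<Sum>G\<in>Mat. \<integral>\<^sup>+z. indicator (?E G) z \<partial>M)" using meas by simp
  also have "\<dots> = (\<integral>\<^sup>+z. (\<Sum>G\<in>Mat. indicator (?E G) z) \<partial>M)"
    using meas by (intro nn_integral_sum[symmetric]) auto
  also have "\<dots> \<le> (\<integral>\<^sup>+z. ennreal ?K \<partial>M)"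
  proof (rule nn_integral_mono)
    fix z
    have "(\<Sum>G\<in>Mat. indicator (?E G) z :: ennreal) = ennreal (\<Sum>G\<in>Mat. indicator (?E G) z)"
      by (simp add: sum_ennreal[symmetric] ennreal_indicator)
    also have "\<dots> \<le> ennreal ?K" by (intro ennreal_leI cnt)
    finally show "(\<Sum>G\<in>Mat. indicator (?E G) z :: ennreal) \<le> ennreal ?K" .
  qed
  also have "\<dots> = ennreal ?K" by (simp add: emeasure_space_1)
  finally show ?thesis using K0 by (simp add: ennreal_le_iff)
qed

text \<open>The receiver knows neither the shift nor the message. The p^kc shifts, together with
  p^(-N) and the number of near points, make up one more factor \<open>loss\<close>; p^\<kappa>
  genuine competitors remain.\<close>

lemma avg_confusion:
  fixes y :: "('c \<Rightarrow> nat \<Rightarrow> int) \<Rightarrow> 'z \<Rightarrow> nat \<Rightarrow> real"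
  assumes M: "prob_space M" and y: "\<And>\<xi> i. i < N \<Longrightarrow> (\<lambda>z. y \<xi> z i) \<in> borel_measurable M"
    and \<tau>: "\<tau> > 0" and I: "kc + \<kappa> \<le> k"
  shows "avg (\<lambda>\<omega>. if all_ok \<omega> a then measure M {z \<in> space M. confusion (fst \<omega>) {..<kc+\<kappa>} (y (cws \<omega> a) z) (s (cws \<omega> a)) \<tau>} else 0)
    \<le> loss ^ card C * (loss * real p ^ \<kappa> * (sqrt \<tau> + 2 * \<gamma>) ^ N)"
proof -
  let ?\<Phi> = "\<lambda>G \<xi>. measure M {z \<in> space M. confusion G {..<kc+\<kappa>} (y \<xi> z) (s \<xi>) \<tau>}"
  let ?R = "loss * real p ^ \<kappa> * (sqrt \<tau> + 2 * \<gamma>) ^ N"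
  have R0: "?R \<ge> 0" using loss_nonneg \<tau> gamma_pos by (intro mult_nonneg_nonneg) auto
  have R: "(\<Sum>G\<in>Mat. ?\<Phi> G \<xi>) \<le> real (card Mat) * ?R" for \<xi>
    using sum_measure_confusion[OF M _ \<tau>, where I = "{..<kc+\<kappa>}" and s = "s \<xi>" and y = "y \<xi>"] I
    y by (simp add: loss_def power_add mult_ac)
  have "avg (\<lambda>\<omega>. if all_ok \<omega> a then ?\<Phi> (fst \<omega>) (cws \<omega> a) else 0)
      \<le> (real p ^ kc / real p ^ N) ^ card C * ((\<Sum>\<xi>\<in>PiE C (\<lambda>_. Shp). \<Sum>G\<in>Mat. ?\<Phi> G \<xi>) / real (card Mat))"
    by (rule avg_change_of_measure) simp
  also have "\<dots> \<le> (real p ^ kc / real p ^ N) ^ card C * ((\<Sum>\<xi>\<in>PiE C (\<lambda>_. Shp). real (card Mat) * ?R) / real (card Mat))"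
    by (intro mult_left_mono divide_right_mono sum_mono R) auto
  also have "\<dots> = (real p ^ kc / real p ^ N) ^ card C * (real (card Shp) ^ card C * ?R)"
    using card_Mat_pos finite_C by (simp add: card_PiE card_gt_0_iff)
  also have "\<dots> \<le> (real p ^ kc / real p ^ N) ^ card C * (((exp (1/2) * gauss_norm \<gamma>) ^ N) ^ card C * ?R)"
    using card_Shp_le R0 by (intro mult_left_mono mult_right_mono power_mono) auto
  also have "\<dots> = loss ^ card C * ?R" unfolding loss_def by (simp only: power_mult_distrib mult.assoc)
  finally show ?thesis .
qed

end

section \<open>The successive decoder\<close>

text \<open>The chosen index depends on y only through the finite set of indices that satisfy
  \<Phi>, so a choice by \<open>SOME\<close> is measurable however it is made.\<close>

lemma measurable_SOME_finite:
  assumes I: "finite I" and \<Phi>: "\<And>i. i \<in> I \<Longrightarrow> {y \<in> space M. \<Phi> i y} \<in> sets M"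
  shows "(\<lambda>y. f (SOME i. i \<in> I \<and> \<Phi> i y)) \<in> measurable M (count_space UNIV)"
proof -
  have "(\<lambda>y. {i \<in> I. \<Phi> i y}) \<in> measurable M (count_space (Pow I))"
  proof (rule measurable_count_space_eq2[THEN iffD2], use I in simp, intro conjI ballI)
    show "(\<lambda>y. {i \<in> I. \<Phi> i y}) \<in> space M \<rightarrow> Pow I" by auto
    fix S assume S: "S \<in> Pow I"
    have "(\<lambda>y. {i \<in> I. \<Phi> i y}) -` {S} \<inter> space M = {y \<in> space M. \<forall>i\<in>I. \<Phi> i y = (i \<in> S)}"
      using S by auto
    also have "\<dots> \<in> sets M"
    proof (rule sets.sets_Collect_finite_All[OF _ I])
      fix i assume i: "i \<in> I"
      have "{y \<in> space M. \<not> \<Phi> i y} \<in> sets M" by (rule sets.sets_Collect_neg[OF \<Phi>[OF i]])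
      thus "{y \<in> space M. \<Phi> i y = (i \<in> S)} \<in> sets M" using \<Phi>[OF i] by (cases "i \<in> S") auto
    qed
    finally show "(\<lambda>y. {i \<in> I. \<Phi> i y}) -` {S} \<inter> space M \<in> sets M" .
  qed
  moreover have "(\<lambda>S. f (SOME i. i \<in> S)) \<in> measurable (count_space (Pow I)) (count_space UNIV)" by simp
  ultimately have "(\<lambda>y. f (SOME i. i \<in> {i \<in> I. \<Phi> i y})) \<in> measurable M (count_space UNIV)"
    by (rule measurable_compose)
  thus ?thesis by simp
qed

context linear_ensemble
begin

text \<open>Stage l subtracts the points decided in stages l' < l; al is the scaling factor and g the received
  amplitude, so the scaled observation is compared with the sum of the codewords in A (ss ! l).\<close>
definition rx_ok :: "'s list \<Rightarrow> ('s \<Rightarrow> 'c set) \<Rightarrow> ('s \<Rightarrow> real) \<Rightarrow> ('s \<Rightarrow> real) \<Rightarrow> ('s \<Rightarrow> real) \<Rightarrow> (nat \<Rightarrow> nat \<Rightarrow> int)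
   \<Rightarrow> ('c \<Rightarrow> nat \<Rightarrow> int) \<Rightarrow> (nat \<Rightarrow> real) \<Rightarrow> ('s \<Rightarrow> nat \<Rightarrow> int) \<times> ('s \<Rightarrow> nat \<Rightarrow> int) \<Rightarrow> bool" where
  "rx_ok ss A g al ta G d y tv \<longleftrightarrow> (\<forall>l<length ss.
     (\<Sum>i<N. (al (ss!l) / g (ss!l) * (y i - \<gamma> * (\<Sum>l'<l. g (ss!l') * of_int (fst tv (ss!l') i)))
          - \<gamma> * of_int (fst tv (ss!l) i))\<^sup>2) \<le> real N * ta (ss!l) \<and>
     (\<forall>i<N. [fst tv (ss!l) i = matvec k G (snd tv (ss!l)) i + (\<Sum>c\<in>A (ss!l). d c i)] (mod int p)))"

definition rx_space :: "'s list \<Rightarrow> ('s \<Rightarrow> nat) \<Rightarrow> (('s \<Rightarrow> nat \<Rightarrow> int) \<times> ('s \<Rightarrow> nat \<Rightarrow> int)) set" where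
  "rx_space ss \<kappa> = PiE (set ss) (\<lambda>_. Box) \<times> PiE (set ss) (\<lambda>s. vecs {..<kc + \<kappa> s})"

text \<open>One \<open>SOME\<close> searches all stages jointly; the successive structure appears
  only in the proof that the answer is unique. The first \<open>kc\<close> entries are cleared
  because sums of shifts carry no message.\<close>

definition rx_dec where
  "rx_dec ss A g al ta \<kappa> \<omega> y = (\<lambda>s. \<lambda>j\<in>{..<k}. if j < kc then 0 else
     snd (SOME tv. tv \<in> rx_space ss \<kappa> \<and> rx_ok ss A g al ta (fst \<omega>) (snd \<omega>) y tv) s j)"

text \<open>The coefficient of codeword c in the scaled residual of stage l, provided that the
  earlier stages were right.\<close>

definition rx_coef where
  "rx_coef ss A g al h l c = (if c \<in> (\<Union>l'<l. A (ss!l')) then 0 else al (ss!l) / g (ss!l) * h c)"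

text \<open>Stage l can fail in two ways: the true sum is too far from the residual, or another
  point explains it. Both are phrased through the true codewords, so the event does not refer to any
  decision.\<close>

definition rx_bad where
  "rx_bad ss A g al ta \<kappa> h \<sigma> \<omega> \<xi> w \<longleftrightarrow> (\<exists>l<length ss.
     real N * ta (ss!l) < (\<Sum>i<N. (\<gamma> * (\<Sum>c\<in>C. (rx_coef ss A g al h l c - (if c \<in> A (ss!l) then 1 else 0)) * of_int (\<xi> c i))
         + al (ss!l) / g (ss!l) * \<sigma> * w i)\<^sup>2) \<or>
     confusion (fst \<omega>) {..<kc + \<kappa> (ss!l)}
         (\<lambda>i. \<gamma> * (\<Sum>c\<in>C. rx_coef ss A g al h l c * of_int (\<xi> c i)) + al (ss!l) / g (ss!l) * \<sigma> * w i)
         (\<lambda>i. \<Sum>c\<in>A (ss!l). \<xi> c i) (ta (ss!l)))"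

lemma finite_rx_space: "finite (rx_space ss \<kappa>)"
  unfolding rx_space_def by (intro finite_cartesian_product finite_PiE) auto

lemma measurable_rx_dec:
  fixes ss :: "'s list"
  assumes "\<And>i. i < N \<Longrightarrow> (\<lambda>x. y x i) \<in> borel_measurable M"
  shows "(\<lambda>x. rx_dec ss A g al ta \<kappa> \<omega> (y x)) \<in> measurable M (count_space UNIV)"
  unfolding rx_dec_def
proof (rule measurable_SOME_finite[where f = "\<lambda>tv s. \<lambda>j\<in>{..<k}. if j < kc then 0 else snd tv s j"])
  show "finite (rx_space ss \<kappa>)" by (rule finite_rx_space)
  fix tv :: "('s \<Rightarrow> nat \<Rightarrow> int) \<times> ('s \<Rightarrow> nat \<Rightarrow> int)"
  have "(\<lambda>x. \<Sum>i<N. (al (ss!l) / g (ss!l) * (y x i - \<gamma> * (\<Sum>l'<l. g (ss!l') * of_int (fst tv (ss!l') i)))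
          - \<gamma> * of_int (fst tv (ss!l) i))\<^sup>2) \<in> borel_measurable M" for l
    using assms
    by (intro borel_measurable_sum borel_measurable_power borel_measurable_diff borel_measurable_times borel_measurable_const) auto
  hence "{x \<in> space M. (\<Sum>i<N. (al (ss!l) / g (ss!l) * (y x i - \<gamma> * (\<Sum>l'<l. g (ss!l') * of_int (fst tv (ss!l') i)))
          - \<gamma> * of_int (fst tv (ss!l) i))\<^sup>2) \<le> real N * ta (ss!l)} \<in> sets M" for l
    by measurable
  hence "{x \<in> space M. \<forall>l\<in>{..<length ss}. (\<Sum>i<N. (al (ss!l) / g (ss!l) * (y x i - \<gamma> * (\<Sum>l'<l. g (ss!l') * of_int (fst tv (ss!l') i)))
          - \<gamma> * of_int (fst tv (ss!l) i))\<^sup>2) \<le> real N * ta (ss!l) \<and>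
      (\<forall>i<N. [fst tv (ss!l) i = matvec k (fst \<omega>) (snd tv (ss!l)) i + (\<Sum>c\<in>A (ss!l). snd \<omega> c i)] (mod int p))} \<in> sets M"
    by (intro sets.sets_Collect_finite_All[OF _ finite_lessThan] sets.sets_Collect_conj sets.sets_Collect_const)
  thus "{x \<in> space M. rx_ok ss A g al ta (fst \<omega>) (snd \<omega>) (y x) tv} \<in> sets M"
    unfolding rx_ok_def Ball_def lessThan_iff .
qed

lemma matvec_mod: "[matvec k G (\<lambda>j. x j mod int p) i = matvec k G x i] (mod int p)"
  unfolding matvec_def by (intro cong_sum cong_mult cong_refl) (simp add: cong_def)

lemma matvec_restrict: "matvec k G (restrict x {..<k}) i = matvec k G x i"
  unfolding matvec_def by (rule sum.cong) auto

lemma matvec_sum: "matvec k G (\<lambda>j. \<Sum>c\<in>A. x c j) i = (\<Sum>c\<in>A. matvec k G (x c) i)"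
  unfolding matvec_def sum_distrib_left by (rule sum.swap)

lemma vecs_modI:
  assumes "\<And>j. j < k \<Longrightarrow> j \<notin> I \<Longrightarrow> x j = 0"
  shows "(\<lambda>j\<in>{..<k}. x j mod int p) \<in> vecs I"
  unfolding vecs_def
proof (rule PiE_I)
  fix j assume "j \<in> {..<k}"
  thus "(\<lambda>j\<in>{..<k}. x j mod int p) j \<in> (if j \<in> I then {0..<int p} else {0})"
    using assms[of j] p_pos by simp
qed simp

lemma vecs_zero: "v \<in> vecs I \<Longrightarrow> j < k \<Longrightarrow> j \<notin> I \<Longrightarrow> v j = 0"
proof -
  assume v: "v \<in> vecs I" and j: "j < k" "j \<notin> I"
  have "v j \<in> (if j \<in> I then {0..<int p} else {0})"
    using v j(1) unfolding vecs_def by (intro PiE_mem[of v "{..<k}"]) auto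
  thus "v j = 0" using j by simp
qed

lemma confusion_cong:
  assumes "\<And>i. i < N \<Longrightarrow> y i = y' i" "\<And>i. i < N \<Longrightarrow> s i = s' i"
  shows "confusion G I y s \<tau> = confusion G I y' s' \<tau>"
proof -
  have "(\<Sum>i<N. (y i - \<gamma> * of_int (t i))\<^sup>2) = (\<Sum>i<N. (y' i - \<gamma> * of_int (t i))\<^sup>2)" for t
    using assms by (intro sum.cong) auto
  moreover have "(\<forall>i<N. [matvec k G w i = t i - s i] (mod int p)) = (\<forall>i<N. [matvec k G w i = t i - s' i] (mod int p))" for t w
    using assms by auto
  ultimately show ?thesis unfolding confusion_def by simp
qed

text \<open>If v differs from v0, their difference reduced mod p is a witness of confusion. If v =
  v0, then t and t0 agree mod p and differ by at most 4 H < p.\<close>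

lemma rx_stage_unique:
  assumes nconf: "\<not> confusion G {..<kc + \<kappa>} y t0 \<tau>"
    and v: "v \<in> vecs {..<kc + \<kappa>}" "v0 \<in> vecs {..<kc + \<kappa>}"
    and t: "t \<in> Box" "t0 \<in> Box"
    and near: "(\<Sum>i<N. (y i - \<gamma> * of_int (t i))\<^sup>2) \<le> real N * \<tau>"
    and c: "\<And>i. i < N \<Longrightarrow> [t i = matvec k G v i + d i] (mod int p)"
    and c0: "\<And>i. i < N \<Longrightarrow> [t0 i = matvec k G v0 i + d i] (mod int p)"
  shows "v = v0 \<and> t = t0"
proof -
  have cd: "[t i - t0 i = matvec k G (\<lambda>j. v j - v0 j) i] (mod int p)" if "i < N" for i
    using cong_diff[OF c[OF that] c0[OF that]] by (simp add: matvec_diff)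
  have vv: "v = v0"
  proof (rule ccontr)
    assume ne: "v \<noteq> v0"
    obtain j where j: "j < k" "\<not> int p dvd (v j - v0 j)" using vecs_cong_eq[OF v ne] by blast
    let ?w = "\<lambda>j\<in>{..<k}. (v j - v0 j) mod int p"
    have "?w \<in> vecs {..<kc + \<kappa>}"
      using vecs_zero[OF v(1)] vecs_zero[OF v(2)] by (intro vecs_modI) simp
    moreover have "?w j \<noteq> 0" using j by (simp add: dvd_eq_mod_eq_0)
    moreover have "[matvec k G ?w i = t i - t0 i] (mod int p)" if "i < N" for i
      unfolding matvec_restrict using cong_trans[OF matvec_mod cong_sym[OF cd[OF that]]] .
    ultimately have "confusion G {..<kc + \<kappa>} y t0 \<tau>"
      unfolding confusion_def using t(1) near j(1) by blast
    thus False using nconf by blast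
  qed
  have "t i = t0 i" for i
  proof (cases "i < N")
    case True
    have "t i \<in> {- 2 * int H..2 * int H}" "t0 i \<in> {- 2 * int H..2 * int H}"
      using t True unfolding Box_def by (auto dest!: PiE_mem)
    hence "\<bar>t i - t0 i\<bar> \<le> 4 * int H" by auto
    moreover have "int p dvd t i - t0 i"
      using cd[OF True] unfolding vv by (simp add: matvec_def cong_0_iff)
    ultimately have "t i - t0 i = 0" using H_p zdvd_imp_le[of "int p" "\<bar>t i - t0 i\<bar>"] by force
    thus ?thesis by simp
  next
    case False
    thus ?thesis using t by (simp add: Box_def PiE_iff extensional_def)
  qed
  thus ?thesis using vv by (simp add: fun_eq_iff)
qed

text \<open>When nothing bad happens the true pair passes every test, so \<open>SOME\<close> returns
  some passing pair. Induction over the stages identifies it: once the earlier points are right, the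
  residual is the true one and \<open>rx_stage_unique\<close> applies.\<close>

lemma rx_dec_correct:
  fixes ss :: "'s list" and y w :: "nat \<Rightarrow> real"
  assumes dist: "distinct ss"
    and A: "\<And>s. s \<in> set ss \<Longrightarrow> A s \<subseteq> C" "\<And>s. s \<in> set ss \<Longrightarrow> card (A s) \<le> 2"
    and disj: "\<And>s s'. s \<in> set ss \<Longrightarrow> s' \<in> set ss \<Longrightarrow> s \<noteq> s' \<Longrightarrow> A s \<inter> A s' = {}"
    and g: "\<And>s. s \<in> set ss \<Longrightarrow> g s \<noteq> 0"
    and h: "\<And>s c. s \<in> set ss \<Longrightarrow> c \<in> A s \<Longrightarrow> h c = g s"
    and ok: "all_ok \<omega> a"
    and a: "\<And>s c. s \<in> set ss \<Longrightarrow> c \<in> A s \<Longrightarrow> a c \<in> vecs {kc..<kc + \<kappa> s}"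
    and y: "\<And>i. i < N \<Longrightarrow> y i = \<gamma> * (\<Sum>c\<in>C. h c * of_int (cws \<omega> a c i)) + \<sigma> * w i"
    and nbad: "\<not> rx_bad ss A g al ta \<kappa> h \<sigma> \<omega> (cws \<omega> a) w"
    and s: "s \<in> set ss"
  shows "rx_dec ss A g al ta \<kappa> \<omega> y s = (\<lambda>j\<in>{..<k}. (\<Sum>c\<in>A s. a c j) mod int p)"
proof -
  define G d where "G = fst \<omega>" and "d = snd \<omega>"
  define u where "u = cws \<omega> a"
  define b where "b = (\<lambda>c. shf G (d c) (a c))"
  have okc: "enc_ok G (d c) (a c)" if "c \<in> C" for c using ok that by (simp add: all_ok_def G_def d_def)
  have uc: "u c = cw G (d c) (a c)" if "c \<in> C" for c using that by (simp add: u_def cws_def G_def d_def)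
  define t0 where "t0 = (\<lambda>s\<in>set ss. \<lambda>i\<in>{..<N}. \<Sum>c\<in>A s. u c i)"
  define v0 where "v0 = (\<lambda>s\<in>set ss. \<lambda>j\<in>{..<k}. (\<Sum>c\<in>A s. a c j + b c j) mod int p)"
  have fA: "finite (A s)" if "s \<in> set ss" for s using A(1)[OF that] finite_C by (rule finite_subset)
  have t0B: "t0 s \<in> Box" if "s \<in> set ss" for s
  proof -
    have "\<bar>\<Sum>c\<in>A s. u c i\<bar> \<le> 2 * int H" if i: "i < N" for i
    proof -
      have "\<bar>\<Sum>c\<in>A s. u c i\<bar> \<le> (\<Sum>c\<in>A s. \<bar>u c i\<bar>)" by (rule sum_abs)
      also have "\<dots> \<le> (\<Sum>c\<in>A s. int H)"
      proof (rule sum_mono)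
        fix c assume "c \<in> A s"
        hence c: "c \<in> C" using A(1)[OF \<open>s \<in> set ss\<close>] by auto
        have "u c \<in> Shp" unfolding uc[OF c] by (rule cw_in_Shp[OF okc[OF c]])
        hence "u c \<in> PiE {..<N} (\<lambda>_. {- int H..int H})" using Shp_subset by blast
        from PiE_mem[OF this, of i] i show "\<bar>u c i\<bar> \<le> int H" by auto
      qed
      also have "\<dots> \<le> 2 * int H" using A(2)[OF \<open>s \<in> set ss\<close>] by (simp add: mult_right_mono)
      finally show ?thesis .
    qed
    hence "(\<Sum>c\<in>A s. u c i) \<in> {- 2 * int H..2 * int H}" if "i < N" for i using that by force
    thus ?thesis unfolding Box_def t0_def using that by (intro PiE_I) auto
  qed
  have v0V: "v0 s \<in> vecs {..<kc + \<kappa> s}" if ss: "s \<in> set ss" for s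
  proof -
    have "(\<Sum>c\<in>A s. a c j + b c j) = 0" if j: "j < k" "j \<notin> {..<kc + \<kappa> s}" for j
    proof (rule sum.neutral, rule ballI)
      fix c assume c: "c \<in> A s"
      have "a c j = 0" using a[OF ss c] j by (intro vecs_zero) auto
      moreover have "b c j = 0" using shf_in_vecs[OF okc] c A(1)[OF ss] j by (intro vecs_zero[of "b c" "{..<kc}"]) (auto simp: b_def)
      ultimately show "a c j + b c j = 0" by simp
    qed
    hence "(\<lambda>j\<in>{..<k}. (\<Sum>c\<in>A s. a c j + b c j) mod int p) \<in> vecs {..<kc + \<kappa> s}" by (rule vecs_modI)
    thus ?thesis unfolding v0_def using ss by simp
  qed
  have c0: "[t0 s i = matvec k G (v0 s) i + (\<Sum>c\<in>A s. d c i)] (mod int p)" if ss: "s \<in> set ss" and i: "i < N" for s i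
  proof -
    have "[(\<Sum>c\<in>A s. u c i) = (\<Sum>c\<in>A s. matvec k G (a c) i + matvec k G (b c) i + d c i)] (mod int p)"
      using A(1)[OF ss] cw_cong[OF okc i] by (intro cong_sum) (auto simp: uc b_def)
    also have "(\<Sum>c\<in>A s. matvec k G (a c) i + matvec k G (b c) i + d c i) = matvec k G (\<lambda>j. \<Sum>c\<in>A s. a c j + b c j) i + (\<Sum>c\<in>A s. d c i)"
      by (simp add: matvec_sum matvec_add sum.distrib)
    also have "[\<dots> = matvec k G (v0 s) i + (\<Sum>c\<in>A s. d c i)] (mod int p)"
      unfolding v0_def using ss by (intro cong_add cong_refl) (simp add: matvec_restrict cong_sym[OF matvec_mod])
    finally show ?thesis using ss i by (simp add: t0_def)
  qed
  let ?S = "\<lambda>l. \<lambda>i. al (ss!l) / g (ss!l) * (y i - \<gamma> * (\<Sum>l'<l. g (ss!l') * of_int (t0 (ss!l') i)))"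
  \<comment> \<open>Subtracting the true earlier sums removes exactly the codewords of the earlier
    groups; the equal amplitude within each group enters here.\<close>
  have S: "?S l i = \<gamma> * (\<Sum>c\<in>C. rx_coef ss A g al h l c * of_int (u c i)) + al (ss!l) / g (ss!l) * \<sigma> * w i"
    if l: "l < length ss" and i: "i < N" for l i
  proof -
    let ?U = "\<Union>l'<l. A (ss!l')"
    have mem: "l' < l \<Longrightarrow> ss ! l' \<in> set ss" for l' using l by auto
    have U: "?U \<subseteq> C" using A(1)[OF mem] by auto
    have "(\<Sum>l'<l. g (ss!l') * of_int (t0 (ss!l') i)) = (\<Sum>l'<l. \<Sum>c\<in>A (ss!l'). h c * of_int (u c i))"
    proof (rule sum.cong[OF refl])
      fix l' assume "l' \<in> {..<l}"
      hence m: "ss ! l' \<in> set ss" using mem by simp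
      show "g (ss!l') * of_int (t0 (ss!l') i) = (\<Sum>c\<in>A (ss!l'). h c * of_int (u c i))"
        using i m by (simp add: t0_def sum_distrib_left h[OF m] cong: sum.cong)
    qed
    also have "\<dots> = (\<Sum>c\<in>?U. h c * of_int (u c i))"
    proof (rule sum.UNION_disjoint[symmetric])
      show "\<forall>i\<in>{..<l}. finite (A (ss ! i))" using fA mem by auto
      show "\<forall>i\<in>{..<l}. \<forall>j\<in>{..<l}. i \<noteq> j \<longrightarrow> A (ss ! i) \<inter> A (ss ! j) = {}"
      proof (intro ballI impI)
        fix i j assume "i \<in> {..<l}" "j \<in> {..<l}" "i \<noteq> j"
        thus "A (ss ! i) \<inter> A (ss ! j) = {}" using disj[OF mem mem, of i j] dist l by (auto simp: nth_eq_iff_index_eq)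
      qed
    qed simp
    finally have "y i - \<gamma> * (\<Sum>l'<l. g (ss!l') * of_int (t0 (ss!l') i))
       = \<gamma> * ((\<Sum>c\<in>C. h c * of_int (u c i)) - (\<Sum>c\<in>?U. h c * of_int (u c i))) + \<sigma> * w i"
      using y[OF i] by (simp add: u_def right_diff_distrib)
    also have "(\<Sum>c\<in>C. h c * of_int (u c i)) - (\<Sum>c\<in>?U. h c * of_int (u c i)) = (\<Sum>c\<in>C - ?U. h c * of_int (u c i))"
      using U finite_C by (simp add: sum_diff)
    also have "\<dots> = (\<Sum>c\<in>C. (if c \<in> ?U then 0 else h c * of_int (u c i)))"
      using finite_C by (intro sum.mono_neutral_cong_left) auto
    finally have "?S l i = al (ss!l) / g (ss!l) * (\<gamma> * (\<Sum>c\<in>C. (if c \<in> ?U then 0 else h c * of_int (u c i))) + \<sigma> * w i)"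
      by (rule arg_cong)
    also have "\<dots> = \<gamma> * (\<Sum>c\<in>C. al (ss!l) / g (ss!l) * (if c \<in> ?U then 0 else h c * of_int (u c i))) + al (ss!l) / g (ss!l) * \<sigma> * w i"
      by (simp only: sum_distrib_left distrib_left) (simp add: mult_ac)
    also have "(\<Sum>c\<in>C. al (ss!l) / g (ss!l) * (if c \<in> ?U then 0 else h c * of_int (u c i))) = (\<Sum>c\<in>C. rx_coef ss A g al h l c * of_int (u c i))"
      by (rule sum.cong) (auto simp: rx_coef_def)
    finally show ?thesis .
  qed
  have near0: "(\<Sum>i<N. (?S l i - \<gamma> * of_int (t0 (ss!l) i))\<^sup>2) \<le> real N * ta (ss!l)" if l: "l < length ss" for l
  proof -
    have mem: "ss ! l \<in> set ss" using l by auto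
    have "?S l i - \<gamma> * of_int (t0 (ss!l) i) = \<gamma> * (\<Sum>c\<in>C. (rx_coef ss A g al h l c - (if c \<in> A (ss!l) then 1 else 0)) * of_int (u c i))
         + al (ss!l) / g (ss!l) * \<sigma> * w i" if i: "i < N" for i
    proof -
      have "(\<Sum>c\<in>A (ss!l). real_of_int (u c i)) = (\<Sum>c\<in>C. (if c \<in> A (ss!l) then 1 else 0) * real_of_int (u c i))"
        using A(1)[OF mem] finite_C by (simp add: if_distrib[of "\<lambda>x. x * _"] sum.If_cases Int_absorb1 cong: if_cong)
      hence e: "(\<Sum>c\<in>C. (rx_coef ss A g al h l c - (if c \<in> A (ss!l) then 1 else 0)) * of_int (u c i))
         = (\<Sum>c\<in>C. rx_coef ss A g al h l c * of_int (u c i)) - (\<Sum>c\<in>A (ss!l). real_of_int (u c i))"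
        by (simp only: left_diff_distrib sum_subtractf)
      have t0i: "of_int (t0 (ss!l) i) = (\<Sum>c\<in>A (ss!l). real_of_int (u c i))" using i mem by (simp add: t0_def)
      show ?thesis unfolding S[OF l i] e t0i by (simp only: right_diff_distrib)
    qed
    hence "(\<Sum>i<N. (?S l i - \<gamma> * of_int (t0 (ss!l) i))\<^sup>2) = (\<Sum>i<N. (\<gamma> * (\<Sum>c\<in>C. (rx_coef ss A g al h l c - (if c \<in> A (ss!l) then 1 else 0)) * of_int (u c i))
         + al (ss!l) / g (ss!l) * \<sigma> * w i)\<^sup>2)" by (intro sum.cong) auto
    moreover have "\<not> real N * ta (ss!l) < (\<Sum>i<N. (\<gamma> * (\<Sum>c\<in>C. (rx_coef ss A g al h l c - (if c \<in> A (ss!l) then 1 else 0)) * of_int (u c i))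
         + al (ss!l) / g (ss!l) * \<sigma> * w i)\<^sup>2)" 
      by (rule contrapos_nn[OF nbad]) (unfold rx_bad_def u_def, intro exI[of _ l] conjI l disjI1, assumption)
    ultimately show ?thesis by linarith
  qed
  have nconf: "\<not> confusion G {..<kc + \<kappa> (ss!l)} (?S l) (t0 (ss!l)) (ta (ss!l))" if l: "l < length ss" for l
  proof -
    have mem: "ss ! l \<in> set ss" using l by auto
    have "confusion G {..<kc + \<kappa> (ss!l)} (?S l) (t0 (ss!l)) (ta (ss!l)) \<longleftrightarrow>
      confusion G {..<kc + \<kappa> (ss!l)} (\<lambda>i. \<gamma> * (\<Sum>c\<in>C. rx_coef ss A g al h l c * of_int (u c i)) + al (ss!l) / g (ss!l) * \<sigma> * w i)
         (\<lambda>i. \<Sum>c\<in>A (ss!l). u c i) (ta (ss!l))"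
    proof (rule confusion_cong)
      fix i assume i: "i < N"
      show "?S l i = \<gamma> * (\<Sum>c\<in>C. rx_coef ss A g al h l c * of_int (u c i)) + al (ss!l) / g (ss!l) * \<sigma> * w i" by (rule S[OF l i])
      show "t0 (ss!l) i = (\<Sum>c\<in>A (ss!l). u c i)" unfolding t0_def using i mem by simp
    qed
    moreover have "\<not> confusion G {..<kc + \<kappa> (ss!l)} (\<lambda>i. \<gamma> * (\<Sum>c\<in>C. rx_coef ss A g al h l c * of_int (u c i)) + al (ss!l) / g (ss!l) * \<sigma> * w i)
         (\<lambda>i. \<Sum>c\<in>A (ss!l). u c i) (ta (ss!l))"
      by (rule contrapos_nn[OF nbad]) (unfold rx_bad_def u_def G_def, intro exI[of _ l] conjI l disjI2, assumption)
    ultimately show ?thesis by simp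
  qed
  let ?P = "\<lambda>tv. tv \<in> rx_space ss \<kappa> \<and> rx_ok ss A g al ta (fst \<omega>) (snd \<omega>) y tv"
  have "?P (t0, v0)"
  proof (intro conjI)
    show "(t0, v0) \<in> rx_space ss \<kappa>"
      unfolding rx_space_def using t0B v0V by (auto simp: t0_def v0_def)
    show "rx_ok ss A g al ta (fst \<omega>) (snd \<omega>) y (t0, v0)"
      unfolding rx_ok_def using near0 c0 by (auto simp: G_def d_def)
  qed
  hence P: "?P (SOME tv. ?P tv)" by (rule someI)
  obtain t v where tv: "(SOME tv. ?P tv) = (t, v)" by force
  have P': "(t, v) \<in> rx_space ss \<kappa>" "rx_ok ss A g al ta G d y (t, v)"
    using P unfolding tv G_def d_def by blast+
  have tvs: "s \<in> set ss \<Longrightarrow> t s \<in> Box" "s \<in> set ss \<Longrightarrow> v s \<in> vecs {..<kc + \<kappa> s}" for s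
    using P'(1) unfolding rx_space_def by (blast dest: PiE_mem)+
  have main: "v (ss!l) = v0 (ss!l) \<and> t (ss!l) = t0 (ss!l)" if "l < length ss" for l
    using that
  proof (induction l rule: less_induct)
    case (less l)
    have mem: "ss ! l \<in> set ss" using less.prems by auto
    have "(\<Sum>l'<l. g (ss!l') * of_int (t (ss!l') i)) = (\<Sum>l'<l. g (ss!l') * of_int (t0 (ss!l') i))" for i
      using less by (intro sum.cong) auto
    moreover have "(\<Sum>i<N. (al (ss!l) / g (ss!l) * (y i - \<gamma> * (\<Sum>l'<l. g (ss!l') * of_int (t (ss!l') i)))
          - \<gamma> * of_int (t (ss!l) i))\<^sup>2) \<le> real N * ta (ss!l)"
      and c: "\<And>i. i < N \<Longrightarrow> [t (ss!l) i = matvec k G (v (ss!l)) i + (\<Sum>c\<in>A (ss!l). d c i)] (mod int p)"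
      using P'(2) less.prems unfolding rx_ok_def fst_conv snd_conv by blast+
    ultimately have near: "(\<Sum>i<N. (?S l i - \<gamma> * of_int (t (ss!l) i))\<^sup>2) \<le> real N * ta (ss!l)" by simp
    show ?case
      by (rule rx_stage_unique[OF nconf[OF less.prems] tvs(2)[OF mem] v0V[OF mem] tvs(1)[OF mem] t0B[OF mem] near c c0[OF mem]])
  qed
  obtain l where l: "l < length ss" "s = ss ! l" using s by (auto simp: in_set_conv_nth)
  have vs: "v s = v0 s" using main[OF l(1)] l(2) by simp
  show ?thesis
  proof
    fix j
    show "rx_dec ss A g al ta \<kappa> \<omega> y s j = (\<lambda>j\<in>{..<k}. (\<Sum>c\<in>A s. a c j) mod int p) j"
    proof (cases "j < k")
      case True
      \<comment> \<open>Messages live on the positions from \<open>kc\<close> on and shifts below,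
        so clearing the first \<open>kc\<close> entries of \<open>v0\<close> leaves the sum of the
        messages alone.\<close>
      have "(\<Sum>c\<in>A s. a c j) = 0" if "j < kc"
        using a[OF s] that True by (intro sum.neutral ballI) (auto intro!: vecs_zero)
      moreover have "(\<Sum>c\<in>A s. b c j) = 0" if "\<not> j < kc"
        using that True A(1)[OF s] by (intro sum.neutral ballI) (auto intro!: vecs_zero[of _ "{..<kc}"] shf_in_vecs okc simp: b_def)
      ultimately show ?thesis using True s unfolding rx_dec_def tv by (simp add: vs v0_def sum.distrib)
    next
      case False
      thus ?thesis by (simp add: rx_dec_def)
    qed
  qed
qed

end

section \<open>MMSE scaling and the union bound over the stages\<close>

context linear_ensemble
begin

text \<open>Interference of the codewords still undecoded after stage l, plus the receiver
  noise.\<close>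

definition rx_noise :: "'s list \<Rightarrow> ('s \<Rightarrow> 'c set) \<Rightarrow> ('c \<Rightarrow> real) \<Rightarrow> real \<Rightarrow> nat \<Rightarrow> real" where
  "rx_noise ss A h \<sigma> l = (\<Sum>c\<in>C - (\<Union>l'\<le>l. A (ss!l')). (h c)\<^sup>2) + \<sigma>\<^sup>2"

text \<open>The residual variance m (1 - \<alpha>)^2 + \<alpha>^2 n / x^2 is minimised by \<alpha> =
  m x^2 / (m x^2 + n). Its first term is the self-noise of the m aligned codewords, which arises
  because they are scaled by \<alpha> and not by 1.\<close>

lemma rx_coef_energy:
  fixes ss :: "'s list" and g al :: "'s \<Rightarrow> real" and h :: "'c \<Rightarrow> real" and \<sigma> :: real
  assumes l: "l < length ss" and dist: "distinct ss" and A: "A (ss!l) \<subseteq> C"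
    and disj: "\<And>s s'. s \<in> set ss \<Longrightarrow> s' \<in> set ss \<Longrightarrow> s \<noteq> s' \<Longrightarrow> A s \<inter> A s' = {}"
    and g: "g (ss!l) \<noteq> 0" and h: "\<And>c. c \<in> A (ss!l) \<Longrightarrow> h c = g (ss!l)"
    and \<sigma>: "\<sigma> \<noteq> 0"
    and al: "al (ss!l) = card (A (ss!l)) * (g (ss!l))\<^sup>2 / (card (A (ss!l)) * (g (ss!l))\<^sup>2 + rx_noise ss A h \<sigma> l)"
  shows "(\<Sum>c\<in>C. (rx_coef ss A g al h l c - (if c \<in> A (ss!l) then 1 else 0))\<^sup>2) + (al (ss!l) / g (ss!l) * \<sigma>)\<^sup>2
    = card (A (ss!l)) * rx_noise ss A h \<sigma> l / (card (A (ss!l)) * (g (ss!l))\<^sup>2 + rx_noise ss A h \<sigma> l)"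
proof -
  define S where "S = A (ss!l)"
  define U where "U = (\<Union>l'<l. A (ss!l'))"
  define \<alpha> where "\<alpha> = al (ss!l)"
  define x where "x = g (ss!l)"
  define n where "n = rx_noise ss A h \<sigma> l"
  define m where "m = real (card S)"
  have SU: "S \<inter> U = {}"
  proof -
    have "A (ss!l) \<inter> A (ss!l') = {}" if "l' < l" for l'
      using that l dist by (intro disj) (auto simp: nth_eq_iff_index_eq)
    thus ?thesis by (auto simp: S_def U_def)
  qed
  have UU: "(\<Union>l'\<le>l. A (ss!l')) = S \<union> U" by (auto simp: S_def U_def le_less)
  have n: "n = (\<Sum>c\<in>C - (S \<union> U). (h c)\<^sup>2) + \<sigma>\<^sup>2" by (simp add: n_def rx_noise_def UU)
  have n0: "n > 0" unfolding n using \<sigma> by (intro add_nonneg_pos sum_nonneg) auto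
  have m0: "m \<ge> 0" by (simp add: m_def)
  let ?f = "\<lambda>c. (rx_coef ss A g al h l c - (if c \<in> S then 1 else 0))\<^sup>2"
  have "(\<Sum>c\<in>C. ?f c) = (\<Sum>c\<in>C - S. ?f c) + (\<Sum>c\<in>S. ?f c)"
    using A finite_C by (intro sum.subset_diff) (auto simp: S_def)
  also have "(\<Sum>c\<in>S. ?f c) = (\<Sum>c\<in>S. (\<alpha> - 1)\<^sup>2)"
  proof (rule sum.cong[OF refl])
    fix c assume c: "c \<in> S"
    hence "c \<notin> U" using SU by auto
    hence "rx_coef ss A g al h l c = \<alpha>" using c g h by (simp add: rx_coef_def U_def \<alpha>_def S_def)
    thus "?f c = (\<alpha> - 1)\<^sup>2" using c by simp
  qed
  also have "(\<Sum>c\<in>C - S. ?f c) = (\<Sum>c\<in>C - (S \<union> U). (\<alpha> / x * h c)\<^sup>2)"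
    using finite_C by (intro sum.mono_neutral_cong_right) (auto simp: rx_coef_def U_def \<alpha>_def x_def)
  also have "(\<Sum>c\<in>C - (S \<union> U). (\<alpha> / x * h c)\<^sup>2) = (\<alpha> / x)\<^sup>2 * (\<Sum>c\<in>C - (S \<union> U). (h c)\<^sup>2)"
    by (simp only: power_mult_distrib sum_distrib_left)
  also have "(\<Sum>c\<in>S. (\<alpha> - 1)\<^sup>2) = m * (1 - \<alpha>)\<^sup>2" by (simp add: m_def power2_commute)
  finally have "(\<Sum>c\<in>C. ?f c) + (\<alpha> / x * \<sigma>)\<^sup>2 = m * (1 - \<alpha>)\<^sup>2 + (\<alpha> / x)\<^sup>2 * n"
    unfolding n power_mult_distrib by (simp only: distrib_left)
  also have "\<dots> = m * n / (m * x\<^sup>2 + n)"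
  proof -
    have x0: "x \<noteq> 0" using g by (simp add: x_def)
    have \<alpha>: "\<alpha> = m * x\<^sup>2 / (m * x\<^sup>2 + n)" using al by (simp add: \<alpha>_def m_def x_def n_def S_def)
    define D where "D = m * x\<^sup>2 + n"
    have D: "D > 0" unfolding D_def using n0 m0 by (intro add_nonneg_pos) auto
    have 1: "1 - \<alpha> = n / D" unfolding \<alpha> D_def[symmetric] using D by (simp add: field_simps) (simp add: D_def)
    have 2: "\<alpha> / x = m * x / D" unfolding \<alpha> D_def[symmetric] using x0 by (simp add: power2_eq_square)
    have "m * (n / D)\<^sup>2 + (m * x / D)\<^sup>2 * n = m * n * (m * x\<^sup>2 + n) / D\<^sup>2"
      by (simp add: power_divide power_mult_distrib add_divide_distrib[symmetric] power2_eq_square algebra_simps)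
    also have "\<dots> = m * n / D" unfolding D_def[symmetric] using D by (simp add: power2_eq_square)
    finally show ?thesis unfolding 1 2 D_def .
  qed
  finally show ?thesis by (simp add: S_def \<alpha>_def x_def m_def n_def)
qed

lemma avg_rx_bad:
  fixes ss :: "'s list" and \<iota> :: "nat \<Rightarrow> 'j" and g al ta :: "'s \<Rightarrow> real" and h :: "'c \<Rightarrow> real" and \<sigma> :: real and lam :: "nat \<Rightarrow> real"
  assumes J: "finite J" "inj_on \<iota> {..<N}" "\<iota> ` {..<N} \<subseteq> J"
    and \<nu>: "\<And>l. l < length ss \<Longrightarrow> (\<Sum>c\<in>C. (rx_coef ss A g al h l c - (if c \<in> A (ss!l) then 1 else 0))\<^sup>2) + (al (ss!l) / g (ss!l) * \<sigma>)\<^sup>2 = \<nu> l"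
    and lam: "\<And>l. l < length ss \<Longrightarrow> lam l \<ge> 0" "\<And>l. l < length ss \<Longrightarrow> 2 * lam l * \<nu> l < 1"
    and ta: "\<And>s. s \<in> set ss \<Longrightarrow> ta s > 0" and \<kappa>: "\<And>s. s \<in> set ss \<Longrightarrow> kc + \<kappa> s \<le> k"
  shows "avg (\<lambda>\<omega>. if all_ok \<omega> a then measure (PiM J (\<lambda>_. std_gauss))
        {z \<in> space (PiM J (\<lambda>_. std_gauss)). rx_bad ss A g al ta \<kappa> h \<sigma> \<omega> (cws \<omega> a) (\<lambda>i. z (\<iota> i))} else 0)
    \<le> (\<Sum>l<length ss. loss ^ card C * (exp (- lam l * ta (ss!l)) / sqrt (1 - 2 * lam l * \<nu> l)) ^ N
        + loss ^ card C * (loss * real p ^ \<kappa> (ss!l) * (sqrt (ta (ss!l)) + 2 * \<gamma>) ^ N))"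
proof -
  let ?M = "PiM J (\<lambda>_. std_gauss)"
  interpret prob_space ?M by (rule prob_space_noise)
  let ?co = "\<lambda>l c. rx_coef ss A g al h l c - (if c \<in> A (ss!l) then 1 else 0)"
  let ?E1 = "\<lambda>l \<omega>. {z \<in> space ?M. real N * ta (ss!l) < (\<Sum>i<N. (\<gamma> * (\<Sum>c\<in>C. ?co l c * of_int (cws \<omega> a c i)) + al (ss!l) / g (ss!l) * \<sigma> * z (\<iota> i))\<^sup>2)}"
  let ?y = "\<lambda>l \<xi> z i. \<gamma> * (\<Sum>c\<in>C. rx_coef ss A g al h l c * of_int (\<xi> c i)) + al (ss!l) / g (ss!l) * \<sigma> * z (\<iota> i)"
  let ?s = "\<lambda>l \<xi> i. \<Sum>c\<in>A (ss!l). \<xi> c i"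
  let ?E2 = "\<lambda>l \<omega>. {z \<in> space ?M. confusion (fst \<omega>) {..<kc + \<kappa> (ss!l)} (?y l (cws \<omega> a) z) (?s l (cws \<omega> a)) (ta (ss!l))}"
  have ym: "(\<lambda>z. ?y l \<xi> z i) \<in> borel_measurable ?M" if "i < N" for l \<xi> i
  proof (intro borel_measurable_add borel_measurable_times borel_measurable_const)
    have "\<iota> i \<in> J" using J(3) that by auto
    thus "(\<lambda>z. z (\<iota> i)) \<in> borel_measurable ?M"
      using measurable_component_singleton[of "\<iota> i" J "\<lambda>_. std_gauss"] by simp
  qed
  have m1: "?E1 l \<omega> \<in> sets ?M" for l \<omega>
  proof -
    have [measurable]: "(\<lambda>z. \<Sum>i<N. (\<gamma> * (\<Sum>c\<in>C. ?co l c * of_int (cws \<omega> a c i)) + al (ss!l) / g (ss!l) * \<sigma> * z (\<iota> i))\<^sup>2) \<in> borel_measurable ?M"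
      by (rule noise_quadratic_measurable[OF J(3)])
    show ?thesis by measurable
  qed
  have m2: "?E2 l \<omega> \<in> sets ?M" for l \<omega> by (rule confusion_measurable[OF ym])
  have "avg (\<lambda>\<omega>. if all_ok \<omega> a then measure ?M {z \<in> space ?M. rx_bad ss A g al ta \<kappa> h \<sigma> \<omega> (cws \<omega> a) (\<lambda>i. z (\<iota> i))} else 0)
    \<le> avg (\<lambda>\<omega>. \<Sum>l<length ss. (if all_ok \<omega> a then measure ?M (?E1 l \<omega>) else 0) + (if all_ok \<omega> a then measure ?M (?E2 l \<omega>) else 0))"
  proof (rule avg_mono)
    fix \<omega>
    have "{z \<in> space ?M. rx_bad ss A g al ta \<kappa> h \<sigma> \<omega> (cws \<omega> a) (\<lambda>i. z (\<iota> i))} = (\<Union>l\<in>{..<length ss}. ?E1 l \<omega> \<union> ?E2 l \<omega>)"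
      unfolding rx_bad_def by auto
    moreover have "measure ?M (\<Union>l\<in>{..<length ss}. ?E1 l \<omega> \<union> ?E2 l \<omega>) \<le> (\<Sum>l<length ss. measure ?M (?E1 l \<omega> \<union> ?E2 l \<omega>))"
      by (rule finite_measure_subadditive_finite, rule finite_lessThan, rule image_subsetI, rule sets.Un[OF m1 m2])
    ultimately have "measure ?M {z \<in> space ?M. rx_bad ss A g al ta \<kappa> h \<sigma> \<omega> (cws \<omega> a) (\<lambda>i. z (\<iota> i))} \<le> (\<Sum>l<length ss. measure ?M (?E1 l \<omega> \<union> ?E2 l \<omega>))"
      by (simp only:)
    also have "\<dots> \<le> (\<Sum>l<length ss. measure ?M (?E1 l \<omega>) + measure ?M (?E2 l \<omega>))"
      by (rule sum_mono, rule measure_Un_le[OF m1 m2])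
    finally show "(if all_ok \<omega> a then measure ?M {z \<in> space ?M. rx_bad ss A g al ta \<kappa> h \<sigma> \<omega> (cws \<omega> a) (\<lambda>i. z (\<iota> i))} else 0)
      \<le> (\<Sum>l<length ss. (if all_ok \<omega> a then measure ?M (?E1 l \<omega>) else 0) + (if all_ok \<omega> a then measure ?M (?E2 l \<omega>) else 0))"
      by (cases "all_ok \<omega> a") (simp_all only: if_True if_False sum.distrib sum.neutral_const add_0 order_refl)
  qed
  also have "\<dots> = (\<Sum>l<length ss. avg (\<lambda>\<omega>. if all_ok \<omega> a then measure ?M (?E1 l \<omega>) else 0) + avg (\<lambda>\<omega>. if all_ok \<omega> a then measure ?M (?E2 l \<omega>) else 0))"
    by (simp only: avg_sum avg_add)
  also have "\<dots> \<le> (\<Sum>l<length ss. loss ^ card C * (exp (- lam l * ta (ss!l)) / sqrt (1 - 2 * lam l * \<nu> l)) ^ N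
        + loss ^ card C * (loss * real p ^ \<kappa> (ss!l) * (sqrt (ta (ss!l)) + 2 * \<gamma>) ^ N))"
  proof (rule sum_mono, rule add_mono)
    fix l assume "l \<in> {..<length ss}"
    hence l: "l < length ss" by simp
    have mem: "ss ! l \<in> set ss" using l by simp
    show "avg (\<lambda>\<omega>. if all_ok \<omega> a then measure ?M (?E1 l \<omega>) else 0) \<le> loss ^ card C * (exp (- lam l * ta (ss!l)) / sqrt (1 - 2 * lam l * \<nu> l)) ^ N"
      by (rule avg_large_deviation[OF J lam(1)[OF l], where \<alpha> = "?co l" and b = "al (ss!l) / g (ss!l) * \<sigma>" and \<tau> = "ta (ss!l)" and a = a,
            unfolded \<nu>[OF l], OF lam(2)[OF l]])
    show "avg (\<lambda>\<omega>. if all_ok \<omega> a then measure ?M (?E2 l \<omega>) else 0) \<le> loss ^ card C * (loss * real p ^ \<kappa> (ss!l) * (sqrt (ta (ss!l)) + 2 * \<gamma>) ^ N)"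
      by (rule avg_confusion[where y = "?y l" and s = "?s l" and M = ?M and \<tau> = "ta (ss!l)" and \<kappa> = "\<kappa> (ss!l)" and a = a])
        (rule prob_space_noise, erule ym, rule ta[OF mem], rule \<kappa>[OF mem])
  qed
  finally show ?thesis .
qed

end

section \<open>Unfolding the channel recursion and the power constraint\<close>

lemma yc_recv_beyond: "t \<le> s \<Longrightarrow> yc_recv h1 h2 h3 enc rel m z t k s = 0"
  by (induction t arbitrary: k) (auto simp: Let_def)

lemma yc_recv_stable: "s < t \<Longrightarrow> yc_recv h1 h2 h3 enc rel m z t k s = yc_recv h1 h2 h3 enc rel m z (Suc s) k s"
proof (induction t)
  case (Suc t)
  show ?case
  proof (cases "s = t")
    case False
    hence "yc_recv h1 h2 h3 enc rel m z (Suc t) k s = yc_recv h1 h2 h3 enc rel m z t k s" by (simp add: Let_def)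
    thus ?thesis using Suc False by simp
  qed simp
qed simp

text \<open>If the users ignore their feedback, the relay observation is an explicit function of
  messages and noise; this cuts the mutual recursion of the channel.\<close>

lemma yc_recv_relay:
  assumes nf: "\<And>u a y y'. u \<in> yc_users \<Longrightarrow> enc u s a y = enc u s a y'" and s: "s < t"
  shows "yc_recv h1 h2 h3 enc rel m z t 0 s = (\<Sum>u\<in>yc_users. yc_gain h1 h2 h3 u * enc u s (yc_own u m) (\<lambda>_. 0)) + z (0, s)"
proof -
  have "(\<Sum>u\<in>yc_users. yc_gain h1 h2 h3 u * enc u s (yc_own u m) (yc_recv h1 h2 h3 enc rel m z s u))
     = (\<Sum>u\<in>yc_users. yc_gain h1 h2 h3 u * enc u s (yc_own u m) (\<lambda>_. 0))"
    by (rule sum.cong[OF refl], rule arg_cong[where f = "(*) _"], erule nf)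
  thus ?thesis unfolding yc_recv_stable[OF s] by (simp add: Let_def)
qed

lemma yc_recv_user:
  assumes "k \<noteq> 0" and s: "s < t"
  shows "yc_recv h1 h2 h3 enc rel m z t k s = yc_gain h1 h2 h3 k * rel s (yc_recv h1 h2 h3 enc rel m z s 0) + z (k, s)"
  unfolding yc_recv_stable[OF s] using assms by (simp add: Let_def)

lemma prob_space_yc_noise: "prob_space (yc_noise n)"
  unfolding yc_noise_def by (intro prob_space_PiM prob_space_std_gauss)

lemma yc_noise_measurable:
  assumes "k \<le> 3" "t < n"
  shows "(\<lambda>z. z (k, t)) \<in> borel_measurable (yc_noise n)"
  unfolding yc_noise_def
  using measurable_component_singleton[of "(k,t)" "{0..3} \<times> {..<n}" "\<lambda>_. std_gauss"] assms by simp

text \<open>A bound that holds for every message tuple and every noise value passes through both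
  averages; clipped signals provide one.\<close>

lemma yc_power_constraintI:
  assumes n: "n > 0" and M: "card (yc_msgs M) > 0" and P: "P \<ge> 0"
    and meas: "\<And>m t. m \<in> yc_msgs M \<Longrightarrow> t < n \<Longrightarrow> (\<lambda>z. yc_tx h1 h2 h3 enc rel m z k t) \<in> borel_measurable (yc_noise n)"
    and bound: "\<And>m z. m \<in> yc_msgs M \<Longrightarrow> (\<Sum>t<n. (yc_tx h1 h2 h3 enc rel m z k t)\<^sup>2) \<le> real n * P"
  shows "ennreal (1 / (real n * real (card (yc_msgs M)))) *
          (\<Sum>t<n. \<Sum>m\<in>yc_msgs M. \<integral>\<^sup>+ z. ennreal ((yc_tx h1 h2 h3 enc rel m z k t)\<^sup>2) \<partial>yc_noise n) \<le> ennreal P"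
proof -
  interpret prob_space "yc_noise n" by (rule prob_space_yc_noise)
  have one: "(\<Sum>t<n. \<integral>\<^sup>+ z. ennreal ((yc_tx h1 h2 h3 enc rel m z k t)\<^sup>2) \<partial>yc_noise n) \<le> ennreal (real n * P)" if m: "m \<in> yc_msgs M" for m
  proof -
    have "(\<Sum>t<n. \<integral>\<^sup>+ z. ennreal ((yc_tx h1 h2 h3 enc rel m z k t)\<^sup>2) \<partial>yc_noise n)
       = (\<integral>\<^sup>+ z. (\<Sum>t<n. ennreal ((yc_tx h1 h2 h3 enc rel m z k t)\<^sup>2)) \<partial>yc_noise n)"
      using meas[OF m] by (intro nn_integral_sum[symmetric]) simp
    also have "\<dots> = (\<integral>\<^sup>+ z. ennreal (\<Sum>t<n. (yc_tx h1 h2 h3 enc rel m z k t)\<^sup>2) \<partial>yc_noise n)"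
      by (simp add: sum_ennreal)
    also have "\<dots> \<le> (\<integral>\<^sup>+ z. ennreal (real n * P) \<partial>yc_noise n)"
      by (intro nn_integral_mono ennreal_leI bound m)
    also have "\<dots> = ennreal (real n * P)" by (simp add: emeasure_space_1)
    finally show ?thesis .
  qed
  have "(\<Sum>t<n. \<Sum>m\<in>yc_msgs M. \<integral>\<^sup>+ z. ennreal ((yc_tx h1 h2 h3 enc rel m z k t)\<^sup>2) \<partial>yc_noise n)
     = (\<Sum>m\<in>yc_msgs M. \<Sum>t<n. \<integral>\<^sup>+ z. ennreal ((yc_tx h1 h2 h3 enc rel m z k t)\<^sup>2) \<partial>yc_noise n)"
    by (rule sum.swap)
  also have "\<dots> \<le> (\<Sum>m\<in>yc_msgs M. ennreal (real n * P))" by (intro sum_mono one)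
  also have "\<dots> = ennreal (real (card (yc_msgs M)) * (real n * P))"
    using P by (simp add: ennreal_mult ennreal_of_nat_eq_real_of_nat)
  finally have "ennreal (1 / (real n * real (card (yc_msgs M)))) *
          (\<Sum>t<n. \<Sum>m\<in>yc_msgs M. \<integral>\<^sup>+ z. ennreal ((yc_tx h1 h2 h3 enc rel m z k t)\<^sup>2) \<partial>yc_noise n)
     \<le> ennreal (1 / (real n * real (card (yc_msgs M)))) * ennreal (real (card (yc_msgs M)) * (real n * P))"
    by (rule mult_left_mono) simp
  also have "\<dots> = ennreal P" using n M P by (simp add: ennreal_mult[symmetric])
  finally show ?thesis .
qed

text \<open>One of the L blocks is silent, the last for the users and the first for the relay, so
  the block added for the relay delay costs no power.\<close>

lemma sum_blocks_le:
  fixes f :: "nat \<Rightarrow> real"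
  assumes N: "L * N \<le> n" and z: "\<And>t. L * N \<le> t \<Longrightarrow> f t = 0"
    and b: "\<And>l. l < L \<Longrightarrow> (\<Sum>i<N. f (l * N + i)) \<le> x" and x: "x \<ge> 0"
    and zero: "\<exists>l<L. \<forall>i<N. f (l * N + i) = 0"
  shows "(\<Sum>t<n. f t) \<le> real (L - 1) * x"
proof -
  obtain l0 where l0: "l0 < L" "\<forall>i<N. f (l0 * N + i) = 0" using zero by blast
  have "(\<Sum>t<n. f t) = (\<Sum>t<L*N. f t)" using N z by (intro sum.mono_neutral_right) auto
  also have "\<dots> = (\<Sum>l<L. sum f {l * N..<l * N + N})" by (rule sum.nat_group[symmetric])
  also have "\<dots> = (\<Sum>l<L. \<Sum>i<N. f (l * N + i))"
  proof (rule sum.cong[OF refl])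
    fix l
    show "sum f {l * N..<l * N + N} = (\<Sum>i<N. f (l * N + i))"
      using sum.shift_bounds_nat_ivl[of f 0 "l * N" N] by (simp add: add.commute lessThan_atLeast0)
  qed
  also have "\<dots> = (\<Sum>l\<in>{..<L} - {l0}. \<Sum>i<N. f (l * N + i))"
    using l0 by (subst sum.remove[of _ l0]) (auto intro!: sum.neutral)
  also have "\<dots> \<le> (\<Sum>l\<in>{..<L} - {l0}. x)" using b by (intro sum_mono) auto
  also have "\<dots> = real (L - 1) * x" using l0 by simp
  finally show ?thesis .
qed

lemma finite_yc_users [simp]: "finite yc_users" by (simp add: yc_users_def)
lemma finite_yc_pairs [simp]: "finite yc_pairs"
  by (rule finite_subset[of _ "yc_users \<times> yc_users"]) (auto simp: yc_pairs_def)
lemma finite_yc_msgs [simp]: "finite (yc_msgs M)" unfolding yc_msgs_def by (intro finite_PiE) auto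

lemma card_yc_msgs_pos: "(\<And>p. p \<in> yc_pairs \<Longrightarrow> M p > 0) \<Longrightarrow> card (yc_msgs M) > 0"
  unfolding yc_msgs_def by (simp add: card_PiE)

text \<open>The per-symbol Chernoff factor for variance \<nu> and threshold \<tau> at the optimal
  tilt.\<close>

definition chernoff_base :: "real \<Rightarrow> real \<Rightarrow> real" where
  "chernoff_base \<nu> \<tau> = exp (- ((1/\<nu> - 1/\<tau>)/2) * \<tau>) / sqrt (1 - 2 * ((1/\<nu> - 1/\<tau>)/2) * \<nu>)"

lemma chernoff_base_less_1: "0 < \<nu> \<Longrightarrow> \<nu> < \<tau> \<Longrightarrow> chernoff_base \<nu> \<tau> < 1"
  unfolding chernoff_base_def by (rule chernoff_factor) auto

lemma chernoff_base_nonneg: "0 < \<nu> \<Longrightarrow> \<nu> < \<tau> \<Longrightarrow> chernoff_base \<nu> \<tau> \<ge> 0"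
  unfolding chernoff_base_def using chernoff_factor(1)[of \<nu> \<tau>] by (intro divide_nonneg_nonneg) auto

lemma chernoff_base_parameter:
  fixes \<nu> \<tau> :: real
  assumes "0 < \<nu>" "\<nu> < \<tau>"
  shows "(1/\<nu> - 1/\<tau>)/2 \<ge> 0" "2 * ((1/\<nu> - 1/\<tau>)/2) * \<nu> < 1"
proof -
  have "1/\<tau> \<le> 1/\<nu>" using assms by (intro divide_left_mono) auto
  thus "(1/\<nu> - 1/\<tau>)/2 \<ge> 0" by simp
  show "2 * ((1/\<nu> - 1/\<tau>)/2) * \<nu> < 1" using chernoff_factor(1)[of \<nu> \<tau>] assms by simp
qed

text \<open>Effective noise variance for m aligned codewords of amplitude x in noise n under the
  best scaling.\<close>

definition mmse_energy :: "real \<Rightarrow> real \<Rightarrow> real \<Rightarrow> real" where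
  "mmse_energy m x n = m * n / (m * x\<^sup>2 + n)"

lemma mmse_energy_pos: "m > 0 \<Longrightarrow> n > 0 \<Longrightarrow> mmse_energy m x n > 0"
  unfolding mmse_energy_def by (intro divide_pos_pos mult_pos_pos add_nonneg_pos) auto

context linear_ensemble
begin

text \<open>\<open>rx_ok\<close> takes the scaling as a function of the stream, so the position of
  the stream in the decoding order is recovered by \<open>THE\<close>.\<close>

definition mmse where
  "mmse ss A g h \<sigma> s = real (card (A s)) * (g s)\<^sup>2 /
     (real (card (A s)) * (g s)\<^sup>2 + rx_noise ss A h \<sigma> (THE l. l < length ss \<and> ss ! l = s))"

lemma mmse_nth: "distinct ss \<Longrightarrow> l < length ss \<Longrightarrow> mmse ss A g h \<sigma> (ss!l) =
   real (card (A (ss!l))) * (g (ss!l))\<^sup>2 / (real (card (A (ss!l))) * (g (ss!l))\<^sup>2 + rx_noise ss A h \<sigma> l)"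
proof -
  assume d: "distinct ss" and l: "l < length ss"
  have "(THE l'. l' < length ss \<and> ss ! l' = ss ! l) = l"
    using d l by (intro the_equality) (auto simp: nth_eq_iff_index_eq)
  thus ?thesis by (simp add: mmse_def)
qed

lemma rx_noise_pos: "\<sigma> \<noteq> 0 \<Longrightarrow> rx_noise ss A h \<sigma> l > 0"
  unfolding rx_noise_def by (intro add_nonneg_pos sum_nonneg) auto

lemma rx_bad_measurable:
  fixes \<iota> :: "nat \<Rightarrow> 'j"
  assumes J: "\<iota> ` {..<N} \<subseteq> J"
  shows "{z \<in> space (PiM J (\<lambda>_. std_gauss)). rx_bad ss A g al ta \<kappa> h \<sigma> \<omega> \<xi> (\<lambda>i. z (\<iota> i))} \<in> sets (PiM J (\<lambda>_. std_gauss))"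
proof -
  let ?M = "PiM J (\<lambda>_. std_gauss)"
  let ?co = "\<lambda>l c. rx_coef ss A g al h l c - (if c \<in> A (ss!l) then 1 else 0)"
  let ?E1 = "\<lambda>l. {z \<in> space ?M. real N * ta (ss!l) < (\<Sum>i<N. (\<gamma> * (\<Sum>c\<in>C. ?co l c * of_int (\<xi> c i)) + al (ss!l) / g (ss!l) * \<sigma> * z (\<iota> i))\<^sup>2)}"
  let ?y = "\<lambda>l z i. \<gamma> * (\<Sum>c\<in>C. rx_coef ss A g al h l c * of_int (\<xi> c i)) + al (ss!l) / g (ss!l) * \<sigma> * z (\<iota> i)"
  let ?s = "\<lambda>l i. \<Sum>c\<in>A (ss!l). \<xi> c i"
  let ?E2 = "\<lambda>l. {z \<in> space ?M. confusion (fst \<omega>) {..<kc + \<kappa> (ss!l)} (?y l z) (?s l) (ta (ss!l))}"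
  have ym: "(\<lambda>z. ?y l z i) \<in> borel_measurable ?M" if "i < N" for l i
  proof (intro borel_measurable_add borel_measurable_times borel_measurable_const)
    have "\<iota> i \<in> J" using J that by auto
    thus "(\<lambda>z. z (\<iota> i)) \<in> borel_measurable ?M"
      using measurable_component_singleton[of "\<iota> i" J "\<lambda>_. std_gauss"] by simp
  qed
  have m1: "?E1 l \<in> sets ?M" for l
  proof -
    have [measurable]: "(\<lambda>z. \<Sum>i<N. (\<gamma> * (\<Sum>c\<in>C. ?co l c * of_int (\<xi> c i)) + al (ss!l) / g (ss!l) * \<sigma> * z (\<iota> i))\<^sup>2) \<in> borel_measurable ?M"
      by (rule noise_quadratic_measurable[OF J])
    show ?thesis by measurable
  qed
  have m2: "?E2 l \<in> sets ?M" for l by (rule confusion_measurable, erule ym)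
  have "{z \<in> space ?M. rx_bad ss A g al ta \<kappa> h \<sigma> \<omega> \<xi> (\<lambda>i. z (\<iota> i))} = (\<Union>l\<in>{..<length ss}. ?E1 l \<union> ?E2 l)"
    unfolding rx_bad_def by auto
  moreover have "(\<Union>l\<in>{..<length ss}. ?E1 l \<union> ?E2 l) \<in> sets ?M"
    by (rule sets.finite_UN[OF finite_lessThan], rule sets.Un[OF m1 m2])
  ultimately show ?thesis by (simp only:)
qed

lemma avg_rx_bad_mmse:
  fixes ss :: "'s list" and \<iota> :: "nat \<Rightarrow> 'j" and g ta :: "'s \<Rightarrow> real" and h :: "'c \<Rightarrow> real" and \<sigma> :: real and \<nu> :: "nat \<Rightarrow> real"
  assumes J: "finite J" "inj_on \<iota> {..<N}" "\<iota> ` {..<N} \<subseteq> J"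
    and dist: "distinct ss" and A: "\<And>s. s \<in> set ss \<Longrightarrow> A s \<subseteq> C" "\<And>s. s \<in> set ss \<Longrightarrow> A s \<noteq> {}"
    and disj: "\<And>s s'. s \<in> set ss \<Longrightarrow> s' \<in> set ss \<Longrightarrow> s \<noteq> s' \<Longrightarrow> A s \<inter> A s' = {}"
    and g: "\<And>s. s \<in> set ss \<Longrightarrow> g s \<noteq> 0" and h: "\<And>s c. s \<in> set ss \<Longrightarrow> c \<in> A s \<Longrightarrow> h c = g s"
    and \<sigma>: "\<sigma> \<noteq> 0"
    and \<nu>: "\<And>l. l < length ss \<Longrightarrow> \<nu> l = mmse_energy (real (card (A (ss!l)))) (g (ss!l)) (rx_noise ss A h \<sigma> l)"
    and ta: "\<And>l. l < length ss \<Longrightarrow> \<nu> l < ta (ss!l)" and \<kappa>: "\<And>s. s \<in> set ss \<Longrightarrow> kc + \<kappa> s \<le> k"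
  shows "avg (\<lambda>\<omega>. if all_ok \<omega> a then measure (PiM J (\<lambda>_. std_gauss))
        {z \<in> space (PiM J (\<lambda>_. std_gauss)). rx_bad ss A g (mmse ss A g h \<sigma>) ta \<kappa> h \<sigma> \<omega> (cws \<omega> a) (\<lambda>i. z (\<iota> i))} else 0)
    \<le> (\<Sum>l<length ss. loss ^ card C * chernoff_base (\<nu> l) (ta (ss!l)) ^ N
        + loss ^ card C * (loss * real p ^ \<kappa> (ss!l) * (sqrt (ta (ss!l)) + 2 * \<gamma>) ^ N))"
proof -
  have \<nu>0: "\<nu> l > 0" if l: "l < length ss" for l
  proof -
    have mem: "ss ! l \<in> set ss" using l by simp
    have "card (A (ss!l)) > 0" using A[OF mem] finite_C finite_subset card_gt_0_iff by metis
    thus ?thesis unfolding \<nu>[OF l] by (intro mmse_energy_pos rx_noise_pos \<sigma>) simp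
  qed
  show ?thesis unfolding chernoff_base_def
  proof (rule avg_rx_bad[OF J, where lam = "\<lambda>l. (1/\<nu> l - 1/ta (ss!l))/2" and \<nu> = \<nu>])
    fix l assume l: "l < length ss"
    hence mem: "ss ! l \<in> set ss" by simp
    show "(\<Sum>c\<in>C. (rx_coef ss A g (mmse ss A g h \<sigma>) h l c - (if c \<in> A (ss ! l) then 1 else 0))\<^sup>2) +
         (mmse ss A g h \<sigma> (ss ! l) / g (ss ! l) * \<sigma>)\<^sup>2 = \<nu> l"
      unfolding \<nu>[OF l] mmse_energy_def
      by (rule rx_coef_energy[where ss = ss and l = l and A = A and g = g and h = h and \<sigma> = \<sigma> and al = "mmse ss A g h \<sigma>",
          OF l dist A(1)[OF mem] disj g[OF mem] h[OF mem] \<sigma> mmse_nth[OF dist l]])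
    show "0 \<le> (1/\<nu> l - 1/ta (ss!l))/2" "2 * ((1/\<nu> l - 1/ta (ss!l))/2) * \<nu> l < 1"
      using chernoff_base_parameter[OF \<nu>0[OF l] ta[OF l]] by auto
  next
    fix s assume s: "s \<in> set ss"
    then obtain l where "l < length ss" "s = ss ! l" by (auto simp: in_set_conv_nth)
    thus "0 < ta s" using \<nu>0 ta less_trans by metis
    show "kc + \<kappa> s \<le> k" by (rule \<kappa>[OF s])
  qed
qed

end

section \<open>Compute-and-forward over the Y-channel\<close>

text \<open>Streams s are sent in the uplink by the users U s with received amplitude g s, and the modular sum is sent
  by the relay with amplitude gr s. The lists ul and dl u are the decoding orders. The message of user i to
  user j is split into parts ((i, j), e) with e < 3, and src s u is the part that user u puts into stream s.\<close>
locale yc_net =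
  fixes h1 h2 h3 P :: real and S :: "nat set" and U :: "nat \<Rightarrow> nat set"
    and src :: "nat \<Rightarrow> nat \<Rightarrow> (nat \<times> nat) \<times> nat"
    and g gr :: "nat \<Rightarrow> real" and ul :: "nat list" and dl :: "nat \<Rightarrow> nat list"
    and \<rho> :: "nat \<Rightarrow> real" and \<rho>s :: "(nat \<times> nat) \<times> nat \<Rightarrow> real"
  assumes P_pos: "P > 0"
    and finite_S: "finite S"
    and U_users: "\<And>s. s \<in> S \<Longrightarrow> U s \<subseteq> yc_users"
    and U_nonempty: "\<And>s. s \<in> S \<Longrightarrow> U s \<noteq> {}"
    and U_card: "\<And>s. s \<in> S \<Longrightarrow> card (U s) \<le> 2"
    and g_pos: "\<And>s. s \<in> S \<Longrightarrow> g s > 0"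
    and gr_pos: "\<And>s. s \<in> S \<Longrightarrow> gr s > 0"
    and gain_nz: "\<And>s u. s \<in> S \<Longrightarrow> u \<in> U s \<Longrightarrow> yc_gain h1 h2 h3 u \<noteq> 0"
    and src_user: "\<And>s u. s \<in> S \<Longrightarrow> u \<in> U s \<Longrightarrow> fst (fst (src s u)) = u"
    and src_pair: "\<And>s u. s \<in> S \<Longrightarrow> u \<in> U s \<Longrightarrow> fst (src s u) \<in> yc_pairs"
    and src_kind: "\<And>s u. s \<in> S \<Longrightarrow> u \<in> U s \<Longrightarrow> snd (src s u) < 3"
    and src_rate: "\<And>s u. s \<in> S \<Longrightarrow> u \<in> U s \<Longrightarrow> \<rho>s (src s u) = \<rho> s"
    and rate_pos: "\<And>s. s \<in> S \<Longrightarrow> \<rho> s > 0"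
    and rates_nonneg: "\<And>x. \<rho>s x \<ge> 0"
    and ul: "set ul = S" "distinct ul"
    and dl: "\<And>u. u \<in> yc_users \<Longrightarrow> set (dl u) \<subseteq> S" "\<And>u. u \<in> yc_users \<Longrightarrow> distinct (dl u)"
    and dl_gain: "\<And>u. u \<in> yc_users \<Longrightarrow> dl u \<noteq> [] \<Longrightarrow> yc_gain h1 h2 h3 u \<noteq> 0"
    and up_rate: "\<And>l. l < length ul \<Longrightarrow>
       2 powr (2 * \<rho> (ul!l)) * mmse_energy (real (card (U (ul!l)))) (g (ul!l)) (1 + (\<Sum>s\<in>S - set (take (Suc l) ul). real (card (U s)) * (g s)\<^sup>2)) < 1"
    and dn_rate: "\<And>u l. u \<in> yc_users \<Longrightarrow> l < length (dl u) \<Longrightarrow>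
       2 powr (2 * \<rho> (dl u!l)) * mmse_energy 1 (yc_gain h1 h2 h3 u * gr (dl u!l)) (1 + (\<Sum>s\<in>S - set (take (Suc l) (dl u)). (yc_gain h1 h2 h3 u * gr s)\<^sup>2)) < 1"
    and user_power: "\<And>u. u \<in> yc_users \<Longrightarrow> (\<Sum>s\<in>{s\<in>S. u \<in> U s}. (g s / yc_gain h1 h2 h3 u)\<^sup>2) < P"
    and relay_power: "(\<Sum>s\<in>S. (gr s)\<^sup>2) < P"
    and decodable: "\<And>u (q::nat) x x' j e. u \<in> yc_users \<Longrightarrow> j \<in> yc_users \<Longrightarrow> j \<noteq> u \<Longrightarrow> e < 3 \<Longrightarrow>
       (\<And>y. fst (fst y) = u \<Longrightarrow> x y = x' y) \<Longrightarrow> (\<And>y. \<rho>s y = 0 \<Longrightarrow> x y = x' y) \<Longrightarrow>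
       (\<And>s. s \<in> set (dl u) \<Longrightarrow> [(\<Sum>i\<in>U s. x (src s i)) = (\<Sum>i\<in>U s. x' (src s i))] (mod int q)) \<Longrightarrow>
       [x ((j,u),e) = x' ((j,u),e)] (mod int q)"
begin

abbreviation "hg \<equiv> yc_gain h1 h2 h3"

text \<open>Codeword (s, u) is sent by user u; the relay is node 0.\<close>
definition comps :: "(nat \<times> nat) set" where "comps = Sigma S (\<lambda>s. insert 0 (U s))"
definition Aup :: "nat \<Rightarrow> (nat \<times> nat) set" where "Aup s = Pair s ` U s"
definition Adn :: "nat \<Rightarrow> (nat \<times> nat) set" where "Adn s = {(s, 0)}"
text \<open>Amplitudes at the relay. The relay codewords belong to the same ensemble but are not
  received there, hence their coefficient 0.\<close>

definition hup :: "nat \<times> nat \<Rightarrow> real" where "hup c = (if snd c = 0 then 0 else g (fst c))"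
definition hdn :: "nat \<Rightarrow> nat \<times> nat \<Rightarrow> real" where "hdn u c = (if snd c = 0 then hg u * gr (fst c) else 0)"
definition gdn :: "nat \<Rightarrow> nat \<Rightarrow> real" where "gdn u s = hg u * gr s"
text \<open>Transmit coefficients: a user divides by its channel gain so that its codeword arrives
  with amplitude \<open>g\<close>.\<close>

definition pco :: "nat \<Rightarrow> nat \<times> nat \<Rightarrow> real" where
  "pco v c = (if snd c = v then (if v = 0 then gr (fst c) else g (fst c) / hg v) else 0)"

lemma finite_U: "s \<in> S \<Longrightarrow> finite (U s)" using U_users finite_subset finite_yc_users by blast
lemma zero_notin_U [simp]: "s \<in> S \<Longrightarrow> 0 \<notin> U s" using U_users[of s] by (auto simp: yc_users_def)
lemma U_nonzero: "s \<in> S \<Longrightarrow> u \<in> U s \<Longrightarrow> u \<noteq> 0" using zero_notin_U by metis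
lemma finite_comps: "finite comps" unfolding comps_def using finite_S finite_U by auto
lemma card_Aup: "card (Aup s) = card (U s)" unfolding Aup_def by (rule card_image) (simp add: inj_on_def)
lemma Aup_comps: "s \<in> S \<Longrightarrow> Aup s \<subseteq> comps" by (auto simp: Aup_def comps_def)
lemma Adn_comps: "s \<in> S \<Longrightarrow> Adn s \<subseteq> comps" by (auto simp: Adn_def comps_def)
lemma comps_mem: "s \<in> S \<Longrightarrow> u \<in> U s \<Longrightarrow> (s, u) \<in> comps" "s \<in> S \<Longrightarrow> (s, 0) \<in> comps" by (auto simp: comps_def)
lemma hup_Aup: "s \<in> S \<Longrightarrow> c \<in> Aup s \<Longrightarrow> hup c = g s" by (auto simp: Aup_def hup_def)
lemma hdn_Adn: "c \<in> Adn s \<Longrightarrow> hdn u c = gdn u s" by (auto simp: Adn_def hdn_def gdn_def)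

lemma sum_comps: "(\<Sum>c\<in>comps. f c) = (\<Sum>s\<in>S. f (s, 0) + (\<Sum>u\<in>U s. f (s, u)))"
proof -
  have "(\<Sum>c\<in>comps. f c) = (\<Sum>s\<in>S. \<Sum>u\<in>insert 0 (U s). f (s, u))"
    unfolding comps_def using finite_S finite_U by (subst sum.Sigma) auto
  also have "\<dots> = (\<Sum>s\<in>S. f (s, 0) + (\<Sum>u\<in>U s. f (s, u)))"
    using finite_U U_nonzero by (intro sum.cong refl sum.insert) auto
  finally show ?thesis .
qed

lemma sum_comps_hup: "(\<Sum>c\<in>comps. hup c * f c) = (\<Sum>s\<in>S. \<Sum>u\<in>U s. g s * f (s, u))"
  unfolding sum_comps
proof (intro sum.cong refl)
  fix s assume s: "s \<in> S"
  have "(\<Sum>u\<in>U s. hup (s, u) * f (s, u)) = (\<Sum>u\<in>U s. g s * f (s, u))"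
    using U_nonzero[OF s] by (intro sum.cong refl) (auto simp: hup_def)
  thus "hup (s, 0) * f (s, 0) + (\<Sum>u\<in>U s. hup (s, u) * f (s, u)) = (\<Sum>u\<in>U s. g s * f (s, u))"
    by (simp add: hup_def)
qed

lemma sum_comps_hdn: "(\<Sum>c\<in>comps. hdn v c * f c) = hg v * (\<Sum>s\<in>S. gr s * f (s, 0))"
  unfolding sum_comps sum_distrib_left
proof (intro sum.cong refl)
  fix s assume s: "s \<in> S"
  have "(\<Sum>u\<in>U s. hdn v (s, u) * f (s, u)) = 0"
    using U_nonzero[OF s] by (intro sum.neutral) (auto simp: hdn_def)
  thus "hdn v (s, 0) * f (s, 0) + (\<Sum>u\<in>U s. hdn v (s, u) * f (s, u)) = hg v * (gr s * f (s, 0))"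
    by (simp add: hdn_def)
qed

lemma sum_comps_pco_relay: "(\<Sum>c\<in>comps. pco 0 c * f c) = (\<Sum>s\<in>S. gr s * f (s, 0))"
  unfolding sum_comps
proof (intro sum.cong refl)
  fix s assume s: "s \<in> S"
  have "(\<Sum>u\<in>U s. pco 0 (s, u) * f (s, u)) = 0"
    using U_nonzero[OF s] by (intro sum.neutral) (auto simp: pco_def)
  thus "pco 0 (s, 0) * f (s, 0) + (\<Sum>u\<in>U s. pco 0 (s, u) * f (s, u)) = gr s * f (s, 0)"
    by (simp add: pco_def)
qed

lemma sum_comps_pco_user: "v \<noteq> 0 \<Longrightarrow> (\<Sum>c\<in>comps. pco v c * f c) = (\<Sum>s\<in>{s\<in>S. v \<in> U s}. g s / hg v * f (s, v))"
proof -
  assume v: "v \<noteq> 0"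
  have "(\<Sum>c\<in>comps. pco v c * f c) = (\<Sum>s\<in>S. if v \<in> U s then g s / hg v * f (s, v) else 0)"
    unfolding sum_comps
  proof (rule sum.cong[OF refl])
    fix s assume s: "s \<in> S"
    have "(\<Sum>u\<in>U s. pco v (s, u) * f (s, u)) = (\<Sum>u\<in>U s. if u = v then g s / hg v * f (s, v) else 0)"
      using v by (intro sum.cong refl) (auto simp: pco_def)
    thus "pco v (s, 0) * f (s, 0) + (\<Sum>u\<in>U s. pco v (s, u) * f (s, u)) = (if v \<in> U s then g s / hg v * f (s, v) else 0)"
      using v finite_U[OF s] by (simp add: pco_def sum.delta)
  qed
  thus ?thesis using finite_S by (simp add: sum.If_cases Int_def)
qed

lemma pco_energy_user: "v \<in> yc_users \<Longrightarrow> (\<Sum>c\<in>comps. (pco v c)\<^sup>2) < P"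
proof -
  assume v: "v \<in> yc_users"
  hence v0: "v \<noteq> 0" by (auto simp: yc_users_def)
  have "(\<Sum>c\<in>comps. (pco v c)\<^sup>2) = (\<Sum>s\<in>{s\<in>S. v \<in> U s}. (g s / hg v)\<^sup>2)"
    unfolding power2_eq_square sum_comps_pco_user[OF v0] using v0 by (intro sum.cong refl) (simp add: pco_def)
  thus ?thesis using user_power[OF v] by simp
qed

lemma pco_energy_relay: "(\<Sum>c\<in>comps. (pco 0 c)\<^sup>2) < P"
proof -
  have "(\<Sum>c\<in>comps. (pco 0 c)\<^sup>2) = (\<Sum>s\<in>S. (gr s)\<^sup>2)"
    unfolding power2_eq_square sum_comps_pco_relay by (intro sum.cong refl) (simp add: pco_def)
  thus ?thesis using relay_power by simp
qed

end

text \<open>A code has B message blocks of length N and one final block for the relay delay; \<kappa> s is the number of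
  message symbols of stream s per block, and \<phi> distributes the symbols of a message over blocks and parts.\<close>
locale net_code = yc_net h1 h2 h3 P S U src g gr ul dl \<rho> \<rho>s +
    linear_ensemble N k kc H p \<gamma> "yc_net.comps S U"
  for h1 h2 h3 P :: real and S :: "nat set" and U :: "nat \<Rightarrow> nat set"
    and src :: "nat \<Rightarrow> nat \<Rightarrow> (nat \<times> nat) \<times> nat"
    and g gr :: "nat \<Rightarrow> real" and ul :: "nat list" and dl :: "nat \<Rightarrow> nat list"
    and \<rho> :: "nat \<Rightarrow> real" and \<rho>s :: "(nat \<times> nat) \<times> nat \<Rightarrow> real"
    and N k kc H p :: nat and \<gamma> :: real +
  fixes B :: nat and \<kappa> :: "nat \<Rightarrow> nat" and \<kappa>s :: "(nat \<times> nat) \<times> nat \<Rightarrow> nat"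
    and \<phi> :: "nat \<times> nat \<Rightarrow> nat \<Rightarrow> nat \<times> nat \<Rightarrow> nat \<Rightarrow> int" and M :: "nat \<times> nat \<Rightarrow> nat" and ta tad :: "nat \<Rightarrow> real"
  assumes N_pos: "N > 0"
    and \<kappa>_src: "\<And>s u. s \<in> S \<Longrightarrow> u \<in> U s \<Longrightarrow> \<kappa>s (src s u) = \<kappa> s"
    and \<kappa>_k: "\<And>s. s \<in> S \<Longrightarrow> kc + \<kappa> s \<le> k"
    and \<kappa>s_zero: "\<And>x. \<rho>s x = 0 \<Longrightarrow> \<kappa>s x = 0"
    and \<phi>_in: "\<And>q x. q \<in> yc_pairs \<Longrightarrow> x < M q \<Longrightarrow>
        \<phi> q x \<in> PiE ({..<B} \<times> {..<3}) (\<lambda>(l,e). vecs {kc..<kc + \<kappa>s (q,e)})"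
    and \<phi>_inj: "\<And>q. q \<in> yc_pairs \<Longrightarrow> inj_on (\<phi> q) {..<M q}"
    and M_pos: "\<And>q. q \<in> yc_pairs \<Longrightarrow> M q > 0"
begin

abbreviation "C \<equiv> comps"

text \<open>Only the user's own messages enter, so the encoder can evaluate it.\<close>

definition udig :: "(nat \<Rightarrow> nat) \<Rightarrow> (nat \<times> nat) \<times> nat \<Rightarrow> nat \<Rightarrow> nat \<Rightarrow> int" where
  "udig own x l = \<phi> (fst x) (own (snd (fst x))) (l, snd x)"

text \<open>The messages of all codewords of block l. Relay codewords get the modular sums of the
  true messages and not the decisions of the relay, so that every bad event can be averaged over the
  code with the messages fixed; on good events both coincide.\<close>

definition asg :: "(nat \<times> nat \<Rightarrow> nat) \<Rightarrow> nat \<Rightarrow> nat \<times> nat \<Rightarrow> nat \<Rightarrow> int" where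
  "asg m l c = (if snd c = 0
     then (\<lambda>j\<in>{..<k}. (\<Sum>u\<in>U (fst c). udig (yc_own u m) (src (fst c) u) l j) mod int p)
     else udig (yc_own (snd c) m) (src (fst c) (snd c)) l)"

text \<open>Clipping makes the power constraint hold surely; it is inactive on good events.\<close>
definition clip :: "(nat \<Rightarrow> real) \<Rightarrow> nat \<Rightarrow> real" where
  "clip x i = (if (\<Sum>i<N. (x i)\<^sup>2) \<le> real N * P then x i else 0)"

definition usig where
  "usig \<omega> u own l i = \<gamma> * (\<Sum>s\<in>{s\<in>S. u \<in> U s}. g s / hg u * of_int (cw (fst \<omega>) (snd \<omega> (s, u)) (udig own (src s u) l) i))"

definition rsig where
  "rsig \<omega> V i = \<gamma> * (\<Sum>s\<in>S. gr s * of_int (cw (fst \<omega>) (snd \<omega> (s, 0)) (V s) i))"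

definition rup where "rup \<omega> y = rx_dec ul Aup g (mmse ul Aup g hup 1) ta \<kappa> \<omega> y"
definition rdn where "rdn \<omega> u y = rx_dec (dl u) Adn (gdn u) (mmse (dl u) Adn (gdn u) (hdn u) 1) tad \<kappa> \<omega> y"

definition cenc :: "_ \<Rightarrow> yc_enc" where
  "cenc \<omega> u t own y = (if t < B * N then clip (usig \<omega> u own (t div N)) (t mod N) else 0)"

text \<open>The relay works one block late: in block t div N it sends what it decodes from the
  preceding block, so block 0 is silent.\<close>

definition crel :: "_ \<Rightarrow> yc_rel" where
  "crel \<omega> t y = (if N \<le> t \<and> t < (B+1) * N then clip (rsig \<omega> (rup \<omega> (\<lambda>i. y ((t div N - 1) * N + i)))) (t mod N) else 0)"

text \<open>Instead of solving for the messages, the user searches for a message tuple with its own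
  messages and the decoded sums; \<open>decodable\<close> makes the wanted entries unique.\<close>

definition cdec :: "_ \<Rightarrow> yc_dec" where
  "cdec \<omega> u own y j = (SOME m'. m' \<in> yc_msgs M \<and> ((\<forall>j. (u, j) \<in> yc_pairs \<longrightarrow> m' (u, j) = own j) \<and>
     (\<forall>l<B. \<forall>s\<in>set (dl u). asg m' l (s, 0) = rdn \<omega> u (\<lambda>i. y ((l+1) * N + i)) s))) (j, u)"

text \<open>The last clause keeps the clipping inactive at all four nodes.\<close>

definition good where
  "good \<omega> m l z \<longleftrightarrow> all_ok \<omega> (asg m l) \<and>
     \<not> rx_bad ul Aup g (mmse ul Aup g hup 1) ta \<kappa> hup 1 \<omega> (cws \<omega> (asg m l)) (\<lambda>i. z (0, l * N + i)) \<and>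
     (\<forall>u\<in>yc_users. \<not> rx_bad (dl u) Adn (gdn u) (mmse (dl u) Adn (gdn u) (hdn u) 1) tad \<kappa> (hdn u) 1 \<omega> (cws \<omega> (asg m l)) (\<lambda>i. z (u, (l+1) * N + i))) \<and>
     (\<forall>v\<in>{0..3}. (\<Sum>i<N. (\<gamma> * (\<Sum>c\<in>C. pco v c * of_int (cws \<omega> (asg m l) c i)))\<^sup>2) \<le> real N * P)"

lemma clip_energy: "(\<Sum>i<N. (clip x i)\<^sup>2) \<le> real N * P"
  unfolding clip_def using P_pos by (cases "(\<Sum>i<N. (x i)\<^sup>2) \<le> real N * P") auto

lemma udig_in:
  assumes "m \<in> yc_msgs M" "l < B" "fst (fst x) = u" "fst x \<in> yc_pairs" "snd x < 3"
  shows "udig (yc_own u m) x l \<in> vecs {kc..<kc + \<kappa>s x}"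
proof -
  obtain i j e where x: "x = ((i,j),e)" by (metis surj_pair)
  have iu: "i = u" using assms x by simp
  have "m (u, j) < M (u, j)" using assms(1,4) unfolding yc_msgs_def x iu by (auto dest: PiE_mem)
  hence "\<phi> (u, j) (m (u, j)) \<in> PiE ({..<B} \<times> {..<3}) (\<lambda>(l,e). vecs {kc..<kc + \<kappa>s ((u,j),e)})"
    using \<phi>_in assms(4) unfolding x iu by simp
  from PiE_mem[OF this, of "(l,e)"] show ?thesis using assms(2,5) unfolding x iu udig_def yc_own_def by simp
qed

lemma asg_user_in:
  assumes "m \<in> yc_msgs M" "l < B" "s \<in> S" "c \<in> Aup s"
  shows "asg m l c \<in> vecs {kc..<kc + \<kappa> s}"
proof -
  obtain u where u: "c = (s, u)" "u \<in> U s" using assms(4) by (auto simp: Aup_def)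
  have "udig (yc_own u m) (src s u) l \<in> vecs {kc..<kc + \<kappa>s (src s u)}"
    using assms u src_user src_pair src_kind by (intro udig_in) auto
  thus ?thesis using u U_nonzero[OF assms(3) u(2)] \<kappa>_src[OF assms(3) u(2)] by (simp add: asg_def)
qed

lemma asg_relay_in:
  assumes "m \<in> yc_msgs M" "l < B" "s \<in> S"
  shows "asg m l (s, 0) \<in> vecs {kc..<kc + \<kappa> s}"
proof -
  have "(\<Sum>u\<in>U s. udig (yc_own u m) (src s u) l j) = 0" if j: "j < k" "j \<notin> {kc..<kc + \<kappa> s}" for j
  proof (rule sum.neutral, rule ballI)
    fix u assume u: "u \<in> U s"
    have "udig (yc_own u m) (src s u) l \<in> vecs {kc..<kc + \<kappa>s (src s u)}"
      using assms u src_user src_pair src_kind by (intro udig_in) auto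
    thus "udig (yc_own u m) (src s u) l j = 0" using j vecs_zero \<kappa>_src[OF assms(3) u] by auto
  qed
  hence "(\<lambda>j\<in>{..<k}. (\<Sum>u\<in>U s. udig (yc_own u m) (src s u) l j) mod int p) \<in> vecs {kc..<kc + \<kappa> s}"
    by (rule vecs_modI)
  thus ?thesis by (simp add: asg_def)
qed

text \<open>A correct uplink decision is exactly the message assigned to the relay codeword, which
  links the two hops.\<close>

lemma asg_relay_sum:
  assumes "s \<in> S"
  shows "(\<lambda>j\<in>{..<k}. (\<Sum>c\<in>Aup s. asg m l c j) mod int p) = asg m l (s, 0)"
proof -
  have "(\<Sum>c\<in>Aup s. asg m l c j) = (\<Sum>u\<in>U s. udig (yc_own u m) (src s u) l j)" for j
  proof -
    have "(\<Sum>c\<in>Aup s. asg m l c j) = (\<Sum>u\<in>U s. asg m l (s, u) j)"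
      unfolding Aup_def by (subst sum.reindex) (auto simp: inj_on_def)
    also have "\<dots> = (\<Sum>u\<in>U s. udig (yc_own u m) (src s u) l j)"
    proof (intro sum.cong refl)
      fix u assume "u \<in> U s"
      hence "u \<noteq> 0" by (rule U_nonzero[OF assms])
      thus "asg m l (s, u) j = udig (yc_own u m) (src s u) l j" by (simp add: asg_def)
    qed
    finally show ?thesis .
  qed
  thus ?thesis by (simp add: asg_def)
qed

lemma asg_relay_self: "(\<lambda>j\<in>{..<k}. (\<Sum>c\<in>Adn s. asg m l c j) mod int p) = asg m l (s, 0)"
  by (auto simp: Adn_def asg_def fun_eq_iff)

end

section \<open>Correctness on good events\<close>

context net_code
begin

lemma Aup_disjoint: "s \<noteq> s' \<Longrightarrow> Aup s \<inter> Aup s' = {}" by (auto simp: Aup_def)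
lemma Adn_disjoint: "s \<noteq> s' \<Longrightarrow> Adn s \<inter> Adn s' = {}" by (auto simp: Adn_def)

lemma block_div: "i < N \<Longrightarrow> (l * N + i) div N = l" using N_pos by simp
lemma block_mod: "i < N \<Longrightarrow> (l * N + i) mod N = i" by simp
lemma block_less: "l < L \<Longrightarrow> i < N \<Longrightarrow> l * N + i < L * N"
proof -
  assume l: "l < L" and i: "i < N"
  have "l * N + i < (l + 1) * N" using i by simp
  also have "\<dots> \<le> L * N" using l by (intro mult_right_mono) auto
  finally show ?thesis .
qed

lemma cws_user: "s \<in> S \<Longrightarrow> u \<in> U s \<Longrightarrow> cws \<omega> (asg m l) (s, u) = cw (fst \<omega>) (snd \<omega> (s, u)) (udig (yc_own u m) (src s u) l)"
  using U_nonzero[of s u] by (simp add: cws_def comps_mem asg_def)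

lemma usig_eq:
  assumes "u \<in> yc_users"
  shows "usig \<omega> u (yc_own u m) l i = \<gamma> * (\<Sum>c\<in>C. pco u c * of_int (cws \<omega> (asg m l) c i))"
proof -
  have u: "u \<noteq> 0" using assms by (auto simp: yc_users_def)
  show ?thesis unfolding usig_def sum_comps_pco_user[OF u]
    by (rule arg_cong[where f = "(*) \<gamma>"], rule sum.cong[OF refl]) (simp add: cws_user)
qed

lemma rup_correct:
  assumes m: "m \<in> yc_msgs M" and l: "l < B" and gd: "good \<omega> m l z" and s: "s \<in> S"
    and y: "\<And>i. i < N \<Longrightarrow> y i = \<gamma> * (\<Sum>c\<in>C. hup c * of_int (cws \<omega> (asg m l) c i)) + 1 * z (0, l * N + i)"
  shows "rup \<omega> y s = asg m l (s, 0)"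
proof -
  have "rup \<omega> y s = (\<lambda>j\<in>{..<k}. (\<Sum>c\<in>Aup s. asg m l c j) mod int p)"
    unfolding rup_def
  proof (rule rx_dec_correct[where h = hup and \<sigma> = 1 and w = "\<lambda>i. z (0, l * N + i)"])
    show "distinct ul" by (rule ul(2))
    show "all_ok \<omega> (asg m l)" using gd by (simp add: good_def)
    show "\<not> rx_bad ul Aup g (mmse ul Aup g hup 1) ta \<kappa> hup 1 \<omega> (cws \<omega> (asg m l)) (\<lambda>i. z (0, l * N + i))"
      using gd unfolding good_def by blast
    show "s \<in> set ul" using s ul(1) by simp
  next
    fix i assume "i < N"
    thus "y i = \<gamma> * (\<Sum>c\<in>C. hup c * of_int (cws \<omega> (asg m l) c i)) + 1 * z (0, l * N + i)" by (rule y)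
  next
    fix s assume "s \<in> set ul"
    hence s: "s \<in> S" using ul(1) by simp
    show "Aup s \<subseteq> C" by (rule Aup_comps[OF s])
    show "card (Aup s) \<le> 2" unfolding card_Aup by (rule U_card[OF s])
    show "g s \<noteq> 0" using g_pos[OF s] by simp
    fix c assume c: "c \<in> Aup s"
    show "hup c = g s" by (rule hup_Aup[OF s c])
    show "asg m l c \<in> vecs {kc..<kc + \<kappa> s}" by (rule asg_user_in[OF m l s c])
  next
    fix s s' :: nat assume "s \<noteq> s'"
    thus "Aup s \<inter> Aup s' = {}" by (rule Aup_disjoint)
  qed
  thus ?thesis unfolding asg_relay_sum[OF s] .
qed

lemma rdn_correct:
  assumes m: "m \<in> yc_msgs M" and l: "l < B" and gd: "good \<omega> m l z" and u: "u \<in> yc_users" and s: "s \<in> set (dl u)"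
    and y: "\<And>i. i < N \<Longrightarrow> y i = \<gamma> * (\<Sum>c\<in>C. hdn u c * of_int (cws \<omega> (asg m l) c i)) + 1 * z (u, (l+1) * N + i)"
  shows "rdn \<omega> u y s = asg m l (s, 0)"
proof -
  have "rdn \<omega> u y s = (\<lambda>j\<in>{..<k}. (\<Sum>c\<in>Adn s. asg m l c j) mod int p)"
    unfolding rdn_def
  proof (rule rx_dec_correct[where h = "hdn u" and \<sigma> = 1 and w = "\<lambda>i. z (u, (l+1) * N + i)"])
    show "distinct (dl u)" by (rule dl(2)[OF u])
    show "all_ok \<omega> (asg m l)" using gd by (simp add: good_def)
    show "\<not> rx_bad (dl u) Adn (gdn u) (mmse (dl u) Adn (gdn u) (hdn u) 1) tad \<kappa> (hdn u) 1 \<omega> (cws \<omega> (asg m l)) (\<lambda>i. z (u, (l+1) * N + i))"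
      using gd u unfolding good_def by blast
    show "s \<in> set (dl u)" by (rule s)
  next
    fix i assume "i < N"
    thus "y i = \<gamma> * (\<Sum>c\<in>C. hdn u c * of_int (cws \<omega> (asg m l) c i)) + 1 * z (u, (l+1) * N + i)" by (rule y)
  next
    fix s assume sd: "s \<in> set (dl u)"
    hence s: "s \<in> S" using dl(1)[OF u] by blast
    show "Adn s \<subseteq> C" by (rule Adn_comps[OF s])
    show "card (Adn s) \<le> 2" by (simp add: Adn_def)
    have "dl u \<noteq> []" using sd by auto
    thus "gdn u s \<noteq> 0" using gr_pos[OF s] dl_gain[OF u] by (simp add: gdn_def)
    fix c assume c: "c \<in> Adn s"
    show "hdn u c = gdn u s" by (rule hdn_Adn[OF c])
    show "asg m l c \<in> vecs {kc..<kc + \<kappa> s}" using c asg_relay_in[OF m l s] by (simp add: Adn_def)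
  next
    fix s s' :: nat assume "s \<noteq> s'"
    thus "Adn s \<inter> Adn s' = {}" by (rule Adn_disjoint)
  qed
  thus ?thesis unfolding asg_relay_self .
qed

abbreviation "recv \<omega> m z \<equiv> yc_recv h1 h2 h3 (cenc \<omega>) (crel \<omega>) m z"

text \<open>Clipping is inactive, and the division by the gain in \<open>usig\<close> cancels
  against the channel, so both users of a stream arrive with the common amplitude.\<close>

lemma relay_recv:
  assumes l: "l < B" and i: "i < N" and gd: "good \<omega> m l z" and t: "l * N + i < t"
  shows "recv \<omega> m z t 0 (l * N + i) = \<gamma> * (\<Sum>c\<in>C. hup c * of_int (cws \<omega> (asg m l) c i)) + 1 * z (0, l * N + i)"
proof -
  let ?x = "\<lambda>c. of_int (cws \<omega> (asg m l) c i) :: real"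
  have "recv \<omega> m z t 0 (l * N + i) = (\<Sum>u\<in>yc_users. hg u * cenc \<omega> u (l * N + i) (yc_own u m) (\<lambda>_. 0)) + z (0, l * N + i)"
    by (rule yc_recv_relay[OF _ t]) (simp add: cenc_def)
  also have "(\<Sum>u\<in>yc_users. hg u * cenc \<omega> u (l * N + i) (yc_own u m) (\<lambda>_. 0)) = (\<Sum>u\<in>yc_users. \<Sum>s\<in>{s\<in>S. u \<in> U s}. \<gamma> * (g s * ?x (s, u)))"
  proof (rule sum.cong[OF refl])
    fix u assume u: "u \<in> yc_users"
    hence u3: "u \<in> {0..3}" "u \<noteq> 0" by (auto simp: yc_users_def)
    have "(\<Sum>i<N. (usig \<omega> u (yc_own u m) l i)\<^sup>2) \<le> real N * P"
      unfolding usig_eq[OF u] using gd u3(1) unfolding good_def by blast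
    hence "cenc \<omega> u (l * N + i) (yc_own u m) (\<lambda>_. 0) = usig \<omega> u (yc_own u m) l i"
      using block_less[OF l i] i by (simp add: cenc_def block_div[OF i] clip_def)
    also have "\<dots> = \<gamma> * (\<Sum>s\<in>{s\<in>S. u \<in> U s}. g s / hg u * ?x (s, u))"
      unfolding usig_eq[OF u] sum_comps_pco_user[OF u3(2)] ..
    finally have "hg u * cenc \<omega> u (l * N + i) (yc_own u m) (\<lambda>_. 0) = (\<Sum>s\<in>{s\<in>S. u \<in> U s}. hg u * (\<gamma> * (g s / hg u * ?x (s, u))))"
      by (simp only: sum_distrib_left)
    also have "\<dots> = (\<Sum>s\<in>{s\<in>S. u \<in> U s}. \<gamma> * (g s * ?x (s, u)))"
      using gain_nz by (intro sum.cong refl) (auto simp: field_simps)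
    finally show "hg u * cenc \<omega> u (l * N + i) (yc_own u m) (\<lambda>_. 0) = (\<Sum>s\<in>{s\<in>S. u \<in> U s}. \<gamma> * (g s * ?x (s, u)))" .
  qed
  also have "\<dots> = (\<Sum>u\<in>yc_users. \<Sum>s\<in>S. if u \<in> U s then \<gamma> * (g s * ?x (s, u)) else 0)"
    using finite_S by (simp add: sum.If_cases Int_def)
  also have "\<dots> = (\<Sum>s\<in>S. \<Sum>u\<in>yc_users. if u \<in> U s then \<gamma> * (g s * ?x (s, u)) else 0)" by (rule sum.swap)
  also have "\<dots> = (\<Sum>s\<in>S. \<Sum>u\<in>U s. \<gamma> * (g s * ?x (s, u)))"
  proof (rule sum.cong[OF refl])
    fix s assume "s \<in> S"
    thus "(\<Sum>u\<in>yc_users. if u \<in> U s then \<gamma> * (g s * ?x (s, u)) else 0) = (\<Sum>u\<in>U s. \<gamma> * (g s * ?x (s, u)))"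
      using U_users by (simp add: sum.If_cases Int_absorb1)
  qed
  also have "\<dots> = \<gamma> * (\<Sum>c\<in>C. hup c * ?x c)" unfolding sum_comps_hup by (simp only: sum_distrib_left)
  finally show ?thesis by simp
qed

text \<open>All samples of block l precede every time of block l + 1, so causality lets the relay
  decode the entire block before its first symbol.\<close>

lemma relay_tx:
  assumes m: "m \<in> yc_msgs M" and l: "l < B" and i: "i < N" and gd: "good \<omega> m l z"
  shows "crel \<omega> ((l+1) * N + i) (recv \<omega> m z ((l+1) * N + i) 0) = \<gamma> * (\<Sum>s\<in>S. gr s * of_int (cws \<omega> (asg m l) (s, 0) i))"
proof -
  let ?t = "(l+1) * N + i"
  let ?y = "\<lambda>i'. recv \<omega> m z ?t 0 ((?t div N - 1) * N + i')"
  have d: "?t div N - 1 = l" unfolding block_div[OF i] by simp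
  have V: "rup \<omega> ?y s = asg m l (s, 0)" if "s \<in> S" for s
  proof (rule rup_correct[OF m l gd that])
    fix i' assume i': "i' < N"
    have "l * N + i' < ?t" using i' by simp
    thus "?y i' = \<gamma> * (\<Sum>c\<in>C. hup c * of_int (cws \<omega> (asg m l) c i')) + 1 * z (0, l * N + i')"
      unfolding d by (rule relay_recv[OF l i' gd])
  qed
  have r: "rsig \<omega> (rup \<omega> ?y) i' = \<gamma> * (\<Sum>c\<in>C. pco 0 c * of_int (cws \<omega> (asg m l) c i'))" for i'
    unfolding rsig_def sum_comps_pco_relay
    by (rule arg_cong[where f = "(*) \<gamma>"], rule sum.cong[OF refl]) (simp only: V cws_def comps_mem(2) restrict_apply' snd_conv)
  have "(\<Sum>i<N. (rsig \<omega> (rup \<omega> ?y) i)\<^sup>2) \<le> real N * P"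
    unfolding r using gd unfolding good_def by simp
  moreover have "N \<le> ?t \<and> ?t < (B+1) * N" using block_less[of "l+1" "B+1" i] l i by simp
  ultimately have "crel \<omega> ?t (recv \<omega> m z ?t 0) = rsig \<omega> (rup \<omega> ?y) i"
    unfolding crel_def clip_def block_mod[OF i] by simp
  thus ?thesis unfolding r sum_comps_pco_relay .
qed

lemma user_recv:
  assumes m: "m \<in> yc_msgs M" and l: "l < B" and i: "i < N" and gd: "good \<omega> m l z" and u: "u \<in> yc_users" and t: "(B+1) * N \<le> n"
  shows "recv \<omega> m z n u ((l+1) * N + i) = \<gamma> * (\<Sum>c\<in>C. hdn u c * of_int (cws \<omega> (asg m l) c i)) + 1 * z (u, (l+1) * N + i)"
proof -
  have u0: "u \<noteq> 0" using u by (auto simp: yc_users_def)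
  have tn: "(l+1) * N + i < n" using block_less[of "l+1" "B+1" i] l i t by simp
  show ?thesis unfolding yc_recv_user[OF u0 tn] relay_tx[OF m l i gd] sum_comps_hdn by simp
qed

text \<open>The true messages solve the search problem. Any other solution has the same own messages
  and the same modular sums, so \<open>decodable\<close>, applied at each symbol position, gives
  equal symbols for every message meant for this user, and \<open>\<phi>\<close> is
  injective.\<close>

lemma good_no_error:
  assumes m: "m \<in> yc_msgs M" and n: "(B+1) * N \<le> n" and gd: "\<And>l. l < B \<Longrightarrow> good \<omega> m l z"
  shows "\<not> yc_error h1 h2 h3 n (cenc \<omega>) (crel \<omega>) (cdec \<omega>) m z"
proof
  assume "yc_error h1 h2 h3 n (cenc \<omega>) (crel \<omega>) (cdec \<omega>) m z"
  then obtain j u where ju: "(j, u) \<in> yc_pairs" and ne: "cdec \<omega> u (yc_own u m) (recv \<omega> m z n u) j \<noteq> m (j, u)"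
    unfolding yc_error_def by auto
  have u: "u \<in> yc_users" "j \<in> yc_users" "j \<noteq> u" using ju by (auto simp: yc_pairs_def)
  have V: "rdn \<omega> u (\<lambda>i. recv \<omega> m z n u ((l+1) * N + i)) s = asg m l (s, 0)" if l: "l < B" and s: "s \<in> set (dl u)" for l s
    by (rule rdn_correct[OF m l gd[OF l] u(1) s]) (rule user_recv[OF m l _ gd[OF l] u(1) n])
  define Q where "Q = (\<lambda>m'. m' \<in> yc_msgs M \<and> ((\<forall>j. (u, j) \<in> yc_pairs \<longrightarrow> m' (u, j) = yc_own u m j) \<and>
     (\<forall>l<B. \<forall>s\<in>set (dl u). asg m' l (s, 0) = rdn \<omega> u (\<lambda>i. recv \<omega> m z n u ((l+1) * N + i)) s)))"
  define m' where "m' = (SOME m'. Q m')"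
  have "Q m" unfolding Q_def by (intro conjI allI impI ballI m) (simp only: yc_own_def, rule V[symmetric])
  hence Q': "Q m'" unfolding m'_def by (rule someI[of Q])
  have m': "m' \<in> yc_msgs M" using Q' unfolding Q_def by (rule conjunct1)
  have own: "m' (u, j) = m (u, j)" if "(u, j) \<in> yc_pairs" for j
    using Q'[unfolded Q_def, THEN conjunct2, THEN conjunct1, rule_format, OF that] by (simp only: yc_own_def)
  have eq: "asg m' l (s, 0) = asg m l (s, 0)" if "l < B" "s \<in> set (dl u)" for l s
    using Q'[unfolded Q_def, THEN conjunct2, THEN conjunct2, rule_format, OF that] V[OF that] by (rule trans)
  have dec: "cdec \<omega> u (yc_own u m) (recv \<omega> m z n u) j = m' (j, u)"
    unfolding cdec_def m'_def Q_def ..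
  \<comment> \<open>Outside \<open>yc_pairs\<close> both tuples take the same default value by
    extensionality.\<close>
  have own': "m' (u, j) = m (u, j)" for j
  proof (cases "(u, j) \<in> yc_pairs")
    case False
    thus ?thesis using PiE_arb[OF m[unfolded yc_msgs_def]] PiE_arb[OF m'[unfolded yc_msgs_def]] by simp
  qed (rule own)
  have lt: "m' (j,u) < M (j,u)" "m (j,u) < M (j,u)" using PiE_mem[OF m[unfolded yc_msgs_def] ju] PiE_mem[OF m'[unfolded yc_msgs_def] ju] by simp_all
  have dig: "\<phi> (j,u) (m' (j,u)) (l, e) jj = \<phi> (j,u) (m (j,u)) (l, e) jj" if l: "l < B" and e: "e < 3" and jj: "jj < k" for l e jj
  proof -
    \<comment> \<open>The symbols at position \<open>jj\<close> of block l in all message parts,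
      read as one assignment. Indices that are not message parts get 0, so that the hypotheses of
      \<open>decodable\<close> hold for every y.\<close>
    let ?x = "\<lambda>m'' y. if fst y \<in> yc_pairs \<and> snd y < 3 then udig (yc_own (fst (fst y)) m'') y l jj else 0"
    have "[?x m' ((j,u),e) = ?x m ((j,u),e)] (mod int p)"
    proof (rule decodable[OF u(1,2,3) e])
      fix y :: "(nat \<times> nat) \<times> nat" assume "fst (fst y) = u"
      thus "?x m' y = ?x m y" by (simp add: udig_def yc_own_def own')
    next
      fix y :: "(nat \<times> nat) \<times> nat" assume y: "\<rho>s y = 0"
      show "?x m' y = ?x m y"
      proof (cases "fst y \<in> yc_pairs \<and> snd y < 3")
        case True
        have "udig (yc_own (fst (fst y)) m'') y l \<in> vecs {kc..<kc + 0}" if "m'' \<in> yc_msgs M" for m''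
          using udig_in[OF that l refl, of y] True \<kappa>s_zero[OF y] by simp
        hence "udig (yc_own (fst (fst y)) m'') y l jj = 0" if "m'' \<in> yc_msgs M" for m''
          using that jj by (intro vecs_zero[of _ "{kc..<kc+0}"]) auto
        thus ?thesis using m m' by simp
      qed auto
    next
      fix s assume sd: "s \<in> set (dl u)"
      hence s: "s \<in> S" using dl(1)[OF u(1)] by blast
      have x: "(\<Sum>i\<in>U s. ?x m'' (src s i)) mod int p = asg m'' l (s, 0) jj" for m''
      proof -
        have "(\<Sum>i\<in>U s. ?x m'' (src s i)) = (\<Sum>i\<in>U s. udig (yc_own i m'') (src s i) l jj)"
          using src_pair[OF s] src_kind[OF s] src_user[OF s] by (intro sum.cong refl) auto
        thus ?thesis using jj by (simp add: asg_def)
      qed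
      show "[(\<Sum>i\<in>U s. ?x m' (src s i)) = (\<Sum>i\<in>U s. ?x m (src s i))] (mod int p)"
        unfolding cong_def x eq[OF l sd] ..
    qed
    hence c: "[\<phi> (j,u) (m' (j,u)) (l, e) jj = \<phi> (j,u) (m (j,u)) (l, e) jj] (mod int p)"
      using ju e by (simp add: udig_def yc_own_def)
    have r: "\<phi> (j,u) (m'' (j,u)) (l, e) jj \<in> {0..<int p}" if "m'' \<in> yc_msgs M" for m''
    proof -
      have "udig (yc_own j m'') ((j,u),e) l \<in> vecs {kc..<kc + \<kappa>s ((j,u),e)}"
        using that l ju e by (intro udig_in) auto
      hence "udig (yc_own j m'') ((j,u),e) l jj \<in> (if jj \<in> {kc..<kc + \<kappa>s ((j,u),e)} then {0..<int p} else {0})"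
        unfolding vecs_def by (rule PiE_mem) (use jj in simp)
      thus ?thesis using p_pos by (auto simp: udig_def yc_own_def split: if_splits)
    qed
    show ?thesis using c r[OF m] r[OF m'] by (simp add: cong_def)
  qed
  have "\<phi> (j,u) (m' (j,u)) = \<phi> (j,u) (m (j,u))"
  proof (rule PiE_ext[OF \<phi>_in[OF ju lt(1)] \<phi>_in[OF ju lt(2)]])
    fix le assume "le \<in> {..<B} \<times> {..<(3::nat)}"
    then obtain l e where le: "le = (l, e)" "l < B" "e < 3" by auto
    have v: "\<phi> (j,u) x (l, e) \<in> vecs {kc..<kc + \<kappa>s ((j,u),e)}" if "x < M (j,u)" for x
      using PiE_mem[OF \<phi>_in[OF ju that], of "(l,e)"] le by simp
    have "\<phi> (j,u) (m' (j,u)) (l, e) = \<phi> (j,u) (m (j,u)) (l, e)"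
      by (rule PiE_ext[OF v[OF lt(1), unfolded vecs_def] v[OF lt(2), unfolded vecs_def]]) (simp add: dig[OF le(2,3)])
    thus "\<phi> (j,u) (m' (j,u)) le = \<phi> (j,u) (m (j,u)) le" unfolding le(1) .
  qed
  hence "m' (j,u) = m (j,u)" using \<phi>_inj[OF ju] lt by (auto dest: inj_onD)
  thus False using ne unfolding dec by simp
qed

end

context linear_ensemble
begin

text \<open>The same block is read through reception histories of different lengths, which agree on
  its samples but not elsewhere.\<close>

lemma rx_dec_cong:
  assumes "\<And>i. i < N \<Longrightarrow> y i = y' i"
  shows "rx_dec ss A g al ta \<kappa> \<omega> y = rx_dec ss A g al ta \<kappa> \<omega> y'"
proof -
  have "rx_ok ss A g al ta G d y tv = rx_ok ss A g al ta G d y' tv" for G d tv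
  proof -
    have "(\<Sum>i<N. (al (ss!l) / g (ss!l) * (y i - \<gamma> * (\<Sum>l'<l. g (ss!l') * of_int (fst tv (ss!l') i))) - \<gamma> * of_int (fst tv (ss!l) i))\<^sup>2)
      = (\<Sum>i<N. (al (ss!l) / g (ss!l) * (y' i - \<gamma> * (\<Sum>l'<l. g (ss!l') * of_int (fst tv (ss!l') i))) - \<gamma> * of_int (fst tv (ss!l) i))\<^sup>2)" for l
      using assms by (intro sum.cong refl) simp
    thus ?thesis unfolding rx_ok_def by (simp only:)
  qed
  thus ?thesis unfolding rx_dec_def by (simp only:)
qed

end

section \<open>Validity of the code and its error event\<close>

context net_code
begin

lemma coord_measurable: "(\<lambda>y. y (i::nat)) \<in> borel_measurable (PiM UNIV (\<lambda>_::nat. borel :: real measure))"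
  using measurable_component_singleton[of i UNIV "\<lambda>_. borel"] by simp

lemma crel_eq: "N \<le> t \<Longrightarrow> t < (B+1) * N \<Longrightarrow>
    crel \<omega> t y = clip (rsig \<omega> (rup \<omega> (\<lambda>i. y ((t div N - 1) * N + i)))) (t mod N)"
  by (simp add: crel_def)

lemma crel_measurable: "crel \<omega> t \<in> borel_measurable (PiM UNIV (\<lambda>_::nat. borel))"
proof (cases "N \<le> t \<and> t < (B+1) * N")
  case True
  have "(\<lambda>y. rup \<omega> (\<lambda>i. y ((t div N - 1) * N + i))) \<in> measurable (PiM UNIV (\<lambda>_::nat. borel)) (count_space UNIV)"
    unfolding rup_def by (rule measurable_rx_dec) (rule coord_measurable)
  from measurable_compose[OF this, of "\<lambda>V. clip (rsig \<omega> V) (t mod N)" borel]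
  have "(\<lambda>y. clip (rsig \<omega> (rup \<omega> (\<lambda>i. y ((t div N - 1) * N + i)))) (t mod N)) \<in> borel_measurable (PiM UNIV (\<lambda>_::nat. borel))"
    by simp
  moreover have "crel \<omega> t = (\<lambda>y. clip (rsig \<omega> (rup \<omega> (\<lambda>i. y ((t div N - 1) * N + i)))) (t mod N))"
    using True by (intro ext crel_eq) auto
  ultimately show ?thesis by (simp only:)
next
  case False
  hence "crel \<omega> t = (\<lambda>y. 0)" unfolding crel_def by (simp only: if_False)
  thus ?thesis by simp
qed

lemma cdec_measurable: "(\<lambda>y. cdec \<omega> u a y j) \<in> measurable (PiM UNIV (\<lambda>_::nat. borel)) (count_space UNIV)"
  unfolding cdec_def
proof (rule measurable_SOME_finite[where f = "\<lambda>m'. m' (j, u)"])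
  fix m' assume "m' \<in> yc_msgs M"
  let ?M = "PiM UNIV (\<lambda>_::nat. borel :: real measure)"
  have "{y \<in> space ?M. asg m' l (s, 0) = rdn \<omega> u (\<lambda>i. y ((l+1) * N + i)) s} \<in> sets ?M" for l s
  proof -
    have "(\<lambda>y. rdn \<omega> u (\<lambda>i. y ((l+1) * N + i))) \<in> measurable ?M (count_space UNIV)"
      unfolding rdn_def by (rule measurable_rx_dec) (rule coord_measurable)
    from measurable_sets[OF this, of "{V. asg m' l (s, 0) = V s}"]
    have "(\<lambda>y. rdn \<omega> u (\<lambda>i. y ((l+1) * N + i))) -` {V. asg m' l (s, 0) = V s} \<inter> space ?M \<in> sets ?M" by simp
    also have "(\<lambda>y. rdn \<omega> u (\<lambda>i. y ((l+1) * N + i))) -` {V. asg m' l (s, 0) = V s} \<inter> space ?M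
       = {y \<in> space ?M. asg m' l (s, 0) = rdn \<omega> u (\<lambda>i. y ((l+1) * N + i)) s}" by blast
    finally show ?thesis .
  qed
  hence "{y \<in> space ?M. \<forall>l\<in>{..<B}. \<forall>s\<in>set (dl u). asg m' l (s, 0) = rdn \<omega> u (\<lambda>i. y ((l+1) * N + i)) s} \<in> sets ?M"
    by (intro sets.sets_Collect_finite_All[OF _ finite_lessThan] sets.sets_Collect_finite_All[OF _ finite_set])
  hence "{y \<in> space ?M. (\<forall>j. (u, j) \<in> yc_pairs \<longrightarrow> m' (u, j) = a j) \<and>
     (\<forall>l\<in>{..<B}. \<forall>s\<in>set (dl u). asg m' l (s, 0) = rdn \<omega> u (\<lambda>i. y ((l+1) * N + i)) s)} \<in> sets ?M"
    by (intro sets.sets_Collect_conj sets.sets_Collect_const)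
  thus "{y \<in> space ?M. (\<forall>j. (u, j) \<in> yc_pairs \<longrightarrow> m' (u, j) = a j) \<and>
     (\<forall>l<B. \<forall>s\<in>set (dl u). asg m' l (s, 0) = rdn \<omega> u (\<lambda>i. y ((l+1) * N + i)) s)} \<in> sets ?M"
    unfolding Ball_def lessThan_iff .
qed simp

lemma recv_relay_measurable:
  assumes "t \<le> n"
  shows "(\<lambda>z. recv \<omega> m z t 0) \<in> measurable (yc_noise n) (PiM UNIV (\<lambda>_::nat. borel))"
proof (rule measurable_PiM_single')
  fix s :: nat
  show "(\<lambda>z. recv \<omega> m z t 0 s) \<in> borel_measurable (yc_noise n)"
  proof (cases "s < t")
    case True
    have "recv \<omega> m z t 0 s = (\<Sum>u\<in>yc_users. hg u * cenc \<omega> u s (yc_own u m) (\<lambda>_. 0)) + z (0, s)" for z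
      by (rule yc_recv_relay[OF _ True]) (simp add: cenc_def)
    moreover have "(\<lambda>z. z (0, s)) \<in> borel_measurable (yc_noise n)" using True assms by (intro yc_noise_measurable) auto
    ultimately show ?thesis by simp
  next
    case False
    hence "recv \<omega> m z t 0 s = 0" for z by (intro yc_recv_beyond) simp
    thus ?thesis by simp
  qed
qed auto

text \<open>Clipping bounds the energy of every block by N P surely, and each node is active in only
  B blocks, with B N \<le> n.\<close>

lemma code_valid:
  assumes n: "(B+1) * N \<le> n"
  shows "yc_code h1 h2 h3 P n M (cenc \<omega>) (crel \<omega>) (cdec \<omega>)"
proof -
  have n0: "n > 0" using n N_pos by (metis add_gr_0 le_zero_eq mult_eq_0_iff neq0_conv zero_less_one)
  have cM: "card (yc_msgs M) > 0" by (rule card_yc_msgs_pos[OF M_pos])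
  have BN: "real B * (real N * P) \<le> real n * P"
  proof -
    have "B * N \<le> n" using n by simp
    hence "real (B * N) \<le> real n" by (rule of_nat_mono)
    thus ?thesis using P_pos by (simp add: mult.assoc[symmetric])
  qed
  have user: "(\<Sum>t<n. (yc_tx h1 h2 h3 (cenc \<omega>) (crel \<omega>) m z u t)\<^sup>2) \<le> real n * P" if u: "u \<noteq> 0" for u m z
  proof -
    let ?f = "\<lambda>t. (yc_tx h1 h2 h3 (cenc \<omega>) (crel \<omega>) m z u t)\<^sup>2"
    have f: "?f t = (cenc \<omega> u t (yc_own u m) (\<lambda>_. 0))\<^sup>2" for t using u by (simp add: yc_tx_def cenc_def)
    have "(\<Sum>t<n. ?f t) \<le> real (B + 1 - 1) * (real N * P)"
    proof (rule sum_blocks_le[OF n])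
      fix t assume "(B+1) * N \<le> t"
      thus "?f t = 0" unfolding f by (simp add: cenc_def)
    next
      fix l assume "l < B + 1"
      show "(\<Sum>i<N. ?f (l * N + i)) \<le> real N * P"
      proof (cases "l < B")
        case True
        have "?f (l * N + i) = (clip (usig \<omega> u (yc_own u m) l) i)\<^sup>2" if "i < N" for i
          unfolding f using block_less[OF True that] that by (simp add: cenc_def block_div)
        hence "(\<Sum>i<N. ?f (l * N + i)) = (\<Sum>i<N. (clip (usig \<omega> u (yc_own u m) l) i)\<^sup>2)" by (intro sum.cong) auto
        thus ?thesis using clip_energy by simp
      next
        case False
        hence "B * N \<le> l * N + i" for i by (simp add: trans_le_add1)
        hence "?f (l * N + i) = 0" for i unfolding f cenc_def by (simp add: leD)
        thus ?thesis using P_pos by simp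
      qed
    next
      show "real N * P \<ge> 0" using P_pos by simp
      show "\<exists>l<B + 1. \<forall>i<N. ?f (l * N + i) = 0" unfolding f by (intro exI[of _ B]) (simp add: cenc_def)
    qed
    thus ?thesis using BN by simp
  qed
  have relay: "(\<Sum>t<n. (yc_tx h1 h2 h3 (cenc \<omega>) (crel \<omega>) m z 0 t)\<^sup>2) \<le> real n * P" for m z
  proof -
    let ?f = "\<lambda>t. (yc_tx h1 h2 h3 (cenc \<omega>) (crel \<omega>) m z 0 t)\<^sup>2"
    have f: "?f t = (crel \<omega> t (recv \<omega> m z t 0))\<^sup>2" for t by (simp add: yc_tx_def)
    have "(\<Sum>t<n. ?f t) \<le> real (B + 1 - 1) * (real N * P)"
    proof (rule sum_blocks_le[OF n])
      fix t assume "(B+1) * N \<le> t"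
      thus "?f t = 0" unfolding f by (simp add: crel_def)
    next
      fix l assume l: "l < B + 1"
      show "(\<Sum>i<N. ?f (l * N + i)) \<le> real N * P"
      proof (cases "l = 0")
        case True
        hence "?f (l * N + i) = 0" if "i < N" for i unfolding f using that by (simp add: crel_def)
        thus ?thesis using P_pos by simp
      next
        case False
        then obtain l' where l': "l = Suc l'" by (cases l) auto
        \<comment> \<open>The relay recomputes its decision at every time of block l; the result is
          always the same, as it reads only the completed block \<open>l'\<close>.\<close>
        let ?V = "rup \<omega> (\<lambda>i. recv \<omega> m z (l * N) 0 (l' * N + i))"
        have "?f (l * N + i) = (clip (rsig \<omega> ?V) i)\<^sup>2" if i: "i < N" for i
        proof -
          have "rup \<omega> (\<lambda>i'. recv \<omega> m z (l * N + i) 0 (l' * N + i')) = ?V"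
            unfolding rup_def
          proof (rule rx_dec_cong)
            fix i' assume i': "i' < N"
            have 1: "l' * N + i' < l * N" using i' unfolding l' by simp
            hence 2: "l' * N + i' < l * N + i" by simp
            show "recv \<omega> m z (l * N + i) 0 (l' * N + i') = recv \<omega> m z (l * N) 0 (l' * N + i')"
              unfolding yc_recv_stable[OF 1, where k = 0] yc_recv_stable[OF 2, where k = 0] ..
          qed
          moreover have "(l * N + i) div N - 1 = l'" unfolding block_div[OF i] l' by simp
          moreover have "N \<le> l * N + i \<and> l * N + i < (B+1) * N" using block_less[OF l i] l' by simp
          ultimately show ?thesis unfolding f by (simp only: crel_eq block_mod[OF i])
        qed
        hence "(\<Sum>i<N. ?f (l * N + i)) = (\<Sum>i<N. (clip (rsig \<omega> ?V) i)\<^sup>2)" by (intro sum.cong) auto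
        thus ?thesis using clip_energy by simp
      qed
    next
      show "real N * P \<ge> 0" using P_pos by simp
      show "\<exists>l<B + 1. \<forall>i<N. ?f (l * N + i) = 0" unfolding f by (intro exI[of _ 0]) (simp add: crel_def)
    qed
    thus ?thesis using BN by simp
  qed
  show ?thesis unfolding yc_code_def
  proof (intro conjI ballI allI impI)
    fix u t a
    have "cenc \<omega> u t a = (\<lambda>y. clip (usig \<omega> u a (t div N)) (t mod N)) \<or> cenc \<omega> u t a = (\<lambda>y. 0)"
      unfolding cenc_def by (cases "t < B * N") auto
    thus "cenc \<omega> u t a \<in> borel_measurable (PiM UNIV (\<lambda>_. borel))" by auto
  next
    fix t show "crel \<omega> t \<in> borel_measurable (PiM UNIV (\<lambda>_. borel))" by (rule crel_measurable)
  next
    fix u a j show "(\<lambda>y. cdec \<omega> u a y j) \<in> measurable (PiM UNIV (\<lambda>_. borel)) (count_space UNIV)" by (rule cdec_measurable)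
  next
    fix v :: nat
    show "ennreal (1 / (real n * real (card (yc_msgs M)))) *
          (\<Sum>t<n. \<Sum>m\<in>yc_msgs M. \<integral>\<^sup>+ z. ennreal ((yc_tx h1 h2 h3 (cenc \<omega>) (crel \<omega>) m z v t)\<^sup>2) \<partial>yc_noise n) \<le> ennreal P"
    proof (rule yc_power_constraintI[OF n0 cM])
      show "P \<ge> 0" using P_pos by simp
      fix m z
      show "(\<Sum>t<n. (yc_tx h1 h2 h3 (cenc \<omega>) (crel \<omega>) m z v t)\<^sup>2) \<le> real n * P"
        using user relay by (cases "v = 0") auto
    next
      fix m t assume t: "t < n"
      show "(\<lambda>z. yc_tx h1 h2 h3 (cenc \<omega>) (crel \<omega>) m z v t) \<in> borel_measurable (yc_noise n)"
      proof (cases "v = 0")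
        case True
        have "(\<lambda>z. crel \<omega> t (recv \<omega> m z t 0)) \<in> borel_measurable (yc_noise n)"
          using measurable_compose[OF recv_relay_measurable crel_measurable] t by simp
        thus ?thesis using True by (simp add: yc_tx_def)
      next
        case False
        thus ?thesis by (simp add: yc_tx_def cenc_def)
      qed
    qed
  qed
qed

text \<open>Union bound for block l, for a given code; it is 1 when some codeword cannot be shaped.
  The clipping event is free of noise and is written with coefficient 0 to match
  \<open>avg_large_deviation\<close>.\<close>

definition badp :: "nat \<Rightarrow> _ \<Rightarrow> _ \<Rightarrow> nat \<Rightarrow> real" where
  "badp n \<omega> m l = (if all_ok \<omega> (asg m l) then
      measure (yc_noise n) {z \<in> space (yc_noise n). rx_bad ul Aup g (mmse ul Aup g hup 1) ta \<kappa> hup 1 \<omega> (cws \<omega> (asg m l)) (\<lambda>i. z (0, l * N + i))}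
      + (\<Sum>u\<in>yc_users. measure (yc_noise n) {z \<in> space (yc_noise n). rx_bad (dl u) Adn (gdn u) (mmse (dl u) Adn (gdn u) (hdn u) 1) tad \<kappa> (hdn u) 1 \<omega> (cws \<omega> (asg m l)) (\<lambda>i. z (u, (l+1) * N + i))})
      + (\<Sum>v\<in>{0..3}. measure (yc_noise n) {z \<in> space (yc_noise n). real N * P < (\<Sum>i<N. (\<gamma> * (\<Sum>c\<in>C. pco v c * of_int (cws \<omega> (asg m l) c i)) + 0 * z (0, l * N + i))\<^sup>2)})
     else 1)"

lemma error_prob:
  assumes m: "m \<in> yc_msgs M" and n: "(B+1) * N \<le> n"
  shows "measure (yc_noise n) {z \<in> space (yc_noise n). yc_error h1 h2 h3 n (cenc \<omega>) (crel \<omega>) (cdec \<omega>) m z} \<le> (\<Sum>l<B. badp n \<omega> m l)"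
proof -
  interpret prob_space "yc_noise n" by (rule prob_space_yc_noise)
  let ?M = "yc_noise n"
  let ?Eu = "\<lambda>l. {z \<in> space ?M. rx_bad ul Aup g (mmse ul Aup g hup 1) ta \<kappa> hup 1 \<omega> (cws \<omega> (asg m l)) (\<lambda>i. z (0, l * N + i))}"
  let ?Ed = "\<lambda>l u. {z \<in> space ?M. rx_bad (dl u) Adn (gdn u) (mmse (dl u) Adn (gdn u) (hdn u) 1) tad \<kappa> (hdn u) 1 \<omega> (cws \<omega> (asg m l)) (\<lambda>i. z (u, (l+1) * N + i))}"
  let ?Ep = "\<lambda>l v. {z \<in> space ?M. real N * P < (\<Sum>i<N. (\<gamma> * (\<Sum>c\<in>C. pco v c * of_int (cws \<omega> (asg m l) c i)) + 0 * z (0, l * N + i))\<^sup>2)}"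
  define G where "G = (\<lambda>l. if all_ok \<omega> (asg m l) then ?Eu l \<union> (\<Union>u\<in>yc_users. ?Ed l u) \<union> (\<Union>v\<in>{0..3}. ?Ep l v) else space ?M)"
  have nl: "l * N + i < n" "(l+1) * N + i < n" if "l < B" "i < N" for l i
    using block_less[of l "B+1" i] block_less[of "l+1" "B+1" i] that n by auto
  have mu: "?Eu l \<in> sets ?M" if l: "l < B" for l
    unfolding yc_noise_def by (rule rx_bad_measurable) (use nl[OF l] in auto)
  have md: "?Ed l u \<in> sets ?M" if l: "l < B" and u: "u \<in> yc_users" for l u
    unfolding yc_noise_def by (rule rx_bad_measurable) (use nl[OF l] u in \<open>auto simp: yc_users_def\<close>)
  have mp: "?Ep l v \<in> sets ?M" for l v by simp
  have Gm: "G l \<in> sets ?M" if "l < B" for l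
    unfolding G_def using mu[OF that] md[OF that] mp[of l] by (auto intro!: sets.Un sets.finite_UN)
  have "{z \<in> space ?M. yc_error h1 h2 h3 n (cenc \<omega>) (crel \<omega>) (cdec \<omega>) m z} \<subseteq> (\<Union>l\<in>{..<B}. G l)"
  proof
    fix z assume z: "z \<in> {z \<in> space ?M. yc_error h1 h2 h3 n (cenc \<omega>) (crel \<omega>) (cdec \<omega>) m z}"
    then obtain l where l: "l < B" "\<not> good \<omega> m l z" using good_no_error[OF m n] by blast
    have "z \<in> G l"
    proof (cases "all_ok \<omega> (asg m l)")
      case True
      hence "rx_bad ul Aup g (mmse ul Aup g hup 1) ta \<kappa> hup 1 \<omega> (cws \<omega> (asg m l)) (\<lambda>i. z (0, l * N + i)) \<or>
         (\<exists>u\<in>yc_users. rx_bad (dl u) Adn (gdn u) (mmse (dl u) Adn (gdn u) (hdn u) 1) tad \<kappa> (hdn u) 1 \<omega> (cws \<omega> (asg m l)) (\<lambda>i. z (u, (l+1) * N + i))) \<or>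
         (\<exists>v\<in>{0..3}. real N * P < (\<Sum>i<N. (\<gamma> * (\<Sum>c\<in>C. pco v c * of_int (cws \<omega> (asg m l) c i)))\<^sup>2))"
        using l(2) unfolding good_def not_le[symmetric] by blast
      thus ?thesis unfolding G_def using True z by auto
    qed (use z in \<open>simp add: G_def\<close>)
    thus "z \<in> (\<Union>l\<in>{..<B}. G l)" using l(1) by blast
  qed
  hence "measure ?M {z \<in> space ?M. yc_error h1 h2 h3 n (cenc \<omega>) (crel \<omega>) (cdec \<omega>) m z} \<le> measure ?M (\<Union>l\<in>{..<B}. G l)"
    using Gm by (intro finite_measure_mono) auto
  also have "\<dots> \<le> (\<Sum>l<B. measure ?M (G l))"
    using Gm by (intro finite_measure_subadditive_finite) auto
  also have "\<dots> \<le> (\<Sum>l<B. badp n \<omega> m l)"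
  proof (rule sum_mono)
    fix l assume "l \<in> {..<B}"
    hence l: "l < B" by simp
    show "measure ?M (G l) \<le> badp n \<omega> m l"
    proof (cases "all_ok \<omega> (asg m l)")
      case True
      have sd: "(\<Union>u\<in>yc_users. ?Ed l u) \<in> sets ?M" using md[OF l] by (intro sets.finite_UN) auto
      have sp: "(\<Union>v\<in>{0..3}. ?Ep l v) \<in> sets ?M" using mp[of l] by (intro sets.finite_UN) auto
      have "measure ?M (G l) = measure ?M ((?Eu l \<union> (\<Union>u\<in>yc_users. ?Ed l u)) \<union> (\<Union>v\<in>{0..3}. ?Ep l v))"
        unfolding G_def using True by (simp only: if_True)
      also have "\<dots> \<le> measure ?M (?Eu l \<union> (\<Union>u\<in>yc_users. ?Ed l u)) + measure ?M (\<Union>v\<in>{0..3}. ?Ep l v)"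
        by (rule measure_Un_le[OF sets.Un[OF mu[OF l] sd] sp])
      also have "\<dots> \<le> measure ?M (?Eu l) + measure ?M (\<Union>u\<in>yc_users. ?Ed l u) + measure ?M (\<Union>v\<in>{0..3}. ?Ep l v)"
        by (rule add_right_mono, rule measure_Un_le[OF mu[OF l] sd])
      also have "\<dots> \<le> measure ?M (?Eu l) + (\<Sum>u\<in>yc_users. measure ?M (?Ed l u)) + (\<Sum>v\<in>{0..3}. measure ?M (?Ep l v))"
      proof (rule add_mono[OF add_left_mono])
        show "measure ?M (\<Union>u\<in>yc_users. ?Ed l u) \<le> (\<Sum>u\<in>yc_users. measure ?M (?Ed l u))"
          by (rule finite_measure_subadditive_finite, rule finite_yc_users, rule image_subsetI, rule md[OF l])
        show "measure ?M (\<Union>v\<in>{0..3}. ?Ep l v) \<le> (\<Sum>v\<in>{0..3}. measure ?M (?Ep l v))"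
          by (rule finite_measure_subadditive_finite, rule finite_atLeastAtMost, rule image_subsetI, rule mp)
      qed
      also have "\<dots> = badp n \<omega> m l" unfolding badp_def using True by (simp only: if_True)
      finally show ?thesis .
    next
      case False
      thus ?thesis using prob_le_1 by (simp add: badp_def)
    qed
  qed
  finally show ?thesis .
qed

end

section \<open>Error probability averaged over the ensemble\<close>

context yc_net
begin

definition nu_up :: "nat \<Rightarrow> real" where
  "nu_up l = mmse_energy (real (card (U (ul!l)))) (g (ul!l)) (1 + (\<Sum>s\<in>S - set (take (Suc l) ul). real (card (U s)) * (g s)\<^sup>2))"

definition nu_dn :: "nat \<Rightarrow> nat \<Rightarrow> real" where
  "nu_dn u l = mmse_energy 1 (hg u * gr (dl u!l)) (1 + (\<Sum>s\<in>S - set (take (Suc l) (dl u)). (hg u * gr s)\<^sup>2))"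

lemma UN_take: "l < length xs \<Longrightarrow> (\<Union>l'\<le>l. F (xs!l')) = (\<Union>s\<in>set (take (Suc l) xs). F s)"
proof -
  assume l: "l < length xs"
  have "set (take (Suc l) xs) = (!) xs ` {..l}"
    using nth_image[of "Suc l" xs] l by (simp add: atLeast0LessThan lessThan_Suc_atMost)
  thus ?thesis by simp
qed

end

context net_code
begin

lemma rx_noise_up:
  assumes "l < length ul"
  shows "rx_noise ul Aup hup 1 l = 1 + (\<Sum>s\<in>S - set (take (Suc l) ul). real (card (U s)) * (g s)\<^sup>2)"
proof -
  let ?T = "set (take (Suc l) ul)"
  have "(\<Sum>c\<in>C - (\<Union>l'\<le>l. Aup (ul!l')). (hup c)\<^sup>2) = (\<Sum>c\<in>Sigma (S - ?T) U. (hup c)\<^sup>2)"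
  proof (rule sum.mono_neutral_right)
    show "finite (C - (\<Union>l'\<le>l. Aup (ul!l')))" using finite_C by simp
    show "Sigma (S - ?T) U \<subseteq> C - (\<Union>l'\<le>l. Aup (ul!l'))"
      unfolding UN_take[OF assms] using comps_mem by (auto simp: Aup_def)
    show "\<forall>c\<in>C - (\<Union>l'\<le>l. Aup (ul!l')) - Sigma (S - ?T) U. (hup c)\<^sup>2 = 0"
      unfolding UN_take[OF assms] by (auto simp: comps_def Aup_def hup_def)
  qed
  also have "\<dots> = (\<Sum>s\<in>S - ?T. \<Sum>u\<in>U s. (hup (s, u))\<^sup>2)"
    using finite_S finite_U by (subst sum.Sigma) auto
  also have "\<dots> = (\<Sum>s\<in>S - ?T. real (card (U s)) * (g s)\<^sup>2)"
  proof (rule sum.cong[OF refl])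
    fix s assume s: "s \<in> S - ?T"
    have "(\<Sum>u\<in>U s. (hup (s, u))\<^sup>2) = (\<Sum>u\<in>U s. (g s)\<^sup>2)"
      using s by (intro sum.cong refl) (auto simp: hup_def)
    thus "(\<Sum>u\<in>U s. (hup (s, u))\<^sup>2) = real (card (U s)) * (g s)\<^sup>2" by simp
  qed
  finally show ?thesis by (simp add: rx_noise_def)
qed

lemma rx_noise_dn:
  assumes u: "u \<in> yc_users" and "l < length (dl u)"
  shows "rx_noise (dl u) Adn (hdn u) 1 l = 1 + (\<Sum>s\<in>S - set (take (Suc l) (dl u)). (hg u * gr s)\<^sup>2)"
proof -
  let ?T = "set (take (Suc l) (dl u))"
  have "(\<Sum>c\<in>C - (\<Union>l'\<le>l. Adn (dl u!l')). (hdn u c)\<^sup>2) = (\<Sum>c\<in>(\<lambda>s. (s, 0)) ` (S - ?T). (hdn u c)\<^sup>2)"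
  proof (rule sum.mono_neutral_right)
    show "finite (C - (\<Union>l'\<le>l. Adn (dl u!l')))" using finite_C by simp
    show "(\<lambda>s. (s, 0)) ` (S - ?T) \<subseteq> C - (\<Union>l'\<le>l. Adn (dl u!l'))"
      unfolding UN_take[OF assms(2)] using comps_mem by (auto simp: Adn_def)
    show "\<forall>c\<in>C - (\<Union>l'\<le>l. Adn (dl u!l')) - (\<lambda>s. (s, 0)) ` (S - ?T). (hdn u c)\<^sup>2 = 0"
      unfolding UN_take[OF assms(2)] by (auto simp: comps_def Adn_def hdn_def)
  qed
  also have "\<dots> = (\<Sum>s\<in>S - ?T. (hg u * gr s)\<^sup>2)"
    by (subst sum.reindex) (auto simp: inj_on_def hdn_def)
  finally show ?thesis by (simp add: rx_noise_def)
qed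

text \<open>The contributions are one shaping failure per codeword, the decoding failures at the
  relay and at each user, and four clipping events, one per node. The number \<open>pe\<close>,
  below P and at least as large as every transmit variance, gives the clipping events a common
  base.\<close>

lemma avg_badp:
  assumes n: "(B+1) * N \<le> n" and l: "l < B"
    and tu: "\<And>l. l < length ul \<Longrightarrow> nu_up l < ta (ul!l)"
    and td: "\<And>u l. u \<in> yc_users \<Longrightarrow> l < length (dl u) \<Longrightarrow> nu_dn u l < tad (dl u!l)"
    and pe: "0 < pe" "pe < P" "\<And>v. v \<in> {0..3} \<Longrightarrow> (\<Sum>c\<in>C. (pco v c)\<^sup>2) \<le> pe"
    and T: "card Shp > 0"
  shows "avg (\<lambda>\<omega>. badp n \<omega> m l) \<le> real (card C) * (real p ^ N / (real p ^ kc * real (card Shp)))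
     + (\<Sum>l<length ul. loss ^ card C * chernoff_base (nu_up l) (ta (ul!l)) ^ N + loss ^ card C * (loss * real p ^ \<kappa> (ul!l) * (sqrt (ta (ul!l)) + 2 * \<gamma>) ^ N))
     + (\<Sum>u\<in>yc_users. \<Sum>l<length (dl u). loss ^ card C * chernoff_base (nu_dn u l) (tad (dl u!l)) ^ N + loss ^ card C * (loss * real p ^ \<kappa> (dl u!l) * (sqrt (tad (dl u!l)) + 2 * \<gamma>) ^ N))
     + 4 * (loss ^ card C * chernoff_base pe P ^ N)"
proof -
  let ?a = "asg m l"
  let ?J = "{0..3} \<times> {..<n} :: (nat \<times> nat) set"
  have nl: "l * N + i < n" "(l+1) * N + i < n" if "i < N" for i
    using block_less[of l "B+1" i] block_less[of "l+1" "B+1" i] that l n by auto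
  have J: "finite ?J" by simp
  have iu: "inj_on (\<lambda>i. (u, l' * N + i)) {..<N}" for u l' :: nat by (auto simp: inj_on_def)
  have su: "(\<lambda>i. (0, l * N + i)) ` {..<N} \<subseteq> ?J" using nl by auto
  have sd: "(\<lambda>i. (u, (l+1) * N + i)) ` {..<N} \<subseteq> ?J" if "u \<in> yc_users" for u using nl that by (auto simp: yc_users_def)
  let ?F = "\<lambda>\<omega> c. if enc_ok (fst \<omega>) (snd \<omega> c) (?a c) then 0 else (1::real)"
  let ?u = "\<lambda>\<omega>. measure (yc_noise n) {z \<in> space (yc_noise n). rx_bad ul Aup g (mmse ul Aup g hup 1) ta \<kappa> hup 1 \<omega> (cws \<omega> ?a) (\<lambda>i. z (0, l * N + i))}"
  let ?d = "\<lambda>\<omega> u. measure (yc_noise n) {z \<in> space (yc_noise n). rx_bad (dl u) Adn (gdn u) (mmse (dl u) Adn (gdn u) (hdn u) 1) tad \<kappa> (hdn u) 1 \<omega> (cws \<omega> ?a) (\<lambda>i. z (u, (l+1) * N + i))}"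
  let ?p = "\<lambda>\<omega> v. measure (yc_noise n) {z \<in> space (yc_noise n). real N * P < (\<Sum>i<N. (\<gamma> * (\<Sum>c\<in>C. pco v c * of_int (cws \<omega> ?a c i)) + 0 * z (0, l * N + i))\<^sup>2)}"
  have "avg (\<lambda>\<omega>. badp n \<omega> m l) \<le> avg (\<lambda>\<omega>. (\<Sum>c\<in>C. ?F \<omega> c) + (if all_ok \<omega> ?a then ?u \<omega> else 0)
      + (\<Sum>u\<in>yc_users. if all_ok \<omega> ?a then ?d \<omega> u else 0) + (\<Sum>v\<in>{0..3}. if all_ok \<omega> ?a then ?p \<omega> v else 0))"
  proof (rule avg_mono)
    fix \<omega>
    show "badp n \<omega> m l \<le> (\<Sum>c\<in>C. ?F \<omega> c) + (if all_ok \<omega> ?a then ?u \<omega> else 0)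
      + (\<Sum>u\<in>yc_users. if all_ok \<omega> ?a then ?d \<omega> u else 0) + (\<Sum>v\<in>{0..3}. if all_ok \<omega> ?a then ?p \<omega> v else 0)"
    proof (cases "all_ok \<omega> ?a")
      case True
      have "(\<Sum>c\<in>C. ?F \<omega> c) \<ge> 0" by (intro sum_nonneg) auto
      thus ?thesis using True unfolding badp_def by (simp only: if_True)
    next
      case False
      then obtain c where c: "c \<in> C" "\<not> enc_ok (fst \<omega>) (snd \<omega> c) (?a c)" by (auto simp: all_ok_def)
      have "1 \<le> (\<Sum>c\<in>C. ?F \<omega> c)"
        using member_le_sum[OF c(1), of "?F \<omega>"] c(2) finite_C by auto
      thus ?thesis using False by (simp add: badp_def)
    qed
  qed
  also have "\<dots> = (\<Sum>c\<in>C. avg (\<lambda>\<omega>. ?F \<omega> c)) + avg (\<lambda>\<omega>. if all_ok \<omega> ?a then ?u \<omega> else 0)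
      + (\<Sum>u\<in>yc_users. avg (\<lambda>\<omega>. if all_ok \<omega> ?a then ?d \<omega> u else 0)) + (\<Sum>v\<in>{0..3}. avg (\<lambda>\<omega>. if all_ok \<omega> ?a then ?p \<omega> v else 0))"
    by (simp only: avg_add avg_sum)
  also have "\<dots> \<le> (\<Sum>c\<in>C. real p ^ N / (real p ^ kc * real (card Shp)))
     + (\<Sum>l<length ul. loss ^ card C * chernoff_base (nu_up l) (ta (ul!l)) ^ N + loss ^ card C * (loss * real p ^ \<kappa> (ul!l) * (sqrt (ta (ul!l)) + 2 * \<gamma>) ^ N))
     + (\<Sum>u\<in>yc_users. \<Sum>l<length (dl u). loss ^ card C * chernoff_base (nu_dn u l) (tad (dl u!l)) ^ N + loss ^ card C * (loss * real p ^ \<kappa> (dl u!l) * (sqrt (tad (dl u!l)) + 2 * \<gamma>) ^ N))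
     + (\<Sum>v\<in>{0..(3::nat)}. loss ^ card C * chernoff_base pe P ^ N)"
  proof (intro add_mono sum_mono)
    fix c assume "c \<in> C"
    thus "avg (\<lambda>\<omega>. ?F \<omega> c) \<le> real p ^ N / (real p ^ kc * real (card Shp))" by (rule avg_encoding_failure[OF T])
  next
    show "avg (\<lambda>\<omega>. if all_ok \<omega> ?a then ?u \<omega> else 0) \<le> (\<Sum>l<length ul. loss ^ card C * chernoff_base (nu_up l) (ta (ul!l)) ^ N + loss ^ card C * (loss * real p ^ \<kappa> (ul!l) * (sqrt (ta (ul!l)) + 2 * \<gamma>) ^ N))"
      unfolding yc_noise_def
    proof (rule avg_rx_bad_mmse[OF J iu su ul(2), where \<nu> = nu_up])
      fix s assume "s \<in> set ul"
      hence s: "s \<in> S" using ul(1) by simp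
      show "Aup s \<subseteq> C" by (rule Aup_comps[OF s])
      show "Aup s \<noteq> {}" using U_nonempty[OF s] by (simp add: Aup_def)
      show "g s \<noteq> 0" using g_pos[OF s] by simp
      show "kc + \<kappa> s \<le> k" by (rule \<kappa>_k[OF s])
      fix c assume "c \<in> Aup s"
      thus "hup c = g s" by (rule hup_Aup[OF s])
    next
      fix s s' :: nat assume "s \<noteq> s'"
      thus "Aup s \<inter> Aup s' = {}" by (rule Aup_disjoint)
    next
      fix l assume l: "l < length ul"
      show "nu_up l = mmse_energy (real (card (Aup (ul ! l)))) (g (ul ! l)) (rx_noise ul Aup hup 1 l)"
        unfolding nu_up_def rx_noise_up[OF l] card_Aup ..
      show "nu_up l < ta (ul!l)" by (rule tu[OF l])
    qed simp
  next
    fix u assume u: "u \<in> yc_users"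
    show "avg (\<lambda>\<omega>. if all_ok \<omega> ?a then ?d \<omega> u else 0) \<le> (\<Sum>l<length (dl u). loss ^ card C * chernoff_base (nu_dn u l) (tad (dl u!l)) ^ N + loss ^ card C * (loss * real p ^ \<kappa> (dl u!l) * (sqrt (tad (dl u!l)) + 2 * \<gamma>) ^ N))"
      unfolding yc_noise_def
    proof (rule avg_rx_bad_mmse[OF J iu sd[OF u] dl(2)[OF u], where \<nu> = "nu_dn u"])
      fix s assume sd: "s \<in> set (dl u)"
      hence s: "s \<in> S" using dl(1)[OF u] by blast
      show "Adn s \<subseteq> C" by (rule Adn_comps[OF s])
      show "Adn s \<noteq> {}" by (simp add: Adn_def)
      have "dl u \<noteq> []" using sd by auto
      thus "gdn u s \<noteq> 0" using gr_pos[OF s] dl_gain[OF u] by (simp add: gdn_def)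
      show "kc + \<kappa> s \<le> k" by (rule \<kappa>_k[OF s])
      fix c assume "c \<in> Adn s"
      thus "hdn u c = gdn u s" by (rule hdn_Adn)
    next
      fix s s' :: nat assume "s \<noteq> s'"
      thus "Adn s \<inter> Adn s' = {}" by (rule Adn_disjoint)
    next
      fix l assume l: "l < length (dl u)"
      show "nu_dn u l = mmse_energy (real (card (Adn (dl u ! l)))) (gdn u (dl u ! l)) (rx_noise (dl u) Adn (hdn u) 1 l)"
        unfolding nu_dn_def rx_noise_dn[OF u l] by (simp add: Adn_def gdn_def)
      show "nu_dn u l < tad (dl u!l)" by (rule td[OF u l])
    qed simp
  next
    fix v :: nat assume v: "v \<in> {0..3}"
    define A where "A = (\<Sum>c\<in>C. (pco v c)\<^sup>2) + 0\<^sup>2"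
    define lam where "lam = (1/pe - 1/P)/2"
    have lam: "lam \<ge> 0" "2 * lam * pe < 1" using chernoff_base_parameter[OF pe(1,2)] by (auto simp: lam_def)
    have A: "A \<le> pe" using pe(3)[OF v] by (simp add: A_def)
    \<comment> \<open>The tilt is optimal for \<open>pe\<close> and not for the actual variance A;
      since A \<le> \<open>pe\<close> the moment bound can only improve.\<close>
    have lA: "2 * lam * A \<le> 2 * lam * pe" using A lam by (intro mult_left_mono) auto
    have "avg (\<lambda>\<omega>. if all_ok \<omega> ?a then ?p \<omega> v else 0) \<le> loss ^ card C * (exp (- lam * P) / sqrt (1 - 2 * lam * A)) ^ N"
      unfolding yc_noise_def A_def by (rule avg_large_deviation[OF J iu su lam(1)]) (use lA lam in \<open>simp add: A_def\<close>)
    also have "\<dots> \<le> loss ^ card C * chernoff_base pe P ^ N"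
      unfolding chernoff_base_def lam_def[symmetric] using lA lam loss_nonneg
      by (intro mult_left_mono power_mono divide_left_mono real_sqrt_le_mono mult_pos_pos) auto
    finally show "avg (\<lambda>\<omega>. if all_ok \<omega> ?a then ?p \<omega> v else 0) \<le> loss ^ card C * chernoff_base pe P ^ N" .
  qed
  finally show ?thesis by simp
qed

end

section \<open>Choice of the code parameters\<close>

lemma finite_strict_upper_bound:
  fixes X :: "real set"
  assumes "finite X" "\<And>x. x \<in> X \<Longrightarrow> x < c" "a < c"
  shows "\<exists>t. a < t \<and> t < c \<and> (\<forall>x\<in>X. x < t)"
proof -
  have m: "Max (insert a X) < c" using assms by (subst Max_less_iff) auto
  have u: "x \<le> Max (insert a X)" if "x \<in> insert a X" for x using assms that by (intro Max_ge) auto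
  have "x < (Max (insert a X) + c) / 2" if "x \<in> insert a X" for x using u[OF that] m by simp
  moreover have "(Max (insert a X) + c) / 2 < c" using m by simp
  ultimately show ?thesis by (intro exI[of _ "(Max (insert a X) + c) / 2"]) simp
qed

text \<open>The number of p-ary symbols that carry x bits, rounded up; rounding costs at most a
  factor p.\<close>

definition digits :: "nat \<Rightarrow> real \<Rightarrow> nat" where
  "digits p x = nat \<lceil>x * ln 2 / ln (real p)\<rceil>"

lemma digits_0 [simp]: "digits p 0 = 0" by (simp add: digits_def)

lemma digits_bounds:
  assumes "p \<ge> 2" "x \<ge> 0"
  shows "2 powr x \<le> real p ^ digits p x" "real p ^ digits p x \<le> real p * 2 powr x"
proof -
  let ?y = "x * ln 2 / ln (real p)"
  have lp: "ln (real p) > 0" using assms by simp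
  have y: "?y \<ge> 0" using assms lp by simp
  have e: "real p powr ?y = 2 powr x" using assms lp by (simp add: powr_def)
  have "?y \<le> real (digits p x)" unfolding digits_def using y by linarith
  hence "real p powr ?y \<le> real p powr real (digits p x)" using assms by (intro powr_mono) auto
  thus "2 powr x \<le> real p ^ digits p x" using e assms by (simp add: powr_realpow)
  have "real (digits p x) \<le> ?y + 1" unfolding digits_def using y by linarith
  hence "real p powr real (digits p x) \<le> real p powr (?y + 1)" using assms by (intro powr_mono) auto
  thus "real p ^ digits p x \<le> real p * 2 powr x" using e assms by (simp add: powr_realpow powr_add mult.commute)
qed

text \<open>Only B of B + 1 blocks carry data, and at most B symbols stay idle after them. The first
  loss vanishes for large B, the second for fixed B and large n, so B is chosen before n.\<close>

lemma block_rate_eventually: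
  fixes r \<sigma> :: real
  assumes "r < \<sigma>" "\<sigma> \<ge> 0"
  shows "\<forall>\<^sub>F B in sequentially. \<forall>\<^sub>F n in sequentially. real n * r \<le> real B * real (n div (B+1)) * \<sigma>"
proof (cases "r < 0")
  case True
  have "real n * r \<le> real B * real (n div (B+1)) * \<sigma>" for n B
  proof -
    have "real n * r \<le> 0" using True by (simp add: mult_nonneg_nonpos)
    also have "0 \<le> real B * real (n div (B+1)) * \<sigma>" using assms by (intro mult_nonneg_nonneg) auto
    finally show ?thesis .
  qed
  thus ?thesis by (auto intro!: always_eventually)
next
  case False
  have "(\<lambda>B. real B / real (B+1) * \<sigma>) \<longlonglongrightarrow> 1 * \<sigma>"
    using LIMSEQ_n_over_Suc_n[where 'a = real] by (intro tendsto_mult tendsto_const) simp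
  hence "\<forall>\<^sub>F B in sequentially. r < real B / real (B+1) * \<sigma>" using assms by (intro order_tendstoD) auto
  thus ?thesis
  proof eventually_elim
    case (elim B)
    define d where "d = real B / real (B+1) * \<sigma> - r"
    have d: "d > 0" using elim by (simp add: d_def)
    obtain n0 :: nat where n0: "real n0 \<ge> real B * \<sigma> / d" using real_arch_simple by blast
    have "real n * r \<le> real B * real (n div (B+1)) * \<sigma>" if n: "n \<ge> n0" for n
    proof -
      have "n < (n div (B+1) + 1) * (B+1)" using dividend_less_div_times[of "B+1" n] by (simp add: algebra_simps)
      hence "real n < real ((n div (B+1) + 1) * (B+1))" by (simp only: of_nat_less_iff)
      hence "real n / real (B+1) < real (n div (B+1)) + 1" by (simp add: divide_less_eq algebra_simps)
      hence "(real n / real (B+1) - 1) * (real B * \<sigma>) \<le> real (n div (B+1)) * (real B * \<sigma>)"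
        using assms by (intro mult_right_mono mult_nonneg_nonneg) auto
      moreover have "real B * \<sigma> \<le> d * real n"
      proof -
        have "real B * \<sigma> / d \<le> real n" using n0 n by (meson of_nat_mono order_trans)
        thus ?thesis using d by (simp add: divide_le_eq mult.commute)
      qed
      moreover have "(real n / real (B+1) - 1) * (real B * \<sigma>) = real n * (r + d) - real B * \<sigma>"
        by (simp add: d_def field_simps)
      ultimately show ?thesis by (simp add: algebra_simps)
    qed
    thus ?case unfolding eventually_sequentially by blast
  qed
qed

context yc_net
begin

text \<open>Any injection of the messages into sequences of symbol vectors will do, so this is a
  comparison of cardinalities.\<close>

lemma message_embedding:
  fixes M :: "nat \<times> nat \<Rightarrow> nat" and \<kappa>s :: "(nat \<times> nat) \<times> nat \<Rightarrow> nat"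
  assumes "linear_ensemble k kc H p \<gamma> comps"
    and k: "\<And>y. y \<in> yc_pairs \<times> {..<3} \<Longrightarrow> kc + \<kappa>s y \<le> k"
    and M: "\<And>q. q \<in> yc_pairs \<Longrightarrow> real (M q) \<le> real p ^ (B * (\<Sum>e<3. \<kappa>s (q, e)))"
  shows "\<exists>\<phi>. \<forall>q\<in>yc_pairs. (\<forall>x<M q. \<phi> q x \<in> PiE ({..<B} \<times> {..<3}) (\<lambda>(l,e). linear_ensemble.vecs k p {kc..<kc + \<kappa>s (q,e)})) \<and> inj_on (\<phi> q) {..<M q}"
proof -
  interpret linear_ensemble N k kc H p \<gamma> comps for N by (rule assms(1))
  have "\<exists>f. f ` {..<M q} \<subseteq> PiE ({..<B} \<times> {..<3}) (\<lambda>(l,e). vecs {kc..<kc + \<kappa>s (q,e)}) \<and> inj_on f {..<M q}" if q: "q \<in> yc_pairs" for q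
  proof (rule card_le_inj)
    let ?V = "PiE ({..<B} \<times> {..<(3::nat)}) (\<lambda>(l,e). vecs {kc..<kc + \<kappa>s (q,e)})"
    show "finite ?V" by (intro finite_PiE) auto
    have "card ?V = (\<Prod>(l,e)\<in>{..<B} \<times> {..<(3::nat)}. card (vecs {kc..<kc + \<kappa>s (q,e)}))"
      by (simp add: card_PiE case_prod_beta)
    also have "\<dots> = (\<Prod>l<B. \<Prod>e<3. card (vecs {kc..<kc + \<kappa>s (q,e)}))"
      by (rule prod.cartesian_product[symmetric])
    also have "\<dots> = (\<Prod>l<B. \<Prod>e<3. p ^ \<kappa>s (q,e))"
    proof (intro prod.cong refl)
      fix e :: nat assume "e \<in> {..<3}"
      hence "{kc..<kc + \<kappa>s (q,e)} \<subseteq> {..<k}" using k[of "(q,e)"] q by auto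
      thus "card (vecs {kc..<kc + \<kappa>s (q,e)}) = p ^ \<kappa>s (q,e)" by (simp add: card_vecs)
    qed
    also have "\<dots> = p ^ (B * (\<Sum>e<3. \<kappa>s (q, e)))" by (simp add: power_sum[symmetric] power_mult[symmetric] mult.commute)
    finally have c: "card ?V = p ^ (B * (\<Sum>e<3. \<kappa>s (q, e)))" .
    have "real (M q) \<le> real (card ?V)" using M[OF q] unfolding c by simp
    thus "card {..<M q} \<le> card ?V" by simp
  qed simp
  hence "\<forall>q\<in>yc_pairs. \<exists>f. (\<forall>x<M q. f x \<in> PiE ({..<B} \<times> {..<3}) (\<lambda>(l,e). vecs {kc..<kc + \<kappa>s (q,e)})) \<and> inj_on f {..<M q}"
    by (simp add: image_subset_iff Ball_def)
  thus ?thesis by (rule bchoice)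
qed

lemma nu_up_pos: "l < length ul \<Longrightarrow> nu_up l > 0"
proof -
  assume "l < length ul"
  hence s: "ul ! l \<in> S" using ul(1) nth_mem by blast
  have "card (U (ul ! l)) > 0" using finite_U[OF s] U_nonempty[OF s] by (simp add: card_gt_0_iff)
  moreover have "(0::real) < 1 + (\<Sum>s\<in>S - set (take (Suc l) ul). real (card (U s)) * (g s)\<^sup>2)"
    by (intro add_pos_nonneg sum_nonneg) auto
  ultimately show ?thesis unfolding nu_up_def by (intro mmse_energy_pos) auto
qed

lemma nu_dn_pos: "nu_dn u l > 0"
  unfolding nu_dn_def by (intro mmse_energy_pos add_pos_nonneg sum_nonneg) auto

text \<open>All conditions of the network are strict and finite in number, which leaves room for one
  decay base w < 1 common to every error event.\<close>

theorem achievable: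
  assumes R: "\<And>q. q \<in> yc_pairs \<Longrightarrow> R q < (\<Sum>e<3. \<rho>s (q, e))"
  shows "yc_achievable h1 h2 h3 P R"
  unfolding yc_achievable_def
proof (intro allI impI)
  fix \<epsilon> :: real assume \<epsilon>: "\<epsilon> > 0"
  let ?K = "card comps"
  let ?two = "\<lambda>s. 2 powr (2 * \<rho> s)"
  have mem_ul: "ul ! l \<in> S" if "l < length ul" for l using ul(1) nth_mem that by blast
  have mem_dl: "dl u ! l \<in> S" if "u \<in> yc_users" "l < length (dl u)" for u l using dl(1)[OF that(1)] nth_mem[OF that(2)] by blast
  have fin_dl: "finite (Sigma yc_users (\<lambda>u. {..<length (dl u)}))" by (intro finite_SigmaI) auto
  let ?X = "(\<lambda>l. ?two (ul!l) * nu_up l) ` {..<length ul} \<union> (\<lambda>(u,l). ?two (dl u!l) * nu_dn u l) ` Sigma yc_users (\<lambda>u. {..<length (dl u)})"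
  have "\<exists>t. 0 < t \<and> t < 1 \<and> (\<forall>x\<in>?X. x < t)"
  proof (rule finite_strict_upper_bound)
    show "finite ?X" using fin_dl by simp
    fix x assume "x \<in> ?X"
    thus "x < 1" using up_rate dn_rate by (auto simp: nu_up_def nu_dn_def)
  qed simp
  then obtain \<theta> where \<theta>: "0 < \<theta>" "\<theta> < 1" and \<theta>x: "\<And>x. x \<in> ?X \<Longrightarrow> x < \<theta>" by blast
  \<comment> \<open>The threshold is just below the confusion limit 2^(-2 \<rho>) and, by
    \<open>up_rate\<close> and \<open>dn_rate\<close>, still above the effective noise variance of
    every stage.\<close>
  define \<tau> where "\<tau> = (\<lambda>s. \<theta> * 2 powr (- 2 * \<rho> s))"
  have two_inv: "?two s * 2 powr (- 2 * \<rho> s) = 1" for s by (simp add: powr_add[symmetric])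
  have lt: "x < \<tau> s" if "?two s * x < \<theta>" for x s
  proof -
    have lt2: "(?two s * x) * 2 powr (- 2 * \<rho> s) < \<theta> * 2 powr (- 2 * \<rho> s)" using that by (intro mult_strict_right_mono) auto
    have "(?two s * x) * 2 powr (- 2 * \<rho> s) = x"
      by (simp only: mult.commute[of "?two s" x] mult.assoc two_inv mult_1_right)
    thus ?thesis using lt2 unfolding \<tau>_def by (simp only:)
  qed
  have tu: "nu_up l < \<tau> (ul!l)" if "l < length ul" for l using that by (intro lt \<theta>x) auto
  have td: "nu_dn u l < \<tau> (dl u!l)" if "u \<in> yc_users" "l < length (dl u)" for u l
    by (rule lt, rule \<theta>x, rule UnI2, rule image_eqI[of _ _ "(u,l)"]) (use that in auto)
  have sqrt_\<tau>: "sqrt (\<tau> s) = sqrt \<theta> * 2 powr (- \<rho> s)" for s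
  proof -
    have "2 powr (- 2 * \<rho> s) = (2 powr (- \<rho> s))\<^sup>2" by (simp add: power2_eq_square powr_add[symmetric])
    thus ?thesis by (simp add: \<tau>_def real_sqrt_mult)
  qed
  let ?Z = "(\<lambda>v. \<Sum>c\<in>comps. (pco v c)\<^sup>2) ` {0..3}"
  have "\<exists>t. 0 < t \<and> t < P \<and> (\<forall>x\<in>?Z. x < t)"
  proof (rule finite_strict_upper_bound)
    fix x assume "x \<in> ?Z"
    then obtain v where v: "v \<in> {0..3}" "x = (\<Sum>c\<in>comps. (pco v c)\<^sup>2)" by blast
    have "v = 0 \<or> v \<in> yc_users" using v(1) by (auto simp: yc_users_def)
    thus "x < P" using v(2) pco_energy_relay pco_energy_user by auto
  qed (use P_pos in auto)
  then obtain pe where pe: "0 < pe" "pe < P" and pex: "\<And>x. x \<in> ?Z \<Longrightarrow> x < pe" by blast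
  have pe3: "(\<Sum>c\<in>comps. (pco v c)\<^sup>2) \<le> pe" if "v \<in> {0..3}" for v using pex[of "\<Sum>c\<in>comps. (pco v c)\<^sup>2"] that by force
  \<comment> \<open>The bases of all exponentials: a bound for the confusion base, the clipping
    base, and the Chernoff bases of all stages.\<close>
  let ?Y = "insert ((1 + sqrt \<theta>) / 2) (insert (chernoff_base pe P) ((\<lambda>l. chernoff_base (nu_up l) (\<tau> (ul!l))) ` {..<length ul} \<union> (\<lambda>(u,l). chernoff_base (nu_dn u l) (\<tau> (dl u!l))) ` Sigma yc_users (\<lambda>u. {..<length (dl u)})))"
  have "\<exists>t. 0 < t \<and> t < 1 \<and> (\<forall>x\<in>?Y. x < t)"
  proof (rule finite_strict_upper_bound)
    show "finite ?Y" using fin_dl by simp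
    fix x assume "x \<in> ?Y"
    then consider "x = (1 + sqrt \<theta>) / 2" | "x = chernoff_base pe P" | l where "l < length ul" "x = chernoff_base (nu_up l) (\<tau> (ul!l))"
      | u l where "u \<in> yc_users" "l < length (dl u)" "x = chernoff_base (nu_dn u l) (\<tau> (dl u!l))" by auto
    thus "x < 1"
    proof cases
      case 1
      have "sqrt \<theta> < 1" using \<theta> by simp
      moreover have "(1 + q) / 2 < 1" if "q < 1" for q :: real using that by simp
      ultimately show ?thesis unfolding 1 by blast
    next
      case 2 thus ?thesis using chernoff_base_less_1[OF pe] by simp
    next
      case 3 thus ?thesis using chernoff_base_less_1[OF nu_up_pos tu] by simp
    next
      case 4 thus ?thesis using chernoff_base_less_1[OF nu_dn_pos td] by simp
    qed
  qed simp
  then obtain w where w: "0 < w" "w < 1" and wx: "\<And>x. x \<in> ?Y \<Longrightarrow> x < w" by blast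
  \<comment> \<open>Chosen so that the total loss exp (3 \<delta>)^(K + 1), with K the number of
    codewords, equals 1 / sqrt w and the decay base \<open>a\<close> becomes sqrt w. The extra 1 in
    the exponent stands for the additional \<open>loss\<close> in the confusion bound.\<close>
  define \<delta> where "\<delta> = - ln w / (6 * real (?K + 1))"
  have lw: "ln w < 0" using w by simp
  have \<delta>: "\<delta> > 0" unfolding \<delta>_def using lw by (intro divide_pos_pos) auto
  define a where "a = exp (3 * \<delta>) ^ (?K + 1) * w"
  have a: "a = sqrt w"
  proof -
    have "real (?K + 1) * (3 * \<delta>) = - ln w / 2" by (simp add: \<delta>_def field_simps)
    hence E: "exp (3 * \<delta>) ^ (?K + 1) = exp (- (ln w / 2))" unfolding exp_of_nat_mult[symmetric] by simp
    have e: "exp (ln w / 2) = sqrt w" using w by (simp add: ln_sqrt[symmetric])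
    have "a = exp (- (ln w / 2)) * (sqrt w * sqrt w)" unfolding a_def E using w by simp
    also have "\<dots> = exp (- (ln w / 2)) * exp (ln w / 2) * sqrt w" unfolding e by (simp only: mult.assoc)
    also have "\<dots> = sqrt w" unfolding mult_exp_exp by simp
    finally show ?thesis .
  qed
  have a01: "0 \<le> a" "a < 1" unfolding a using w by auto
  define Mx where "Mx = 1 + (\<Sum>s\<in>S. 2 powr \<rho> s)"
  have Mx: "Mx > 0" unfolding Mx_def by (intro add_pos_nonneg sum_nonneg) auto
  \<comment> \<open>For \<gamma> below this value the discretisation term 2 \<gamma> 2^\<rho> is at
    most half the gap between sqrt \<theta> and 1.\<close>
  define \<gamma>1 where "\<gamma>1 = (1 - sqrt \<theta>) / (4 * Mx)"
  have \<gamma>1: "\<gamma>1 > 0" unfolding \<gamma>1_def using \<theta> Mx by (intro divide_pos_pos) auto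
  obtain \<gamma> H p where \<gamma>: "0 < \<gamma>" "\<gamma> < \<gamma>1" and p: "prime (p::nat)" "4 * H < p"
    and kcN: "\<forall>\<^sub>F N in sequentially. \<exists>kc. real p ^ N * exp \<delta> ^ N \<le> real p ^ kc * real (card (shaping N H \<gamma>)) \<and>
        real p ^ kc * (exp (1/2) * gauss_norm \<gamma>) ^ N \<le> real p ^ N * exp (3*\<delta>) ^ N"
    using lattice_parameters[OF \<delta> \<gamma>1] by blast
  have p2: "p \<ge> 2" using p prime_ge_2_nat by blast
  have \<gamma>w: "sqrt \<theta> + 2 * \<gamma> * 2 powr \<rho> s \<le> w" if s: "s \<in> S" for s
  proof -
    have "2 powr \<rho> s \<le> (\<Sum>s\<in>S. 2 powr \<rho> s)" using s finite_S by (intro member_le_sum) auto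
    hence "2 powr \<rho> s \<le> Mx" by (simp add: Mx_def)
    hence "\<gamma> * 2 powr \<rho> s \<le> \<gamma>1 * Mx" using \<gamma> by (intro mult_mono) auto
    also have "\<gamma>1 * Mx = (1 - sqrt \<theta>) / 4" using Mx by (simp add: \<gamma>1_def)
    finally have "sqrt \<theta> + 2 * \<gamma> * 2 powr \<rho> s \<le> (1 + sqrt \<theta>) / 2" by simp
    thus ?thesis using wx[of "(1 + sqrt \<theta>) / 2"] by simp
  qed
  have evB: "\<forall>\<^sub>F B in sequentially. \<forall>q\<in>yc_pairs. \<forall>\<^sub>F n in sequentially. real n * R q \<le> real B * real (n div (B+1)) * (\<Sum>e<3. \<rho>s (q, e))"
    using R rates_nonneg by (intro eventually_ball_finite finite_yc_pairs ballI block_rate_eventually sum_nonneg) auto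
  obtain B where B: "\<forall>q\<in>yc_pairs. \<forall>\<^sub>F n in sequentially. real n * R q \<le> real B * real (n div (B+1)) * (\<Sum>e<3. \<rho>s (q, e))"
    using eventually_happens'[OF sequentially_bot evB] by blast
  have Bn: "\<forall>\<^sub>F n in sequentially. \<forall>q\<in>yc_pairs. real n * R q \<le> real B * real (n div (B+1)) * (\<Sum>e<3. \<rho>s (q, e))"
    using B by (intro eventually_ball_finite finite_yc_pairs)
  define L where "L = length ul + (\<Sum>u\<in>yc_users. length (dl u))"
  \<comment> \<open>Per block: one shaping failure for each codeword, one Chernoff and one confusion
    term for each of the L stages, and four clipping events. The factor p comes from rounding up to
    p-ary symbols.\<close>
  define tot where "tot = (\<lambda>N::nat. real ?K * exp (- \<delta>) ^ N + (real L * (1 + real p) + 4) * a ^ N)"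
  have "(\<lambda>N. real B * tot N) \<longlonglongrightarrow> real B * (real ?K * 0 + (real L * (1 + real p) + 4) * 0)"
    unfolding tot_def using a01 \<delta> by (intro tendsto_intros LIMSEQ_realpow_zero) auto
  hence totN: "\<forall>\<^sub>F N in sequentially. real B * tot N < \<epsilon>" using \<epsilon> by (intro order_tendstoD) auto
  have div_top: "filterlim (\<lambda>n. n div (B+1)) sequentially sequentially"
    unfolding filterlim_at_top
  proof
    fix Z :: nat
    have "Z \<le> n div (B+1)" if "n \<ge> Z * (B+1)" for n using div_le_mono[OF that, of "B+1"] nonzero_mult_div_cancel_right[of "B+1" Z] by simp
    thus "\<forall>\<^sub>F n in sequentially. Z \<le> n div (B+1)" unfolding eventually_sequentially by blast
  qed
  have "\<forall>\<^sub>F N::nat in sequentially. N > 0" by (rule eventually_gt_at_top)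
  with kcN totN have "\<forall>\<^sub>F N in sequentially. N > 0 \<and> real B * tot N < \<epsilon> \<and> (\<exists>kc. real p ^ N * exp \<delta> ^ N \<le> real p ^ kc * real (card (shaping N H \<gamma>)) \<and>
        real p ^ kc * (exp (1/2) * gauss_norm \<gamma>) ^ N \<le> real p ^ N * exp (3*\<delta>) ^ N)" by eventually_elim blast
  from eventually_compose_filterlim[OF this div_top] Bn
  have "\<forall>\<^sub>F n in sequentially. \<exists>enc rel dec.
        yc_code h1 h2 h3 P n (\<lambda>p. nat \<lceil>2 powr (real n * R p)\<rceil>) enc rel dec \<and>
        yc_perr h1 h2 h3 n (\<lambda>p. nat \<lceil>2 powr (real n * R p)\<rceil>) enc rel dec \<le> \<epsilon>"
  proof eventually_elim
    case (elim n)
    define N where "N = n div (B+1)"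
    have N: "N > 0" and Nt: "real B * tot N < \<epsilon>" using elim(1) by (auto simp: N_def)
    obtain kc where kc1: "real p ^ N * exp \<delta> ^ N \<le> real p ^ kc * real (card (shaping N H \<gamma>))"
      and kc2: "real p ^ kc * (exp (1/2) * gauss_norm \<gamma>) ^ N \<le> real p ^ N * exp (3*\<delta>) ^ N" using elim(1) unfolding N_def by blast
    define M where "M = (\<lambda>q. nat \<lceil>2 powr (real n * R q)\<rceil>)"
    define \<kappa>s where "\<kappa>s = (\<lambda>y. digits p (real N * \<rho>s y))"
    define \<kappa> where "\<kappa> = (\<lambda>s. digits p (real N * \<rho> s))"
    define k where "k = kc + (\<Sum>y\<in>yc_pairs \<times> {..<3}. \<kappa>s y)"
    have nN: "(B+1) * N \<le> n" unfolding N_def by (rule times_div_less_eq_dividend)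
    have ens: "linear_ensemble k kc H p \<gamma> comps"
      by unfold_locales (use p \<gamma> finite_comps in \<open>auto simp: k_def\<close>)
    have ky: "kc + \<kappa>s y \<le> k" if "y \<in> yc_pairs \<times> {..<3}" for y
      using that member_le_sum[of y "yc_pairs \<times> {..<3}" \<kappa>s] by (simp add: k_def)
    have Mle: "real (M q) \<le> real p ^ (B * (\<Sum>e<3. \<kappa>s (q, e)))" if q: "q \<in> yc_pairs" for q
    proof -
      have d: "2 powr (real N * \<rho>s y) \<le> real p ^ \<kappa>s y" for y
        unfolding \<kappa>s_def using p2 rates_nonneg by (intro digits_bounds) auto
      have "2 powr (real n * R q) \<le> 2 powr (real B * real N * (\<Sum>e<3. \<rho>s (q, e)))"
        using elim(2) q unfolding N_def by (intro powr_mono) auto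
      also have "\<dots> = (\<Prod>e<3. 2 powr (real N * \<rho>s (q, e))) ^ B"
      proof -
        have "(\<Prod>e<3. 2 powr (real N * \<rho>s (q, e))) = 2 powr (\<Sum>e<3. real N * \<rho>s (q, e))" by (simp add: powr_sum)
        thus ?thesis by (simp add: sum_distrib_left[symmetric] powr_realpow[symmetric] powr_powr mult_ac)
      qed
      also have "\<dots> \<le> (\<Prod>e<3. real p ^ \<kappa>s (q, e)) ^ B"
        using d by (intro power_mono prod_mono prod_nonneg) auto
      also have "\<dots> = real p ^ (B * (\<Sum>e<3. \<kappa>s (q, e)))"
        by (simp add: power_sum[symmetric] power_mult[symmetric] mult.commute)
      finally have "2 powr (real n * R q) \<le> of_int (int (p ^ (B * (\<Sum>e<3. \<kappa>s (q, e)))))" by simp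
      hence "\<lceil>2 powr (real n * R q)\<rceil> \<le> int (p ^ (B * (\<Sum>e<3. \<kappa>s (q, e))))" by (simp only: ceiling_le_iff)
      hence "M q \<le> p ^ (B * (\<Sum>e<3. \<kappa>s (q, e)))" unfolding M_def by (simp only: nat_le_iff)
      hence "real (M q) \<le> real (p ^ (B * (\<Sum>e<3. \<kappa>s (q, e))))" by (rule of_nat_mono)
      thus ?thesis by simp
    qed
    obtain \<phi> where \<phi>: "\<And>q x. q \<in> yc_pairs \<Longrightarrow> x < M q \<Longrightarrow> \<phi> q x \<in> PiE ({..<B} \<times> {..<3}) (\<lambda>(l,e). linear_ensemble.vecs k p {kc..<kc + \<kappa>s (q,e)})"
      "\<And>q. q \<in> yc_pairs \<Longrightarrow> inj_on (\<phi> q) {..<M q}"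
      using message_embedding[OF ens ky Mle] by blast
    interpret E: linear_ensemble N k kc H p \<gamma> comps by (rule ens)
    interpret net_code h1 h2 h3 P S U src g gr ul dl \<rho> \<rho>s N k kc H p \<gamma> B \<kappa> \<kappa>s \<phi> M \<tau> \<tau>
    proof unfold_locales
      fix s u assume su: "s \<in> S" "u \<in> U s"
      show "\<kappa>s (src s u) = \<kappa> s" using src_rate[OF su] by (simp add: \<kappa>s_def \<kappa>_def)
    next
      fix s assume s: "s \<in> S"
      then obtain u where u: "u \<in> U s" using U_nonempty by blast
      have "src s u \<in> yc_pairs \<times> {..<3}" using src_pair[OF s u] src_kind[OF s u] by (simp add: mem_Times_iff)
      from ky[OF this] show "kc + \<kappa> s \<le> k" using src_rate[OF s u] by (simp add: \<kappa>s_def \<kappa>_def)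
    next
      fix y assume "\<rho>s y = 0"
      thus "\<kappa>s y = 0" by (simp add: \<kappa>s_def)
    qed (use N \<phi> in \<open>auto simp: M_def\<close>)
    have loss: "E.loss \<le> exp (3 * \<delta>) ^ N"
      unfolding E.loss_def using kc2 p2 by (simp add: field_simps)
    have T: "card E.Shp > 0"
    proof -
      have "0 < real p ^ N * exp \<delta> ^ N" using p2 by simp
      hence "0 < real p ^ kc * real (card (shaping N H \<gamma>))" using kc1 by linarith
      thus ?thesis unfolding E.Shp_def by (simp add: zero_less_mult_iff)
    qed
    have enc: "real p ^ N / (real p ^ kc * real (card E.Shp)) \<le> exp (- \<delta>) ^ N"
    proof -
      have "real p ^ N * exp \<delta> ^ N * exp (- \<delta>) ^ N \<le> real p ^ kc * real (card E.Shp) * exp (- \<delta>) ^ N"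
        unfolding E.Shp_def using kc1 by (intro mult_right_mono) auto
      moreover have "exp \<delta> ^ N * exp (- \<delta>) ^ N = 1" unfolding power_mult_distrib[symmetric] mult_exp_exp by simp
      ultimately have "real p ^ N \<le> real p ^ kc * real (card E.Shp) * exp (- \<delta>) ^ N" by (simp add: mult.assoc)
      thus ?thesis using T p2 by (simp add: divide_le_eq mult_ac)
    qed
    have e1: "exp (3 * \<delta>) ^ N \<ge> 1" using \<delta> by (intro one_le_power) simp
    have lossK: "E.loss ^ ?K \<le> (exp (3 * \<delta>) ^ N) ^ ?K" using loss E.loss_nonneg by (rule power_mono)
    have aN: "a ^ N = (exp (3 * \<delta>) ^ N) ^ (?K + 1) * w ^ N"
      by (simp add: a_def power_mult_distrib power_mult[symmetric] mult.commute)
    have bc: "E.loss ^ ?K * x ^ N \<le> a ^ N" if "0 \<le> x" "x \<le> w" for x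
    proof -
      have "E.loss ^ ?K * x ^ N \<le> (exp (3 * \<delta>) ^ N) ^ ?K * w ^ N"
        by (rule mult_mono[OF lossK power_mono[OF that(2,1)]]) (use that in auto)
      also have "\<dots> \<le> (exp (3 * \<delta>) ^ N) ^ (?K + 1) * w ^ N"
        using e1 w by (intro mult_right_mono power_increasing) auto
      finally show ?thesis unfolding aN .
    qed
    have bd: "E.loss ^ ?K * (E.loss * real p ^ \<kappa> s * (sqrt (\<tau> s) + 2 * \<gamma>) ^ N) \<le> real p * a ^ N" if s: "s \<in> S" for s
    proof -
      have "real p ^ \<kappa> s \<le> real p * 2 powr (real N * \<rho> s)"
        unfolding \<kappa>_def using p2 rate_pos[OF s] by (intro digits_bounds) auto
      also have "2 powr (real N * \<rho> s) = (2 powr \<rho> s) ^ N" by (simp add: powr_realpow[symmetric] powr_powr mult.commute)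
      finally have "real p ^ \<kappa> s * (sqrt (\<tau> s) + 2 * \<gamma>) ^ N \<le> real p * (2 powr \<rho> s) ^ N * (sqrt (\<tau> s) + 2 * \<gamma>) ^ N"
        using \<theta> \<gamma> by (intro mult_right_mono) (auto simp: sqrt_\<tau>)
      also have "\<dots> = real p * (2 powr \<rho> s * (sqrt (\<tau> s) + 2 * \<gamma>)) ^ N" by (simp add: power_mult_distrib)
      \<comment> \<open>The rate cancels against the square root of the threshold, up to sqrt
        \<theta> and the discretisation term.\<close>
      also have "2 powr \<rho> s * (sqrt (\<tau> s) + 2 * \<gamma>) = sqrt \<theta> + 2 * \<gamma> * 2 powr \<rho> s"
      proof -
        have "2 powr \<rho> s * 2 powr (- \<rho> s) = 1" by (simp add: powr_add[symmetric])
        thus ?thesis unfolding sqrt_\<tau> by (simp add: algebra_simps)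
      qed
      also have "real p * (sqrt \<theta> + 2 * \<gamma> * 2 powr \<rho> s) ^ N \<le> real p * w ^ N"
        using \<gamma>w[OF s] \<theta> \<gamma> by (intro mult_left_mono power_mono) auto
      finally have x: "real p ^ \<kappa> s * (sqrt (\<tau> s) + 2 * \<gamma>) ^ N \<le> real p * w ^ N" .
      have "E.loss ^ ?K * (E.loss * (real p ^ \<kappa> s * (sqrt (\<tau> s) + 2 * \<gamma>) ^ N)) \<le> (exp (3 * \<delta>) ^ N) ^ ?K * (exp (3 * \<delta>) ^ N * (real p * w ^ N))"
        using \<theta> \<gamma> E.loss_nonneg
        by (intro mult_mono[OF lossK mult_mono[OF loss x]]) (auto simp: sqrt_\<tau> intro!: mult_nonneg_nonneg)
      also have "\<dots> = real p * a ^ N" unfolding aN by simp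
      finally show ?thesis by (simp only: mult.assoc)
    qed
    have badp: "E.avg (\<lambda>\<omega>. badp n \<omega> m l) \<le> tot N" if l: "l < B" for m l
    proof -
      have "E.avg (\<lambda>\<omega>. badp n \<omega> m l) \<le> real ?K * (real p ^ N / (real p ^ kc * real (card E.Shp)))
     + (\<Sum>l<length ul. E.loss ^ ?K * chernoff_base (nu_up l) (\<tau> (ul!l)) ^ N + E.loss ^ ?K * (E.loss * real p ^ \<kappa> (ul!l) * (sqrt (\<tau> (ul!l)) + 2 * \<gamma>) ^ N))
     + (\<Sum>u\<in>yc_users. \<Sum>l<length (dl u). E.loss ^ ?K * chernoff_base (nu_dn u l) (\<tau> (dl u!l)) ^ N + E.loss ^ ?K * (E.loss * real p ^ \<kappa> (dl u!l) * (sqrt (\<tau> (dl u!l)) + 2 * \<gamma>) ^ N))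
     + 4 * (E.loss ^ ?K * chernoff_base pe P ^ N)"
        by (rule avg_badp[OF nN l tu td pe pe3 T])
      also have "\<dots> \<le> real ?K * exp (- \<delta>) ^ N + (\<Sum>l<length ul. a ^ N + real p * a ^ N) + (\<Sum>u\<in>yc_users. \<Sum>l<length (dl u). a ^ N + real p * a ^ N) + 4 * a ^ N"
      proof (intro add_mono sum_mono mult_left_mono enc)
        fix l assume "l \<in> {..<length ul}"
        hence l: "l < length ul" by simp
        show "E.loss ^ ?K * chernoff_base (nu_up l) (\<tau> (ul!l)) ^ N \<le> a ^ N"
          using l by (intro bc chernoff_base_nonneg nu_up_pos tu less_imp_le[OF wx]) auto
        show "E.loss ^ ?K * (E.loss * real p ^ \<kappa> (ul!l) * (sqrt (\<tau> (ul!l)) + 2 * \<gamma>) ^ N) \<le> real p * a ^ N" by (rule bd[OF mem_ul[OF l]])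
      next
        fix u l assume u: "u \<in> yc_users" and "l \<in> {..<length (dl u)}"
        hence l: "l < length (dl u)" by simp
        have "chernoff_base (nu_dn u l) (\<tau> (dl u!l)) \<in> ?Y"
          by (rule insertI2, rule insertI2, rule UnI2, rule image_eqI[of _ _ "(u,l)"]) (use u l in auto)
        thus "E.loss ^ ?K * chernoff_base (nu_dn u l) (\<tau> (dl u!l)) ^ N \<le> a ^ N"
          by (intro bc chernoff_base_nonneg nu_dn_pos td[OF u l] less_imp_le[OF wx])
        show "E.loss ^ ?K * (E.loss * real p ^ \<kappa> (dl u!l) * (sqrt (\<tau> (dl u!l)) + 2 * \<gamma>) ^ N) \<le> real p * a ^ N" by (rule bd[OF mem_dl[OF u l]])
      next
        show "E.loss ^ ?K * chernoff_base pe P ^ N \<le> a ^ N" by (intro bc chernoff_base_nonneg pe less_imp_le[OF wx]) simp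
      qed auto
      also have "\<dots> = tot N" by (simp add: tot_def L_def sum_distrib_right sum_distrib_left algebra_simps)
      finally show ?thesis .
    qed
    have cM: "card (yc_msgs M) > 0" by (rule card_yc_msgs_pos[OF M_pos])
    have "E.avg (\<lambda>\<omega>. yc_perr h1 h2 h3 n M (cenc \<omega>) (crel \<omega>) (cdec \<omega>)) \<le> E.avg (\<lambda>\<omega>. \<Sum>m\<in>yc_msgs M. \<Sum>l<B. (1 / real (card (yc_msgs M))) * badp n \<omega> m l)"
    proof (rule E.avg_mono)
      fix \<omega>
      have "yc_perr h1 h2 h3 n M (cenc \<omega>) (crel \<omega>) (cdec \<omega>) \<le> (\<Sum>m\<in>yc_msgs M. \<Sum>l<B. badp n \<omega> m l) / real (card (yc_msgs M))"
        unfolding yc_perr_def by (intro divide_right_mono sum_mono error_prob[OF _ nN]) auto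
      thus "yc_perr h1 h2 h3 n M (cenc \<omega>) (crel \<omega>) (cdec \<omega>) \<le> (\<Sum>m\<in>yc_msgs M. \<Sum>l<B. (1 / real (card (yc_msgs M))) * badp n \<omega> m l)"
        by (simp add: sum_divide_distrib)
    qed
    also have "\<dots> = (\<Sum>m\<in>yc_msgs M. \<Sum>l<B. (1 / real (card (yc_msgs M))) * E.avg (\<lambda>\<omega>. badp n \<omega> m l))"
      by (simp only: E.avg_sum E.avg_cmult)
    also have "\<dots> \<le> (\<Sum>m\<in>yc_msgs M. \<Sum>l<B. (1 / real (card (yc_msgs M))) * tot N)"
      using badp by (intro sum_mono mult_left_mono) auto
    also have "\<dots> = real B * tot N" using cM by (simp add: card_gt_0_iff)
    also have "\<dots> \<le> \<epsilon>" using Nt by simp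
    finally obtain \<omega> where "yc_perr h1 h2 h3 n M (cenc \<omega>) (crel \<omega>) (cdec \<omega>) \<le> \<epsilon>"
      using E.avg_le_imp_ex by blast
    moreover have "yc_code h1 h2 h3 P n M (cenc \<omega>) (crel \<omega>) (cdec \<omega>)" by (rule code_valid[OF nN])
    ultimately show ?case unfolding M_def by blast
  qed
  thus "\<exists>N. \<forall>n\<ge>N. \<exists>enc rel dec.
        yc_code h1 h2 h3 P n (\<lambda>p. nat \<lceil>2 powr (real n * R p)\<rceil>) enc rel dec \<and>
        yc_perr h1 h2 h3 n (\<lambda>p. nat \<lceil>2 powr (real n * R p)\<rceil>) enc rel dec \<le> \<epsilon>"
    unfolding eventually_sequentially .
qed

end

section \<open>From power allocations to a network with strict margins\<close>

fun after :: "'a \<Rightarrow> 'a list \<Rightarrow> 'a list" where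
  "after s [] = []"
| "after s (x # xs) = (if x = s then xs else after s xs)"

text \<open>The order of a receiver is a sublist of the full order, so what it has not yet decoded
  lies behind the current stream in the full order too.\<close>

lemma after_filter_nth:
  assumes "distinct xs" "l < length (filter Q xs)"
  shows "set (filter Q xs) - set (take (Suc l) (filter Q xs)) \<subseteq> set (after (filter Q xs ! l) xs)"
  using assms
proof (induction xs arbitrary: l)
  case (Cons x xs)
  show ?case
  proof (cases "Q x")
    case True
    show ?thesis
    proof (cases l)
      case 0
      thus ?thesis using True by auto
    next
      case (Suc l')
      have l': "l' < length (filter Q xs)" using Cons.prems True Suc by simp
      have "filter Q xs ! l' \<in> set xs" using nth_mem[OF l'] by auto
      hence "x \<noteq> filter Q xs ! l'" using Cons.prems by auto
      thus ?thesis using True Suc Cons.IH[OF _ l'] Cons.prems by auto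
    qed
  next
    case False
    hence l: "l < length (filter Q xs)" using Cons.prems by simp
    have "filter Q xs ! l \<in> set xs" using nth_mem[OF l] by auto
    hence "x \<noteq> filter Q xs ! l" using Cons.prems by auto
    thus ?thesis using False Cons.IH[OF _ l] Cons.prems by auto
  qed
qed simp

text \<open>Dividing \<open>rate\<close> by m N gives 2^(2 r) \<le> T / N + 1 / m, the inverse of
  the effective noise variance. Lowering the rate by \<eta> gains \<theta>^2 with \<theta> =
  2^(-\<eta>); scaling the power by \<theta> uses up one factor only, and the noise term makes the
  result strict.\<close>

lemma mmse_energy_rate:
  fixes m T N N' r \<eta> :: real
  assumes m: "m > 0" and T: "T \<ge> 0" and N': "1 \<le> N'" "N' \<le> N" and \<eta>: "\<eta> > 0"
    and rate: "2 powr (2 * r) * (m * N) \<le> m * T + N"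
  shows "2 powr (2 * (r - \<eta>)) * mmse_energy m (sqrt (2 powr (- \<eta>) * T)) N' < 1"
proof -
  define \<theta> :: real where "\<theta> = 2 powr (- \<eta>)"
  have \<theta>: "0 < \<theta>" "\<theta> < 1" using \<eta> by (auto simp: \<theta>_def powr_less_one)
  define D where "D = m * (\<theta> * T) + N'"
  have D: "D > 0" unfolding D_def using m T N' \<theta> by (intro add_nonneg_pos) auto
  have N: "N > 0" using N' by simp
  have sq: "(sqrt (\<theta> * T))\<^sup>2 = \<theta> * T" using \<theta> T by simp
  have "2 powr (2 * (r - \<eta>)) = 2 powr (2 * r) * \<theta>\<^sup>2"
    by (simp add: \<theta>_def power2_eq_square powr_add[symmetric] right_diff_distrib)
  hence "2 powr (2 * (r - \<eta>)) * mmse_energy m (sqrt (\<theta> * T)) N' = \<theta>\<^sup>2 * (2 powr (2 * r) * (m * N')) / D"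
    unfolding mmse_energy_def sq D_def by (simp only: times_divide_eq_right mult_ac)
  also have "\<dots> < 1"
  proof -
    have "2 powr (2 * r) * (m * N') * N = (2 powr (2 * r) * (m * N)) * N'" by (simp add: mult_ac)
    also have "\<dots> \<le> (m * T + N) * N'" using rate N' by (intro mult_right_mono) auto
    also have "\<dots> = m * T * N' + N' * N" by (simp add: algebra_simps)
    also have "\<dots> \<le> m * T * N + N' * N" using N' m T by (intro add_mono mult_left_mono) auto
    finally have "2 powr (2 * r) * (m * N') * N \<le> (m * T + N') * N" by (simp add: algebra_simps)
    hence "2 powr (2 * r) * (m * N') \<le> m * T + N'" using N by simp
    hence "\<theta>\<^sup>2 * (2 powr (2 * r) * (m * N')) \<le> \<theta>\<^sup>2 * (m * T + N')" by (intro mult_left_mono) auto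
    also have "\<dots> = \<theta> * (m * (\<theta> * T)) + \<theta>\<^sup>2 * N'" by (simp add: power2_eq_square algebra_simps)
    also have "\<dots> \<le> m * (\<theta> * T) + \<theta>\<^sup>2 * N'"
      using \<theta> m T by (simp add: mult_left_le_one_le)
    also have "\<dots> < D"
    proof -
      have "\<theta>\<^sup>2 < 1" using \<theta> by (simp add: power_less_one_iff abs_square_less_1)
      hence "\<theta>\<^sup>2 * N' < 1 * N'" using N' by (intro mult_strict_right_mono) auto
      thus ?thesis by (simp add: D_def)
    qed
    finally show ?thesis using D by simp
  qed
  finally show ?thesis by (simp add: \<theta>_def)
qed

text \<open>The downlink is degraded: passing from the gain a to b multiplies signal and
  interference by t = b^2 / a^2 \<ge> 1 but not the receiver noise, so a rate that the weak user
  supports is supported by the strong one. A positive rate forces a \<noteq> 0.\<close>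

lemma scaled_gain_rate:
  fixes a b r Q X :: real
  assumes "a\<^sup>2 \<le> b\<^sup>2" "r > 0" "X \<ge> 0"
    and "2 powr (2 * r) * (1 * (1 + a\<^sup>2 * X)) \<le> 1 * (a\<^sup>2 * Q) + (1 + a\<^sup>2 * X)"
  shows "2 powr (2 * r) * (1 * (1 + b\<^sup>2 * X)) \<le> 1 * (b\<^sup>2 * Q) + (1 + b\<^sup>2 * X)" and "a \<noteq> 0"
proof -
  define z where "z = 2 powr (2 * r) - 1"
  have z: "z > 0" using assms(2) by (simp add: z_def)
  have 1: "z * (1 + a\<^sup>2 * X) \<le> a\<^sup>2 * Q" using assms(4) by (simp add: z_def algebra_simps)
  show a: "a \<noteq> 0" using 1 z by auto
  define t where "t = b\<^sup>2 / a\<^sup>2"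
  have t: "t \<ge> 1" "t * a\<^sup>2 = b\<^sup>2" using a assms(1) by (auto simp: t_def field_simps)
  have "t * (z * (1 + a\<^sup>2 * X)) \<le> t * (a\<^sup>2 * Q)" using 1 t by (intro mult_left_mono) auto
  moreover have "t * (z * (1 + a\<^sup>2 * X)) = z * (t + b\<^sup>2 * X)" unfolding t(2)[symmetric] by (simp add: algebra_simps)
  moreover have "t * (a\<^sup>2 * Q) = b\<^sup>2 * Q" unfolding t(2)[symmetric] by (simp add: algebra_simps)
  moreover have "z * (1 + b\<^sup>2 * X) \<le> z * (t + b\<^sup>2 * X)" using t z by (intro mult_left_mono) auto
  ultimately have "z * (1 + b\<^sup>2 * X) \<le> b\<^sup>2 * Q" by linarith
  thus "2 powr (2 * r) * (1 * (1 + b\<^sup>2 * X)) \<le> 1 * (b\<^sup>2 * Q) + (1 + b\<^sup>2 * X)" by (simp add: z_def algebra_simps)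
qed

text \<open>Weak inequalities become the strict ones of \<open>yc_net\<close> by lowering rates by
  \<eta>, scaling powers by \<theta> and dropping streams of rate at most \<eta>. User u decodes the
  streams with u \<le> \<open>w s\<close>, where \<open>w s\<close> is the weakest user that decodes
  s; the downlink condition is stated for this user alone.\<close>

lemma achievable_of_powers:
  fixes h1 h2 h3 P \<delta> :: real and upL dnL :: "nat list" and U :: "nat \<Rightarrow> nat set"
    and src :: "nat \<Rightarrow> nat \<Rightarrow> (nat \<times> nat) \<times> nat" and T Q r :: "nat \<Rightarrow> real" and w :: "nat \<Rightarrow> nat"
    and rs :: "(nat \<times> nat) \<times> nat \<Rightarrow> real"
  defines "hg \<equiv> yc_gain h1 h2 h3"
  assumes P: "P > 0" and \<delta>: "\<delta> > 0"
    and dist: "distinct upL" "distinct dnL" "set dnL = set upL"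
    and U: "\<And>s. s \<in> set upL \<Longrightarrow> U s \<subseteq> yc_users" "\<And>s. s \<in> set upL \<Longrightarrow> U s \<noteq> {}" "\<And>s. s \<in> set upL \<Longrightarrow> card (U s) \<le> 2"
    and src: "\<And>s u. s \<in> set upL \<Longrightarrow> u \<in> U s \<Longrightarrow> fst (fst (src s u)) = u"
      "\<And>s u. s \<in> set upL \<Longrightarrow> u \<in> U s \<Longrightarrow> fst (src s u) \<in> yc_pairs"
      "\<And>s u. s \<in> set upL \<Longrightarrow> u \<in> U s \<Longrightarrow> snd (src s u) < 3"
      "\<And>s u. s \<in> set upL \<Longrightarrow> u \<in> U s \<Longrightarrow> rs (src s u) = r s"
    and T: "\<And>s. s \<in> set upL \<Longrightarrow> T s \<ge> 0" and Q: "\<And>s. s \<in> set upL \<Longrightarrow> Q s \<ge> 0"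
    and gains: "\<And>s u. s \<in> set upL \<Longrightarrow> u \<in> U s \<Longrightarrow> T s > 0 \<Longrightarrow> hg u \<noteq> 0"
    and w: "\<And>s s'. s \<in> set upL \<Longrightarrow> s' \<in> set upL \<Longrightarrow> w s' < w s \<Longrightarrow> s' \<in> set (after s dnL)"
    and mono: "\<And>s u. s \<in> set upL \<Longrightarrow> u \<in> yc_users \<Longrightarrow> u \<le> w s \<Longrightarrow> (hg (w s))\<^sup>2 \<le> (hg u)\<^sup>2"
    and up: "\<And>s. s \<in> set upL \<Longrightarrow> r s > 0 \<Longrightarrow>
       2 powr (2 * r s) * (real (card (U s)) * (1 + (\<Sum>s'\<in>set (after s upL). real (card (U s')) * T s')))
         \<le> real (card (U s)) * T s + (1 + (\<Sum>s'\<in>set (after s upL). real (card (U s')) * T s'))"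
    and dn: "\<And>s. s \<in> set upL \<Longrightarrow> r s > 0 \<Longrightarrow>
       2 powr (2 * r s) * (1 * (1 + (hg (w s))\<^sup>2 * (\<Sum>s'\<in>set (after s dnL). Q s')))
         \<le> 1 * ((hg (w s))\<^sup>2 * Q s) + (1 + (hg (w s))\<^sup>2 * (\<Sum>s'\<in>set (after s dnL). Q s'))"
    and upow: "\<And>u. u \<in> yc_users \<Longrightarrow> (\<Sum>s\<in>{s\<in>set upL. u \<in> U s}. T s / (hg u)\<^sup>2) \<le> P"
    and rpow: "(\<Sum>s\<in>set upL. Q s) \<le> P"
    and Tpos: "\<And>s. s \<in> set upL \<Longrightarrow> r s > 0 \<Longrightarrow> T s > 0"
    and decodable: "\<And>u (q::nat) x x' j e. u \<in> yc_users \<Longrightarrow> j \<in> yc_users \<Longrightarrow> j \<noteq> u \<Longrightarrow> e < 3 \<Longrightarrow>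
       (\<And>y. fst (fst y) = u \<Longrightarrow> x y = x' y) \<Longrightarrow>
       (\<And>s. s \<in> set upL \<Longrightarrow> u \<le> w s \<Longrightarrow> [(\<Sum>i\<in>U s. x (src s i)) = (\<Sum>i\<in>U s. x' (src s i))] (mod int q)) \<Longrightarrow>
       [x ((j,u),e) = x' ((j,u),e)] (mod int q)"
  shows "yc_achievable h1 h2 h3 P (\<lambda>q. (\<Sum>e<3. rs (q, e)) - \<delta>)"
proof -
  \<comment> \<open>A message has three parts, each losing at most \<eta>, and 3 \<eta> < \<delta>
    keeps the final inequality strict.\<close>
  define \<eta> where "\<eta> = \<delta> / 4"
  have \<eta>: "\<eta> > 0" using \<delta> by (simp add: \<eta>_def)
  define \<theta> :: real where "\<theta> = 2 powr (- \<eta>)"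
  have \<theta>: "0 < \<theta>" "\<theta> < 1" using \<eta> by (auto simp: \<theta>_def powr_less_one)
  define S where "S = {s \<in> set upL. r s > \<eta>}"
  define ul where "ul = filter (\<lambda>s. r s > \<eta>) upL"
  define dl where "dl = (\<lambda>u. filter (\<lambda>s. r s > \<eta> \<and> u \<le> w s) dnL)"
  define \<rho> where "\<rho> = (\<lambda>s. r s - \<eta>)"
  define \<rho>s where "\<rho>s = (\<lambda>y. max 0 (rs y - \<eta>))"
  define g where "g = (\<lambda>s. sqrt (\<theta> * T s))"
  define gr where "gr = (\<lambda>s. sqrt (\<theta> * Q s))"
  have SU: "s \<in> S \<Longrightarrow> s \<in> set upL" and Sr: "s \<in> S \<Longrightarrow> r s > 0" for s using \<eta> by (auto simp: S_def)
  \<comment> \<open>A positive downlink rate needs positive relay power, as \<open>yc_net\<close>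
    demands of every active stream.\<close>
  have Qpos: "Q s > 0" if "s \<in> S" for s
  proof -
    define X where "X = (\<Sum>s'\<in>set (after s dnL). Q s')"
    have "set (after s dnL) \<subseteq> set dnL" by (induction dnL) auto
    hence X: "X \<ge> 0" unfolding X_def using Q dist(3) by (intro sum_nonneg) auto
    have "0 < 2 powr (2 * r s) - 1" using Sr[OF that] by simp
    hence "0 < (2 powr (2 * r s) - 1) * (1 + (hg (w s))\<^sup>2 * X)"
      using X by (intro mult_pos_pos add_pos_nonneg mult_nonneg_nonneg) auto
    also have "\<dots> \<le> (hg (w s))\<^sup>2 * Q s" using dn[OF SU[OF that] Sr[OF that]] unfolding X_def[symmetric] by (simp add: algebra_simps)
    finally show ?thesis using Q[OF SU[OF that]] by (cases "Q s = 0") auto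
  qed
  interpret yc_net h1 h2 h3 P S U src g gr ul dl \<rho> \<rho>s
  proof (unfold_locales, fold hg_def)
    show "0 < P" by (rule P)
    show "finite S" by (simp add: S_def)
    show "set ul = S" "distinct ul" using dist by (auto simp: ul_def S_def)
  next
    fix s assume s: "s \<in> S"
    show "U s \<subseteq> yc_users" "U s \<noteq> {}" "card (U s) \<le> 2" using U[OF SU[OF s]] by auto
    show "0 < g s" using Tpos[OF SU[OF s] Sr[OF s]] \<theta> by (simp add: g_def)
    show "0 < gr s" using Qpos[OF s] \<theta> by (simp add: gr_def)
    show "0 < \<rho> s" using s by (simp add: \<rho>_def S_def)
    fix u assume u: "u \<in> U s"
    show "hg u \<noteq> 0" by (rule gains[OF SU[OF s] u Tpos[OF SU[OF s] Sr[OF s]]])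
    show "fst (fst (src s u)) = u" "fst (src s u) \<in> yc_pairs" "snd (src s u) < 3" using src[OF SU[OF s] u] by auto
    show "\<rho>s (src s u) = \<rho> s" using src(4)[OF SU[OF s] u] s by (simp add: \<rho>s_def \<rho>_def S_def)
  next
    fix y show "0 \<le> \<rho>s y" by (simp add: \<rho>s_def)
  next
    fix u assume u: "u \<in> yc_users"
    show "set (dl u) \<subseteq> S" using dist by (auto simp: dl_def S_def)
    show "distinct (dl u)" using dist by (simp add: dl_def)
    have T0: "T s / (hg u)\<^sup>2 \<ge> 0" if "s \<in> set upL" for s using T[OF that] by simp
    have "(\<Sum>s\<in>{s \<in> S. u \<in> U s}. (g s / hg u)\<^sup>2) = \<theta> * (\<Sum>s\<in>{s \<in> S. u \<in> U s}. T s / (hg u)\<^sup>2)"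
      unfolding sum_distrib_left
    proof (rule sum.cong[OF refl])
      fix s assume "s \<in> {s \<in> S. u \<in> U s}"
      hence "T s \<ge> 0" using T SU by auto
      thus "(g s / hg u)\<^sup>2 = \<theta> * (T s / (hg u)\<^sup>2)" using \<theta> by (simp add: g_def power_divide)
    qed
    also have "\<dots> \<le> \<theta> * P"
    proof -
      have "(\<Sum>s\<in>{s \<in> S. u \<in> U s}. T s / (hg u)\<^sup>2) \<le> (\<Sum>s\<in>{s\<in>set upL. u \<in> U s}. T s / (hg u)\<^sup>2)"
        using T0 by (intro sum_mono2) (auto simp: S_def)
      thus ?thesis using upow[OF u] \<theta> by (intro mult_left_mono) auto
    qed
    also have "\<dots> < P" using \<theta> P by simp
    finally show "(\<Sum>s\<in>{s \<in> S. u \<in> U s}. (g s / hg u)\<^sup>2) < P" .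
    have gz: "hg u \<noteq> 0" if s: "s \<in> set (dl u)" for s
    proof -
      have su: "s \<in> set upL" "r s > 0" "u \<le> w s" using s dist \<eta> by (auto simp: dl_def)
      have "set (after s dnL) \<subseteq> set dnL" by (induction dnL) auto
      hence "(\<Sum>s'\<in>set (after s dnL). Q s') \<ge> 0" using Q dist(3) by (intro sum_nonneg) auto
      from scaled_gain_rate(2)[OF order_refl su(2) this dn[OF su(1,2)]] have "hg (w s) \<noteq> 0" .
      thus ?thesis using mono[OF su(1) u su(3)] by auto
    qed
    show "hg u \<noteq> 0" if "dl u \<noteq> []" using gz[of "hd (dl u)"] that by simp
    fix l assume l: "l < length (dl u)"
    define s where "s = dl u ! l"
    have sd: "s \<in> set (dl u)" unfolding s_def using l by (rule nth_mem)
    have su: "s \<in> set upL" "r s > 0" "u \<le> w s" using sd dist \<eta> by (auto simp: dl_def)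
    \<comment> \<open>A stream that u skips has weakest user below u and hence below
      \<open>w s\<close>; by \<open>w\<close> it comes after s and is counted among the interference
      already.\<close>
    have "S - set (take (Suc l) (dl u)) \<subseteq> set (after s dnL)"
    proof
      fix s' assume s': "s' \<in> S - set (take (Suc l) (dl u))"
      show "s' \<in> set (after s dnL)"
      proof (cases "u \<le> w s'")
        case True
        hence "s' \<in> set (dl u) - set (take (Suc l) (dl u))" using s' dist by (auto simp: dl_def S_def)
        thus ?thesis using after_filter_nth[OF dist(2), of l "\<lambda>s. r s > \<eta> \<and> u \<le> w s"] l unfolding dl_def s_def by blast
      next
        case False
        thus ?thesis using w[OF su(1), of s'] su(3) s' by (auto simp: S_def)
      qed
    qed
    moreover have af: "set (after s dnL) \<subseteq> set upL" unfolding dist(3)[symmetric] by (induction dnL) auto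
    ultimately have "(\<Sum>s'\<in>S - set (take (Suc l) (dl u)). Q s') \<le> (\<Sum>s'\<in>set (after s dnL). Q s')"
      using Q by (intro sum_mono2) auto
    moreover have "(\<Sum>s'\<in>S - set (take (Suc l) (dl u)). (hg u * gr s')\<^sup>2) = \<theta> * ((hg u)\<^sup>2 * (\<Sum>s'\<in>S - set (take (Suc l) (dl u)). Q s'))"
      unfolding sum_distrib_left
    proof (rule sum.cong[OF refl])
      fix s' assume "s' \<in> S - set (take (Suc l) (dl u))"
      hence "Q s' \<ge> 0" using Q SU by auto
      thus "(hg u * gr s')\<^sup>2 = \<theta> * ((hg u)\<^sup>2 * Q s')" using \<theta> by (simp add: gr_def power_mult_distrib)
    qed
    moreover have X0: "(\<Sum>s'\<in>set (after s dnL). Q s') \<ge> 0" using Q af by (intro sum_nonneg) auto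
    moreover have "0 \<le> (\<Sum>s'\<in>S - set (take (Suc l) (dl u)). Q s')" using Q SU by (intro sum_nonneg) auto
    ultimately have N': "(\<Sum>s'\<in>S - set (take (Suc l) (dl u)). (hg u * gr s')\<^sup>2) \<le> (hg u)\<^sup>2 * (\<Sum>s'\<in>set (after s dnL). Q s')"
      using \<theta> by (smt (verit) mult_left_mono mult_left_le_one_le mult_nonneg_nonneg zero_le_power2)
    have e: "mmse_energy 1 (hg u * gr s) n = mmse_energy 1 (sqrt (\<theta> * ((hg u)\<^sup>2 * Q s))) n" for n
      unfolding mmse_energy_def using \<theta> Q[OF su(1)] by (simp add: gr_def power_mult_distrib)
    have "2 powr (2 * (r s - \<eta>)) * mmse_energy 1 (sqrt (\<theta> * ((hg u)\<^sup>2 * Q s))) (1 + (\<Sum>s'\<in>S - set (take (Suc l) (dl u)). (hg u * gr s')\<^sup>2)) < 1"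
      unfolding \<theta>_def
    proof (rule mmse_energy_rate[OF _ _ _ _ \<eta> scaled_gain_rate(1)[OF mono[OF su(1) u su(3)] su(2) X0 dn[OF su(1,2)]]])
      show "0 \<le> (hg u)\<^sup>2 * Q s" using Q[OF su(1)] by simp
      show "1 \<le> 1 + (\<Sum>s'\<in>S - set (take (Suc l) (dl u)). (hg u * gr s')\<^sup>2)" by (simp add: sum_nonneg)
      show "1 + (\<Sum>s'\<in>S - set (take (Suc l) (dl u)). (hg u * gr s')\<^sup>2) \<le> 1 + (hg u)\<^sup>2 * (\<Sum>s'\<in>set (after s dnL). Q s')" using N' by simp
    qed simp
    thus "2 powr (2 * \<rho> (dl u ! l)) * mmse_energy 1 (hg u * gr (dl u ! l)) (1 + (\<Sum>s\<in>S - set (take (Suc l) (dl u)). (hg u * gr s)\<^sup>2)) < 1"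
      unfolding s_def[symmetric] \<rho>_def e .
  next
    fix l assume l: "l < length ul"
    define s where "s = ul ! l"
    have "s \<in> set ul" unfolding s_def using l by (rule nth_mem)
    hence su: "s \<in> set upL" "r s > 0" using \<eta> by (auto simp: ul_def)
    have "S = set ul" by (auto simp: ul_def S_def)
    hence sub: "S - set (take (Suc l) ul) \<subseteq> set (after s upL)"
      using after_filter_nth[OF dist(1), of l "\<lambda>s. r s > \<eta>"] l unfolding ul_def s_def by simp
    have af: "set (after s upL) \<subseteq> set upL" by (induction upL) auto
    have "(\<Sum>s'\<in>S - set (take (Suc l) ul). real (card (U s')) * (g s')\<^sup>2) \<le> (\<Sum>s'\<in>S - set (take (Suc l) ul). real (card (U s')) * T s')"
    proof (rule sum_mono)
      fix s' assume "s' \<in> S - set (take (Suc l) ul)"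
      hence "T s' \<ge> 0" using T SU by auto
      thus "real (card (U s')) * (g s')\<^sup>2 \<le> real (card (U s')) * T s'"
        using \<theta> by (intro mult_left_mono) (auto simp: g_def mult_left_le_one_le)
    qed
    also have "\<dots> \<le> (\<Sum>s'\<in>set (after s upL). real (card (U s')) * T s')"
      using T af by (intro sum_mono2 sub) (auto intro!: mult_nonneg_nonneg)
    finally have N': "(\<Sum>s'\<in>S - set (take (Suc l) ul). real (card (U s')) * (g s')\<^sup>2) \<le> (\<Sum>s'\<in>set (after s upL). real (card (U s')) * T s')" .
    have cU: "real (card (U s)) > 0" using U(1,2)[OF su(1)] finite_subset[OF _ finite_yc_users] by (simp add: card_gt_0_iff)
    have "2 powr (2 * (r s - \<eta>)) * mmse_energy (real (card (U s))) (sqrt (\<theta> * T s)) (1 + (\<Sum>s'\<in>S - set (take (Suc l) ul). real (card (U s')) * (g s')\<^sup>2)) < 1"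
      unfolding \<theta>_def
    proof (rule mmse_energy_rate[OF cU T[OF su(1)] _ _ \<eta> up[OF su]])
      show "1 \<le> 1 + (\<Sum>s'\<in>S - set (take (Suc l) ul). real (card (U s')) * (g s')\<^sup>2)" by (simp add: sum_nonneg)
      show "1 + (\<Sum>s'\<in>S - set (take (Suc l) ul). real (card (U s')) * (g s')\<^sup>2) \<le> 1 + (\<Sum>s'\<in>set (after s upL). real (card (U s')) * T s')" using N' by simp
    qed
    thus "2 powr (2 * \<rho> (ul ! l)) * mmse_energy (real (card (U (ul ! l)))) (g (ul ! l)) (1 + (\<Sum>s\<in>S - set (take (Suc l) ul). real (card (U s)) * (g s)\<^sup>2)) < 1"
      unfolding s_def[symmetric] \<rho>_def by (simp only: g_def)
  next
    have "(\<Sum>s\<in>S. (gr s)\<^sup>2) = \<theta> * (\<Sum>s\<in>S. Q s)" unfolding sum_distrib_left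
    proof (rule sum.cong[OF refl])
      fix s assume "s \<in> S"
      hence "Q s \<ge> 0" using Q SU by auto
      thus "(gr s)\<^sup>2 = \<theta> * Q s" using \<theta> by (simp add: gr_def)
    qed
    also have "\<dots> \<le> \<theta> * P"
    proof -
      have "(\<Sum>s\<in>S. Q s) \<le> (\<Sum>s\<in>set upL. Q s)" using Q by (intro sum_mono2) (auto simp: S_def)
      thus ?thesis using rpow \<theta> by (intro mult_left_mono) auto
    qed
    also have "\<dots> < P" using \<theta> P by simp
    finally show "(\<Sum>s\<in>S. (gr s)\<^sup>2) < P" .
  next
    fix u q :: nat and x x' :: "(nat \<times> nat) \<times> nat \<Rightarrow> int" and j e :: nat
    assume u: "u \<in> yc_users" "j \<in> yc_users" "j \<noteq> u" "e < 3" and own: "\<And>y. fst (fst y) = u \<Longrightarrow> x y = x' y"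
      and inact: "\<And>y. \<rho>s y = 0 \<Longrightarrow> x y = x' y"
      and sums: "\<And>s. s \<in> set (dl u) \<Longrightarrow> [(\<Sum>i\<in>U s. x (src s i)) = (\<Sum>i\<in>U s. x' (src s i))] (mod int q)"
    show "[x ((j,u),e) = x' ((j,u),e)] (mod int q)"
    proof (rule decodable[OF u own])
      fix s assume s: "s \<in> set upL" "u \<le> w s"
      show "[(\<Sum>i\<in>U s. x (src s i)) = (\<Sum>i\<in>U s. x' (src s i))] (mod int q)"
      proof (cases "r s > \<eta>")
        case True
        thus ?thesis using s dist by (intro sums) (simp add: dl_def)
      next
        \<comment> \<open>A dropped stream has parts of rate 0 in the network, on which both
          assignments agree.\<close>
        case False
        have "x (src s i) = x' (src s i)" if "i \<in> U s" for i
          using src(4)[OF s(1) that] False by (intro inact) (simp add: \<rho>s_def)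
        hence "(\<Sum>i\<in>U s. x (src s i)) = (\<Sum>i\<in>U s. x' (src s i))" by (intro sum.cong) auto
        thus ?thesis by simp
      qed
    qed
  qed
  show ?thesis
  proof (rule achievable)
    fix q
    have "(\<Sum>e<3. rs (q, e)) - 3 * \<eta> = (\<Sum>e<(3::nat). rs (q, e) - \<eta>)" by (simp add: sum_subtractf)
    also have "\<dots> \<le> (\<Sum>e<3. \<rho>s (q, e))" unfolding \<rho>s_def by (intro sum_mono) auto
    finally show "(\<Sum>e<3. rs (q, e)) - \<delta> < (\<Sum>e<3. \<rho>s (q, e))" using \<delta> by (simp add: \<eta>_def)
  qed
qed

section \<open>The thirteen streams\<close>

text \<open>Streams 0 to 12 are, in the uplink decoding order, 12u, 13u, 21u, 23u, 21c + 13c, 23c + 12c, 21b + 12b,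
  31u, 32u, 32c + 13c, 31c + 23c, 31b + 13b, 32b + 23b. Part kinds 0, 1, 2 stand for b, c, u. In the downlink, a stream
  is decoded by the users up to weakest_user.\<close>
definition up_order :: "nat list" where "up_order = [0,1,2,3,4,5,6,7,8,9,10,11,12]"
text \<open>Streams whose weakest decoder is user 3 precede those for user 2, and these precede
  those for user 1, so that each stronger user first strips off the layers meant for weaker
  ones.\<close>

definition dn_order :: "nat list" where "dn_order = [1,3,9,10,11,12,0,8,5,4,6,2,7]"
definition stream_users :: "nat \<Rightarrow> nat set" where
  "stream_users s = [{1},{1},{2},{2},{1,2},{1,2},{1,2},{3},{3},{1,3},{2,3},{1,3},{2,3}] ! s"
definition stream_src :: "nat \<Rightarrow> nat \<Rightarrow> (nat \<times> nat) \<times> nat" where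
  "stream_src s u = [((1,2),2), ((1,3),2), ((2,1),2), ((2,3),2),
     (if u = 2 then (2,1) else (1,3), 1), (if u = 1 then (1,2) else (2,3), 1), (if u = 2 then (2,1) else (1,2), 0),
     ((3,1),2), ((3,2),2),
     (if u = 3 then (3,2) else (1,3), 1), (if u = 2 then (2,3) else (3,1), 1),
     (if u = 3 then (3,1) else (1,3), 0), (if u = 3 then (3,2) else (2,3), 0)] ! s"
definition weakest_user :: "nat \<Rightarrow> nat" where "weakest_user s = [2,3,1,3,2,2,2,1,2,3,3,3,3] ! s"

lemma up_order_cases:
  assumes "s \<in> set up_order"
  shows "s = 0 \<or> s = 1 \<or> s = 2 \<or> s = 3 \<or> s = 4 \<or> s = 5 \<or> s = 6 \<or> s = 7 \<or> s = 8 \<or> s = 9 \<or> s = 10 \<or> s = 11 \<or> s = 12"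
  using assms by (simp add: up_order_def)

lemma stream_orders: "distinct up_order" "distinct dn_order" "set dn_order = set up_order"
  by (simp_all add: up_order_def dn_order_def) auto

lemma stream_users_props:
  assumes "s \<in> set up_order"
  shows "stream_users s \<subseteq> yc_users" "stream_users s \<noteq> {}" "card (stream_users s) \<le> 2"
  using up_order_cases[OF assms] by (elim disjE; simp add: stream_users_def yc_users_def)+

lemma stream_src_props:
  assumes "s \<in> set up_order" "u \<in> stream_users s"
  shows "fst (fst (stream_src s u)) = u" "fst (stream_src s u) \<in> yc_pairs" "snd (stream_src s u) < 3"
  using up_order_cases[OF assms(1)] assms(2)
  by (elim disjE; auto simp: stream_users_def stream_src_def yc_pairs_def yc_users_def)+

lemma weakest_user_order:
  assumes "s \<in> set up_order" "s' \<in> set up_order" "weakest_user s' < weakest_user s"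
  shows "s' \<in> set (after s dn_order)"
proof -
  have "\<forall>s\<in>set up_order. \<forall>s'\<in>set up_order. weakest_user s' < weakest_user s \<longrightarrow> s' \<in> set (after s dn_order)"
    by code_simp
  thus ?thesis using assms by blast
qed

lemma weakest_user_users: "s \<in> set up_order \<Longrightarrow> weakest_user s \<in> yc_users"
  by (drule up_order_cases, elim disjE) (simp_all add: weakest_user_def yc_users_def)

lemma cong_cancel_left:
  fixes a b a' b' :: int
  assumes "[a + b = a' + b'] (mod q)" "[a = a'] (mod q)"
  shows "[b = b'] (mod q)"
  using cong_diff[OF assms] by simp

text \<open>Bidirectional and one-way parts follow at once, by cancelling the own summand where
  there is one. Cyclic parts may need two steps: user 1 gets 23c from stream 5 with its own 12c and
  then 31c from stream 10; user 2 gets 13c from stream 4 with its own 21c and then 32c from stream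
  9.\<close>

lemma streams_decodable:
  fixes x x' :: "(nat \<times> nat) \<times> nat \<Rightarrow> int"
  assumes u: "u \<in> yc_users" and j: "j \<in> yc_users" "j \<noteq> u" and e: "e < 3"
    and own: "\<And>y. fst (fst y) = u \<Longrightarrow> x y = x' y"
    and sums: "\<And>s. s \<in> set up_order \<Longrightarrow> u \<le> weakest_user s \<Longrightarrow>
       [(\<Sum>i\<in>stream_users s. x (stream_src s i)) = (\<Sum>i\<in>stream_users s. x' (stream_src s i))] (mod q)"
  shows "[x ((j,u),e) = x' ((j,u),e)] (mod q)"
proof -
  have o: "[x ((u,i),e) = x' ((u,i),e)] (mod q)" for i e using own[of "((u,i),e)"] by simp
  note defs = up_order_def weakest_user_def stream_users_def stream_src_def
  have e3: "e = 0 \<or> e = 1 \<or> e = 2" using e by auto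
  consider "u = 1" | "u = 2" | "u = 3" using u by (auto simp: yc_users_def)
  thus ?thesis
  proof cases
    case 1
    have o: "[x ((1,i),e) = x' ((1,i),e)] (mod q)" for i e using o 1 by simp
    have s2: "[x ((2,1),2) = x' ((2,1),2)] (mod q)" using sums[of 2] 1 by (simp add: defs)
    have s7: "[x ((3,1),2) = x' ((3,1),2)] (mod q)" using sums[of 7] 1 by (simp add: defs)
    have "[x ((1,2),0) + x ((2,1),0) = x' ((1,2),0) + x' ((2,1),0)] (mod q)" using sums[of 6] 1 by (simp add: defs)
    from cong_cancel_left[OF this o] have s6: "[x ((2,1),0) = x' ((2,1),0)] (mod q)" .
    have "[x ((1,3),1) + x ((2,1),1) = x' ((1,3),1) + x' ((2,1),1)] (mod q)" using sums[of 4] 1 by (simp add: defs)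
    from cong_cancel_left[OF this o] have s4: "[x ((2,1),1) = x' ((2,1),1)] (mod q)" .
    have "[x ((1,3),0) + x ((3,1),0) = x' ((1,3),0) + x' ((3,1),0)] (mod q)" using sums[of 11] 1 by (simp add: defs)
    from cong_cancel_left[OF this o] have s11: "[x ((3,1),0) = x' ((3,1),0)] (mod q)" .
    have "[x ((1,2),1) + x ((2,3),1) = x' ((1,2),1) + x' ((2,3),1)] (mod q)" using sums[of 5] 1 by (simp add: defs)
    from cong_cancel_left[OF this o] have s5: "[x ((2,3),1) = x' ((2,3),1)] (mod q)" .
    have "[x ((2,3),1) + x ((3,1),1) = x' ((2,3),1) + x' ((3,1),1)] (mod q)" using sums[of 10] 1 by (simp add: defs)
    from cong_cancel_left[OF this s5] have s10: "[x ((3,1),1) = x' ((3,1),1)] (mod q)" .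
    have "j = 2 \<or> j = 3" using j 1 by (auto simp: yc_users_def)
    thus ?thesis using e3 1 s2 s7 s6 s4 s11 s10 by (elim disjE) simp_all
  next
    case 2
    have o: "[x ((2,i),e) = x' ((2,i),e)] (mod q)" for i e using o 2 by simp
    have s0: "[x ((1,2),2) = x' ((1,2),2)] (mod q)" using sums[of 0] 2 by (simp add: defs)
    have s8: "[x ((3,2),2) = x' ((3,2),2)] (mod q)" using sums[of 8] 2 by (simp add: defs)
    have "[x ((2,1),0) + x ((1,2),0) = x' ((2,1),0) + x' ((1,2),0)] (mod q)" using sums[of 6] 2 by (simp add: defs add.commute)
    from cong_cancel_left[OF this o] have s6: "[x ((1,2),0) = x' ((1,2),0)] (mod q)" .
    have "[x ((2,3),1) + x ((1,2),1) = x' ((2,3),1) + x' ((1,2),1)] (mod q)" using sums[of 5] 2 by (simp add: defs add.commute)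
    from cong_cancel_left[OF this o] have s5: "[x ((1,2),1) = x' ((1,2),1)] (mod q)" .
    have "[x ((2,3),0) + x ((3,2),0) = x' ((2,3),0) + x' ((3,2),0)] (mod q)" using sums[of 12] 2 by (simp add: defs)
    from cong_cancel_left[OF this o] have s12: "[x ((3,2),0) = x' ((3,2),0)] (mod q)" .
    have "[x ((2,1),1) + x ((1,3),1) = x' ((2,1),1) + x' ((1,3),1)] (mod q)" using sums[of 4] 2 by (simp add: defs add.commute)
    from cong_cancel_left[OF this o] have s4: "[x ((1,3),1) = x' ((1,3),1)] (mod q)" .
    have "[x ((1,3),1) + x ((3,2),1) = x' ((1,3),1) + x' ((3,2),1)] (mod q)" using sums[of 9] 2 by (simp add: defs)
    from cong_cancel_left[OF this s4] have s9: "[x ((3,2),1) = x' ((3,2),1)] (mod q)" .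
    have "j = 1 \<or> j = 3" using j 2 by (auto simp: yc_users_def)
    thus ?thesis using e3 2 s0 s8 s6 s5 s12 s9 by (elim disjE) simp_all
  next
    case 3
    have o: "[x ((3,i),e) = x' ((3,i),e)] (mod q)" for i e using o 3 by simp
    have s1: "[x ((1,3),2) = x' ((1,3),2)] (mod q)" using sums[of 1] 3 by (simp add: defs)
    have s3: "[x ((2,3),2) = x' ((2,3),2)] (mod q)" using sums[of 3] 3 by (simp add: defs)
    have "[x ((3,1),0) + x ((1,3),0) = x' ((3,1),0) + x' ((1,3),0)] (mod q)" using sums[of 11] 3 by (simp add: defs add.commute)
    from cong_cancel_left[OF this o] have s11: "[x ((1,3),0) = x' ((1,3),0)] (mod q)" .
    have "[x ((3,2),1) + x ((1,3),1) = x' ((3,2),1) + x' ((1,3),1)] (mod q)" using sums[of 9] 3 by (simp add: defs add.commute)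
    from cong_cancel_left[OF this o] have s9: "[x ((1,3),1) = x' ((1,3),1)] (mod q)" .
    have "[x ((3,2),0) + x ((2,3),0) = x' ((3,2),0) + x' ((2,3),0)] (mod q)" using sums[of 12] 3 by (simp add: defs add.commute)
    from cong_cancel_left[OF this o] have s12: "[x ((2,3),0) = x' ((2,3),0)] (mod q)" .
    have "[x ((3,1),1) + x ((2,3),1) = x' ((3,1),1) + x' ((2,3),1)] (mod q)" using sums[of 10] 3 by (simp add: defs add.commute)
    from cong_cancel_left[OF this o] have s10: "[x ((2,3),1) = x' ((2,3),1)] (mod q)" .
    have "j = 1 \<or> j = 2" using j 3 by (auto simp: yc_users_def)
    thus ?thesis using e3 3 s1 s3 s11 s9 s12 s10 by (elim disjE) simp_all
  qed
qed

section \<open>Rate constraints in exponential form, degenerate power, and the closure\<close>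

lemma Cg_rate:
  assumes r: "r > 0" "r \<le> Cg (T / Nf)" and N: "0 < N" "N \<le> Nf" and T: "T \<ge> 0"
  shows "2 powr (2 * r) * (1 * N) \<le> 1 * T + N"
proof -
  have x: "1 + T / Nf > 0" using T N by (intro add_pos_nonneg) auto
  have "2 * r \<le> log 2 (1 + T / Nf)" using r(2) by (simp add: Cg_def)
  hence "2 powr (2 * r) \<le> 1 + T / Nf" using x by (simp add: le_log_iff)
  hence 1: "(2 powr (2 * r) - 1) * Nf \<le> T" using N by (simp add: field_simps)
  have "(2 powr (2 * r) - 1) * N \<le> (2 powr (2 * r) - 1) * Nf"
    using N r(1) by (intro mult_left_mono) (auto simp: ge_one_powr_ge_zero)
  thus ?thesis using 1 by (simp add: algebra_simps)
qed

text \<open>A positive rate rules out the branch 0 of the maximum. The remaining 1/2 + T /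
  \<open>Nf\<close> is the inverse MMSE variance for two codewords; \<open>Nf\<close> is the
  denominator of the constraint and N the noise really present.\<close>

lemma Cplus_rate:
  assumes r: "r > 0" "r \<le> Cplus (T / Nf - 1/2)" and N: "0 < N" "N \<le> Nf" and T: "T \<ge> 0"
  shows "2 powr (2 * r) * (2 * N) \<le> 2 * T + N"
proof -
  have x: "1/2 + T / Nf > 0" using T N by (intro add_pos_nonneg) auto
  have "r \<le> Cg (T / Nf - 1/2)" using r by (auto simp: Cplus_def max_def split: if_splits)
  hence "2 * r \<le> log 2 (1/2 + T / Nf)" by (simp add: Cg_def)
  hence "2 powr (2 * r) \<le> 1/2 + T / Nf" using x by (simp add: le_log_iff)
  hence 1: "(2 powr (2 * r) - 1/2) * Nf \<le> T" using N by (simp add: field_simps)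
  have "2 powr (2 * r) \<ge> 1" using r(1) by (simp add: ge_one_powr_ge_zero)
  hence "(2 powr (2 * r) - 1/2) * N \<le> (2 powr (2 * r) - 1/2) * Nf"
    using N by (intro mult_left_mono) auto
  thus ?thesis using 1 by (simp add: algebra_simps)
qed

text \<open>At nonpositive rates every message set has one element, since a positive number at most
  1 rounds up to 1; silence and constant decoders suffice.\<close>

lemma trivial_achievable:
  assumes P: "P \<ge> 0" and R: "\<And>q. q \<in> yc_pairs \<Longrightarrow> R q \<le> 0"
  shows "yc_achievable h1 h2 h3 P R"
  unfolding yc_achievable_def
proof (intro allI impI exI[of _ "1::nat"])
  fix \<epsilon> :: real and n :: nat assume \<epsilon>: "\<epsilon> > 0" and n: "1 \<le> n"
  let ?M = "\<lambda>p. nat \<lceil>2 powr (real n * R p)\<rceil>"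
  let ?enc = "(\<lambda>_ _ _ _. 0) :: yc_enc" and ?rel = "(\<lambda>_ _. 0) :: yc_rel" and ?dec = "(\<lambda>_ _ _ _. 0) :: yc_dec"
  have M1: "?M q = 1" if "q \<in> yc_pairs" for q
  proof -
    have "2 powr (real n * R q) \<le> 2 powr 0" using R[OF that] by (intro powr_mono) (auto simp: mult_nonneg_nonpos)
    hence "\<lceil>2 powr (real n * R q)\<rceil> \<le> 1" by (simp add: ceiling_le_iff)
    moreover have "\<lceil>2 powr (real n * R q)\<rceil> > 0" by simp
    ultimately show ?thesis by linarith
  qed
  have c: "card (yc_msgs ?M) > 0" by (rule card_yc_msgs_pos) (simp add: M1)
  have tx: "yc_tx h1 h2 h3 ?enc ?rel m z k t = 0" for m z k t by (simp add: yc_tx_def)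
  have "yc_code h1 h2 h3 P n ?M ?enc ?rel ?dec"
    unfolding yc_code_def tx by simp
  moreover have "yc_perr h1 h2 h3 n ?M ?enc ?rel ?dec \<le> \<epsilon>"
  proof -
    have "\<not> yc_error h1 h2 h3 n ?enc ?rel ?dec m z" if m: "m \<in> yc_msgs ?M" for m z
    proof -
      have "m q = 0" if "q \<in> yc_pairs" for q
        using PiE_mem[OF m[unfolded yc_msgs_def] that] M1[OF that] by simp
      thus ?thesis by (auto simp: yc_error_def)
    qed
    hence "yc_perr h1 h2 h3 n ?M ?enc ?rel ?dec = 0" unfolding yc_perr_def by simp
    thus ?thesis using \<epsilon> by simp
  qed
  ultimately show "\<exists>enc rel dec. yc_code h1 h2 h3 P n ?M enc rel dec \<and> yc_perr h1 h2 h3 n ?M enc rel dec \<le> \<epsilon>" by blast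
qed

text \<open>In the product topology, lowering all coordinates by \<delta> converges back to R as
  \<delta> tends to 0.\<close>

lemma capacity_region_limit:
  assumes "\<And>\<delta>. \<delta> > 0 \<Longrightarrow> yc_achievable h1 h2 h3 P (\<lambda>q. R q - \<delta>)"
  shows "R \<in> yc_capacity_region h1 h2 h3 P"
proof -
  have lim: "((\<lambda>\<delta>::real. (\<lambda>q. R q - \<delta>)) \<longlongrightarrow> (\<lambda>q. R q - 0)) (at_right 0)"
  proof -
    have "continuous_on UNIV (\<lambda>\<delta>::real. (\<lambda>q. R q - \<delta>))"
      by (intro continuous_on_coordinatewise_then_product continuous_intros)
    hence "((\<lambda>\<delta>::real. (\<lambda>q. R q - \<delta>)) \<longlongrightarrow> (\<lambda>q. R q - 0)) (at 0)"
      unfolding continuous_on_def by (drule_tac bspec[OF _ UNIV_I[of 0]]) simp_all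
    thus ?thesis by (rule tendsto_within_subset) auto
  qed
  have "\<forall>\<^sub>F \<delta> in at_right (0::real). (\<lambda>q. R q - \<delta>) \<in> closure {R. yc_achievable h1 h2 h3 P R}"
    using eventually_at_right_less by (rule eventually_mono) (intro subsetD[OF closure_subset] CollectI assms)
  hence "(\<lambda>q. R q - 0) \<in> closure {R. yc_achievable h1 h2 h3 P R}"
    by (intro Lim_in_closed_set[OF closed_closure _ trivial_limit_at_right_real lim])
  thus ?thesis by (simp add: yc_capacity_region_def)
qed

lemma Cg_0 [simp]: "Cg 0 = 0"
  by (simp add: Cg_def)

text \<open>This is the rate bound of an aligned stream without power: the logarithm is negative and
  the maximum cuts it off.\<close>

lemma Cplus_minus_half: "Cplus (- (1/2)) = 0"
  by (simp add: Cplus_def Cg_def log_divide)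

lemma yc_pairs_eq: "yc_pairs = {(1,2),(1,3),(2,1),(2,3),(3,1),(3,2)}"
  by (auto simp: yc_pairs_def yc_users_def)

text \<open>An inequality, because the quotient is 0 when h = 0.\<close>

lemma scaled_power_le:
  fixes p :: real assumes "p \<ge> 0"
  shows "h\<^sup>2 * p / h\<^sup>2 \<le> p"
  using assms by (cases "h = 0") auto

theorem theorem1:
  fixes h1 h2 h3 P :: real
    and R Rb Rc Ru :: "nat \<times> nat \<Rightarrow> real"
    and Pb Pc Pu :: "nat \<times> nat \<Rightarrow> real"
    and Pt23c Pt13c :: real
    and Pru :: "nat \<times> nat \<Rightarrow> real"
    and Prc12 Prc31 Prc21 Prc32 Prb21 Prb31 Prb32 :: real
  assumes gains: "h1\<^sup>2 \<ge> h2\<^sup>2" "h2\<^sup>2 \<ge> h3\<^sup>2"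
    and split_nonneg: "\<forall>p\<in>yc_pairs. Rb p \<ge> 0 \<and> Rc p \<ge> 0 \<and> Ru p \<ge> 0"
    and split_sum: "\<forall>p\<in>yc_pairs. R p = Rb p + Rc p + Ru p"
    and b_sym: "Rb (1,2) = Rb (2,1)" "Rb (1,3) = Rb (3,1)" "Rb (2,3) = Rb (3,2)"
    and c_cyc: "Rc (1,2) = Rc (2,3)" "Rc (2,3) = Rc (3,1)"
               "Rc (1,3) = Rc (3,2)" "Rc (3,2) = Rc (2,1)"
    and upow_nonneg: "\<forall>p\<in>yc_pairs. Pb p \<ge> 0 \<and> Pc p \<ge> 0 \<and> Pu p \<ge> 0"
               "Pt23c \<ge> 0" "Pt13c \<ge> 0"
    and rpow_nonneg: "\<forall>p\<in>yc_pairs. Pru p \<ge> 0"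
               "Prc12 \<ge> 0" "Prc31 \<ge> 0" "Prc21 \<ge> 0" "Prc32 \<ge> 0"
               "Prb21 \<ge> 0" "Prb31 \<ge> 0" "Prb32 \<ge> 0"
    and align: "h1\<^sup>2 * Pb (1,2) = h2\<^sup>2 * Pb (2,1)"
               "h1\<^sup>2 * Pb (1,3) = h3\<^sup>2 * Pb (3,1)"
               "h2\<^sup>2 * Pb (2,3) = h3\<^sup>2 * Pb (3,2)"
               "h1\<^sup>2 * Pc (1,2) = h2\<^sup>2 * Pc (2,3)"
               "h2\<^sup>2 * Pt23c = h3\<^sup>2 * Pc (3,1)"
               "h1\<^sup>2 * Pc (1,3) = h3\<^sup>2 * Pc (3,2)"
               "h1\<^sup>2 * Pt13c = h2\<^sup>2 * Pc (2,1)"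
    and upow: "Pb (1,2) + Pb (1,3) + Pc (1,2) + Pc (1,3) + Pt13c + Pu (1,2) + Pu (1,3) \<le> P"
              "Pb (2,1) + Pb (2,3) + Pc (2,1) + Pc (2,3) + Pt23c + Pu (2,1) + Pu (2,3) \<le> P"
              "Pb (3,1) + Pb (3,2) + Pc (3,1) + Pc (3,2) + Pu (3,1) + Pu (3,2) \<le> P"
    and rpow: "(\<Sum>p\<in>yc_pairs. Pru p) + Prc12 + Prc31 + Prc21 + Prc32 + Prb21 + Prb31 + Prb32 \<le> P"
    and uplink:
      "let P2 = Pb (2,1) + Pb (2,3) + Pc (2,1) + Pc (2,3) + Pt23c + Pu (2,1) + Pu (2,3);
           P3 = Pb (3,1) + Pb (3,2) + Pc (3,1) + Pc (3,2) + Pu (3,1) + Pu (3,2);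
           \<sigma>2 = 1 + h3\<^sup>2 * (2 * Pb (3,1) + 2 * Pb (3,2) + 2 * Pc (3,1) + 2 * Pc (3,2)
                              + Pu (3,1) + Pu (3,2))
       in Ru (1,2) \<le> Cg (h1\<^sup>2 * Pu (1,2) / (1 + h3\<^sup>2 * P3 + h2\<^sup>2 * P2 + h1\<^sup>2 * (P - Pu (1,2)))) \<and>
          Ru (1,3) \<le> Cg (h1\<^sup>2 * Pu (1,3) /
                      (1 + h3\<^sup>2 * P3 + h2\<^sup>2 * P2 + h1\<^sup>2 * (P - Pu (1,2) - Pu (1,3)))) \<and>
          Ru (2,1) \<le> Cg (h2\<^sup>2 * Pu (2,1) /
                      (1 + h3\<^sup>2 * P3 + h2\<^sup>2 * (P2 - Pu (2,1)) + h1\<^sup>2 * (P - Pu (1,2) - Pu (1,3)))) \<and>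
          Ru (2,3) \<le> Cg (h2\<^sup>2 * Pu (2,3) /
                      (1 + h3\<^sup>2 * P3 + h2\<^sup>2 * (P2 - Pu (2,1) - Pu (2,3))
                         + h1\<^sup>2 * (P - Pu (1,2) - Pu (1,3)))) \<and>
          Rc (1,3) \<le> Cplus (h2\<^sup>2 * Pc (2,1) / (\<sigma>2 + 2 * h2\<^sup>2 * (Pb (2,1) + Pc (2,3))) - 1/2) \<and>
          Rc (1,2) \<le> Cplus (h2\<^sup>2 * Pc (2,3) / (\<sigma>2 + 2 * h2\<^sup>2 * Pb (2,1)) - 1/2) \<and>
          Rb (2,1) \<le> Cplus (h2\<^sup>2 * Pb (2,1) / \<sigma>2 - 1/2) \<and>
          Ru (3,1) \<le> Cg (h3\<^sup>2 * Pu (3,1) /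
                      (1 + h3\<^sup>2 * (2 * Pb (3,2) + 2 * Pb (3,1) + 2 * Pc (3,1) + 2 * Pc (3,2) + Pu (3,2)))) \<and>
          Ru (3,2) \<le> Cg (h3\<^sup>2 * Pu (3,2) /
                      (1 + 2 * h3\<^sup>2 * (Pb (3,2) + Pb (3,1) + Pc (3,1) + Pc (3,2)))) \<and>
          Rc (1,3) \<le> Cplus (h3\<^sup>2 * Pc (3,2) / (1 + 2 * h3\<^sup>2 * (Pb (3,2) + Pb (3,1) + Pc (3,1))) - 1/2) \<and>
          Rc (1,2) \<le> Cplus (h3\<^sup>2 * Pc (3,1) / (1 + 2 * h3\<^sup>2 * (Pb (3,2) + Pb (3,1))) - 1/2) \<and>
          Rb (3,1) \<le> Cplus (h3\<^sup>2 * Pb (3,1) / (1 + 2 * h3\<^sup>2 * Pb (3,2)) - 1/2) \<and>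
          Rb (3,2) \<le> Cplus (h3\<^sup>2 * Pb (3,2) - 1/2)"
    and downlink:
      "let \<sigma>r1 = 1 + h3\<^sup>2 * (Pru (1,2) + Pru (3,2) + Prc12 + Prc21 + Prb21 + Pru (2,1) + Pru (3,1));
           \<sigma>r2 = 1 + h2\<^sup>2 * (Pru (2,1) + Pru (3,1))
       in Ru (1,3) \<le> Cg (h3\<^sup>2 * Pru (1,3) /
                      (\<sigma>r1 + h3\<^sup>2 * (Pru (2,3) + Prc32 + Prc31 + Prb31 + Prb32))) \<and>
          Ru (2,3) \<le> Cg (h3\<^sup>2 * Pru (2,3) / (\<sigma>r1 + h3\<^sup>2 * (Prc32 + Prc31 + Prb31 + Prb32))) \<and>
          Rc (1,3) \<le> Cg (h3\<^sup>2 * Prc32 / (\<sigma>r1 + h3\<^sup>2 * (Prc31 + Prb31 + Prb32))) \<and>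
          Rc (1,2) \<le> Cg (h3\<^sup>2 * Prc31 / (\<sigma>r1 + h3\<^sup>2 * (Prb31 + Prb32))) \<and>
          Rb (3,1) \<le> Cg (h3\<^sup>2 * Prb31 / (\<sigma>r1 + h3\<^sup>2 * Prb32)) \<and>
          Rb (3,2) \<le> Cg (h3\<^sup>2 * Prb32 / \<sigma>r1) \<and>
          Ru (1,2) \<le> Cg (h2\<^sup>2 * Pru (1,2) /
                      (\<sigma>r2 + h2\<^sup>2 * (Pru (3,2) + Prc12 + Prc21 + Prb21))) \<and>
          Ru (3,2) \<le> Cg (h2\<^sup>2 * Pru (3,2) / (\<sigma>r2 + h2\<^sup>2 * (Prc12 + Prc21 + Prb21))) \<and>
          Rc (1,2) \<le> Cg (h2\<^sup>2 * Prc12 / (\<sigma>r2 + h2\<^sup>2 * (Prc21 + Prb21))) \<and>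
          Rc (1,3) \<le> Cg (h2\<^sup>2 * Prc21 / (\<sigma>r2 + h2\<^sup>2 * Prb21)) \<and>
          Rb (2,1) \<le> Cg (h2\<^sup>2 * Prb21 / \<sigma>r2) \<and>
          Ru (2,1) \<le> Cg (h1\<^sup>2 * Pru (2,1) / (1 + h1\<^sup>2 * Pru (3,1))) \<and>
          Ru (3,1) \<le> Cg (h1\<^sup>2 * Pru (3,1))"
  shows "R \<in> yc_capacity_region h1 h2 h3 P"
proof -
  note nonneg = upow_nonneg[unfolded yc_pairs_eq, simplified] rpow_nonneg[unfolded yc_pairs_eq, simplified]
  have relay: "Pru (1,2) + Pru (1,3) + Pru (2,1) + Pru (2,3) + Pru (3,1) + Pru (3,2)
      + Prc12 + Prc31 + Prc21 + Prc32 + Prb21 + Prb31 + Prb32 \<le> P"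
    using rpow by (simp add: yc_pairs_eq)
  note up = uplink[unfolded Let_def] and dn = downlink[unfolded Let_def]
  note upD = up[THEN conjunct1]
    up[THEN conjunct2, THEN conjunct1]
    up[THEN conjunct2, THEN conjunct2, THEN conjunct1]
    up[THEN conjunct2, THEN conjunct2, THEN conjunct2, THEN conjunct1]
    up[THEN conjunct2, THEN conjunct2, THEN conjunct2, THEN conjunct2, THEN conjunct1]
    up[THEN conjunct2, THEN conjunct2, THEN conjunct2, THEN conjunct2, THEN conjunct2, THEN conjunct1]
    up[THEN conjunct2, THEN conjunct2, THEN conjunct2, THEN conjunct2, THEN conjunct2, THEN conjunct2, THEN conjunct1]
    up[THEN conjunct2, THEN conjunct2, THEN conjunct2, THEN conjunct2, THEN conjunct2, THEN conjunct2, THEN conjunct2, THEN conjunct1]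
    up[THEN conjunct2, THEN conjunct2, THEN conjunct2, THEN conjunct2, THEN conjunct2, THEN conjunct2, THEN conjunct2, THEN conjunct2, THEN conjunct1]
    up[THEN conjunct2, THEN conjunct2, THEN conjunct2, THEN conjunct2, THEN conjunct2, THEN conjunct2, THEN conjunct2, THEN conjunct2, THEN conjunct2, THEN conjunct1]
    up[THEN conjunct2, THEN conjunct2, THEN conjunct2, THEN conjunct2, THEN conjunct2, THEN conjunct2, THEN conjunct2, THEN conjunct2, THEN conjunct2, THEN conjunct2, THEN conjunct1]
    up[THEN conjunct2, THEN conjunct2, THEN conjunct2, THEN conjunct2, THEN conjunct2, THEN conjunct2, THEN conjunct2, THEN conjunct2, THEN conjunct2, THEN conjunct2, THEN conjunct2, THEN conjunct1]
    up[THEN conjunct2, THEN conjunct2, THEN conjunct2, THEN conjunct2, THEN conjunct2, THEN conjunct2, THEN conjunct2, THEN conjunct2, THEN conjunct2, THEN conjunct2, THEN conjunct2, THEN conjunct2]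
  note dnD = dn[THEN conjunct1]
    dn[THEN conjunct2, THEN conjunct1]
    dn[THEN conjunct2, THEN conjunct2, THEN conjunct1]
    dn[THEN conjunct2, THEN conjunct2, THEN conjunct2, THEN conjunct1]
    dn[THEN conjunct2, THEN conjunct2, THEN conjunct2, THEN conjunct2, THEN conjunct1]
    dn[THEN conjunct2, THEN conjunct2, THEN conjunct2, THEN conjunct2, THEN conjunct2, THEN conjunct1]
    dn[THEN conjunct2, THEN conjunct2, THEN conjunct2, THEN conjunct2, THEN conjunct2, THEN conjunct2, THEN conjunct1]
    dn[THEN conjunct2, THEN conjunct2, THEN conjunct2, THEN conjunct2, THEN conjunct2, THEN conjunct2, THEN conjunct2, THEN conjunct1]
    dn[THEN conjunct2, THEN conjunct2, THEN conjunct2, THEN conjunct2, THEN conjunct2, THEN conjunct2, THEN conjunct2, THEN conjunct2, THEN conjunct1]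
    dn[THEN conjunct2, THEN conjunct2, THEN conjunct2, THEN conjunct2, THEN conjunct2, THEN conjunct2, THEN conjunct2, THEN conjunct2, THEN conjunct2, THEN conjunct1]
    dn[THEN conjunct2, THEN conjunct2, THEN conjunct2, THEN conjunct2, THEN conjunct2, THEN conjunct2, THEN conjunct2, THEN conjunct2, THEN conjunct2, THEN conjunct2, THEN conjunct1]
    dn[THEN conjunct2, THEN conjunct2, THEN conjunct2, THEN conjunct2, THEN conjunct2, THEN conjunct2, THEN conjunct2, THEN conjunct2, THEN conjunct2, THEN conjunct2, THEN conjunct2, THEN conjunct1]
    dn[THEN conjunct2, THEN conjunct2, THEN conjunct2, THEN conjunct2, THEN conjunct2, THEN conjunct2, THEN conjunct2, THEN conjunct2, THEN conjunct2, THEN conjunct2, THEN conjunct2, THEN conjunct2]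
  \<comment> \<open>Received power at the relay of one codeword of each stream. By
    \<open>align\<close> both users of a shared stream give the same value; the entry is written
    with the weaker user, as in the rate constraints.\<close>
  define T where "T s = [h1\<^sup>2 * Pu (1,2), h1\<^sup>2 * Pu (1,3), h2\<^sup>2 * Pu (2,1), h2\<^sup>2 * Pu (2,3),
     h2\<^sup>2 * Pc (2,1), h2\<^sup>2 * Pc (2,3), h2\<^sup>2 * Pb (2,1), h3\<^sup>2 * Pu (3,1), h3\<^sup>2 * Pu (3,2),
     h3\<^sup>2 * Pc (3,2), h3\<^sup>2 * Pc (3,1), h3\<^sup>2 * Pb (3,1), h3\<^sup>2 * Pb (3,2)] ! s" for s :: nat
  define Q where "Q s = [Pru (1,2), Pru (1,3), Pru (2,1), Pru (2,3), Prc21, Prc12, Prb21,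
     Pru (3,1), Pru (3,2), Prc32, Prc31, Prb31, Prb32] ! s" for s :: nat
  define r where "r s = [Ru (1,2), Ru (1,3), Ru (2,1), Ru (2,3), Rc (1,3), Rc (1,2), Rb (2,1),
     Ru (3,1), Ru (3,2), Rc (1,3), Rc (1,2), Rb (3,1), Rb (3,2)] ! s" for s :: nat
  \<comment> \<open>Off \<open>yc_pairs\<close> part 0 carries \<open>R\<close>, so that the sums
    reproduce \<open>R\<close> at every index and not only at the message pairs; the closure is
    taken over all coordinates.\<close>
  define rs where "rs y = (if fst y \<in> yc_pairs
       then (if snd y = 0 then Rb (fst y) else if snd y = 1 then Rc (fst y) else Ru (fst y))
       else if snd y = 0 then R (fst y) else 0)" for y :: "(nat \<times> nat) \<times> nat"
  let ?hg = "yc_gain h1 h2 h3"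
  have rs_sum: "(\<lambda>q. (\<Sum>e<3. rs (q, e)) - \<delta>) = (\<lambda>q. R q - \<delta>)" for \<delta>
  proof
    fix q
    show "(\<Sum>e<3. rs (q, e)) - \<delta> = R q - \<delta>"
      using split_sum by (cases "q \<in> yc_pairs") (simp_all add: rs_def eval_nat_numeral)
  qed
  have rs_src: "rs (stream_src s u) = r s" if s: "s \<in> set up_order" "u \<in> stream_users s" for s u
    using up_order_cases[OF s(1)] s(2) b_sym c_cyc
    by (elim disjE; auto simp: stream_users_def stream_src_def rs_def r_def yc_pairs_eq)+
  have T0: "T s \<ge> 0" if "s \<in> set up_order" for s
    using up_order_cases[OF that] nonneg by (elim disjE; simp add: T_def)+
  have Q0: "Q s \<ge> 0" if "s \<in> set up_order" for s
    using up_order_cases[OF that] nonneg by (elim disjE; simp add: Q_def)+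
  have mono: "(?hg (weakest_user s))\<^sup>2 \<le> (?hg u)\<^sup>2"
    if s: "s \<in> set up_order" "u \<in> yc_users" "u \<le> weakest_user s" for s u
  proof -
    have "h3\<^sup>2 \<le> h1\<^sup>2" using gains by simp
    thus ?thesis using weakest_user_users[OF s(1)] s(2,3) gains by (auto simp: yc_users_def yc_gain_def)
  qed
  \<comment> \<open>\<open>Nu\<close> and \<open>Nd\<close> are the noise levels that the successive
    decoders face; \<open>Du\<close> and \<open>Dd\<close> below are the denominators of the
    constraints.\<close>
  define Nu where "Nu s = 1 + (\<Sum>s'\<in>set (after s up_order). real (card (stream_users s')) * T s')" for s
  define Nd where "Nd s = 1 + (?hg (weakest_user s))\<^sup>2 * (\<Sum>s'\<in>set (after s dn_order). Q s')" for s
  have after_sub: "set (after s L) \<subseteq> set L" for s :: nat and L by (induction L) auto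
  have Nu1: "Nu s \<ge> 1" for s
    unfolding Nu_def using T0 after_sub[of s up_order] by (auto intro!: sum_nonneg mult_nonneg_nonneg)
  have Nd1: "Nd s \<ge> 1" for s
    unfolding Nd_def using Q0 after_sub[of s dn_order] stream_orders(3)
    by (auto intro!: sum_nonneg mult_nonneg_nonneg)
  let ?P2 = "Pb (2,1) + Pb (2,3) + Pc (2,1) + Pc (2,3) + Pt23c + Pu (2,1) + Pu (2,3)"
  let ?P3 = "Pb (3,1) + Pb (3,2) + Pc (3,1) + Pc (3,2) + Pu (3,1) + Pu (3,2)"
  let ?\<sigma> = "1 + h3\<^sup>2 * (2 * Pb (3,1) + 2 * Pb (3,2) + 2 * Pc (3,1) + 2 * Pc (3,2) + Pu (3,1) + Pu (3,2))"
  define Du where "Du s = [1 + h3\<^sup>2 * ?P3 + h2\<^sup>2 * ?P2 + h1\<^sup>2 * (P - Pu (1,2)),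
     1 + h3\<^sup>2 * ?P3 + h2\<^sup>2 * ?P2 + h1\<^sup>2 * (P - Pu (1,2) - Pu (1,3)),
     1 + h3\<^sup>2 * ?P3 + h2\<^sup>2 * (?P2 - Pu (2,1)) + h1\<^sup>2 * (P - Pu (1,2) - Pu (1,3)),
     1 + h3\<^sup>2 * ?P3 + h2\<^sup>2 * (?P2 - Pu (2,1) - Pu (2,3)) + h1\<^sup>2 * (P - Pu (1,2) - Pu (1,3)),
     ?\<sigma> + 2 * h2\<^sup>2 * (Pb (2,1) + Pc (2,3)), ?\<sigma> + 2 * h2\<^sup>2 * Pb (2,1), ?\<sigma>,
     1 + h3\<^sup>2 * (2 * Pb (3,2) + 2 * Pb (3,1) + 2 * Pc (3,1) + 2 * Pc (3,2) + Pu (3,2)),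
     1 + 2 * h3\<^sup>2 * (Pb (3,2) + Pb (3,1) + Pc (3,1) + Pc (3,2)),
     1 + 2 * h3\<^sup>2 * (Pb (3,2) + Pb (3,1) + Pc (3,1)),
     1 + 2 * h3\<^sup>2 * (Pb (3,2) + Pb (3,1)), 1 + 2 * h3\<^sup>2 * Pb (3,2), 1] ! s" for s :: nat
  let ?\<sigma>1 = "1 + h3\<^sup>2 * (Pru (1,2) + Pru (3,2) + Prc12 + Prc21 + Prb21 + Pru (2,1) + Pru (3,1))"
  let ?\<sigma>2 = "1 + h2\<^sup>2 * (Pru (2,1) + Pru (3,1))"
  define Dd where "Dd s = [?\<sigma>2 + h2\<^sup>2 * (Pru (3,2) + Prc12 + Prc21 + Prb21),
     ?\<sigma>1 + h3\<^sup>2 * (Pru (2,3) + Prc32 + Prc31 + Prb31 + Prb32), 1 + h1\<^sup>2 * Pru (3,1),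
     ?\<sigma>1 + h3\<^sup>2 * (Prc32 + Prc31 + Prb31 + Prb32), ?\<sigma>2 + h2\<^sup>2 * Prb21,
     ?\<sigma>2 + h2\<^sup>2 * (Prc21 + Prb21), ?\<sigma>2, 1, ?\<sigma>2 + h2\<^sup>2 * (Prc12 + Prc21 + Prb21),
     ?\<sigma>1 + h3\<^sup>2 * (Prc31 + Prb31 + Prb32), ?\<sigma>1 + h3\<^sup>2 * (Prb31 + Prb32),
     ?\<sigma>1 + h3\<^sup>2 * Prb32, ?\<sigma>1] ! s" for s :: nat
  have single: "s \<in> {0,1,2,3,7,8} \<and> card (stream_users s) = 1 \<and> r s \<le> Cg (T s / Du s)
      \<or> s \<in> {4,5,6,9,10,11,12} \<and> card (stream_users s) = 2 \<and> r s \<le> Cplus (T s / Du s - 1/2)"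
    if "s \<in> set up_order" for s
    using up_order_cases[OF that]
  proof (elim disjE)
    assume [simp]: "s = 0"
    show ?thesis using upD(1) by (simp add: stream_users_def r_def T_def Du_def)
  next
    assume [simp]: "s = 1"
    show ?thesis using upD(2) by (simp add: stream_users_def r_def T_def Du_def)
  next
    assume [simp]: "s = 2"
    show ?thesis using upD(3) by (simp add: stream_users_def r_def T_def Du_def)
  next
    assume [simp]: "s = 3"
    show ?thesis using upD(4) by (simp add: stream_users_def r_def T_def Du_def)
  next
    assume [simp]: "s = 4"
    show ?thesis using upD(5) by (simp add: stream_users_def r_def T_def Du_def)
  next
    assume [simp]: "s = 5"
    show ?thesis using upD(6) by (simp add: stream_users_def r_def T_def Du_def)
  next
    assume [simp]: "s = 6"
    show ?thesis using upD(7) by (simp add: stream_users_def r_def T_def Du_def)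
  next
    assume [simp]: "s = 7"
    show ?thesis using upD(8) by (simp add: stream_users_def r_def T_def Du_def)
  next
    assume [simp]: "s = 8"
    show ?thesis using upD(9) by (simp add: stream_users_def r_def T_def Du_def)
  next
    assume [simp]: "s = 9"
    show ?thesis using upD(10) by (simp add: stream_users_def r_def T_def Du_def)
  next
    assume [simp]: "s = 10"
    show ?thesis using upD(11) by (simp add: stream_users_def r_def T_def Du_def)
  next
    assume [simp]: "s = 11"
    show ?thesis using upD(12) by (simp add: stream_users_def r_def T_def Du_def)
  next
    assume [simp]: "s = 12"
    show ?thesis using upD(13) by (simp add: stream_users_def r_def T_def Du_def)
  qed
  have dn_rate: "r s \<le> Cg ((?hg (weakest_user s))\<^sup>2 * Q s / Dd s)" if "s \<in> set up_order" for s
    using up_order_cases[OF that]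
  proof (elim disjE)
    assume [simp]: "s = 0"
    show ?thesis using dnD(7) by (simp add: yc_gain_def weakest_user_def r_def Q_def Dd_def)
  next
    assume [simp]: "s = 1"
    show ?thesis using dnD(1) by (simp add: yc_gain_def weakest_user_def r_def Q_def Dd_def)
  next
    assume [simp]: "s = 2"
    show ?thesis using dnD(12) by (simp add: yc_gain_def weakest_user_def r_def Q_def Dd_def)
  next
    assume [simp]: "s = 3"
    show ?thesis using dnD(2) by (simp add: yc_gain_def weakest_user_def r_def Q_def Dd_def)
  next
    assume [simp]: "s = 4"
    show ?thesis using dnD(10) by (simp add: yc_gain_def weakest_user_def r_def Q_def Dd_def)
  next
    assume [simp]: "s = 5"
    show ?thesis using dnD(9) by (simp add: yc_gain_def weakest_user_def r_def Q_def Dd_def)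
  next
    assume [simp]: "s = 6"
    show ?thesis using dnD(11) by (simp add: yc_gain_def weakest_user_def r_def Q_def Dd_def)
  next
    assume [simp]: "s = 7"
    show ?thesis using dnD(13) by (simp add: yc_gain_def weakest_user_def r_def Q_def Dd_def)
  next
    assume [simp]: "s = 8"
    show ?thesis using dnD(8) by (simp add: yc_gain_def weakest_user_def r_def Q_def Dd_def)
  next
    assume [simp]: "s = 9"
    show ?thesis using dnD(3) by (simp add: yc_gain_def weakest_user_def r_def Q_def Dd_def)
  next
    assume [simp]: "s = 10"
    show ?thesis using dnD(4) by (simp add: yc_gain_def weakest_user_def r_def Q_def Dd_def)
  next
    assume [simp]: "s = 11"
    show ?thesis using dnD(5) by (simp add: yc_gain_def weakest_user_def r_def Q_def Dd_def)
  next
    assume [simp]: "s = 12"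
    show ?thesis using dnD(6) by (simp add: yc_gain_def weakest_user_def r_def Q_def Dd_def)
  qed
  have Nd_le: "Nd s \<le> Dd s" if "s \<in> set up_order" for s
    using up_order_cases[OF that]
    by (elim disjE; simp add: Nd_def Dd_def Q_def yc_gain_def weakest_user_def dn_order_def algebra_simps)+
  \<comment> \<open>The first four uplink denominators contain P in place of the power of user 1, so
    they dominate the real noise only by way of the power constraint of user 1.\<close>
  have h1P: "h1\<^sup>2 * (Pb (1,2) + Pb (1,3) + Pc (1,2) + Pc (1,3) + Pt13c + Pu (1,2) + Pu (1,3)) \<le> h1\<^sup>2 * P"
    using upow(1) by (rule mult_left_mono) simp
  have Nu_le: "Nu s \<le> Du s" if "s \<in> set up_order" for s
  proof -
    have x: "0 \<le> h1\<^sup>2 * Pb (1,2)" "0 \<le> h1\<^sup>2 * Pb (1,3)" "0 \<le> h2\<^sup>2 * Pb (2,3)" 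
      "0 \<le> h1\<^sup>2 * Pc (1,2)" "0 \<le> h1\<^sup>2 * Pc (1,3)" "0 \<le> h2\<^sup>2 * Pt23c" "0 \<le> h1\<^sup>2 * Pt13c" using nonneg by simp_all
    show ?thesis
      using up_order_cases[OF that]
    proof (elim disjE)
      assume "s = 0"
      show ?thesis unfolding \<open>s = 0\<close>
        by (simp add: Nu_def Du_def T_def up_order_def stream_users_def distrib_left right_diff_distrib mult.assoc del: One_nat_def,
            (use x h1P[unfolded distrib_left] align in linarith)?)
    next
      assume "s = 1"
      show ?thesis unfolding \<open>s = 1\<close>
        by (simp add: Nu_def Du_def T_def up_order_def stream_users_def distrib_left right_diff_distrib mult.assoc del: One_nat_def,
            (use x h1P[unfolded distrib_left] align in linarith)?)
    next
      assume "s = 2"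
      show ?thesis unfolding \<open>s = 2\<close>
        by (simp add: Nu_def Du_def T_def up_order_def stream_users_def distrib_left right_diff_distrib mult.assoc del: One_nat_def,
            (use x h1P[unfolded distrib_left] align in linarith)?)
    next
      assume "s = 3"
      show ?thesis unfolding \<open>s = 3\<close>
        by (simp add: Nu_def Du_def T_def up_order_def stream_users_def distrib_left right_diff_distrib mult.assoc del: One_nat_def,
            (use x h1P[unfolded distrib_left] align in linarith)?)
    next
      assume "s = 4"
      show ?thesis unfolding \<open>s = 4\<close>
        by (simp add: Nu_def Du_def T_def up_order_def stream_users_def distrib_left right_diff_distrib mult.assoc del: One_nat_def,
            (use x h1P[unfolded distrib_left] align in linarith)?)
    next
      assume "s = 5"
      show ?thesis unfolding \<open>s = 5\<close>
        by (simp add: Nu_def Du_def T_def up_order_def stream_users_def distrib_left right_diff_distrib mult.assoc del: One_nat_def,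
            (use x h1P[unfolded distrib_left] align in linarith)?)
    next
      assume "s = 6"
      show ?thesis unfolding \<open>s = 6\<close>
        by (simp add: Nu_def Du_def T_def up_order_def stream_users_def distrib_left right_diff_distrib mult.assoc del: One_nat_def,
            (use x h1P[unfolded distrib_left] align in linarith)?)
    next
      assume "s = 7"
      show ?thesis unfolding \<open>s = 7\<close>
        by (simp add: Nu_def Du_def T_def up_order_def stream_users_def distrib_left right_diff_distrib mult.assoc del: One_nat_def,
            (use x h1P[unfolded distrib_left] align in linarith)?)
    next
      assume "s = 8"
      show ?thesis unfolding \<open>s = 8\<close>
        by (simp add: Nu_def Du_def T_def up_order_def stream_users_def distrib_left right_diff_distrib mult.assoc del: One_nat_def,
            (use x h1P[unfolded distrib_left] align in linarith)?)
    next
      assume "s = 9"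
      show ?thesis unfolding \<open>s = 9\<close>
        by (simp add: Nu_def Du_def T_def up_order_def stream_users_def distrib_left right_diff_distrib mult.assoc del: One_nat_def,
            (use x h1P[unfolded distrib_left] align in linarith)?)
    next
      assume "s = 10"
      show ?thesis unfolding \<open>s = 10\<close>
        by (simp add: Nu_def Du_def T_def up_order_def stream_users_def distrib_left right_diff_distrib mult.assoc del: One_nat_def,
            (use x h1P[unfolded distrib_left] align in linarith)?)
    next
      assume "s = 11"
      show ?thesis unfolding \<open>s = 11\<close>
        by (simp add: Nu_def Du_def T_def up_order_def stream_users_def distrib_left right_diff_distrib mult.assoc del: One_nat_def,
            (use x h1P[unfolded distrib_left] align in linarith)?)
    next
      assume "s = 12"
      show ?thesis unfolding \<open>s = 12\<close>
        by (simp add: Nu_def Du_def T_def up_order_def stream_users_def distrib_left right_diff_distrib mult.assoc del: One_nat_def,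
            (use x h1P[unfolded distrib_left] align in linarith)?)
    qed
  qed
  have Tpos: "T s > 0" if s: "s \<in> set up_order" "r s > 0" for s
  proof (rule ccontr)
    assume "\<not> T s > 0"
    hence "T s = 0" using T0[OF s(1)] by simp
    thus False using single[OF s(1)] s(2) by (auto simp: Cplus_minus_half)
  qed
  have upr: "2 powr (2 * r s) * (real (card (stream_users s)) * Nu s) \<le> real (card (stream_users s)) * T s + Nu s"
    if s: "s \<in> set up_order" "r s > 0" for s
    using single[OF s(1)]
  proof (elim disjE conjE)
    assume "card (stream_users s) = 1" "r s \<le> Cg (T s / Du s)"
    thus ?thesis using Cg_rate[OF s(2) _ _ Nu_le[OF s(1)] T0[OF s(1)]] Nu1[of s] by simp
  next
    assume "card (stream_users s) = 2" "r s \<le> Cplus (T s / Du s - 1/2)"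
    thus ?thesis using Cplus_rate[OF s(2) _ _ Nu_le[OF s(1)] T0[OF s(1)]] Nu1[of s] by simp
  qed
  have dnr: "2 powr (2 * r s) * (1 * Nd s) \<le> 1 * ((?hg (weakest_user s))\<^sup>2 * Q s) + Nd s"
    if s: "s \<in> set up_order" "r s > 0" for s
  proof (rule Cg_rate[OF s(2) dn_rate[OF s(1)] _ Nd_le[OF s(1)]])
    show "Nd s > 0" using Nd1[of s] by simp
    show "(?hg (weakest_user s))\<^sup>2 * Q s \<ge> 0" using Q0[OF s(1)] by simp
  qed
  have gz: "?hg u \<noteq> 0" if s: "s \<in> set up_order" "u \<in> stream_users s" "T s > 0" for s u
  proof -
    \<comment> \<open>The gains are ordered, so a vanishing gain makes all weaker ones vanish;
      \<open>T\<close> is written with the weaker user of each stream and vanishes as well.\<close>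
    have z: "h2 = 0" if "h1 = 0" using gains(1) that by simp
    have z': "h3 = 0" if "h2 = 0" using gains(2) that by simp
    have "T s = 0" if hz: "?hg u = 0"
    proof -
      consider "u = 1" | "u = 2" | "u = 3" using stream_users_props(1)[OF s(1)] s(2) by (auto simp: yc_users_def)
      thus ?thesis
      proof cases
        case 1
        hence "h1 = 0" "h2 = 0" "h3 = 0" using hz z z' by (simp_all add: yc_gain_def)
        thus ?thesis using up_order_cases[OF s(1)] by (elim disjE; simp add: T_def)
      next
        case 2
        hence "h2 = 0" "h3 = 0" using hz z' by (simp_all add: yc_gain_def)
        thus ?thesis using up_order_cases[OF s(1)] s(2) 2 by (elim disjE; simp add: T_def stream_users_def)
      next
        case 3
        hence "h3 = 0" using hz by (simp add: yc_gain_def)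
        thus ?thesis using up_order_cases[OF s(1)] s(2) 3 by (elim disjE; simp add: T_def stream_users_def)
      qed
    qed
    thus ?thesis using s(3) by auto
  qed
  have upw: "(\<Sum>s\<in>{s\<in>set up_order. u \<in> stream_users s}. T s / (?hg u)\<^sup>2) \<le> P" if u: "u \<in> yc_users" for u
  proof -
    consider "u = 1" | "u = 2" | "u = 3" using u by (auto simp: yc_users_def)
    thus ?thesis
    proof cases
      case 1
      have f: "filter (\<lambda>s. 1 \<in> stream_users s) up_order = [0,1,4,5,6,9,11]"
        by (simp add: up_order_def stream_users_def)
      have f': "{s\<in>set up_order. 1 \<in> stream_users s} = set [0,1,4,5,6,9,11]" by (simp only: f[symmetric] set_filter)
      have "(\<Sum>s\<in>{s\<in>set up_order. u \<in> stream_users s}. T s / (?hg u)\<^sup>2) =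
         h1\<^sup>2 * Pu (1,2) / h1\<^sup>2 + h1\<^sup>2 * Pu (1,3) / h1\<^sup>2 + h1\<^sup>2 * Pt13c / h1\<^sup>2 + h1\<^sup>2 * Pc (1,2) / h1\<^sup>2
         + h1\<^sup>2 * Pb (1,2) / h1\<^sup>2 + h1\<^sup>2 * Pc (1,3) / h1\<^sup>2 + h1\<^sup>2 * Pb (1,3) / h1\<^sup>2"
        \<comment> \<open>Alignment turns each power of user 1 in a shared stream into the received
          power recorded in \<open>T\<close>.\<close>
        unfolding 1 f' align by (simp add: T_def yc_gain_def)
      also have "\<dots> \<le> Pu (1,2) + Pu (1,3) + Pt13c + Pc (1,2) + Pb (1,2) + Pc (1,3) + Pb (1,3)"
        using nonneg by (intro add_mono scaled_power_le) auto
      finally show ?thesis using upow(1) by simp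
    next
      case 2
      have f: "filter (\<lambda>s. 2 \<in> stream_users s) up_order = [2,3,4,5,6,10,12]"
        by (simp add: up_order_def stream_users_def)
      have f': "{s\<in>set up_order. 2 \<in> stream_users s} = set [2,3,4,5,6,10,12]" by (simp only: f[symmetric] set_filter)
      have "(\<Sum>s\<in>{s\<in>set up_order. u \<in> stream_users s}. T s / (?hg u)\<^sup>2) =
         h2\<^sup>2 * Pu (2,1) / h2\<^sup>2 + h2\<^sup>2 * Pu (2,3) / h2\<^sup>2 + h2\<^sup>2 * Pc (2,1) / h2\<^sup>2 + h2\<^sup>2 * Pc (2,3) / h2\<^sup>2
         + h2\<^sup>2 * Pb (2,1) / h2\<^sup>2 + h2\<^sup>2 * Pt23c / h2\<^sup>2 + h2\<^sup>2 * Pb (2,3) / h2\<^sup>2"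
        unfolding 2 f' align by (simp add: T_def yc_gain_def)
      also have "\<dots> \<le> Pu (2,1) + Pu (2,3) + Pc (2,1) + Pc (2,3) + Pb (2,1) + Pt23c + Pb (2,3)"
        using nonneg by (intro add_mono scaled_power_le) auto
      finally show ?thesis using upow(2) by simp
    next
      case 3
      have f: "filter (\<lambda>s. 3 \<in> stream_users s) up_order = [7,8,9,10,11,12]"
        by (simp add: up_order_def stream_users_def)
      have f': "{s\<in>set up_order. 3 \<in> stream_users s} = set [7,8,9,10,11,12]" by (simp only: f[symmetric] set_filter)
      have "(\<Sum>s\<in>{s\<in>set up_order. u \<in> stream_users s}. T s / (?hg u)\<^sup>2) =
         h3\<^sup>2 * Pu (3,1) / h3\<^sup>2 + h3\<^sup>2 * Pu (3,2) / h3\<^sup>2 + h3\<^sup>2 * Pc (3,2) / h3\<^sup>2 + h3\<^sup>2 * Pc (3,1) / h3\<^sup>2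
         + h3\<^sup>2 * Pb (3,1) / h3\<^sup>2 + h3\<^sup>2 * Pb (3,2) / h3\<^sup>2"
        unfolding 3 f' by (simp add: T_def yc_gain_def)
      also have "\<dots> \<le> Pu (3,1) + Pu (3,2) + Pc (3,2) + Pc (3,1) + Pb (3,1) + Pb (3,2)"
        using nonneg by (intro add_mono scaled_power_le) auto
      finally show ?thesis using upow(3) by simp
    qed
  qed
  have rpw: "(\<Sum>s\<in>set up_order. Q s) \<le> P"
    using relay by (simp add: up_order_def Q_def)
  have P0: "P \<ge> 0" using order_trans[OF sum_nonneg rpw] Q0 by blast
  show ?thesis
  proof (rule capacity_region_limit)
    fix \<delta> :: real assume \<delta>: "\<delta> > 0"
    show "yc_achievable h1 h2 h3 P (\<lambda>q. R q - \<delta>)"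
    \<comment> \<open>The random code needs positive power. For P = 0 all relay powers vanish, and
      the downlink constraints force every rate to be nonpositive.\<close>
    proof (cases "P = 0")
      case True
      have "Q s = 0" if "s \<in> set up_order" for s
        using Q0 rpw True that by (metis List.finite_set order_antisym sum_nonneg sum_nonneg_eq_0_iff)
      hence "\<forall>s\<in>set up_order. r s \<le> 0" using dn_rate by fastforce
      hence "Ru (1,2) \<le> 0" "Ru (1,3) \<le> 0" "Ru (2,1) \<le> 0" "Ru (2,3) \<le> 0" "Rc (1,3) \<le> 0" "Rc (1,2) \<le> 0"
        "Rb (2,1) \<le> 0" "Ru (3,1) \<le> 0" "Ru (3,2) \<le> 0" "Rb (3,1) \<le> 0" "Rb (3,2) \<le> 0"
        by (simp_all add: up_order_def r_def)
      hence R0: "R q \<le> 0" if "q \<in> yc_pairs" for q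
        using that b_sym c_cyc split_sum by (auto simp: yc_pairs_eq)
      show ?thesis using \<delta> R0 by (intro trivial_achievable P0) (smt (verit))
    next
      case False
      show ?thesis unfolding rs_sum[symmetric]
      proof (rule achievable_of_powers[where U = stream_users and src = stream_src and T = T and Q = Q
            and r = r and w = weakest_user and rs = rs and upL = up_order and dnL = dn_order])
        show "P > 0" using False P0 by simp
        show "\<And>s. s \<in> set up_order \<Longrightarrow> r s > 0 \<Longrightarrow>
         2 powr (2 * r s) * (real (card (stream_users s)) * (1 + (\<Sum>s'\<in>set (after s up_order). real (card (stream_users s')) * T s')))
         \<le> real (card (stream_users s)) * T s + (1 + (\<Sum>s'\<in>set (after s up_order). real (card (stream_users s')) * T s'))"
          using upr unfolding Nu_def .
        show "\<And>s. s \<in> set up_order \<Longrightarrow> r s > 0 \<Longrightarrow>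
         2 powr (2 * r s) * (1 * (1 + (?hg (weakest_user s))\<^sup>2 * (\<Sum>s'\<in>set (after s dn_order). Q s')))
         \<le> 1 * ((?hg (weakest_user s))\<^sup>2 * Q s) + (1 + (?hg (weakest_user s))\<^sup>2 * (\<Sum>s'\<in>set (after s dn_order). Q s'))"
          using dnr unfolding Nd_def .
      qed (fact \<delta> stream_orders stream_users_props stream_src_props rs_src T0 Q0 gz weakest_user_order mono
          upw rpw Tpos streams_decodable)+
    qed
  qed
qed

end
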